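(* Let $(M^0,M^1)\in\mathcal M(\theta_0,\theta_1,\theta_\infty)$ with Stokes matrices $S_1,S_2$, and write $[M]_{\sigma_1}:=\sigma_1M\sigma_1$, $\sigma_1=\begin{pmatrix}0&1\\ 1&0\end{pmatrix}$. Then $$y(e^{\pi i}x,M^0,M^1)=1/y_{-\theta_\infty}(x,[\hat M^0]_{\sigma_1},[\hat M^1]_{\sigma_1}),$$ $$y(e^{-\pi i}x,M^0,M^1)=1/y_{-\theta_\infty}(x,[\check M^0]_{\sigma_1},[\check M^1]_{\sigma_1}),$$ where for $j=0,1$ $$\hat M^j:=e^{-\frac{\pi i}2\theta_\infty\sigma_3}S_2^{-1}M^jS_2e^{\frac{\pi i}2\theta_\infty\sigma_3},\qquad \check M^j:=e^{\frac{\pi i}2\theta_\infty\sigma_3}S_1M^jS_1^{-1}e^{-\frac{\pi i}2\theta_\infty\sigma_3}.$$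
   Context: Painlevé V. For $\theta_0,\theta_1,\theta_\infty\in\mathbb{C}$, $(\mathrm{P_V})$ is $$y''=\Bigl(\frac1{2y}+\frac1{y-1}\Bigr)(y')^2-\frac{y'}x+\frac{(y-1)^2}{x^2}\Bigl(a_\theta y-\frac{b_\theta}y\Bigr)+c_\theta\frac yx-\frac{y(y+1)}{2(y-1)},$$ $a_\theta=\frac18(\theta_0-\theta_1+\theta_\infty)^2$, $b_\theta=\frac18(\theta_0-\theta_1-\theta_\infty)^2$, $c_\theta=1-\theta_0-\theta_1$. It is equivalent to the system for $(y,\mathfrak z,u)$ $$xy'=xy-2\mathfrak z(y-1)^2-(y-1)\bigl(\tfrac12(\theta_0-\theta_1+\theta_\infty)y-\tfrac12(3\theta_0+\theta_1+\theta_\infty)\bigr),$$ $$x\mathfrak z'=y\mathfrak z(\mathfrak z+\tfrac12(\theta_0-\theta_1+\theta_\infty))-y^{-1}(\mathfrak z+\theta_0)(\mathfrak z+\tfrac12(\theta_0+\theta_1+\theta_\infty)),$$ $$x(\ln u)'=-2\mathfrak z-\theta_0+y(\mathfrak z+\tfrac12(\theta_0-\theta_1+\theta_\infty))+y^{-1}(\mathfrak z+\tfrac12(\theta_0+\theta_1+\theta_\infty)),$$ which governs the isomonodromy deformation of $$\frac{d\Xi}{d\xi}=\Bigl(\frac x2\sigma_3+\frac{\mathcal A_0}\xi+\frac{\mathcal A_1}{\xi-1}\Bigr)\Xi,\quad \mathcal A_0=\begin{pmatrix}\mathfrak z+\frac12\theta_0&-u(\mathfrak z+\theta_0)\\ u^{-1}\mathfrak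 z&-\mathfrak z-\frac12\theta_0\end{pmatrix},$$ $$\mathcal A_1=\begin{pmatrix}-\mathfrak z-\frac12(\theta_0+\theta_\infty)&uy(\mathfrak z+\frac12(\theta_0-\theta_1+\theta_\infty))\\ -(uy)^{-1}(\mathfrak z+\frac12(\theta_0+\theta_1+\theta_\infty))&\mathfrak z+\frac12(\theta_0+\theta_\infty)\end{pmatrix},$$ $\sigma_3=\mathrm{diag}(1,-1)$. Monodromy data. For $x=e^{i\phi}t$, $t>0$, $|\phi|<\pi/2$, put $\xi=\frac12(e^{-i\phi}\lambda+1)$, $Y=\exp(-\varpi\sigma_3)\Xi$, $\varpi=\frac14e^{i\phi}t+\frac12\theta_\infty(i\phi+\ln2)$. The resulting linear system in $\lambda$ (singular at $\mp e^{i\phi},\infty$) has, for $k\in\mathbb{Z}$, the solution $Y_k=(I+O(\lambda^{-1}))\exp(\frac14(t\lambda-2\theta_\infty\ln\lambda)\sigma_3)$ as $\lambda\to\infty$ in $|\arg\lambda-\pi/2-(k-2)\pi|<\pi$. The Stokes matrices are defined by $Y_{k+1}=Y_kS_k$; $S_1=\begin{pmatrix}1&0\\ s_1&1\end{pmatrix}$, $S_2=\begin{pmatrix}1&s_2\\ 0&1\end{pmatrix}$. Let $\hat l_0,\hat l_1$ start at $\hat p_{\rm st}$ ($\arg\hat p_{\rm st}=\pi/2$, $|\hat p_{\rm st}|>100$), go straight to near $-e^{i\phi}$, respectively $e^{i\phi}$, circle it once anticlockwise, and return. $M^0=(m^0_{ij})$, $M^1=(m^1_{ij})\in SL_2(\mathbb{C})$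 are defined by $Y_2|_{\hat l_0}=Y_2M^0$, $Y_2|_{\hat l_1}=Y_2M^1$ (analytic continuation). They satisfy $M^1M^0=S_1^{-1}e^{-\pi i\theta_\infty\sigma_3}S_2^{-1}$, so that $s_2=-e^{\pi i\theta_\infty}(m^0_{12}m^1_{11}+m^0_{22}m^1_{12})$, $s_1=-e^{\pi i\theta_\infty}(m^0_{11}m^1_{21}+m^0_{21}m^1_{22})$. The monodromy manifold $\mathcal M(\theta_0,\theta_1,\theta_\infty)$ is the set of $(M^0,M^1)\in SL_2(\mathbb{C})^2$ with $m^0_{11}m^1_{11}+m^0_{21}m^1_{12}=e^{-\pi i\theta_\infty}$, $\mathrm{tr}M^0=2\cos\pi\theta_0$, $\mathrm{tr}M^1=2\cos\pi\theta_1$, modulo $(M^0,M^1)\sim c^{\sigma_3}(M^0,M^1)c^{-\sigma_3}$, $c\ne0$. For each class $(M^0,M^1)$, $y(x,M^0,M^1)$ denotes a solution of $(\mathrm{P_V})$ whose linear system (for $|\arg x|<\pi/2$) has this class of monodromy data; it is unique if $M^0,M^1\ne\pm I$. The same symbol denotes its analytic continuation to the universal covering of $\mathbb{C}\setminus\{0\}$. $y_{-\theta_\infty}(x,M^0_-,M^1_-)$ denotes, in the same sense, the solution of the Painlevé V equation with parameters $(\theta_0,\theta_1,-\theta_\infty)$ labelled with $(M^0_-,M^1_-)\in\mathcal M(\theta_0,\theta_1,-\theta_\infty)$ (all definitions with $\theta_\infty$ replaced by $-\theta_\infty$). *)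

theory Defs
  imports "HOL-Complex_Analysis.Complex_Analysis"
begin

section \<open>Two-by-two matrices\<close>

type_synonym cmat = "complex^2^2"

definition mat2 :: "complex \<Rightarrow> complex \<Rightarrow> complex \<Rightarrow> complex \<Rightarrow> cmat" where
  "mat2 a b c d = vector [vector [a, b], vector [c, d]]"

definition sigma1 :: cmat where "sigma1 = mat2 0 1 1 0"

definition sigma3 :: cmat where "sigma3 = mat2 1 0 0 (-1)"

definition scale_mat :: "complex \<Rightarrow> cmat \<Rightarrow> cmat" where
  "scale_mat c A = (\<chi> i j. c * A $ i $ j)"

text \<open>The matrix exponential of \<open>a\<close> times \<^const>\<open>sigma3\<close>.\<close>
definition exp_sigma3 :: "complex \<Rightarrow> cmat" where
  "exp_sigma3 a = mat2 (exp a) 0 0 (exp (- a))"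

text \<open>Conjugation by \<open>c\<close> raised to the power \<^const>\<open>sigma3\<close>, for nonzero \<open>c\<close>.\<close>
definition gauge :: "complex \<Rightarrow> cmat \<Rightarrow> cmat" where
  "gauge c M = mat2 c 0 0 (1 / c) ** M ** mat2 (1 / c) 0 0 c"

definition conj_sigma1 :: "cmat \<Rightarrow> cmat" where
  "conj_sigma1 M = sigma1 ** M ** sigma1"


section \<open>The fifth Painleve equation on the universal covering\<close>

text \<open>
  The universal covering of the punctured plane is identified with the complex plane by
  \<open>x = exp s\<close>, so that \<open>arg x = Im s\<close> without restriction and multiplying \<open>x\<close> by
  \<open>e\<^sup>\<plusminus>\<^sup>\<pi>\<^sup>i\<close> on the covering is the shift \<open>s \<mapsto> s \<plusminus> \<i>\<pi>\<close>. A multivalued function \<open>y(x)\<close> is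
  represented by \<open>w(s) = y(exp s)\<close>. Solutions are meromorphic on the covering; the
  normalisation \<open>nicely_meromorphic_on\<close> gives them the value 0 at poles, which agrees with
  \<open>1 / 0 = 0\<close> and so makes \<open>1 / w\<close> the pointwise and the meromorphic reciprocal at once.
\<close>

text \<open>The derivative with respect to \<open>x\<close>, in the coordinate \<open>s\<close>.\<close>
definition xderiv :: "(complex \<Rightarrow> complex) \<Rightarrow> complex \<Rightarrow> complex" where
  "xderiv f s = deriv f s / exp s"

definition PV_solution ::
  "complex \<Rightarrow> complex \<Rightarrow> complex \<Rightarrow> (complex \<Rightarrow> complex) \<Rightarrow> bool" where
  "PV_solution \<theta>0 \<theta>1 \<theta>inf w \<longleftrightarrow>
     w nicely_meromorphic_on UNIV \<and> (\<exists>s. w s \<noteq> 0) \<and> (\<exists>s. w s \<noteq> 1) \<and>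
     (\<forall>s. w analytic_on {s} \<and> w s \<noteq> 0 \<and> w s \<noteq> 1 \<longrightarrow>
        (let x = exp s; y = w s; y' = xderiv w s; y'' = xderiv (xderiv w) s;
             a = (\<theta>0 - \<theta>1 + \<theta>inf)\<^sup>2 / 8;
             b = (\<theta>0 - \<theta>1 - \<theta>inf)\<^sup>2 / 8;
             c = 1 - \<theta>0 - \<theta>1
         in y'' = (1 / (2 * y) + 1 / (y - 1)) * y'\<^sup>2 - y' / x
                  + (y - 1)\<^sup>2 / x\<^sup>2 * (a * y - b / y) + c * y / x
                  - y * (y + 1) / (2 * (y - 1))))"

text \<open>Points at which the coefficients of the linear system are given by finite values.\<close>
definition regular_point ::
  "(complex \<Rightarrow> complex) \<Rightarrow> (complex \<Rightarrow> complex) \<Rightarrow> (complex \<Rightarrow> complex) \<Rightarrow> complex \<Rightarrow> bool" where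
  "regular_point w zf uf s \<longleftrightarrow>
     w analytic_on {s} \<and> zf analytic_on {s} \<and> uf analytic_on {s} \<and> w s \<noteq> 0 \<and> uf s \<noteq> 0"

definition PV_system ::
  "complex \<Rightarrow> complex \<Rightarrow> complex \<Rightarrow>
   (complex \<Rightarrow> complex) \<Rightarrow> (complex \<Rightarrow> complex) \<Rightarrow> (complex \<Rightarrow> complex) \<Rightarrow> bool" where
  "PV_system \<theta>0 \<theta>1 \<theta>inf w zf uf \<longleftrightarrow>
     w nicely_meromorphic_on UNIV \<and> zf nicely_meromorphic_on UNIV \<and>
     uf nicely_meromorphic_on UNIV \<and> (\<exists>s. w s \<noteq> 0) \<and> (\<exists>s. uf s \<noteq> 0) \<and>
     (\<forall>s. regular_point w zf uf s \<longrightarrow>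
        (let x = exp s; y = w s; z = zf s; u = uf s
         in x * xderiv w s =
              x * y - 2 * z * (y - 1)\<^sup>2
              - (y - 1) * ((\<theta>0 - \<theta>1 + \<theta>inf) / 2 * y - (3 * \<theta>0 + \<theta>1 + \<theta>inf) / 2) \<and>
            x * xderiv zf s =
              y * z * (z + (\<theta>0 - \<theta>1 + \<theta>inf) / 2)
              - 1 / y * (z + \<theta>0) * (z + (\<theta>0 + \<theta>1 + \<theta>inf) / 2) \<and>
            x * (xderiv uf s / u) =
              - 2 * z - \<theta>0 + y * (z + (\<theta>0 - \<theta>1 + \<theta>inf) / 2)
              + 1 / y * (z + (\<theta>0 + \<theta>1 + \<theta>inf) / 2)))"


section \<open>The linear system and its monodromy data\<close>

definition residue0 :: "complex \<Rightarrow> complex \<Rightarrow> complex \<Rightarrow> cmat" where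
  "residue0 \<theta>0 z u = mat2 (z + \<theta>0 / 2) (- u * (z + \<theta>0)) (z / u) (- z - \<theta>0 / 2)"

definition residue1 ::
  "complex \<Rightarrow> complex \<Rightarrow> complex \<Rightarrow> complex \<Rightarrow> complex \<Rightarrow> complex \<Rightarrow> cmat" where
  "residue1 \<theta>0 \<theta>1 \<theta>inf y z u =
     mat2 (- z - (\<theta>0 + \<theta>inf) / 2)
          (u * y * (z + (\<theta>0 - \<theta>1 + \<theta>inf) / 2))
          (- (1 / (u * y)) * (z + (\<theta>0 + \<theta>1 + \<theta>inf) / 2))
          (z + (\<theta>0 + \<theta>inf) / 2)"

definition xi_coeff ::
  "complex \<Rightarrow> complex \<Rightarrow> complex \<Rightarrow> complex \<Rightarrow> complex \<Rightarrow> complex \<Rightarrow> complex \<Rightarrow> complex \<Rightarrow> cmat"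
where
  "xi_coeff \<theta>0 \<theta>1 \<theta>inf x y z u \<xi> =
     scale_mat (x / 2) sigma3 + scale_mat (1 / \<xi>) (residue0 \<theta>0 z u)
     + scale_mat (1 / (\<xi> - 1)) (residue1 \<theta>0 \<theta>1 \<theta>inf y z u)"

definition varpi :: "complex \<Rightarrow> complex \<Rightarrow> complex" where
  "varpi \<theta>inf s = exp s / 4 + \<theta>inf / 2 * (\<i> * of_real (Im s) + of_real (ln 2))"

text \<open>
  The coefficient matrix of the system for \<open>Y = exp (- \<varpi> \<sigma>\<^sub>3) \<Xi>\<close> in the variable \<open>\<lambda>\<close>,
  where \<open>x = exp s\<close>, that is \<open>t = exp (Re s)\<close> and \<open>\<phi> = Im s\<close>; the factor
  \<open>e\<^sup>-\<^sup>i\<^sup>\<phi> / 2\<close> is \<open>d\<xi>/d\<lambda>\<close>.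
\<close>
definition lambda_coeff ::
  "complex \<Rightarrow> complex \<Rightarrow> complex \<Rightarrow> complex \<Rightarrow> complex \<Rightarrow> complex \<Rightarrow> complex \<Rightarrow> complex \<Rightarrow> cmat"
where
  "lambda_coeff \<theta>0 \<theta>1 \<theta>inf s y z u lam =
     scale_mat (cis (- Im s) / 2)
       (exp_sigma3 (- varpi \<theta>inf s)
        ** xi_coeff \<theta>0 \<theta>1 \<theta>inf (exp s) y z u ((cis (- Im s) * lam + 1) / 2)
        ** exp_sigma3 (varpi \<theta>inf s))"

text \<open>
  Both finite singular points of the system lie on the unit circle. A solution near infinity is
  regarded as a function of \<open>l = ln \<lambda>\<close> on the half-plane \<open>Re l > 0\<close>, which is the universal
  covering of \<open>\<bar>\<lambda>\<bar> > 1\<close>; then \<open>arg \<lambda> = Im l\<close> and \<open>dY/dl = \<lambda> dY/d\<lambda>\<close>. As usual, the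
  asymptotic relation in an open sector is meant uniformly in closed subsectors.
\<close>
definition canonical_solution ::
  "complex \<Rightarrow> complex \<Rightarrow> complex \<Rightarrow> complex \<Rightarrow> complex \<Rightarrow> complex \<Rightarrow> complex \<Rightarrow>
   int \<Rightarrow> (complex \<Rightarrow> cmat) \<Rightarrow> bool"
where
  "canonical_solution \<theta>0 \<theta>1 \<theta>inf s y z u k Y \<longleftrightarrow>
     (\<forall>l i j. Re l > 0 \<longrightarrow>
        ((\<lambda>v. Y v $ i $ j) has_field_derivative
           exp l * (lambda_coeff \<theta>0 \<theta>1 \<theta>inf s y z u (exp l) ** Y l) $ i $ j) (at l)) \<and>
     (\<forall>\<delta>>0. \<exists>C R. \<forall>l. Re l > R \<and> Re l > 0 \<and>
        \<bar>Im l - pi / 2 - of_int (k - 2) * pi\<bar> \<le> pi - \<delta> \<longrightarrow>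
        norm (Y l ** exp_sigma3 (- ((of_real (exp (Re s)) * exp l - 2 * \<theta>inf * l) / 4)) - mat 1)
          \<le> C * exp (- Re l))"

text \<open>
  Analytic continuation of a germ along a path: a family of germs \<open>f \<tau>\<close> at the points
  \<open>\<gamma> \<tau>\<close> which locally in \<open>\<tau>\<close> are germs of one analytic function. The germ of \<open>F\<close> at the
  initial point is continued to the germ of \<open>G\<close> at the final point.
\<close>
definition continues_along ::
  "(real \<Rightarrow> complex) \<Rightarrow> (complex \<Rightarrow> cmat) \<Rightarrow> (complex \<Rightarrow> cmat) \<Rightarrow> bool" where
  "continues_along \<gamma> F G \<longleftrightarrow>
     (\<exists>f :: real \<Rightarrow> complex \<Rightarrow> cmat.
        (\<forall>\<tau>\<in>{0..1}. \<forall>i j. (\<lambda>v. f \<tau> v $ i $ j) analytic_on {\<gamma> \<tau>}) \<and>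
        (\<forall>\<tau>\<in>{0..1}. \<exists>\<epsilon>>0. \<forall>\<tau>'\<in>{0..1}. \<bar>\<tau>' - \<tau>\<bar> < \<epsilon> \<longrightarrow>
           (\<forall>\<^sub>F v in nhds (\<gamma> \<tau>'). f \<tau>' v = f \<tau> v)) \<and>
        (\<forall>\<^sub>F v in nhds (\<gamma> 0). f 0 v = F v) \<and>
        (\<forall>\<^sub>F v in nhds (\<gamma> 1). f 1 v = G v))"

text \<open>
  Straight from \<open>p\<close> to the point at distance \<open>\<rho>\<close> from \<open>a\<close>, once anticlockwise around \<open>a\<close>,
  and straight back.
\<close>
definition lasso :: "complex \<Rightarrow> complex \<Rightarrow> real \<Rightarrow> real \<Rightarrow> complex" where
  "lasso p a \<rho> =
     (let q = a + of_real \<rho> * cis (Arg (p - a))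
      in linepath p q +++ part_circlepath a \<rho> (Arg (p - a)) (Arg (p - a) + 2 * pi)
         +++ linepath q p)"

text \<open>
  The base point is \<open>\<i> * r\<close> with \<open>r > 100\<close>. Near it the branch with \<open>arg \<lambda> = \<pi>/2\<close> is
  the principal logarithm, so \<open>Y 2 (Ln \<lambda>)\<close> is the germ of \<open>Y\<^sub>2\<close>. The finite singular points
  have distance 2, hence all radii \<open>\<rho> < 1\<close> give homotopic loops.
\<close>
definition has_monodromy_data ::
  "complex \<Rightarrow> complex \<Rightarrow> complex \<Rightarrow> complex \<Rightarrow> complex \<Rightarrow> complex \<Rightarrow> complex \<Rightarrow>
   cmat \<Rightarrow> cmat \<Rightarrow> cmat \<Rightarrow> cmat \<Rightarrow> bool"
where
  "has_monodromy_data \<theta>0 \<theta>1 \<theta>inf s y z u S1 S2 M0 M1 \<longleftrightarrow>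
     (\<exists>Y :: int \<Rightarrow> complex \<Rightarrow> cmat.
        (\<forall>k. canonical_solution \<theta>0 \<theta>1 \<theta>inf s y z u k (Y k)) \<and>
        (\<forall>l. Re l > 0 \<longrightarrow> Y 2 l = Y 1 l ** S1 \<and> Y 3 l = Y 2 l ** S2) \<and>
        (\<forall>r>100. \<forall>\<rho>. 0 < \<rho> \<and> \<rho> < 1 \<longrightarrow>
           continues_along (lasso (\<i> * of_real r) (- cis (Im s)) \<rho>)
             (\<lambda>v. Y 2 (Ln v)) (\<lambda>v. Y 2 (Ln v) ** M0) \<and>
           continues_along (lasso (\<i> * of_real r) (cis (Im s)) \<rho>)
             (\<lambda>v. Y 2 (Ln v)) (\<lambda>v. Y 2 (Ln v) ** M1)))"


section \<open>The monodromy manifold and the labelling of solutions\<close>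

text \<open>
  Representatives of the points of the monodromy manifold. Passing to classes modulo
  simultaneous conjugation by \<^const>\<open>gauge\<close> is done in \<open>solution_with_data\<close> below.
\<close>
definition monodromy_pairs :: "complex \<Rightarrow> complex \<Rightarrow> complex \<Rightarrow> (cmat \<times> cmat) set" where
  "monodromy_pairs \<theta>0 \<theta>1 \<theta>inf =
     {(M0, M1). det M0 = 1 \<and> det M1 = 1 \<and>
        M0 $ 1 $ 1 * M1 $ 1 $ 1 + M0 $ 2 $ 1 * M1 $ 1 $ 2 = exp (- (of_real pi * \<i> * \<theta>inf)) \<and>
        trace M0 = 2 * cos (of_real pi * \<theta>0) \<and> trace M1 = 2 * cos (of_real pi * \<theta>1)}"

text \<open>
  \<open>w\<close> is a solution of the fifth Painleve equation on the universal covering whose linear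
  system for \<open>\<bar>arg x\<bar> < \<pi>/2\<close> has monodromy matrices and Stokes matrices in the class of
  \<open>(M0, M1)\<close>, \<open>(S1, S2)\<close>. Data at different \<open>x\<close> are
  compared only as classes, so \<open>c\<close> may depend on \<open>s\<close>.
\<close>
definition solution_with_data ::
  "complex \<Rightarrow> complex \<Rightarrow> complex \<Rightarrow> cmat \<Rightarrow> cmat \<Rightarrow> cmat \<Rightarrow> cmat \<Rightarrow> (complex \<Rightarrow> complex) \<Rightarrow> bool"
where
  "solution_with_data \<theta>0 \<theta>1 \<theta>inf S1 S2 M0 M1 w \<longleftrightarrow>
     (M0, M1) \<in> monodromy_pairs \<theta>0 \<theta>1 \<theta>inf \<and> PV_solution \<theta>0 \<theta>1 \<theta>inf w \<and>
     (\<exists>zf uf. PV_system \<theta>0 \<theta>1 \<theta>inf w zf uf \<and>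
        (\<forall>s. \<bar>Im s\<bar> < pi / 2 \<and> regular_point w zf uf s \<longrightarrow>
           (\<exists>c. c \<noteq> 0 \<and>
              has_monodromy_data \<theta>0 \<theta>1 \<theta>inf s (w s) (zf s) (uf s)
                (gauge c S1) (gauge c S2) (gauge c M0) (gauge c M1))))"

text \<open>
  \<open>w\<close> is a function denoted by \<open>y(x, M0, M1)\<close>. This is a relation and not a function
  of \<open>(M0, M1)\<close>, because \<open>w\<close> need not be unique if \<open>M0\<close> or \<open>M1\<close> is plus or minus the identity.
\<close>
definition labelled_solution ::
  "complex \<Rightarrow> complex \<Rightarrow> complex \<Rightarrow> cmat \<Rightarrow> cmat \<Rightarrow> (complex \<Rightarrow> complex) \<Rightarrow> bool" where
  "labelled_solution \<theta>0 \<theta>1 \<theta>inf M0 M1 w \<longleftrightarrow>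
     (\<exists>S1 S2. solution_with_data \<theta>0 \<theta>1 \<theta>inf S1 S2 M0 M1 w)"

definition hat_mat :: "complex \<Rightarrow> cmat \<Rightarrow> cmat \<Rightarrow> cmat" where
  "hat_mat \<theta>inf S2 M =
     exp_sigma3 (- (of_real pi * \<i> / 2 * \<theta>inf)) ** matrix_inv S2 ** M ** S2
     ** exp_sigma3 (of_real pi * \<i> / 2 * \<theta>inf)"

definition check_mat :: "complex \<Rightarrow> cmat \<Rightarrow> cmat \<Rightarrow> cmat" where
  "check_mat \<theta>inf S1 M =
     exp_sigma3 (of_real pi * \<i> / 2 * \<theta>inf) ** S1 ** M ** matrix_inv S1
     ** exp_sigma3 (- (of_real pi * \<i> / 2 * \<theta>inf))"

end

theory Submission
  imports Defs "HOL-Real_Asymp.Real_Asymp"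
begin

text \<open>
  In the coordinate \<open>\<eta> = 2 \<xi> - 1\<close> the change \<open>x \<mapsto> e\<^sup>\<plusminus>\<^sup>\<pi>\<^sup>i x\<close>, \<open>\<theta>\<^sub>\<infinity> \<mapsto> - \<theta>\<^sub>\<infinity>\<close> together with conjugation
  by \<open>\<sigma>\<^sub>1\<close> is a symmetry of the linear system: it sends \<open>(y, z, u)\<close> to \<open>(1/y, - z - \<theta>\<^sub>0, 1/u)\<close> and keeps
  the residues up to \<open>\<sigma>\<^sub>1\<close>. An isomonodromic deformation from \<open>x\<close> to \<open>e\<^sup>\<plusminus>\<^sup>\<pi>\<^sup>i x\<close>
  carries each canonical solution to one whose sector is turned by \<open>\<mp>\<pi>\<close>, so that
  the solution normalised in the original sector is reached through one Stokes matrix. This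
  gives the conjugation by \<open>S\<^sub>2\<close> or \<open>S\<^sub>1\<close>; the powers of \<open>e\<^sup>\<pi>\<^sup>i\<^sup>\<theta>\<close> are a gauge. Deformations with entire
  coefficients in \<open>\<eta>\<close> do not affect the loops around the singular points.

  For uniqueness, the quotient \<open>R\<close> of two solutions with equal monodromy is single valued. At a
  singular point with exponents \<open>\<plusminus>\<theta>/2\<close> it satisfies \<open>v R' = A R - R B + O(v) R\<close>, where \<open>A\<close>, \<open>B\<close> have
  equal spectra, so a pole of order \<open>k\<close> forces \<open>k\<^sup>2 = \<theta>\<^sup>2\<close>; the nontrivial Jordan block of a
  monodromy matrix different from \<open>\<plusminus>1\<close> excludes that case. Hence \<open>R\<close> is entire, tends to a
  diagonal matrix at infinity, and is constant.
\<close>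

text \<open>The obstacle is that data are given only for |arg x| < pi/2, while the continued
  solution has to be tested beyond that sector. There the canonical solutions are not constructed
  anew: they are deformations of the known ones, and it is their asymptotics that must survive. One
  column is treated at a time. On a ray where a column is recessive, its unwanted component is
  damped towards the point of interest, and a maximum argument bounds it without any formal series;
  from such a ray the asymptotics spread to all directions at an angle less than pi. Since turning x
  turns the recessive directions, the path is cut into short steps, each controlled on a ray at
  angle pi/4 from the most recessive direction. The path is also tilted, to miss the countably many
  points where the coefficients are not finite. For uniqueness, meromorphic solutions are compared
  on arg x = 0 only. There both singular points are real, and every fundamental solution is single
  valued off two real half-lines. The Stokes matrices are reached through M^1 M^0, which determines
  them by triangular factorisation.\<close>

no_notation fps_nth (infixl \<open>$\<close> 75)

section \<open>Two-by-two matrix functions and linear systems\<close>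

lemma mat2_nth [simp]:
  "mat2 a b c d $ 1 $ 1 = a" "mat2 a b c d $ 1 $ 2 = b"
  "mat2 a b c d $ 2 $ 1 = c" "mat2 a b c d $ 2 $ 2 = d"
  by (simp_all add: mat2_def)

lemma cmat_eq_iff: "(A::cmat) = B \<longleftrightarrow> A$1$1 = B$1$1 \<and> A$1$2 = B$1$2 \<and> A$2$1 = B$2$1 \<and> A$2$2 = B$2$2"
  by (simp only: vec_eq_iff forall_2 conj_assoc)

lemma all_2_iff: "(\<forall>(i::2) (j::2). P i j) \<longleftrightarrow> P 1 1 \<and> P 1 2 \<and> P 2 1 \<and> P 2 2"
  by (simp only: forall_2 conj_assoc)

lemma mmult_nth: "((A::cmat) ** B) $ i $ j = A$i$1 * B$1$j + A$i$2 * B$2$j"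
  by (simp add: matrix_matrix_mult_def sum_2)

lemma scale_mat_nth [simp]: "scale_mat c A $ i $ j = c * A $ i $ j"
  by (simp add: scale_mat_def)

lemma mat_one_nth [simp]:
  "(mat 1 :: cmat) $ 1 $ 1 = 1" "(mat 1 :: cmat) $ 1 $ 2 = 0"
  "(mat 1 :: cmat) $ 2 $ 1 = 0" "(mat 1 :: cmat) $ 2 $ 2 = 1"
  by (simp_all add: mat_def)

lemma exp_sigma3_nth [simp]:
  "exp_sigma3 a $ 1 $ 1 = exp a" "exp_sigma3 a $ 1 $ 2 = 0"
  "exp_sigma3 a $ 2 $ 1 = 0" "exp_sigma3 a $ 2 $ 2 = exp (- a)"
  by (simp_all add: exp_sigma3_def)

text \<open>The adjugate stands in for the inverse throughout: for determinant 1 the two agree, and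
  its entries are linear in those of \<open>M\<close>, so holomorphy and derivatives pass to it at
  once.\<close>

definition adj2 :: "cmat \<Rightarrow> cmat" where
  "adj2 M = mat2 (M$2$2) (- M$1$2) (- M$2$1) (M$1$1)"

lemma adj2_nth [simp]:
  "adj2 M $ 1 $ 1 = M$2$2" "adj2 M $ 1 $ 2 = - M$1$2"
  "adj2 M $ 2 $ 1 = - M$2$1" "adj2 M $ 2 $ 2 = M$1$1"
  by (simp_all add: adj2_def)

lemma adj2_left: "adj2 M ** M = mat (det M)"
  by (simp add: cmat_eq_iff mmult_nth det_2 mat_def algebra_simps)

lemma adj2_right: "M ** adj2 M = mat (det M)"
  by (simp add: cmat_eq_iff mmult_nth det_2 mat_def algebra_simps)

lemma adj2_mult: "adj2 (A ** B) = adj2 B ** adj2 A"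
  by (simp add: cmat_eq_iff mmult_nth algebra_simps)

lemma det_adj2 [simp]: "det (adj2 A) = det A"
  by (simp add: det_2)

section \<open>Entrywise complex calculus for matrix functions\<close>

definition has_mderiv :: "(complex \<Rightarrow> cmat) \<Rightarrow> cmat \<Rightarrow> complex \<Rightarrow> bool" where
  "has_mderiv F D z \<longleftrightarrow> (\<forall>i j. ((\<lambda>v. F v $ i $ j) has_field_derivative D $ i $ j) (at z))"

definition mholo :: "(complex \<Rightarrow> cmat) \<Rightarrow> complex set \<Rightarrow> bool" where
  "mholo F S \<longleftrightarrow> (\<forall>i j. (\<lambda>v. F v $ i $ j) holomorphic_on S)"

lemma has_mderivD: "has_mderiv F D z \<Longrightarrow> ((\<lambda>v. F v $ i $ j) has_field_derivative D $ i $ j) (at z)"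
  by (simp add: has_mderiv_def)

lemma mholoD: "mholo F S \<Longrightarrow> (\<lambda>v. F v $ i $ j) holomorphic_on S"
  by (simp add: mholo_def)

lemma has_mderiv_const [intro]: "has_mderiv (\<lambda>z. M) 0 z"
  by (simp add: has_mderiv_def)

lemma has_mderiv_mult:
  assumes "has_mderiv F F' z" "has_mderiv G G' z"
  shows "has_mderiv (\<lambda>v. F v ** G v) (F' ** G z + F z ** G') z"
  unfolding has_mderiv_def mmult_nth vector_add_component
proof (intro allI)
  fix i j
  note d = assms[THEN has_mderivD]
  show "((\<lambda>v. F v $ i $ 1 * G v $ 1 $ j + F v $ i $ 2 * G v $ 2 $ j) has_field_derivative
     F' $ i $ 1 * G z $ 1 $ j + F' $ i $ 2 * G z $ 2 $ j +
     (F z $ i $ 1 * G' $ 1 $ j + F z $ i $ 2 * G' $ 2 $ j)) (at z)"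
    by (rule derivative_eq_intros d refl)+ (simp add: algebra_simps)
qed

lemma has_mderiv_adj2: "has_mderiv F D z \<Longrightarrow> has_mderiv (\<lambda>v. adj2 (F v)) (adj2 D) z"
  unfolding has_mderiv_def all_2_iff by (auto intro!: derivative_eq_intros)

lemma has_mderiv_chain:
  assumes "has_mderiv F D (g z)" "(g has_field_derivative g') (at z)"
  shows "has_mderiv (\<lambda>v. F (g v)) (scale_mat g' D) z"
  unfolding has_mderiv_def scale_mat_nth
  using DERIV_chain2[OF has_mderivD[OF assms(1)] assms(2)] by (simp add: mult.commute)

lemma has_mderiv_cong_ev:
  assumes "has_mderiv F D z" "eventually (\<lambda>v. F v = G v) (nhds z)"
  shows "has_mderiv G D z"
  unfolding has_mderiv_def
proof (intro allI)
  fix i j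
  have "eventually (\<lambda>v. F v $ i $ j = G v $ i $ j) (nhds z)"
    using assms(2) by (rule eventually_mono) auto
  from DERIV_cong_ev[OF refl this refl] assms(1)
  show "((\<lambda>v. G v $ i $ j) has_field_derivative D $ i $ j) (at z)"
    by (auto simp: has_mderiv_def)
qed

lemma mholo_mderiv: "open S \<Longrightarrow> (\<And>z. z \<in> S \<Longrightarrow> has_mderiv F (D z) z) \<Longrightarrow> mholo F S"
  unfolding mholo_def has_mderiv_def by (auto simp: holomorphic_on_open)

lemma mholo_mult: "mholo F S \<Longrightarrow> mholo G S \<Longrightarrow> mholo (\<lambda>z. F z ** G z) S"
  by (auto simp: mholo_def mmult_nth intro!: holomorphic_intros)

lemma mholo_add: "mholo F S \<Longrightarrow> mholo G S \<Longrightarrow> mholo (\<lambda>z. F z + G z) S"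
  by (auto simp: mholo_def intro!: holomorphic_intros)

lemma mholo_const: "mholo (\<lambda>z. M) S"
  by (simp add: mholo_def)

lemma mholo_adj2: "mholo F S \<Longrightarrow> mholo (\<lambda>z. adj2 (F z)) S"
  unfolding mholo_def all_2_iff by (auto intro!: holomorphic_intros)

lemma mholo_scale: "g holomorphic_on S \<Longrightarrow> mholo F S \<Longrightarrow> mholo (\<lambda>z. scale_mat (g z) (F z)) S"
  by (auto simp: mholo_def intro!: holomorphic_intros)

lemma mholo_subset: "mholo F S \<Longrightarrow> T \<subseteq> S \<Longrightarrow> mholo F T"
  by (meson holomorphic_on_subset mholo_def)

lemma mholo_compose:
  "mholo F T \<Longrightarrow> g holomorphic_on S \<Longrightarrow> g ` S \<subseteq> T \<Longrightarrow> mholo (\<lambda>z. F (g z)) S"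
  unfolding mholo_def
proof (intro allI)
  fix i j
  assume "\<forall>i j. (\<lambda>v. F v $ i $ j) holomorphic_on T" "g holomorphic_on S" "g ` S \<subseteq> T"
  then show "(\<lambda>v. F (g v) $ i $ j) holomorphic_on S"
    using holomorphic_on_compose_gen[of g S "\<lambda>v. F v $ i $ j" T] by (simp add: o_def)
qed

section \<open>Linear systems with a spectral parameter\<close>

lemma mprimitive_starlike:
  assumes "open S" "a \<in> S" "\<And>z. z \<in> S \<Longrightarrow> closed_segment a z \<subseteq> S" "mholo F S"
  shows "\<exists>G. (\<forall>z\<in>S. has_mderiv G (F z) z) \<and> G a = 0"
proof -
  have "\<exists>g. \<forall>z\<in>S. (g has_field_derivative F z $ i $ j) (at z)" for i j
  proof -
    have h: "(\<lambda>z. F z $ i $ j) holomorphic_on S" using assms(4) by (rule mholoD)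
    show ?thesis
    proof (rule holomorphic_starlike_primitive[of S _ "{}"])
      show "starlike S" using assms(2,3) unfolding starlike_def by blast
    qed (use h assms(1) in \<open>simp_all add: holomorphic_on_imp_continuous_on holomorphic_on_imp_differentiable_at\<close>)
  qed
  then obtain g where g: "\<And>i j z. z \<in> S \<Longrightarrow> (g i j has_field_derivative F z $ i $ j) (at z)"
    by metis
  define G where "G = (\<lambda>z. \<chi> i j. g i j z - g i j a)"
  have "has_mderiv G (F z) z" if "z \<in> S" for z
    unfolding has_mderiv_def G_def using g[OF that] by (auto intro!: derivative_eq_intros)
  moreover have "G a = 0" by (simp add: G_def vec_eq_iff)
  ultimately show ?thesis by blast
qed

text \<open>The \<open>T k\<close> are the iterated integrals of Picard iteration, so that \<Sum>
  \<xi>^k \<open>T k\<close> solves F' = \<xi> C F with F(a) = 1. The locally uniform bound K^k / k!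
  makes such series converge for every \<xi>.\<close>

lemma dyson_terms:
  assumes S: "open S" "a \<in> S" "\<And>z. z \<in> S \<Longrightarrow> closed_segment a z \<subseteq> S" and C: "mholo C S"
  obtains T where "\<And>z. T 0 z = mat 1" "\<And>k. T (Suc k) a = 0"
    "\<And>k z. z \<in> S \<Longrightarrow> has_mderiv (T (Suc k)) (C z ** T k z) z"
    "\<And>z0. z0 \<in> S \<Longrightarrow> \<exists>r>0. \<exists>K\<ge>0. ball z0 r \<subseteq> S \<and>
        (\<forall>z\<in>ball z0 r. \<forall>k i j. norm (T k z $ i $ j) \<le> K ^ k / fact k)"
proof -
  define prim where "prim F = (SOME G. (\<forall>z\<in>S. has_mderiv G (F z) z) \<and> G a = 0)" for F
  have prim: "(\<forall>z\<in>S. has_mderiv (prim F) (F z) z) \<and> prim F a = 0" if "mholo F S" for F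
    unfolding prim_def by (rule someI_ex[OF mprimitive_starlike[OF S that]])
  define T where "T = rec_nat (\<lambda>z. mat 1) (\<lambda>k t. prim (\<lambda>z. C z ** t z))"
  have T0: "T 0 = (\<lambda>z. mat 1)" and TS: "T (Suc k) = prim (\<lambda>z. C z ** T k z)" for k
    by (simp_all add: T_def)
  have holT: "mholo (T k) S" for k
  proof (induction k)
    case 0
    show ?case by (simp add: T0 mholo_const)
  next
    case (Suc k)
    show ?case unfolding TS
      using prim[OF mholo_mult[OF C Suc]] S(1) by (intro mholo_mderiv) auto
  qed
  have dT: "has_mderiv (T (Suc k)) (C z ** T k z) z" if "z \<in> S" for k z
    unfolding TS using prim[OF mholo_mult[OF C holT[of k]]] that by blast
  have aT: "T (Suc k) a = 0" for k
    unfolding TS using prim[OF mholo_mult[OF C holT[of k]]] by blast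
  have bound: "\<exists>r>0. \<exists>K\<ge>0. ball z0 r \<subseteq> S \<and>
        (\<forall>z\<in>ball z0 r. \<forall>k i j. norm (T k z $ i $ j) \<le> K ^ k / fact k)" if z0: "z0 \<in> S" for z0
  proof -
    obtain r where r: "r > 0" "cball z0 r \<subseteq> S" using S(1) z0 open_contains_cball by blast
    \<comment> \<open>The compact set swept out by the segments from \<open>a\<close> to a closed
      ball. A bound for \<open>C\<close> on it gives one constant valid for all end points in the
      ball.\<close>
    define Q where "Q = (\<lambda>(t, z). a + complex_of_real t * (z - a)) ` ({0..1} \<times> cball z0 r)"
    have cQ: "compact Q" unfolding Q_def
      by (intro compact_continuous_image compact_Times) (auto intro!: continuous_intros simp: split_beta)
    have segin: "a + complex_of_real t * (z - a) \<in> S" if "z \<in> S" "t \<in> {0..1}" for t z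
    proof -
      have "a + complex_of_real t * (z - a) = (1 - t) *\<^sub>R a + t *\<^sub>R z"
        by (simp add: scaleR_conv_of_real algebra_simps)
      then have "a + complex_of_real t * (z - a) \<in> closed_segment a z"
        using that(2) unfolding closed_segment_def by auto
      with S(3)[OF that(1)] show ?thesis by blast
    qed
    have QS: "Q \<subseteq> S" unfolding Q_def using segin r by auto
    have "\<exists>M. \<forall>z\<in>Q. norm (C z $ i $ j) \<le> M" for i j
    proof -
      have "continuous_on Q (\<lambda>z. C z $ i $ j)"
        using holomorphic_on_imp_continuous_on[OF mholoD[OF C]] QS by (rule continuous_on_subset)
      then have "compact ((\<lambda>z. C z $ i $ j) ` Q)" using cQ by (rule compact_continuous_image)
      then have "bounded ((\<lambda>z. C z $ i $ j) ` Q)" by (rule compact_imp_bounded)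
      then show ?thesis unfolding bounded_iff by blast
    qed
    then obtain M0 where M0: "\<And>i j z. z \<in> Q \<Longrightarrow> norm (C z $ i $ j) \<le> M0 i j" by metis
    define M where "M = (\<Sum>i\<in>UNIV. \<Sum>j\<in>UNIV. \<bar>M0 i j\<bar>)"
    have M: "norm (C z $ i $ j) \<le> M" if "z \<in> Q" for i j z
    proof -
      have "\<bar>M0 i j\<bar> \<le> (\<Sum>j\<in>UNIV. \<bar>M0 i j\<bar>)" by (rule member_le_sum) auto
      also have "\<dots> \<le> M" unfolding M_def by (rule member_le_sum) (auto intro: sum_nonneg)
      finally show ?thesis using M0[OF that, of i j] by linarith
    qed
    have Mpos: "M \<ge> 0" unfolding M_def by (intro sum_nonneg) auto
    define K where "K = 2 * M * (norm (z0 - a) + r)"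
    have Kpos: "K \<ge> 0" unfolding K_def using Mpos r by simp
    \<comment> \<open>The bound has to be proved at every time \<open>t\<close> along the segment,
      because integrating t^k / k! is what produces the next factorial. The 2 counts the two terms
      in an entry of a matrix product.\<close>
    have main: "norm (T k (a + complex_of_real t * (z - a)) $ i $ j) \<le> (2 * M * norm (z - a) * t) ^ k / fact k"
      if z: "z \<in> cball z0 r" and t: "t \<in> {0..1}" for z t k i j
      using t
    proof (induction k arbitrary: t i j)
      case 0
      then show ?case by (simp add: T0 mat_def)
    next
      case (Suc k)
      let ?p = "\<lambda>t. a + complex_of_real t * (z - a)"
      let ?B = "2 * M * norm (z - a)"
      have inS: "?p u \<in> S" if "u \<in> {0..1}" for u
        using that z r by (intro segin) auto
      have inQ: "?p u \<in> Q" if "u \<in> {0..1}" for u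
        unfolding Q_def using that z by (intro image_eqI[of _ _ "(u, z)"]) auto
      have der: "((\<lambda>u. T (Suc k) (?p u) $ i $ j) has_vector_derivative
                   (z - a) * (C (?p u) ** T k (?p u)) $ i $ j) (at u)" if "u \<in> {0..1}" for u
      proof -
        have 1: "((\<lambda>x. T (Suc k) x $ i $ j) has_field_derivative (C (?p u) ** T k (?p u)) $ i $ j) (at (?p u))"
          using dT[OF inS[OF that]] by (rule has_mderivD)
        have 2: "(?p has_vector_derivative (z - a)) (at u)"
          by (auto intro!: derivative_eq_intros)
        show ?thesis using field_vector_diff_chain_at[OF 2 1] by (simp add: o_def mult.commute)
      qed
      show ?case
      proof (cases "t = 0")
        case True
        then show ?thesis using aT by simp
      next
        case False
        then have tpos: "0 < t" using Suc.prems by auto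
        have "norm (T (Suc k) (?p t) $ i $ j - T (Suc k) (?p 0) $ i $ j)
               \<le> (?B * t) ^ Suc k / fact (Suc k) - (?B * 0) ^ Suc k / fact (Suc k)"
        proof (rule differentiable_bound_general[OF tpos, where \<phi> = "\<lambda>t. (?B * t) ^ Suc k / fact (Suc k)"
              and \<phi>' = "\<lambda>u. ?B * ((?B * u) ^ k / fact k)"])
          show "continuous_on {0..t} (\<lambda>u. T (Suc k) (?p u) $ i $ j)"
          proof (intro continuous_at_imp_continuous_on ballI)
            fix u assume "u \<in> {0..t}"
            then have "u \<in> {0..1}" using Suc.prems by auto
            from has_vector_derivative_continuous[OF der[OF this]]
            show "isCont (\<lambda>u. T (Suc k) (?p u) $ i $ j) u" .
          qed
          show "continuous_on {0..t} (\<lambda>t. (?B * t) ^ Suc k / fact (Suc k))"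
            by (intro continuous_intros) auto
          fix u assume u: "0 < u" "u < t"
          then have u01: "u \<in> {0..1}" using Suc.prems by auto
          show "((\<lambda>u. T (Suc k) (?p u) $ i $ j) has_vector_derivative
                   (z - a) * (C (?p u) ** T k (?p u)) $ i $ j) (at u)" by (rule der[OF u01])
          have "((\<lambda>t. (?B * t) ^ Suc k / fact (Suc k)) has_real_derivative
                 ?B * ((?B * u) ^ k / fact k)) (at u)"
            apply (rule derivative_eq_intros refl | simp)+
            done
          then show "((\<lambda>t. (?B * t) ^ Suc k / fact (Suc k)) has_vector_derivative
                 ?B * ((?B * u) ^ k / fact k)) (at u)"
            by (simp add: has_real_derivative_iff_has_vector_derivative)
          have "norm ((C (?p u) ** T k (?p u)) $ i $ j) \<le>
              norm (C (?p u) $ i $ 1) * norm (T k (?p u) $ 1 $ j) + norm (C (?p u) $ i $ 2) * norm (T k (?p u) $ 2 $ j)"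
            unfolding mmult_nth norm_mult[symmetric] by (rule norm_triangle_ineq)
          also have "\<dots> \<le> M * ((?B * u) ^ k / fact k) + M * ((?B * u) ^ k / fact k)"
            by (intro add_mono mult_mono M inQ u01 Suc.IH Mpos) auto
          finally have "norm ((C (?p u) ** T k (?p u)) $ i $ j) \<le> 2 * M * ((?B * u) ^ k / fact k)"
            by simp
          then have "norm (z - a) * norm ((C (?p u) ** T k (?p u)) $ i $ j) \<le>
             norm (z - a) * (2 * M * ((?B * u) ^ k / fact k))"
            by (rule mult_left_mono) auto
          then show "norm ((z - a) * (C (?p u) ** T k (?p u)) $ i $ j) \<le> ?B * ((?B * u) ^ k / fact k)"
            by (simp add: norm_mult mult_ac)
        qed
        then show ?thesis by (simp add: aT)
      qed
    qed
    have "norm (T k z $ i $ j) \<le> K ^ k / fact k" if z: "z \<in> ball z0 r" for z k i j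
    proof -
      have "norm (z - a) \<le> norm (z0 - a) + r"
        using z norm_triangle_ineq[of "z - z0" "z0 - a"] by (auto simp: dist_norm norm_minus_commute)
      then have "2 * M * norm (z - a) \<le> K" unfolding K_def using Mpos by (intro mult_left_mono) auto
      then have "(2 * M * norm (z - a)) ^ k \<le> K ^ k" using Mpos by (intro power_mono) auto
      then have "(2 * M * norm (z - a)) ^ k / fact k \<le> K ^ k / fact k" by (rule divide_right_mono) auto
      moreover have "norm (T k z $ i $ j) \<le> (2 * M * norm (z - a)) ^ k / fact k"
        using main[of z 1 k i j] z by auto
      ultimately show ?thesis by linarith
    qed
    moreover have "ball z0 r \<subseteq> S" using r ball_subset_cball by blast
    ultimately show ?thesis using r(1) Kpos by blast
  qed
  show ?thesis using that[of T] T0 dT aT bound by auto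
qed

text \<open>The coefficients \<alpha> are kept general in order to treat \<xi>^k and its
  \<xi>-derivative k \<xi>^(k-1) by one differentiation of the series in \<open>z\<close>.
  Differentiation shifts the index because (T (k+1))' = C T k.\<close>

lemma dyson_series:
  fixes \<alpha> :: "nat \<Rightarrow> complex"
  assumes S: "open S" and C: "mholo C S"
    and T: "\<And>z. T 0 z = mat 1"
      "\<And>k z. z \<in> S \<Longrightarrow> has_mderiv (T (Suc k)) (C z ** T k z) z"
      "\<And>z0. z0 \<in> S \<Longrightarrow> \<exists>r>0. \<exists>K\<ge>0. ball z0 r \<subseteq> S \<and>
        (\<forall>z\<in>ball z0 r. \<forall>k i j. norm (T k z $ i $ j) \<le> K ^ k / fact k)"
    and \<alpha>: "\<And>k. norm (\<alpha> k) \<le> A * L ^ k" "L \<ge> 0" "A \<ge> 0" and z: "z \<in> S"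
  shows "summable (\<lambda>k. \<alpha> k * T k z $ i $ j)"
    and "has_mderiv (\<lambda>z. \<chi> i j. \<Sum>k. \<alpha> k * T k z $ i $ j)
           (C z ** (\<chi> i j. \<Sum>k. \<alpha> (Suc k) * T k z $ i $ j)) z"
proof -
  obtain r0 K where r0: "r0 > 0" "K \<ge> 0" "ball z r0 \<subseteq> S"
    and TK: "\<And>v k i j. v \<in> ball z r0 \<Longrightarrow> norm (T k v $ i $ j) \<le> K ^ k / fact k"
    using T(3)[OF z] by blast
  have sumb: "summable (\<lambda>k. A' * L ^ k * (K ^ k / fact k))" for A' :: real
  proof -
    have "summable (\<lambda>k. A' * ((L * K) ^ k /\<^sub>R fact k))"
      by (intro summable_mult summable_exp_generic)
    then show ?thesis by (simp add: power_mult_distrib field_simps)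
  qed
  have summ: "summable (\<lambda>k. \<beta> k * T k v $ i $ j)" if "v \<in> ball z r0" "\<And>k. norm (\<beta> k) \<le> A' * L ^ k" "A' \<ge> 0"
    for \<beta> :: "nat \<Rightarrow> complex" and v i j A'
  proof (rule summable_comparison_test'[OF sumb[of A'], of 0])
    fix k
    show "norm (\<beta> k * T k v $ i $ j) \<le> A' * L ^ k * (K ^ k / fact k)"
      unfolding norm_mult using that TK \<alpha>(2) by (intro mult_mono) auto
  qed
  have zin: "z \<in> ball z r0" using r0 by simp
  show "summable (\<lambda>k. \<alpha> k * T k z $ i $ j)" by (rule summ[OF zin \<alpha>(1,3)])
  have \<alpha>S: "norm (\<alpha> (Suc k)) \<le> (A * L) * L ^ k" for k
    using \<alpha>(1)[of "Suc k"] by (simp add: mult_ac)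
  have AL: "A * L \<ge> 0" using \<alpha> by simp
  define r where "r = r0 / 2"
  have r: "r > 0" "cball z r \<subseteq> ball z r0" unfolding r_def using r0 by (auto simp: subset_iff)
  have "\<exists>M. \<forall>v\<in>cball z r. norm (C v $ i $ j) \<le> M" for i j
  proof -
    have "continuous_on (cball z r) (\<lambda>z. C z $ i $ j)"
      using holomorphic_on_imp_continuous_on[OF mholoD[OF C]] r r0 by (meson continuous_on_subset subset_trans)
    then have "bounded ((\<lambda>z. C z $ i $ j) ` cball z r)"
      by (intro compact_imp_bounded compact_continuous_image) auto
    then show ?thesis unfolding bounded_iff by blast
  qed
  then obtain M where M: "\<And>i j v. v \<in> cball z r \<Longrightarrow> norm (C v $ i $ j) \<le> M i j" by metis
  show "has_mderiv (\<lambda>z. \<chi> i j. \<Sum>k. \<alpha> k * T k z $ i $ j)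
           (C z ** (\<chi> i j. \<Sum>k. \<alpha> (Suc k) * T k z $ i $ j)) z"
    unfolding has_mderiv_def
  proof (intro allI)
    fix i j
    define f' where "f' k v = (case k of 0 \<Rightarrow> 0 | Suc k \<Rightarrow> \<alpha> (Suc k) * (C v ** T k v) $ i $ j)" for k v
    define D where "D = (\<bar>M i 1\<bar> + \<bar>M i 2\<bar>)"
    have "((\<lambda>v. \<Sum>k. \<alpha> k * T k v $ i $ j) has_field_derivative (\<Sum>k. f' k z)) (at z)"
    proof (rule has_field_derivative_series'(2)[where S = "ball z r"])
      show "convex (ball z r)" by simp
      show "z \<in> ball z r" "z \<in> interior (ball z r)" using r by simp_all
      show "summable (\<lambda>k. \<alpha> k * T k z $ i $ j)" by (rule summ[OF zin \<alpha>(1,3)])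
      fix k v assume v: "v \<in> ball z r"
      then have "v \<in> cball z r" by auto
      moreover from this have "v \<in> ball z r0" using r(2) by (rule subsetD[rotated])
      ultimately have vS: "v \<in> S" "v \<in> cball z r" using r0(3) by (auto dest: subsetD)
      show "((\<lambda>v. \<alpha> k * T k v $ i $ j) has_field_derivative f' k v) (at v within ball z r)"
      proof (cases k)
        case 0
        then show ?thesis by (simp add: T(1) f'_def)
      next
        case (Suc m)
        have "((\<lambda>v. \<alpha> k * T k v $ i $ j) has_field_derivative f' k v) (at v)"
          unfolding Suc f'_def by (auto intro!: DERIV_cmult has_mderivD[OF T(2)[OF vS(1)]])
        then show ?thesis by (rule has_field_derivative_at_within)
      qed
    next
      show "uniformly_convergent_on (ball z r) (\<lambda>n x. \<Sum>i<n. f' i x)"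
      proof (rule Weierstrass_m_test'[where M = "\<lambda>k. case k of 0 \<Rightarrow> 0 | Suc k \<Rightarrow> (A * L * D) * L ^ k * (K ^ k / fact k)"])
        show "summable (\<lambda>k. case k of 0 \<Rightarrow> 0 | Suc k \<Rightarrow> (A * L * D) * L ^ k * (K ^ k / fact k))"
          using sumb[of "A * L * D"] by (subst summable_Suc_iff[symmetric]) simp
        fix k v assume v: "v \<in> ball z r"
        then have v': "v \<in> cball z r" by auto
        moreover from this have "v \<in> ball z r0" using r(2) by (rule subsetD[rotated])
        ultimately have v': "v \<in> ball z r0" "v \<in> cball z r" by auto
        show "norm (f' k v) \<le> (case k of 0 \<Rightarrow> 0 | Suc k \<Rightarrow> (A * L * D) * L ^ k * (K ^ k / fact k))"
        proof (cases k)
          case 0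
          then show ?thesis by (simp add: f'_def)
        next
          case (Suc m)
          have "norm ((C v ** T m v) $ i $ j) \<le> norm (C v $ i $ 1) * norm (T m v $ 1 $ j) + norm (C v $ i $ 2) * norm (T m v $ 2 $ j)"
            unfolding mmult_nth norm_mult[symmetric] by (rule norm_triangle_ineq)
          also have "\<dots> \<le> \<bar>M i 1\<bar> * (K ^ m / fact m) + \<bar>M i 2\<bar> * (K ^ m / fact m)"
            by (intro add_mono mult_mono TK v' order_trans[OF M[OF v'(2)]]) auto
          also have "\<dots> = D * (K ^ m / fact m)" by (simp add: D_def algebra_simps add_divide_distrib)
          finally have 1: "norm ((C v ** T m v) $ i $ j) \<le> D * (K ^ m / fact m)" .
          have "norm (\<alpha> (Suc m)) * norm ((C v ** T m v) $ i $ j) \<le> (A * L * L ^ m) * (D * (K ^ m / fact m))"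
            using \<alpha>S[of m] 1 AL \<alpha>(2) by (intro mult_mono) auto
          then show ?thesis unfolding Suc f'_def by (simp add: norm_mult mult_ac)
        qed
      qed
    qed
    moreover have "(\<Sum>k. f' k z) = (C z ** (\<chi> i j. \<Sum>k. \<alpha> (Suc k) * T k z $ i $ j)) $ i $ j"
    proof -
      have s: "summable (\<lambda>k. \<alpha> (Suc k) * T k z $ l $ j)" for l
        by (rule summ[OF zin \<alpha>S AL])
      have sf: "(\<lambda>k. f' (Suc k) z) sums ((C z ** (\<chi> i j. \<Sum>k. \<alpha> (Suc k) * T k z $ i $ j)) $ i $ j)"
        unfolding f'_def mmult_nth nat.case
        using sums_add[OF sums_mult[OF summable_sums[OF s[of 1]], of "C z $ i $ 1"]
                          sums_mult[OF summable_sums[OF s[of 2]], of "C z $ i $ 2"]]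
        by (simp add: algebra_simps)
      have "f' 0 z = 0" by (simp add: f'_def)
      with sf have "(\<lambda>k. f' k z) sums ((C z ** (\<chi> i j. \<Sum>k. \<alpha> (Suc k) * T k z $ i $ j)) $ i $ j)"
        by (subst (asm) sums_Suc_iff) simp
      then show ?thesis by (rule sums_unique[symmetric])
    qed
    ultimately show "((\<lambda>v. (\<chi> i j. \<Sum>k. \<alpha> k * T k v $ i $ j) $ i $ j) has_field_derivative
          (C z ** (\<chi> i j. \<Sum>k. \<alpha> (Suc k) * T k z $ i $ j)) $ i $ j) (at z)"
      by simp
  qed
qed

lemma scale_mat_mult: "scale_mat c A ** B = scale_mat c (A ** B)" "A ** scale_mat c B = scale_mat c (A ** B)"
  by (simp_all add: cmat_eq_iff mmult_nth algebra_simps)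

text \<open>\<open>Q\<close> is the derivative of \<open>P\<close> in the parameter and obeys the
  variational equation. Both are wanted because \<xi> will be the spectral variable, in which the
  deformed solution must again satisfy a differential equation.\<close>

lemma lode_pencil1:
  assumes S: "open S" "a \<in> S" "\<And>z. z \<in> S \<Longrightarrow> closed_segment a z \<subseteq> S" and C: "mholo C S"
  obtains P Q :: "complex \<Rightarrow> complex \<Rightarrow> cmat"
  where "\<And>\<xi>. P \<xi> a = mat 1"
    "\<And>\<xi>. Q \<xi> a = 0"
    "\<And>\<xi> z. z \<in> S \<Longrightarrow> has_mderiv (\<lambda>z. P \<xi> z) (scale_mat \<xi> (C z) ** P \<xi> z) z"
    "\<And>\<xi> z. z \<in> S \<Longrightarrow> has_mderiv (\<lambda>\<xi>. P \<xi> z) (Q \<xi> z) \<xi>"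
    "\<And>\<xi> z. z \<in> S \<Longrightarrow> has_mderiv (\<lambda>z. Q \<xi> z) (C z ** P \<xi> z + scale_mat \<xi> (C z) ** Q \<xi> z) z"
proof -
  obtain T where T: "\<And>z. T 0 z = mat 1" "\<And>k. T (Suc k) a = 0"
    "\<And>k z. z \<in> S \<Longrightarrow> has_mderiv (T (Suc k)) (C z ** T k z) z"
    "\<And>z0. z0 \<in> S \<Longrightarrow> \<exists>r>0. \<exists>K\<ge>0. ball z0 r \<subseteq> S \<and>
        (\<forall>z\<in>ball z0 r. \<forall>k i j. norm (T k z $ i $ j) \<le> K ^ k / fact k)"
    using dyson_terms[OF S C] by metis
  have dys1: "summable (\<lambda>k. \<alpha> k * T k z $ i $ j)"
    and dys2: "has_mderiv (\<lambda>z. \<chi> i j. \<Sum>k. \<alpha> k * T k z $ i $ j)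
           (C z ** (\<chi> i j. \<Sum>k. \<alpha> (Suc k) * T k z $ i $ j)) z"
    if "\<And>k. norm (\<alpha> k) \<le> A * L ^ k" "L \<ge> 0" "A \<ge> 0" "z \<in> S" for \<alpha> :: "nat \<Rightarrow> complex" and A L z i j
    by (rule dyson_series[OF S(1) C T(1) T(3) T(4) that]; assumption)+
  define P where "P = (\<lambda>\<xi> z. \<chi> i j. \<Sum>k. \<xi> ^ k * T k z $ i $ j)"
  define \<beta> :: "complex \<Rightarrow> nat \<Rightarrow> complex" where "\<beta> \<xi> k = of_nat k * \<xi> ^ (k - 1)" for \<xi> k
  define Q where "Q = (\<lambda>\<xi> z. \<chi> i j. \<Sum>k. \<beta> \<xi> k * T k z $ i $ j)"
  have bp: "norm (\<xi> ^ k) \<le> 1 * norm \<xi> ^ k" for \<xi> :: complex and k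
    by (simp add: norm_power)
  \<comment> \<open>A crude geometric bound is enough, since it competes with a factorial: k is at
    most 2^k and |\<xi>|^(k-1) at most (|\<xi>| + 1)^k.\<close>
  have b\<beta>: "norm (\<beta> \<xi> k) \<le> 1 * (2 * (norm \<xi> + 1)) ^ k" for \<xi> k
  proof -
    have "norm (\<beta> \<xi> k) = real k * norm \<xi> ^ (k - 1)" by (simp add: \<beta>_def norm_mult norm_power)
    also have "\<dots> \<le> 2 ^ k * (norm \<xi> + 1) ^ k"
    proof (rule mult_mono)
      show "real k \<le> 2 ^ k" by (simp add: less_imp_le)
      have "norm \<xi> ^ (k - 1) \<le> (norm \<xi> + 1) ^ (k - 1)" by (intro power_mono) auto
      also have "\<dots> \<le> (norm \<xi> + 1) ^ k" by (intro power_increasing) auto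
      finally show "norm \<xi> ^ (k - 1) \<le> (norm \<xi> + 1) ^ k" .
    qed auto
    finally show ?thesis by (simp add: power_mult_distrib[symmetric])
  qed
  have sP: "summable (\<lambda>k. \<xi> ^ k * T k z $ i $ j)" if "z \<in> S" for \<xi> z i j
    by (rule dys1[OF bp]) (auto simp: that)
  have sQ: "summable (\<lambda>k. \<beta> \<xi> k * T k z $ i $ j)" if "z \<in> S" for \<xi> z i j
    by (rule dys1[OF b\<beta>]) (auto simp: that)
  show ?thesis
  proof (rule that)
    fix \<xi>
    have s1: "suminf f = f 0" if "\<And>k. f (Suc k) = 0" for f :: "nat \<Rightarrow> complex"
    proof -
      have "f k = 0" if "k \<noteq> 0" for k using that \<open>\<And>k. f (Suc k) = 0\<close> by (cases k) auto
      then show ?thesis using suminf_finite[of "{0}" f] by auto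
    qed
    show "P \<xi> a = mat 1" unfolding P_def vec_eq_iff by (auto simp: s1 T(1,2))
    show "Q \<xi> a = 0" unfolding Q_def vec_eq_iff by (auto simp: s1 T(1,2) \<beta>_def)
    fix z assume z: "z \<in> S"
    have eqS: "C z ** (\<chi> i j. \<Sum>k. \<xi> ^ Suc k * T k z $ i $ j) = scale_mat \<xi> (C z) ** P \<xi> z"
    proof -
      have "(\<chi> i j. \<Sum>k. \<xi> ^ Suc k * T k z $ i $ j) = scale_mat \<xi> (P \<xi> z)"
        unfolding vec_eq_iff P_def using suminf_mult[OF sP[OF z], of \<xi> \<xi>] by (simp add: mult_ac)
      then show ?thesis by (simp add: scale_mat_mult)
    qed
    have "has_mderiv (\<lambda>z. P \<xi> z) (C z ** (\<chi> i j. \<Sum>k. \<xi> ^ Suc k * T k z $ i $ j)) z"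
      unfolding P_def by (rule dys2[OF bp]) (auto simp: z)
    with eqS show "has_mderiv (\<lambda>z. P \<xi> z) (scale_mat \<xi> (C z) ** P \<xi> z) z" by simp
    have dQ: "has_mderiv (\<lambda>z. Q \<xi> z) (C z ** (\<chi> i j. \<Sum>k. \<beta> \<xi> (Suc k) * T k z $ i $ j)) z"
      unfolding Q_def by (rule dys2[OF b\<beta>]) (auto simp: z)
    have "(\<chi> i j. \<Sum>k. \<beta> \<xi> (Suc k) * T k z $ i $ j) = P \<xi> z + scale_mat \<xi> (Q \<xi> z)"
      unfolding vec_eq_iff P_def Q_def
    proof (intro allI)
      fix i j
      have "\<beta> \<xi> (Suc k) * T k z $ i $ j = \<xi> ^ k * T k z $ i $ j + \<xi> * (\<beta> \<xi> k * T k z $ i $ j)" for k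
        by (cases k) (simp_all add: \<beta>_def algebra_simps)
      then show "(\<chi> i j. \<Sum>k. \<beta> \<xi> (Suc k) * T k z $ i $ j) $ i $ j =
         ((\<chi> i j. \<Sum>k. \<xi> ^ k * T k z $ i $ j) + scale_mat \<xi> (\<chi> i j. \<Sum>k. \<beta> \<xi> k * T k z $ i $ j)) $ i $ j"
        using suminf_add[OF sP[OF z, of \<xi> i j] summable_mult[OF sQ[OF z, of \<xi> i j], of \<xi>]] suminf_mult[OF sQ[OF z], of \<xi> \<xi> i j]
        by simp
    qed
    with dQ show "has_mderiv (\<lambda>z. Q \<xi> z) (C z ** P \<xi> z + scale_mat \<xi> (C z) ** Q \<xi> z) z"
      by (simp add: matrix_add_ldistrib scale_mat_mult)
    show "has_mderiv (\<lambda>\<xi>. P \<xi> z) (Q \<xi> z) \<xi>"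
      unfolding has_mderiv_def
    proof (intro allI)
      fix i j
      have "((\<lambda>x. \<Sum>k. (T k z $ i $ j) * x ^ k) has_field_derivative
              (\<Sum>k. diffs (\<lambda>k. T k z $ i $ j) k * \<xi> ^ k)) (at \<xi>)"
        using sP[OF z] by (intro termdiffs_strong_converges_everywhere) (simp add: mult.commute)
      moreover have "(\<Sum>k. diffs (\<lambda>k. T k z $ i $ j) k * \<xi> ^ k) = (\<Sum>k. \<beta> \<xi> k * T k z $ i $ j)"
      proof -
        have "(\<lambda>k. \<beta> \<xi> (Suc k) * T (Suc k) z $ i $ j) sums (\<Sum>k. \<beta> \<xi> k * T k z $ i $ j)"
          using summable_sums[OF sQ[OF z, of \<xi> i j]] by (subst sums_Suc_iff) (simp add: \<beta>_def)
        then show ?thesis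
          by (intro sums_unique[symmetric]) (simp add: diffs_def \<beta>_def mult_ac)
      qed
      ultimately show "((\<lambda>v. P v z $ i $ j) has_field_derivative Q \<xi> z $ i $ j) (at \<xi>)"
        unfolding P_def Q_def by (simp add: mult.commute)
    qed
  qed
qed

section \<open>Quotients of solutions of traceless systems\<close>

lemma trace_2: "trace (A::cmat) = A$1$1 + A$2$2"
  by (simp add: trace_def sum_2)

text \<open>A traceless matrix has adjugate \<open>- A\<close>. Hence \<open>adj2 Y\<close>
  satisfies the adjoint equation whenever \<open>Y\<close> solves a traceless system, and
  \<open>adj2 Y ** Z\<close> is constant for two solutions; this replaces every use of existence and
  uniqueness theorems below.\<close>

lemma adj2_traceless: "trace A = 0 \<Longrightarrow> adj2 (A ** B) = - (adj2 B ** A)"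
proof -
  assume "trace A = 0"
  then have "A$2$2 = - A$1$1" by (simp add: trace_2 add_eq_0_iff)
  then show ?thesis by (simp add: cmat_eq_iff mmult_nth algebra_simps)
qed

lemma matrix_minus_left [simp]: "(- A :: cmat) ** (B::cmat) = - (A ** B)"
  by (simp add: cmat_eq_iff mmult_nth)

lemma matrix_zero_right [simp]: "(B::cmat) ** 0 = 0"
  by (simp add: cmat_eq_iff mmult_nth)

lemma matrix_add_rdistrib2: "((A::cmat) + B) ** (C::cmat) = A ** C + B ** C"
  by (simp add: cmat_eq_iff mmult_nth algebra_simps)

lemma mderiv_zero_const:
  assumes "open S" "connected S" "\<And>z. z \<in> S \<Longrightarrow> has_mderiv F 0 z" "a \<in> S" "b \<in> S"
  shows "F a = F b"
proof -
  have "F a $ i $ j = F b $ i $ j" for i j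
  proof -
    have "((\<lambda>v. F v $ i $ j) has_field_derivative 0) (at z within S)" if "z \<in> S" for z
      using has_mderivD[OF assms(3)[OF that], of i j] by (simp add: has_field_derivative_at_within)
    moreover have "continuous_on S (\<lambda>v. F v $ i $ j)"
      using calculation by (meson DERIV_continuous continuous_on_eq_continuous_within)
    ultimately obtain c where "\<And>z. z \<in> S \<Longrightarrow> F z $ i $ j = c"
      using DERIV_zero_connected_constant[OF assms(2,1) finite.emptyI, of "\<lambda>v. F v $ i $ j"]
      by (metis Diff_empty at_within_open assms(1))
    then show ?thesis using assms(4,5) by simp
  qed
  then show ?thesis by (simp add: vec_eq_iff)
qed

lemma lode_quotient_const:
  assumes "open S" "connected S" "\<And>z. z \<in> S \<Longrightarrow> has_mderiv Y (A z ** Y z) z"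
    "\<And>z. z \<in> S \<Longrightarrow> has_mderiv Z (A z ** Z z) z" "\<And>z. z \<in> S \<Longrightarrow> trace (A z) = 0" "a \<in> S" "b \<in> S"
  shows "adj2 (Y a) ** Z a = adj2 (Y b) ** Z b"
proof (rule mderiv_zero_const[OF assms(1,2) _ assms(6,7)])
  fix z assume z: "z \<in> S"
  have "has_mderiv (\<lambda>v. adj2 (Y v) ** Z v) (adj2 (A z ** Y z) ** Z z + adj2 (Y z) ** (A z ** Z z)) z"
    using assms(3,4)[OF z] by (intro has_mderiv_mult has_mderiv_adj2)
  also have "adj2 (A z ** Y z) ** Z z + adj2 (Y z) ** (A z ** Z z) = 0"
    by (simp add: adj2_traceless[OF assms(5)[OF z]] matrix_mul_assoc)
  finally show "has_mderiv (\<lambda>v. adj2 (Y v) ** Z v) 0 z" .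
qed

lemma mat_mult_left: "mat c ** (A::cmat) = scale_mat c A" "(A::cmat) ** mat c = scale_mat c A"
  by (simp_all add: cmat_eq_iff mmult_nth mat_def)

lemma lode_det_const:
  assumes "open S" "connected S" "\<And>z. z \<in> S \<Longrightarrow> has_mderiv Y (A z ** Y z) z"
    "\<And>z. z \<in> S \<Longrightarrow> trace (A z) = 0" "a \<in> S" "b \<in> S"
  shows "det (Y a) = det (Y b)"
proof -
  have "(mat (det (Y a)) :: cmat) $ 1 $ 1 = (mat (det (Y b)) :: cmat) $ 1 $ 1"
    using lode_quotient_const[OF assms(1-3,3,4,5,6)] unfolding adj2_left by (rule arg_cong)
  then show ?thesis by (simp add: mat_def)
qed

lemma lode_starlike:
  assumes S: "open S" "a \<in> S" "\<And>z. z \<in> S \<Longrightarrow> closed_segment a z \<subseteq> S" and C: "mholo C S"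
  obtains F where "F a = mat 1" "\<And>z. z \<in> S \<Longrightarrow> has_mderiv F (C z ** F z) z"
proof -
  obtain P Q where "P 1 a = mat 1" "\<And>z. z \<in> S \<Longrightarrow> has_mderiv (\<lambda>z. P (1::complex) z) (scale_mat 1 (C z) ** P 1 z) z"
    using lode_pencil1[OF S C] by metis
  moreover have "scale_mat 1 A = A" for A by (simp add: cmat_eq_iff)
  ultimately show ?thesis using that[of "P 1"] by simp
qed

text \<open>The term \<open>B\<close> is gauged away by a solution \<open>F\<close> of F' = B F. In
  the new frame the coefficient is \<xi> times F^-1 C F, which is the case already solved.\<close>

lemma lode_pencil:
  assumes S: "open S" "a \<in> S" "\<And>z. z \<in> S \<Longrightarrow> closed_segment a z \<subseteq> S"
    and C: "mholo C S" and B: "mholo B S" "\<And>z. z \<in> S \<Longrightarrow> trace (B z) = 0"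
  obtains P Q :: "complex \<Rightarrow> complex \<Rightarrow> cmat"
  where "\<And>\<xi>. P \<xi> a = mat 1" "\<And>\<xi>. Q \<xi> a = 0"
    "\<And>\<xi> z. z \<in> S \<Longrightarrow> has_mderiv (\<lambda>z. P \<xi> z) ((scale_mat \<xi> (C z) + B z) ** P \<xi> z) z"
    "\<And>\<xi> z. z \<in> S \<Longrightarrow> has_mderiv (\<lambda>\<xi>. P \<xi> z) (Q \<xi> z) \<xi>"
    "\<And>\<xi> z. z \<in> S \<Longrightarrow> has_mderiv (\<lambda>z. Q \<xi> z) (C z ** P \<xi> z + (scale_mat \<xi> (C z) + B z) ** Q \<xi> z) z"
proof -
  obtain F where F: "F a = mat 1" "\<And>z. z \<in> S \<Longrightarrow> has_mderiv F (B z ** F z) z"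
    using lode_starlike[OF S B(1)] by metis
  have holF: "mholo F S" using F(2) S(1) by (intro mholo_mderiv) auto
  have star: "starlike S" unfolding starlike_def using S by blast
  have detF: "det (F z) = 1" if "z \<in> S" for z
    using lode_det_const[OF S(1) starlike_imp_connected[OF star] F(2) B(2) that S(2)] F(1) by simp
  have FF: "F z ** adj2 (F z) = mat 1" if "z \<in> S" for z
    using adj2_right[of "F z"] detF[OF that] by simp
  define D where "D z = adj2 (F z) ** C z ** F z" for z
  have FD: "F z ** D z = C z ** F z" if "z \<in> S" for z
    unfolding D_def by (simp add: matrix_mul_assoc FF[OF that])
  have "mholo D S" unfolding D_def by (intro mholo_mult mholo_adj2 holF C)
  from S(1,2) _ this show ?thesis
  proof (rule lode_pencil1)
    fix P Q :: "complex \<Rightarrow> complex \<Rightarrow> cmat"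
    assume PQ:
    "\<And>\<xi>. P \<xi> a = mat 1" "\<And>\<xi>. Q \<xi> a = 0"
    "\<And>\<xi> z. z \<in> S \<Longrightarrow> has_mderiv (\<lambda>z. P \<xi> z) (scale_mat \<xi> (D z) ** P \<xi> z) z"
    "\<And>\<xi> z. z \<in> S \<Longrightarrow> has_mderiv (\<lambda>\<xi>. P \<xi> z) (Q \<xi> z) \<xi>"
    "\<And>\<xi> z. z \<in> S \<Longrightarrow> has_mderiv (\<lambda>z. Q \<xi> z) (D z ** P \<xi> z + scale_mat \<xi> (D z) ** Q \<xi> z) z"
  show thesis
  proof (rule that[of "\<lambda>\<xi> z. F z ** P \<xi> z" "\<lambda>\<xi> z. F z ** Q \<xi> z"])
    fix \<xi> z assume z: "z \<in> S"
    have 1: "F z ** (D z ** A) = C z ** (F z ** A)" for A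
      by (simp add: matrix_mul_assoc FD[OF z])
    have "has_mderiv (\<lambda>z. F z ** P \<xi> z) ((B z ** F z) ** P \<xi> z + F z ** (scale_mat \<xi> (D z) ** P \<xi> z)) z"
      by (intro has_mderiv_mult F PQ z)
    then show "has_mderiv (\<lambda>z. F z ** P \<xi> z) ((scale_mat \<xi> (C z) + B z) ** (F z ** P \<xi> z)) z"
      by (simp add: scale_mat_mult 1 matrix_add_rdistrib2 add.commute matrix_mul_assoc[symmetric])
    have "has_mderiv (\<lambda>\<xi>. F z ** P \<xi> z) (0 ** P \<xi> z + F z ** Q \<xi> z) \<xi>"
      by (intro has_mderiv_mult has_mderiv_const PQ z)
    then show "has_mderiv (\<lambda>\<xi>. F z ** P \<xi> z) (F z ** Q \<xi> z) \<xi>" by simp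
    have "has_mderiv (\<lambda>z. F z ** Q \<xi> z) ((B z ** F z) ** Q \<xi> z + F z ** (D z ** P \<xi> z + scale_mat \<xi> (D z) ** Q \<xi> z)) z"
      by (intro has_mderiv_mult F PQ z)
    then show "has_mderiv (\<lambda>z. F z ** Q \<xi> z) (C z ** (F z ** P \<xi> z) + (scale_mat \<xi> (C z) + B z) ** (F z ** Q \<xi> z)) z"
      by (simp add: scale_mat_mult 1 matrix_add_rdistrib2 matrix_add_ldistrib add_ac matrix_mul_assoc[symmetric])
  qed (simp_all add: F PQ)
qed (rule S(3))
qed

section \<open>Asymptotics along rays\<close>

text \<open>The second component is damped when \<open>r\<close> decreases, so \<open>(\<rho>\<^sub>0 + r) \<bar>h\<^sub>2\<bar>\<close> attains its maximum
  either at the right end or where \<open>\<kappa> \<bar>h\<^sub>2\<bar>\<close> is dominated by the coupling to \<open>h\<^sub>1\<close>.\<close>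
lemma backward_bound:
  fixes h1 h2 \<alpha> \<beta> \<gamma> \<omega> :: "real \<Rightarrow> complex"
  assumes l: "l \<ge> 0" and K: "K \<ge> 0" and \<kappa>: "\<kappa> > 0" and C: "C \<ge> 0"
    and d1: "\<And>r. r \<in> {0..l} \<Longrightarrow> (h1 has_vector_derivative (\<alpha> r * h1 r + \<beta> r * h2 r)) (at r within {0..l})"
    and d2: "\<And>r. r \<in> {0..l} \<Longrightarrow> (h2 has_vector_derivative (\<gamma> r * h2 r + \<omega> r * h1 r)) (at r within {0..l})"
    and \<alpha>: "\<And>r. r \<in> {0..l} \<Longrightarrow> norm (\<alpha> r) \<le> K / (\<rho>0 + r)\<^sup>2"
    and \<beta>: "\<And>r. r \<in> {0..l} \<Longrightarrow> norm (\<beta> r) \<le> K / (\<rho>0 + r)"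
    and \<omega>: "\<And>r. r \<in> {0..l} \<Longrightarrow> norm (\<omega> r) \<le> K / (\<rho>0 + r)"
    and \<gamma>: "\<And>r. r \<in> {0..l} \<Longrightarrow> Re (\<gamma> r) \<ge> \<kappa>"
    and t: "norm (h1 l - 1) \<le> C / (\<rho>0 + l)" "norm (h2 l) \<le> C / (\<rho>0 + l)"
    and \<rho>0: "\<rho>0 \<ge> 2 * K * (1 + K / \<kappa>) + 2 * (C + K * C) + 1"
  shows "norm (h1 0 - 1) \<le> (C + K * (3 + C + 3 * K / \<kappa>) + 3 * K / \<kappa>) / \<rho>0"
    and "norm (h2 0) \<le> (C + K * (3 + C + 3 * K / \<kappa>) + 3 * K / \<kappa>) / \<rho>0"
proof -
  have Kk: "K / \<kappa> \<ge> 0" using K \<kappa> by simp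
  have \<rho>pos: "\<rho>0 \<ge> 1"
    using \<rho>0 K C Kk by (smt (verit, best) mult_nonneg_nonneg)
  have cont1: "continuous_on {0..l} h1"
    unfolding continuous_on_eq_continuous_within using has_vector_derivative_continuous[OF d1] by blast
  have cont2: "continuous_on {0..l} h2"
    unfolding continuous_on_eq_continuous_within using has_vector_derivative_continuous[OF d2] by blast
  have ne: "{0..l} \<noteq> {}" using l by auto
  obtain r1 where r1: "r1 \<in> {0..l}" "\<And>r. r \<in> {0..l} \<Longrightarrow> norm (h1 r) \<le> norm (h1 r1)"
    using continuous_attains_sup[OF compact_Icc ne continuous_on_norm[OF cont1]] by blast
  define M1 where "M1 = norm (h1 r1)"
  have M1: "norm (h1 r) \<le> M1" if "r \<in> {0..l}" for r using r1(2)[OF that] by (simp add: M1_def)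
  have M1n: "M1 \<ge> 0" by (simp add: M1_def)
  \<comment> \<open>The square of (\<rho>0 + r) |h2|, written with real and imaginary parts, is
    differentiable also where \<open>h2\<close> vanishes.\<close>
  define g where "g r = (\<rho>0 + r)\<^sup>2 * ((Re (h2 r))\<^sup>2 + (Im (h2 r))\<^sup>2)" for r
  have g_alt: "g r = ((\<rho>0 + r) * norm (h2 r))\<^sup>2" for r
    by (simp add: g_def power_mult_distrib cmod_power2)
  have "continuous_on {0..l} g" unfolding g_alt
    by (intro continuous_intros cont2)
  then obtain r2 where r2: "r2 \<in> {0..l}" "\<And>r. r \<in> {0..l} \<Longrightarrow> g r \<le> g r2"
    using continuous_attains_sup[OF compact_Icc ne] by blast
  have M2a: "(\<rho>0 + r2) * norm (h2 r2) \<le> C + K * M1 / \<kappa>"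
  proof (cases "r2 = l")
    case True
    then have "(\<rho>0 + r2) * norm (h2 r2) \<le> C"
      using t(2) \<rho>pos l by (simp add: field_simps)
    moreover have "K * M1 / \<kappa> \<ge> 0" using K M1n \<kappa> by simp
    ultimately show ?thesis by linarith
  next
    case False
    then have r2l: "r2 < l" using r2(1) by auto
    define h' where "h' = \<gamma> r2 * h2 r2 + \<omega> r2 * h1 r2"
    define \<rho> where "\<rho> = \<rho>0 + r2"
    have \<rho>: "\<rho> \<ge> 1" using \<rho>pos r2(1) by (auto simp: \<rho>_def)
    define D where "D = 2 * \<rho> * ((Re (h2 r2))\<^sup>2 + (Im (h2 r2))\<^sup>2)
            + \<rho>\<^sup>2 * (2 * Re (h2 r2) * Re h' + 2 * Im (h2 r2) * Im h')"
    have dh: "(h2 has_vector_derivative h') (at r2 within {0..l})" using d2[OF r2(1)] by (simp add: h'_def)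
    have gd: "(g has_real_derivative D) (at r2 within {0..l})"
      unfolding g_def D_def \<rho>_def
      by (rule derivative_eq_intros refl has_field_derivative_Re has_field_derivative_Im dh)+ (simp add: algebra_simps)
    \<comment> \<open>Only increments to the right are compared, so a maximum at r = 0 is covered as
      well.\<close>
    have "D \<le> 0"
    proof (rule ccontr)
      assume "\<not> D \<le> 0"
      then have "D > 0" by simp
      from has_real_derivative_pos_inc_right[OF gd this] obtain d where d: "d > 0"
        "\<And>h. h > 0 \<Longrightarrow> r2 + h \<in> {0..l} \<Longrightarrow> h < d \<Longrightarrow> g r2 < g (r2 + h)" by blast
      define h where "h = min (d / 2) (l - r2)"
      have "h > 0" "h < d" "r2 + h \<in> {0..l}" using d(1) r2l r2(1) by (auto simp: h_def)
      then have "g r2 < g (r2 + h)" "g (r2 + h) \<le> g r2" using d(2) r2(2) by blast+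
      then show False by simp
    qed
    define n where "n = norm (h2 r2)"
    have n2: "(Re (h2 r2))\<^sup>2 + (Im (h2 r2))\<^sup>2 = n\<^sup>2" by (simp add: n_def cmod_power2)
    have Deq: "D = 2 * \<rho> * n\<^sup>2 + \<rho>\<^sup>2 * (2 * Re (cnj (h2 r2) * h'))"
      unfolding D_def n2 by (simp add: algebra_simps)
    have "Re (cnj (h2 r2) * h') = Re (\<gamma> r2) * n\<^sup>2 + Re (cnj (h2 r2) * \<omega> r2 * h1 r2)"
    proof -
      have "cnj (h2 r2) * h' = \<gamma> r2 * (h2 r2 * cnj (h2 r2)) + cnj (h2 r2) * \<omega> r2 * h1 r2"
        unfolding h'_def by (simp add: algebra_simps)
      also have "h2 r2 * cnj (h2 r2) = complex_of_real (n\<^sup>2)"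
        unfolding n_def by (rule complex_norm_square[symmetric])
      finally show ?thesis by (simp only: plus_complex.sel Re_complex_of_real times_complex.sel Im_complex_of_real)
    qed
    moreover have "Re (\<gamma> r2) * n\<^sup>2 \<ge> \<kappa> * n\<^sup>2" using \<gamma>[OF r2(1)] by (simp add: mult_right_mono)
    moreover have "Re (cnj (h2 r2) * \<omega> r2 * h1 r2) \<ge> - (n * (K / \<rho>) * M1)"
    proof -
      have "norm (cnj (h2 r2) * \<omega> r2 * h1 r2) \<le> n * (K / \<rho>) * M1"
        unfolding norm_mult n_def complex_mod_cnj \<rho>_def using \<omega>[OF r2(1)] M1[OF r2(1)] K \<rho>pos r2(1)
        by (intro mult_mono mult_left_mono mult_nonneg_nonneg divide_nonneg_nonneg) auto
      then show ?thesis using abs_Re_le_cmod[of "cnj (h2 r2) * \<omega> r2 * h1 r2"] by linarith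
    qed
    ultimately have "Re (cnj (h2 r2) * h') \<ge> \<kappa> * n\<^sup>2 - n * (K / \<rho>) * M1" by linarith
    then have "\<rho>\<^sup>2 * (2 * (\<kappa> * n\<^sup>2 - n * (K / \<rho>) * M1)) \<le> \<rho>\<^sup>2 * (2 * Re (cnj (h2 r2) * h'))"
      by (intro mult_left_mono) auto
    also have "\<dots> \<le> D" unfolding Deq using \<rho> by simp
    also note \<open>D \<le> 0\<close>
    finally have "2 * (\<rho> * n) * (\<kappa> * (\<rho> * n) - K * M1) \<le> 0"
      using \<rho> by (simp add: power2_eq_square field_simps)
    moreover have "\<rho> * n \<ge> 0" using \<rho> by (simp add: n_def)
    ultimately have "\<rho> * n = 0 \<or> \<kappa> * (\<rho> * n) \<le> K * M1"
      by (smt (verit) mult_pos_pos)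
    then have "\<rho> * n \<le> K * M1 / \<kappa>"
      using \<kappa> K M1n by (auto simp: field_simps)
    then show ?thesis unfolding \<rho>_def n_def using C by linarith
  qed
  define M2 where "M2 = C + K * M1 / \<kappa>"
  have M2: "norm (h2 r) \<le> M2 / (\<rho>0 + r)" if "r \<in> {0..l}" for r
  proof -
    have "((\<rho>0 + r) * norm (h2 r))\<^sup>2 \<le> ((\<rho>0 + r2) * norm (h2 r2))\<^sup>2"
      using r2(2)[OF that] unfolding g_alt .
    then have "(\<rho>0 + r) * norm (h2 r) \<le> (\<rho>0 + r2) * norm (h2 r2)"
      by (rule power2_le_imp_le) (use \<rho>pos r2(1) in auto)
    also have "\<dots> \<le> M2" using M2a by (simp add: M2_def)
    finally show ?thesis using \<rho>pos that by (simp add: field_simps)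
  qed
  have M2n: "M2 \<ge> 0" unfolding M2_def using C K M1n \<kappa> by simp
  have h1b: "norm (h1 r - 1) \<le> (C + K * (M1 + M2)) / \<rho>0" if r: "r \<in> {0..l}" for r
  proof -
    have "norm (h1 l - h1 r) \<le> K * (M1 + M2) / \<rho>0"
    proof (cases "r = l")
      case True
      then show ?thesis using K M1n M2n \<rho>pos by simp
    next
      case False
      then have rl: "r < l" using r by auto
      have "norm (h1 l - h1 r) \<le> - (K * (M1 + M2)) / (\<rho>0 + l) - (- (K * (M1 + M2)) / (\<rho>0 + r))"
      proof (rule differentiable_bound_general[OF rl, where \<phi>' = "\<lambda>u. K * (M1 + M2) / (\<rho>0 + u)\<^sup>2"])
        show "continuous_on {r..l} h1" using cont1 by (rule continuous_on_subset) (use r in auto)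
        show "continuous_on {r..l} (\<lambda>u. - (K * (M1 + M2)) / (\<rho>0 + u))"
          using r \<rho>pos by (intro continuous_intros) auto
        fix u assume u: "r < u" "u < l"
        then have u': "u \<in> {0..l}" "u \<in> {0<..<l}" using r by auto
        have atu: "at u within {0..l} = at u" using u' by (intro at_within_interior) auto
        show "(h1 has_vector_derivative (\<alpha> u * h1 u + \<beta> u * h2 u)) (at u)"
          using d1[OF u'(1)] atu by simp
        have "((\<lambda>u. - (K * (M1 + M2)) / (\<rho>0 + u)) has_real_derivative K * (M1 + M2) / (\<rho>0 + u)\<^sup>2) (at u)"
          using u' \<rho>pos by (auto intro!: derivative_eq_intros simp: power2_eq_square)
        then show "((\<lambda>u. - (K * (M1 + M2)) / (\<rho>0 + u)) has_vector_derivative K * (M1 + M2) / (\<rho>0 + u)\<^sup>2) (at u)"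
          by (simp add: has_real_derivative_iff_has_vector_derivative)
        have "norm (\<alpha> u * h1 u + \<beta> u * h2 u) \<le> norm (\<alpha> u) * norm (h1 u) + norm (\<beta> u) * norm (h2 u)"
          unfolding norm_mult[symmetric] by (rule norm_triangle_ineq)
        also have "\<dots> \<le> K / (\<rho>0 + u)\<^sup>2 * M1 + K / (\<rho>0 + u) * (M2 / (\<rho>0 + u))"
          using u' K \<rho>pos by (intro add_mono mult_mono \<alpha> \<beta> M1 M2) auto
        also have "\<dots> = K * (M1 + M2) / (\<rho>0 + u)\<^sup>2"
          by (simp add: power2_eq_square add_divide_distrib algebra_simps)
        finally show "norm (\<alpha> u * h1 u + \<beta> u * h2 u) \<le> K * (M1 + M2) / (\<rho>0 + u)\<^sup>2" .
      qed
      also have "\<dots> \<le> K * (M1 + M2) / (\<rho>0 + r)"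
        using K M1n M2n \<rho>pos l by (simp add: divide_nonneg_nonneg)
      also have "\<dots> \<le> K * (M1 + M2) / \<rho>0"
        using K M1n M2n \<rho>pos r by (intro divide_left_mono) auto
      finally show ?thesis .
    qed
    moreover have "C / (\<rho>0 + l) \<le> C / \<rho>0" using C l \<rho>pos by (intro divide_left_mono) auto
    ultimately have "norm (h1 r - 1) \<le> C / \<rho>0 + K * (M1 + M2) / \<rho>0"
      using t(1) norm_triangle_ineq[of "h1 r - h1 l" "h1 l - 1"] by (simp add: norm_minus_commute)
    then show ?thesis by (simp add: add_divide_distrib)
  qed
  \<comment> \<open>The bound for \<open>h1\<close> contains its own maximum \<open>M1\<close>. The
    lower bound on \<rho>0 makes the coefficient of \<open>M1\<close> on the right at most 1/2, so
    it can be absorbed and \<open>M1\<close> is at most 3.\<close>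
  have "M1 \<le> 1 + (C + K * (M1 + M2)) / \<rho>0"
    using h1b[OF r1(1)] norm_triangle_ineq[of "h1 r1 - 1" 1] by (simp add: M1_def)
  then have "M1 * \<rho>0 \<le> \<rho>0 + (C + K * (M1 + (C + K * M1 / \<kappa>)))"
    using \<rho>pos by (simp add: field_simps M2_def)
  also have "\<dots> = \<rho>0 + (C + K * C) + M1 * (K * (1 + K / \<kappa>))"
    by (simp add: algebra_simps)
  also have "\<dots> \<le> \<rho>0 + \<rho>0 / 2 + M1 * (\<rho>0 / 2)"
  proof -
    have "K * (1 + K / \<kappa>) \<ge> 0" "C + K * C \<ge> 0" using K Kk C by auto
    moreover have "2 * (K * (1 + K / \<kappa>)) + 2 * (C + K * C) + 1 \<le> \<rho>0"
      using \<rho>0 by (simp only: mult.assoc)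
    moreover have "y \<le> r / 2 \<and> x \<le> r / 2" if "0 \<le> x" "0 \<le> y" "2 * x + 2 * y + 1 \<le> r" for x y r :: real
      using that by linarith
    ultimately have "C + K * C \<le> \<rho>0 / 2" "K * (1 + K / \<kappa>) \<le> \<rho>0 / 2" by blast+
    then show ?thesis using M1n by (intro add_mono mult_left_mono order_refl) auto
  qed
  finally have "M1 * (\<rho>0 / 2) \<le> 3 * (\<rho>0 / 2)" by (simp add: algebra_simps)
  then have M13: "M1 \<le> 3" using \<rho>pos by (simp add: mult_right_le_imp_le)
  have M2b: "M2 \<le> C + 3 * K / \<kappa>"
    unfolding M2_def using M13 K \<kappa> by (intro add_left_mono divide_right_mono) (auto simp: mult.commute[of K] mult_right_mono)
  have "K * (M1 + M2) \<le> K * (3 + C + 3 * K / \<kappa>)" using M13 M2b K by (intro mult_left_mono) auto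
  then have e1: "C + K * (M1 + M2) \<le> C + K * (3 + C + 3 * K / \<kappa>) + 3 * K / \<kappa>" using Kk by simp
  show "norm (h1 0 - 1) \<le> (C + K * (3 + C + 3 * K / \<kappa>) + 3 * K / \<kappa>) / \<rho>0"
    using h1b[of 0] l e1 \<rho>pos by (smt (verit, best) atLeastAtMost_iff divide_right_mono)
  have "K * (3 + C + 3 * K / \<kappa>) \<ge> 0" using K C Kk by simp
  then have e2: "M2 \<le> C + K * (3 + C + 3 * K / \<kappa>) + 3 * K / \<kappa>" using M2b by linarith
  show "norm (h2 0) \<le> (C + K * (3 + C + 3 * K / \<kappa>) + 3 * K / \<kappa>) / \<rho>0"
    using M2[of 0] l e2 \<rho>pos by (smt (verit, best) atLeastAtMost_iff divide_right_mono)
qed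

lemma segment_direction:
  fixes \<nu> :: complex and L :: real
  assumes "L > norm \<nu>"
  shows "norm ((of_real L - \<nu>) / of_real (norm (of_real L - \<nu>)) - 1) \<le> 2 * norm \<nu> / (L - norm \<nu>)"
proof -
  let ?d = "norm (of_real L - \<nu>)"
  have Lp: "norm (of_real L :: complex) = L" using assms by (simp add: order.strict_implies_order[OF le_less_trans[OF norm_ge_zero]])
  have d: "?d \<ge> L - norm \<nu>" using norm_triangle_ineq2[of "of_real L" \<nu>] Lp by simp
  then have dp: "?d > 0" using assms by linarith
  have "(of_real L - \<nu>) / of_real ?d - 1 = (of_real L - \<nu> - of_real ?d) / of_real ?d"
    using dp by (simp add: diff_divide_distrib)
  then have "norm ((of_real L - \<nu>) / of_real ?d - 1) = norm (of_real L - \<nu> - of_real ?d) / ?d"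
    by (simp add: norm_divide)
  also have "norm (of_real L - \<nu> - of_real ?d) \<le> norm (of_real (L - ?d) :: complex) + norm \<nu>"
    using norm_triangle_ineq4[of "of_real (L - ?d)" \<nu>] by (simp add: algebra_simps)
  also have "norm (of_real (L - ?d) :: complex) \<le> norm \<nu>"
    unfolding norm_of_real using norm_triangle_ineq3[of "of_real L" "of_real L - \<nu>"] Lp
    by simp
  finally have "norm ((of_real L - \<nu>) / of_real ?d - 1) \<le> 2 * norm \<nu> / ?d"
    using dp by (simp add: divide_right_mono)
  also have "\<dots> \<le> 2 * norm \<nu> / (L - norm \<nu>)"
    using d assms by (intro divide_left_mono mult_pos_pos dp) auto
  finally show ?thesis .
qed

text \<open>Integrate along the segment from \<open>\<nu>\<close> to a far point \<open>L\<close> of the positive axis; as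
  \<open>L \<rightarrow> \<infinity>\<close> its direction tends to \<open>1\<close>, in which the second component is damped towards \<open>\<nu>\<close>.\<close>
lemma asymptotics_from_ray:
  fixes G1 G2 n11 n12 n21 n22 :: "complex \<Rightarrow> complex"
  assumes d1: "\<And>\<nu>. \<nu> \<notin> \<real>\<^sub>\<le>\<^sub>0 \<Longrightarrow> norm \<nu> > R0 \<Longrightarrow> (G1 has_field_derivative n11 \<nu> * G1 \<nu> + n12 \<nu> * G2 \<nu>) (at \<nu>)"
    and d2: "\<And>\<nu>. \<nu> \<notin> \<real>\<^sub>\<le>\<^sub>0 \<Longrightarrow> norm \<nu> > R0 \<Longrightarrow> (G2 has_field_derivative (a + n22 \<nu>) * G2 \<nu> + n21 \<nu> * G1 \<nu>) (at \<nu>)"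
    and n11: "\<And>\<nu>. norm \<nu> > R0 \<Longrightarrow> norm (n11 \<nu>) \<le> K / (norm \<nu>)\<^sup>2"
    and n12: "\<And>\<nu>. norm \<nu> > R0 \<Longrightarrow> norm (n12 \<nu>) \<le> K / norm \<nu>"
    and n21: "\<And>\<nu>. norm \<nu> > R0 \<Longrightarrow> norm (n21 \<nu>) \<le> K / norm \<nu>"
    and n22: "\<And>\<nu>. norm \<nu> > R0 \<Longrightarrow> norm (n22 \<nu>) \<le> K / norm \<nu>"
    and a: "Re a > 0" and R0: "R0 > 0"
    and ray: "\<And>L. L > L0 \<Longrightarrow> norm (G1 (of_real L) - 1) \<le> C / L" "\<And>L. L > L0 \<Longrightarrow> norm (G2 (of_real L)) \<le> C / L"
    and p: "0 \<le> p" "p < 1"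
  shows "\<exists>C' R'. \<forall>\<nu>. norm \<nu> > R' \<and> Re \<nu> \<ge> - p * norm \<nu> \<longrightarrow>
           norm (G1 \<nu> - 1) \<le> C' / norm \<nu> \<and> norm (G2 \<nu>) \<le> C' / norm \<nu>"
proof -
  \<comment> \<open>The gap between \<open>p\<close> and \<open>q\<close> pays for the fact that the
    direction of the segment is only close to 1.\<close>
  define q where "q = (1 + p) / 2"
  have q: "p < q" "q < 1" "0 \<le> q" using p by (auto simp: q_def)
  define c where "c = sqrt ((1 - q) / 2)"
  have c: "c > 0" "c\<^sup>2 = (1 - q) / 2" "c \<le> 1" using q by (auto simp: c_def)
  have K: "K \<ge> 0"
  proof -
    have "norm (of_real (R0 + 1) :: complex) = R0 + 1" unfolding norm_of_real using R0 by simp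
    then have "0 \<le> K / (R0 + 1)" using n12[of "of_real (R0 + 1)"] R0 by (metis less_add_one norm_ge_zero order_trans)
    then show ?thesis using R0 by (simp add: zero_le_divide_iff)
  qed
  have Cn: "C \<ge> 0"
  proof -
    have "0 \<le> C / (\<bar>L0\<bar> + 1)" using ray(1)[of "\<bar>L0\<bar> + 1"] by (smt (verit, best) norm_ge_zero)
    then show ?thesis by (smt (verit) divide_less_0_iff)
  qed
  define b where "b = Re a"
  define \<kappa> where "\<kappa> = b / 2"
  define K' where "K' = K / c\<^sup>2"
  have K': "K' \<ge> 0" "K / c \<le> K'"
  proof -
    show "K' \<ge> 0" using K by (simp add: K'_def)
    have "c\<^sup>2 \<le> c" using c(1,3) by (simp add: power2_eq_square mult_left_le)
    then show "K / c \<le> K'" unfolding K'_def using K c(1) by (intro divide_left_mono) auto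
  qed
  have \<kappa>: "\<kappa> > 0" "b > 0" using a by (auto simp: \<kappa>_def b_def)
  define C2 where "C2 = 2 * C"
  define C' where "C' = C2 + K' * (3 + C2 + 3 * K' / \<kappa>) + 3 * K' / \<kappa>"
  define R' where "R' = max (max (R0 / c) (4 * K' / b)) (2 * K' * (1 + K' / \<kappa>) + 2 * (C2 + K' * C2) + 1)"
  have "norm (G1 \<nu> - 1) \<le> C' / norm \<nu> \<and> norm (G2 \<nu>) \<le> C' / norm \<nu>"
    if \<nu>: "norm \<nu> > R'" "Re \<nu> \<ge> - p * norm \<nu>" for \<nu>
  proof -
    define \<rho>0 where "\<rho>0 = norm \<nu>"
    have \<rho>0a: "\<rho>0 > R0 / c" "\<rho>0 > 4 * K' / b" "\<rho>0 \<ge> 2 * K' * (1 + K' / \<kappa>) + 2 * (C2 + K' * C2) + 1"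
      using \<nu>(1) by (auto simp: R'_def \<rho>0_def)
    have \<rho>0p: "\<rho>0 > 0" using \<rho>0a(1) R0 c(1) by (smt (verit) divide_pos_pos)
    have \<nu>pos: "\<nu> \<notin> \<real>\<^sub>\<le>\<^sub>0"
    proof
      assume "\<nu> \<in> \<real>\<^sub>\<le>\<^sub>0"
      then have "Re \<nu> \<le> 0" "Im \<nu> = 0" by (auto simp: complex_nonpos_Reals_iff)
      then have "Re \<nu> = - norm \<nu>" by (simp add: cmod_eq_Re)
      then have "norm \<nu> \<le> p * norm \<nu>" using \<nu>(2) by simp
      then show False using p(2) \<rho>0p by (simp add: \<rho>0_def)
    qed
    \<comment> \<open>Two tolerances for the direction \<open>e\<close>: the first keeps the segment
      away from the origin, the second keeps the real part of \<open>e * a\<close> above 3/4 of that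
      of \<open>a\<close>.\<close>
    define \<epsilon> where "\<epsilon> = min (q - p) (b / (4 * (norm a + 1)))"
    have \<epsilon>: "\<epsilon> > 0" "\<epsilon> \<le> q - p" "\<epsilon> * norm a \<le> b / 4"
    proof -
      have na: "norm a + 1 > 0" by (simp add: add_nonneg_pos)
      show "\<epsilon> > 0" unfolding \<epsilon>_def using q(1) \<kappa>(2) na by simp
      show "\<epsilon> \<le> q - p" by (simp add: \<epsilon>_def)
      have "\<epsilon> * norm a \<le> b / (4 * (norm a + 1)) * (norm a + 1)"
        using \<open>\<epsilon> > 0\<close> na \<kappa>(2) by (intro mult_mono) (auto simp: \<epsilon>_def)
      also have "\<dots> = b / 4" using na by (simp add: field_simps)
      finally show "\<epsilon> * norm a \<le> b / 4" .
    qed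
    \<comment> \<open>The far end point depends on \<nu>, but only through the direction it
      enforces; the constants \<open>C'\<close> and \<open>R'\<close> fixed above do not depend on
      it.\<close>
    define L where "L = max (2 * \<rho>0 + 2 * \<rho>0 / \<epsilon>) (\<bar>L0\<bar> + 1)"
    have L: "L > \<rho>0" "L \<ge> 2 * \<rho>0" "L > L0" "2 * \<rho>0 / (L - \<rho>0) \<le> \<epsilon>" "L > 0"
    proof -
      have "2 * \<rho>0 / \<epsilon> > 0" using \<rho>0p \<epsilon> by simp
      then show 1: "L \<ge> 2 * \<rho>0" "L > \<rho>0" unfolding L_def using \<rho>0p by linarith+
      show "L > L0" "L > 0" unfolding L_def by linarith+
      have "2 * \<rho>0 / \<epsilon> \<le> L - \<rho>0" unfolding L_def using \<rho>0p by linarith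
      then show "2 * \<rho>0 / (L - \<rho>0) \<le> \<epsilon>" using 1 \<epsilon>(1) by (simp add: field_simps)
    qed
    define l where "l = norm (of_real L - \<nu>)"
    have lpos: "l > 0" unfolding l_def using L(1) \<rho>0_def
      by (smt (verit, best) norm_of_real zero_less_norm_iff eq_iff_diff_eq_0 abs_of_pos L(5))
    define e where "e = (of_real L - \<nu>) / of_real l"
    have e1: "norm (e - 1) \<le> \<epsilon>"
      using segment_direction[of \<nu> L] L(1,4) by (simp add: e_def l_def \<rho>0_def)
    have en: "norm e = 1" using lpos by (simp add: e_def norm_divide l_def)
    have ee: "\<nu> + of_real l * e = of_real L" using lpos by (simp add: e_def)
    have Rea: "Re (e * a) \<ge> 3 * b / 4"
    proof -
      have "\<bar>Re ((e - 1) * a)\<bar> \<le> norm (e - 1) * norm a" by (metis abs_Re_le_cmod norm_mult)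
      also have "\<dots> \<le> \<epsilon> * norm a" using e1 by (intro mult_right_mono) auto
      finally have "\<bar>Re ((e - 1) * a)\<bar> \<le> b / 4" using \<epsilon>(3) by linarith
      moreover have "Re (e * a) = b + Re ((e - 1) * a)" by (simp add: b_def algebra_simps)
      ultimately show ?thesis by linarith
    qed
    have Re\<nu>: "Re (cnj \<nu> * e) \<ge> - (q * \<rho>0)"
    proof -
      have "\<bar>Re (cnj \<nu> * (e - 1))\<bar> \<le> \<rho>0 * norm (e - 1)" unfolding \<rho>0_def by (metis abs_Re_le_cmod complex_mod_cnj norm_mult)
      also have "\<dots> \<le> \<rho>0 * (q - p)" using e1 \<epsilon>(2) \<rho>0p by (intro mult_left_mono) auto
      finally have "\<bar>Re (cnj \<nu> * (e - 1))\<bar> \<le> \<rho>0 * (q - p)" .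
      moreover have "Re (cnj \<nu> * e) = Re \<nu> + Re (cnj \<nu> * (e - 1))" by (simp add: algebra_simps)
      ultimately show ?thesis using \<nu>(2) by (simp add: \<rho>0_def algebra_simps)
    qed
    define \<mu> where "\<mu> r = \<nu> + of_real r * e" for r
    \<comment> \<open>\<rho>0^2 + r^2 - 2 q r \<rho>0 splits as (1 - q)/2 (\<rho>0 + r)^2 + (1 +
      q)/2 (\<rho>0 - r)^2, which is where \<open>c\<close> comes from. Thus bounds in 1/|\<nu>|
      become bounds in 1/(\<rho>0 + r) along the segment.\<close>
    have \<mu>norm: "norm (\<mu> r) \<ge> c * (\<rho>0 + r)" if "r \<ge> 0" for r
    proof -
      have "(norm (\<mu> r))\<^sup>2 = \<rho>0\<^sup>2 + r\<^sup>2 * (norm e)\<^sup>2 + 2 * r * Re (cnj \<nu> * e)"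
        unfolding \<mu>_def \<rho>0_def cmod_power2 by (simp add: power2_eq_square algebra_simps)
      also have "\<dots> \<ge> \<rho>0\<^sup>2 + r\<^sup>2 - 2 * r * (q * \<rho>0)"
        using Re\<nu> that mult_left_mono[of "- (q * \<rho>0)" "Re (cnj \<nu> * e)" "2 * r"] by (simp add: en)
      also have "\<rho>0\<^sup>2 + r\<^sup>2 - 2 * r * (q * \<rho>0) = (1 - q) / 2 * (\<rho>0 + r)\<^sup>2 + (1 + q) / 2 * (\<rho>0 - r)\<^sup>2"
        by (simp add: power2_eq_square field_simps)
      also have "\<dots> \<ge> (1 - q) / 2 * (\<rho>0 + r)\<^sup>2" using q by simp
      finally have "(c * (\<rho>0 + r))\<^sup>2 \<le> (norm (\<mu> r))\<^sup>2" by (simp add: power_mult_distrib c(2))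
      then show ?thesis by (rule power2_le_imp_le) simp
    qed
    have \<mu>R: "norm (\<mu> r) > R0" if "r \<ge> 0" for r
    proof -
      have "R0 < c * \<rho>0" using \<rho>0a(1) c(1) by (simp add: field_simps)
      also have "\<dots> \<le> c * (\<rho>0 + r)" using c(1) that by simp
      finally show ?thesis using \<mu>norm[OF that] by linarith
    qed
    have \<mu>slit: "\<mu> r \<notin> \<real>\<^sub>\<le>\<^sub>0" if "r \<in> {0..l}" for r
    proof
      assume "\<mu> r \<in> \<real>\<^sub>\<le>\<^sub>0"
      then have m: "Re (\<mu> r) \<le> 0" "Im (\<mu> r) = 0" by (auto simp: complex_nonpos_Reals_iff)
      have m_eq: "\<mu> r = of_real (1 - r / l) * \<nu> + of_real (r / l * L)"
        unfolding \<mu>_def e_def using lpos by (simp add: field_simps)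
      have "(1 - r / l) * Im \<nu> = 0" using m(2) unfolding m_eq by simp
      then consider "r = l" | "Im \<nu> = 0" using lpos by auto
      then show False
      proof cases
        case 1
        then show ?thesis using m(1) m_eq lpos L(5) by simp
      next
        case 2
        then have "Re \<nu> > 0" using \<nu>pos by (auto simp: complex_nonpos_Reals_iff)
        moreover have "Re (\<mu> r) = (1 - r / l) * Re \<nu> + r / l * L" unfolding m_eq by simp
        moreover have "0 \<le> r / l" "r / l \<le> 1" using that lpos by auto
        ultimately have "Re (\<mu> r) > 0" using L(5)
          by (smt (verit, best) mult_nonneg_nonneg mult_pos_pos mult_eq_0_iff)
        then show ?thesis using m by simp
      qed
    qed
    have inv1: "K / norm (\<mu> r) \<le> K' / (\<rho>0 + r)" if "r \<ge> 0" for r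
    proof -
      have "K / norm (\<mu> r) \<le> K / (c * (\<rho>0 + r))"
        using \<mu>norm[OF that] K c(1) \<rho>0p that \<mu>R[OF that] R0 by (intro divide_left_mono) (auto intro!: mult_pos_pos)
      also have "\<dots> = (K / c) / (\<rho>0 + r)" by simp
      also have "\<dots> \<le> K' / (\<rho>0 + r)" using K'(2) \<rho>0p that by (intro divide_right_mono) auto
      finally show ?thesis .
    qed
    have inv2: "K / (norm (\<mu> r))\<^sup>2 \<le> K' / (\<rho>0 + r)\<^sup>2" if "r \<ge> 0" for r
    proof -
      have "(c * (\<rho>0 + r))\<^sup>2 \<le> (norm (\<mu> r))\<^sup>2"
        using \<mu>norm[OF that] c(1) \<rho>0p that by (intro power_mono) auto
      moreover have "0 < (c * (\<rho>0 + r))\<^sup>2" using c(1) \<rho>0p that by simp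
      ultimately have "K / (norm (\<mu> r))\<^sup>2 \<le> K / (c * (\<rho>0 + r))\<^sup>2"
        using K by (intro divide_left_mono) (auto intro!: mult_pos_pos)
      also have "\<dots> = K' / (\<rho>0 + r)\<^sup>2" by (simp add: K'_def power_mult_distrib)
      finally show ?thesis .
    qed
    have \<mu>d: "(\<mu> has_vector_derivative e) (at r within {0..l})" for r
      unfolding \<mu>_def by (auto intro!: derivative_eq_intros)
    define h1 where "h1 r = G1 (\<mu> r)" for r
    define h2 where "h2 r = G2 (\<mu> r)" for r
    have hd1: "(h1 has_vector_derivative (e * n11 (\<mu> r) * h1 r + e * n12 (\<mu> r) * h2 r)) (at r within {0..l})"
      if "r \<in> {0..l}" for r
      using field_vector_diff_chain_within[OF \<mu>d[of r], of G1 "n11 (\<mu> r) * G1 (\<mu> r) + n12 (\<mu> r) * G2 (\<mu> r)"]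
        d1[OF \<mu>slit[OF that] \<mu>R] that
      by (simp add: h1_def[abs_def] h2_def[abs_def] o_def algebra_simps has_field_derivative_at_within)
    have hd2: "(h2 has_vector_derivative (e * (a + n22 (\<mu> r)) * h2 r + e * n21 (\<mu> r) * h1 r)) (at r within {0..l})"
      if "r \<in> {0..l}" for r
      using field_vector_diff_chain_within[OF \<mu>d[of r], of G2 "(a + n22 (\<mu> r)) * G2 (\<mu> r) + n21 (\<mu> r) * G1 (\<mu> r)"]
        d2[OF \<mu>slit[OF that] \<mu>R] that
      by (simp add: h1_def[abs_def] h2_def[abs_def] o_def algebra_simps has_field_derivative_at_within)
    have hl: "h1 l = G1 (of_real L)" "h2 l = G2 (of_real L)" "h1 0 = G1 \<nu>" "h2 0 = G2 \<nu>"
      by (simp_all add: h1_def h2_def \<mu>_def ee)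
    have tC: "C / L \<le> C2 / (\<rho>0 + l)"
    proof -
      have "l \<le> L + \<rho>0" unfolding l_def \<rho>0_def using norm_triangle_ineq4[of "of_real L" \<nu>] L(5) by simp
      then have "\<rho>0 + l \<le> 2 * L" using L(2) by linarith
      then have "2 * C / (2 * L) \<le> 2 * C / (\<rho>0 + l)" using Cn \<rho>0p lpos L(5) by (intro divide_left_mono) auto
      then show ?thesis by (simp add: C2_def)
    qed
    note bb = backward_bound[where l = l and K = K' and \<kappa> = \<kappa> and C = C2 and ?h1.0 = h1 and ?h2.0 = h2
        and \<alpha> = "\<lambda>r. e * n11 (\<mu> r)" and \<beta> = "\<lambda>r. e * n12 (\<mu> r)" and \<gamma> = "\<lambda>r. e * (a + n22 (\<mu> r))"
        and \<omega> = "\<lambda>r. e * n21 (\<mu> r)" and ?\<rho>0.0 = \<rho>0]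
    have as: "l \<ge> 0" "C2 \<ge> 0" "norm (h1 l - 1) \<le> C2 / (\<rho>0 + l)" "norm (h2 l) \<le> C2 / (\<rho>0 + l)"
      using lpos Cn hl ray[OF L(3)] tC by (auto simp: C2_def)
    have b11: "norm (e * n11 (\<mu> r)) \<le> K' / (\<rho>0 + r)\<^sup>2"
      and b12: "norm (e * n12 (\<mu> r)) \<le> K' / (\<rho>0 + r)"
      and b21: "norm (e * n21 (\<mu> r)) \<le> K' / (\<rho>0 + r)"
      and b22: "Re (e * (a + n22 (\<mu> r))) \<ge> \<kappa>" if "r \<in> {0..l}" for r
    proof -
      have r0: "r \<ge> 0" using that by simp
      show "norm (e * n11 (\<mu> r)) \<le> K' / (\<rho>0 + r)\<^sup>2" "norm (e * n12 (\<mu> r)) \<le> K' / (\<rho>0 + r)"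
        "norm (e * n21 (\<mu> r)) \<le> K' / (\<rho>0 + r)"
        using n11[OF \<mu>R[OF r0]] n12[OF \<mu>R[OF r0]] n21[OF \<mu>R[OF r0]] inv1[OF r0] inv2[OF r0]
        by (simp_all add: norm_mult en)
      have "norm (e * n22 (\<mu> r)) \<le> K' / (\<rho>0 + r)"
        using n22[OF \<mu>R[OF r0]] inv1[OF r0] by (simp add: norm_mult en)
      also have "\<dots> \<le> K' / \<rho>0" using K' \<rho>0p r0 by (intro divide_left_mono) auto
      also have "\<dots> \<le> b / 4" using \<rho>0a(2) \<rho>0p \<kappa>(2) by (simp add: field_simps)
      finally have "\<bar>Re (e * n22 (\<mu> r))\<bar> \<le> b / 4" using abs_Re_le_cmod order_trans by blast
      moreover have "Re (e * (a + n22 (\<mu> r))) = Re (e * a) + Re (e * n22 (\<mu> r))" by (simp add: algebra_simps)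
      ultimately show "Re (e * (a + n22 (\<mu> r))) \<ge> \<kappa>" using Rea unfolding \<kappa>_def by linarith
    qed
    have "norm (h1 0 - 1) \<le> C' / \<rho>0" unfolding C'_def
      by (rule bb(1); (rule as K' \<kappa> hd1 hd2 b11 b12 b21 b22 \<rho>0a)?)
    moreover have "norm (h2 0) \<le> C' / \<rho>0" unfolding C'_def
      by (rule bb(2); (rule as K' \<kappa> hd1 hd2 b11 b12 b21 b22 \<rho>0a)?)
    ultimately show ?thesis by (simp add: hl \<rho>0_def)
  qed
  then show ?thesis by blast
qed

section \<open>Canonical solutions\<close>

text \<open>In the coordinate \<open>\<eta> = 2 \<xi> - 1\<close>, in which the finite singular points are \<open>\<mp>1\<close>.\<close>
definition eta_coeff :: "cmat \<Rightarrow> cmat \<Rightarrow> complex \<Rightarrow> complex \<Rightarrow> cmat" where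
  "eta_coeff A0 A1 x \<eta> = scale_mat (x / 4) sigma3 + scale_mat (1 / (\<eta> + 1)) A0 + scale_mat (1 / (\<eta> - 1)) A1"

text \<open>The exponent of the formal solution \<open>(I + O(1/\<xi>)) exp (q \<sigma>\<^sub>3)\<close>, with \<open>\<xi> = (e\<^sup>m + 1) / 2\<close>.\<close>
definition qexp :: "complex \<Rightarrow> complex \<Rightarrow> complex \<Rightarrow> complex" where
  "qexp \<theta> x m = (x * (exp m + 1) / 2 - \<theta> * (m - of_real (ln 2))) / 2"

text \<open>The independent variable is m = ln \<eta> on the half-plane \<open>Re m > 0\<close>, the
  universal covering of |\<eta>| > 1; the factor \<open>exp m\<close> is d\<eta>/dm.\<close>

definition system_solution :: "cmat \<Rightarrow> cmat \<Rightarrow> complex \<Rightarrow> (complex \<Rightarrow> cmat) \<Rightarrow> bool" where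
  "system_solution A0 A1 x X \<longleftrightarrow>
     (\<forall>m. Re m > 0 \<longrightarrow> has_mderiv X (scale_mat (exp m) (eta_coeff A0 A1 x (exp m)) ** X m) m)"

text \<open>This concerns the first column only. Conjugation by \<sigma>_1 together with (\<theta>,
  x) -> (-\<theta>, -x) negates the exponent and exchanges the columns, so one analysis of a column
  serves for both.\<close>

definition col_asym :: "complex \<Rightarrow> complex \<Rightarrow> (complex \<Rightarrow> cmat) \<Rightarrow> real set \<Rightarrow> bool" where
  "col_asym \<theta> x X S \<longleftrightarrow> (\<exists>C R. \<forall>m. Re m > R \<and> Re m > 0 \<and> Im m \<in> S \<longrightarrow>
      norm (X m $ 1 $ 1 * exp (- qexp \<theta> x m) - 1) \<le> C * exp (- Re m) \<and>
      norm (X m $ 2 $ 1 * exp (- qexp \<theta> x m)) \<le> C * exp (- Re m))"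

text \<open>\<open>c\<close> is the central direction of a sector of opening 2 pi in arg \<eta>; the
  two conditions are the normalisations of the first and the second column in its closed
  subsectors.\<close>

definition canonX :: "complex \<Rightarrow> cmat \<Rightarrow> cmat \<Rightarrow> complex \<Rightarrow> real \<Rightarrow> (complex \<Rightarrow> cmat) \<Rightarrow> bool" where
  "canonX \<theta> A0 A1 x c X \<longleftrightarrow> system_solution A0 A1 x X \<and>
     (\<forall>\<delta>>0. col_asym \<theta> x X {c - (pi - \<delta>)..c + (pi - \<delta>)} \<and>
            col_asym (- \<theta>) (- x) (\<lambda>m. conj_sigma1 (X m)) {c - (pi - \<delta>)..c + (pi - \<delta>)})"

lemma sigma3_nth [simp]: "sigma3 $ 1 $ 1 = 1" "sigma3 $ 1 $ 2 = 0" "sigma3 $ 2 $ 1 = 0" "sigma3 $ 2 $ 2 = -1"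
  by (simp_all add: sigma3_def)

lemma conj_sigma1_nth [simp]:
  "conj_sigma1 M $ 1 $ 1 = M $ 2 $ 2" "conj_sigma1 M $ 1 $ 2 = M $ 2 $ 1"
  "conj_sigma1 M $ 2 $ 1 = M $ 1 $ 2" "conj_sigma1 M $ 2 $ 2 = M $ 1 $ 1"
  by (simp_all add: conj_sigma1_def sigma1_def mmult_nth)

lemma conj_sigma1_conj [simp]: "conj_sigma1 (conj_sigma1 M) = M"
  by (simp add: cmat_eq_iff)

lemma conj_sigma1_mult: "conj_sigma1 (A ** B) = conj_sigma1 A ** conj_sigma1 B"
  by (simp add: cmat_eq_iff mmult_nth)

lemma has_mderiv_conj_sigma1:
  "has_mderiv X D z \<Longrightarrow> has_mderiv (\<lambda>v. conj_sigma1 (X v)) (conj_sigma1 D) z"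
  unfolding has_mderiv_def all_2_iff by simp

lemma eta_coeff_conj_sigma1:
  "conj_sigma1 (eta_coeff A0 A1 x \<eta>) = eta_coeff (conj_sigma1 A0) (conj_sigma1 A1) (- x) \<eta>"
  by (simp add: cmat_eq_iff eta_coeff_def)

lemma scale_conj_sigma1: "conj_sigma1 (scale_mat c A) = scale_mat c (conj_sigma1 A)"
  by (simp add: cmat_eq_iff)

lemma system_solution_conj_sigma1:
  assumes "system_solution A0 A1 x X"
  shows "system_solution (conj_sigma1 A0) (conj_sigma1 A1) (- x) (\<lambda>m. conj_sigma1 (X m))"
  using assms has_mderiv_conj_sigma1 unfolding system_solution_def
  by (metis conj_sigma1_mult eta_coeff_conj_sigma1 scale_conj_sigma1)

lemma canonX_conj_sigma1:
  assumes "canonX \<theta> A0 A1 x c X"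
  shows "canonX (- \<theta>) (conj_sigma1 A0) (conj_sigma1 A1) (- x) c (\<lambda>m. conj_sigma1 (X m))"
  using assms system_solution_conj_sigma1 by (simp add: canonX_def)

lemma trace_eta_coeff: "trace A0 = 0 \<Longrightarrow> trace A1 = 0 \<Longrightarrow> trace (scale_mat c (eta_coeff A0 A1 x \<eta>)) = 0"
  unfolding trace_2 eta_coeff_def
  by (simp add: add_eq_0_iff algebra_simps)

lemma qexp_deriv: "(qexp \<theta> x has_field_derivative ((x * exp m / 2 - \<theta>) / 2)) (at m)"
  unfolding qexp_def by (auto intro!: derivative_eq_intros)

lemma qexp_minus: "qexp (- \<theta>) (- x) m = - qexp \<theta> x m"
  by (simp add: qexp_def field_simps)

lemma col_asym_subset: "col_asym \<theta> x X S \<Longrightarrow> T \<subseteq> S \<Longrightarrow> col_asym \<theta> x X T"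
  unfolding col_asym_def by blast

lemma col_asym_Un:
  assumes "col_asym \<theta> x X S" "col_asym \<theta> x X T"
  shows "col_asym \<theta> x X (S \<union> T)"
proof -
  obtain C R where 1: "\<And>m. Re m > R \<and> Re m > 0 \<and> Im m \<in> S \<Longrightarrow>
      norm (X m $ 1 $ 1 * exp (- qexp \<theta> x m) - 1) \<le> C * exp (- Re m) \<and>
      norm (X m $ 2 $ 1 * exp (- qexp \<theta> x m)) \<le> C * exp (- Re m)"
    using assms(1) unfolding col_asym_def by blast
  obtain C' R' where 2: "\<And>m. Re m > R' \<and> Re m > 0 \<and> Im m \<in> T \<Longrightarrow>
      norm (X m $ 1 $ 1 * exp (- qexp \<theta> x m) - 1) \<le> C' * exp (- Re m) \<and>
      norm (X m $ 2 $ 1 * exp (- qexp \<theta> x m)) \<le> C' * exp (- Re m)"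
    using assms(2) unfolding col_asym_def by blast
  have le: "C * exp (- Re m) \<le> max C C' * exp (- Re m)" "C' * exp (- Re m) \<le> max C C' * exp (- Re m)" for m :: complex
    by (intro mult_right_mono; simp)+
  show ?thesis unfolding col_asym_def
  proof (rule exI[of _ "max C C'"], rule exI[of _ "max R R'"], intro allI impI)
    fix m assume m: "max R R' < Re m \<and> 0 < Re m \<and> Im m \<in> S \<union> T"
    show "norm (X m $ 1 $ 1 * exp (- qexp \<theta> x m) - 1) \<le> max C C' * exp (- Re m) \<and>
      norm (X m $ 2 $ 1 * exp (- qexp \<theta> x m)) \<le> max C C' * exp (- Re m)"
    proof (cases "Im m \<in> S")
      case True
      then show ?thesis using 1[of m] m by (intro conjI order_trans[OF _ le(1)]) auto
    next
      case False
      then show ?thesis using 2[of m] m by (intro conjI order_trans[OF _ le(2)]) auto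
    qed
  qed
qed

text \<open>The first column is recessive in the direction \<open>\<beta>\<close>.\<close>
lemma col_asym_extend:
  assumes sol: "system_solution A0 A1 x X" and diag: "A0 $ 1 $ 1 + A1 $ 1 $ 1 = - (\<theta> / 2)"
    and ray: "col_asym \<theta> x X {\<beta>}" and rec: "Re (x * cis \<beta>) < 0" and \<delta>: "0 < \<delta>" "\<delta> < pi"
  shows "col_asym \<theta> x X {\<beta> - (pi - \<delta>)..\<beta> + (pi - \<delta>)}"
proof -
  obtain C R where CR: "\<And>m. Re m > R \<and> Re m > 0 \<and> Im m \<in> {\<beta>} \<Longrightarrow>
      norm (X m $ 1 $ 1 * exp (- qexp \<theta> x m) - 1) \<le> C * exp (- Re m) \<and>
      norm (X m $ 2 $ 1 * exp (- qexp \<theta> x m)) \<le> C * exp (- Re m)"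
    using ray unfolding col_asym_def by blast
  define e where "e = cis \<beta>"
  have e: "norm e = 1" "e \<noteq> 0" by (auto simp: e_def)
  define mm where "mm \<nu> = \<i> * of_real \<beta> + Ln \<nu>" for \<nu>
  have exp_mm: "exp (mm \<nu>) = e * \<nu>" if "\<nu> \<noteq> 0" for \<nu>
    using that by (simp add: mm_def exp_add e_def cis_conv_exp)
  have Re_mm: "Re (mm \<nu>) = ln (norm \<nu>)" if "\<nu> \<noteq> 0" for \<nu>
    using that by (simp add: mm_def)
  define A where "A \<nu> = eta_coeff A0 A1 x (e * \<nu>)" for \<nu>
  define G1 where "G1 \<nu> = X (mm \<nu>) $ 1 $ 1 * exp (- qexp \<theta> x (mm \<nu>))" for \<nu>
  define G2 where "G2 \<nu> = X (mm \<nu>) $ 2 $ 1 * exp (- qexp \<theta> x (mm \<nu>))" for \<nu>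
  \<comment> \<open>After division by exp q the two diagonal entries differ by the rate
    \<open>a\<close> to leading order. Its real part is positive exactly when the first column is
    recessive in the direction \<beta>.\<close>
  define a where "a = - e * x / 2"
  define n11 where "n11 \<nu> = e * (A \<nu> $ 1 $ 1 - (x / 4 - \<theta> / (2 * e * \<nu>)))" for \<nu>
  define n12 where "n12 \<nu> = e * A \<nu> $ 1 $ 2" for \<nu>
  define n21 where "n21 \<nu> = e * A \<nu> $ 2 $ 1" for \<nu>
  define n22 where "n22 \<nu> = e * (A \<nu> $ 2 $ 2 - (x / 4 - \<theta> / (2 * e * \<nu>))) - a" for \<nu>
  have dG: "((\<lambda>\<nu>. X (mm \<nu>) $ i $ 1 * exp (- qexp \<theta> x (mm \<nu>))) has_field_derivative
      e * (A \<nu> $ i $ 1 * G1 \<nu> + A \<nu> $ i $ 2 * G2 \<nu> - (x / 4 - \<theta> / (2 * e * \<nu>)) * (X (mm \<nu>) $ i $ 1 * exp (- qexp \<theta> x (mm \<nu>))))) (at \<nu>)"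
    if \<nu>: "\<nu> \<notin> \<real>\<^sub>\<le>\<^sub>0" "norm \<nu> > 2" for \<nu> i
  proof -
    have \<nu>0: "\<nu> \<noteq> 0" using \<nu> by auto
    have dm: "(mm has_field_derivative 1 / \<nu>) (at \<nu>)"
      unfolding mm_def using \<nu> by (auto intro!: derivative_eq_intros simp: inverse_eq_divide)
    have "Re (mm \<nu>) > 0" using \<nu> \<nu>0 by (simp add: Re_mm)
    then have "has_mderiv X (scale_mat (exp (mm \<nu>)) (eta_coeff A0 A1 x (exp (mm \<nu>))) ** X (mm \<nu>)) (mm \<nu>)"
      using sol by (simp add: system_solution_def)
    from has_mderivD[OF has_mderiv_chain[OF this dm], of i 1]
    have 1: "((\<lambda>\<nu>. X (mm \<nu>) $ i $ 1) has_field_derivative e * (A \<nu> $ i $ 1 * X (mm \<nu>) $ 1 $ 1 + A \<nu> $ i $ 2 * X (mm \<nu>) $ 2 $ 1)) (at \<nu>)"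
      using \<nu>0 by (simp add: exp_mm mmult_nth A_def distrib_left mult.assoc)
    have 2: "((\<lambda>\<nu>. qexp \<theta> x (mm \<nu>)) has_field_derivative e * (x / 4 - \<theta> / (2 * e * \<nu>))) (at \<nu>)"
    proof -
      have "(x * (e * \<nu>) / 2 - \<theta>) / 2 * (1 / \<nu>) = e * (x / 4 - \<theta> / (2 * e * \<nu>))"
        using \<nu>0 e(2) by (simp add: divide_simps) (simp add: algebra_simps)?
      then show ?thesis
        using DERIV_chain2[OF qexp_deriv[of \<theta> x "mm \<nu>"] dm] by (simp add: exp_mm[OF \<nu>0])
    qed
    show ?thesis
      by (rule derivative_eq_intros 1 2 refl)+ (simp add: G1_def G2_def algebra_simps)
  qed
  define K where "K = 2 * (norm (A0$1$1) + norm (A1$1$1) + norm (A0$1$2) + norm (A1$1$2) + norm (A0$2$1) + norm (A1$2$1)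
     + norm (A0$2$2) + norm (A1$2$2)) + norm \<theta>"
  have inv: "norm (1 / (e * \<nu> + 1)) \<le> 2 / norm \<nu>" "norm (1 / (e * \<nu> - 1)) \<le> 2 / norm \<nu>"
    "e * \<nu> + 1 \<noteq> 0" "e * \<nu> - 1 \<noteq> 0" if "norm \<nu> > 2" for \<nu>
  proof -
    have \<nu>0: "\<nu> \<noteq> 0" using that by auto
    have en: "norm (e * \<nu>) = norm \<nu>" by (simp add: norm_mult e)
    have 1: "norm \<nu> / 2 \<le> norm (e * \<nu> + 1)" "norm \<nu> / 2 \<le> norm (e * \<nu> - 1)"
      using norm_triangle_ineq2[of "e * \<nu>" "-1"] norm_triangle_ineq2[of "e * \<nu>" 1] en that by auto
    then have 2: "norm (e * \<nu> + 1) > 0" "norm (e * \<nu> - 1) > 0" using that by linarith+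
    then show "e * \<nu> + 1 \<noteq> 0" "e * \<nu> - 1 \<noteq> 0" by auto
    show "norm (1 / (e * \<nu> + 1)) \<le> 2 / norm \<nu>" "norm (1 / (e * \<nu> - 1)) \<le> 2 / norm \<nu>"
      unfolding norm_divide norm_one
      using frac_le[of 1 1 "norm \<nu> / 2" "norm (e * \<nu> + 1)"] frac_le[of 1 1 "norm \<nu> / 2" "norm (e * \<nu> - 1)"] 1 that \<nu>0
      by simp_all
  qed
  have Aij: "norm (scale_mat (1 / (e * \<nu> + 1)) A0 $ i $ j + scale_mat (1 / (e * \<nu> - 1)) A1 $ i $ j)
        \<le> 2 * (norm (A0 $ i $ j) + norm (A1 $ i $ j)) / norm \<nu>" if "norm \<nu> > 2" for \<nu> i j
  proof -
    have "norm (scale_mat (1 / (e * \<nu> + 1)) A0 $ i $ j + scale_mat (1 / (e * \<nu> - 1)) A1 $ i $ j)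
       \<le> norm (1 / (e * \<nu> + 1)) * norm (A0 $ i $ j) + norm (1 / (e * \<nu> - 1)) * norm (A1 $ i $ j)"
      unfolding scale_mat_nth norm_mult[symmetric] by (rule norm_triangle_ineq)
    also have "\<dots> \<le> 2 / norm \<nu> * norm (A0 $ i $ j) + 2 / norm \<nu> * norm (A1 $ i $ j)"
      using inv[OF that] by (intro add_mono mult_right_mono) auto
    finally show ?thesis by (simp add: algebra_simps add_divide_distrib)
  qed
  \<comment> \<open>The condition Re \<nu> \<ge> -|cos \<delta>| |\<nu>| contains all \<nu> with
    |arg \<nu>| \<le> pi - \<delta>; the absolute value keeps the parameter nonnegative when
    \<delta> exceeds pi/2.\<close>
  have "\<exists>C' R'. \<forall>\<nu>. norm \<nu> > R' \<and> Re \<nu> \<ge> - \<bar>cos \<delta>\<bar> * norm \<nu> \<longrightarrow>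
           norm (G1 \<nu> - 1) \<le> C' / norm \<nu> \<and> norm (G2 \<nu>) \<le> C' / norm \<nu>"
  proof (rule asymptotics_from_ray[where ?R0.0 = 2 and K = K and a = a and ?n11.0 = n11 and ?n12.0 = n12 and ?n21.0 = n21
        and ?n22.0 = n22 and ?L0.0 = "max 1 (exp R)" and C = C])
    fix \<nu> :: complex assume \<nu>: "\<nu> \<notin> \<real>\<^sub>\<le>\<^sub>0" "norm \<nu> > 2"
    show "(G1 has_field_derivative n11 \<nu> * G1 \<nu> + n12 \<nu> * G2 \<nu>) (at \<nu>)"
      using dG[OF \<nu>, of 1] unfolding G1_def[abs_def, symmetric] G1_def[of \<nu>, symmetric] n11_def n12_def
      by (simp add: algebra_simps e(2))
    show "(G2 has_field_derivative (a + n22 \<nu>) * G2 \<nu> + n21 \<nu> * G1 \<nu>) (at \<nu>)"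
      using dG[OF \<nu>, of 2] unfolding G2_def[abs_def, symmetric] G2_def[of \<nu>, symmetric] n21_def n22_def
      by (simp add: algebra_simps e(2))
  next
    fix \<nu> :: complex assume \<nu>: "norm \<nu> > 2"
    then have \<nu>0: "\<nu> \<noteq> 0" by auto
    have A12: "A \<nu> $ 1 $ 2 = scale_mat (1 / (e * \<nu> + 1)) A0 $ 1 $ 2 + scale_mat (1 / (e * \<nu> - 1)) A1 $ 1 $ 2"
      "A \<nu> $ 2 $ 1 = scale_mat (1 / (e * \<nu> + 1)) A0 $ 2 $ 1 + scale_mat (1 / (e * \<nu> - 1)) A1 $ 2 $ 1"
      unfolding A_def eta_coeff_def by simp_all
    have "norm (n12 \<nu>) \<le> 2 * (norm (A0 $ 1 $ 2) + norm (A1 $ 1 $ 2)) / norm \<nu>"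
      unfolding n12_def norm_mult e A12 using Aij[OF \<nu>, of 1 2] by simp
    also have "\<dots> \<le> K / norm \<nu>" unfolding K_def by (intro divide_right_mono) auto
    finally show "norm (n12 \<nu>) \<le> K / norm \<nu>" .
    have "norm (n21 \<nu>) \<le> 2 * (norm (A0 $ 2 $ 1) + norm (A1 $ 2 $ 1)) / norm \<nu>"
      unfolding n21_def norm_mult e A12 using Aij[OF \<nu>, of 2 1] by simp
    also have "\<dots> \<le> K / norm \<nu>" unfolding K_def by (intro divide_right_mono) auto
    finally show "norm (n21 \<nu>) \<le> K / norm \<nu>" .
    have "n22 \<nu> = e * (scale_mat (1 / (e * \<nu> + 1)) A0 $ 2 $ 2 + scale_mat (1 / (e * \<nu> - 1)) A1 $ 2 $ 2 + \<theta> / (2 * e * \<nu>))"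
      unfolding n22_def a_def A_def eta_coeff_def by (simp add: algebra_simps)
    then have "norm (n22 \<nu>) \<le> norm (scale_mat (1 / (e * \<nu> + 1)) A0 $ 2 $ 2 + scale_mat (1 / (e * \<nu> - 1)) A1 $ 2 $ 2) + norm (\<theta> / (2 * e * \<nu>))"
      by (simp add: norm_mult e norm_triangle_ineq del: scale_mat_nth)
    also have "\<dots> \<le> 2 * (norm (A0 $ 2 $ 2) + norm (A1 $ 2 $ 2)) / norm \<nu> + norm \<theta> / norm \<nu>"
    proof (rule add_mono[OF Aij[OF \<nu>]])
      have "norm (\<theta> / (2 * e * \<nu>)) = norm \<theta> / norm \<nu> / 2" by (simp add: norm_divide norm_mult e)
      also have "\<dots> \<le> norm \<theta> / norm \<nu>"
      proof -
        have "y / 2 \<le> y" if "0 \<le> y" for y :: real using that by simp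
        then show ?thesis using divide_nonneg_nonneg[OF norm_ge_zero norm_ge_zero] by blast
      qed
      finally show "norm (\<theta> / (2 * e * \<nu>)) \<le> norm \<theta> / norm \<nu>" .
    qed
    also have "\<dots> = (2 * (norm (A0 $ 2 $ 2) + norm (A1 $ 2 $ 2)) + norm \<theta>) / norm \<nu>" by (simp add: add_divide_distrib)
    also have "\<dots> \<le> K / norm \<nu>" unfolding K_def by (intro divide_right_mono) auto
    finally show "norm (n22 \<nu>) \<le> K / norm \<nu>" .
    \<comment> \<open>The terms of order 1/\<nu> in \<open>n11\<close> cancel because
      \<open>diag\<close> matches the sum of the residues with the exponent \<theta>; what remains
      is of order \<nu>^-2 and hence integrable.\<close>
    define \<eta> where "\<eta> = e * \<nu>"
    have \<eta>: "\<eta> \<noteq> 0" "\<eta> + 1 \<noteq> 0" "\<eta> - 1 \<noteq> 0" using e(2) \<nu>0 inv(3,4)[OF \<nu>] by (auto simp: \<eta>_def)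
    have "A \<nu> $ 1 $ 1 - (x / 4 - \<theta> / (2 * e * \<nu>)) = 1 / \<eta> * (A1$1$1 * (1 / (\<eta> - 1)) - A0$1$1 * (1 / (\<eta> + 1)))"
    proof -
      have p: "1 / (\<eta> + 1) = 1 / \<eta> - 1 / \<eta> * (1 / (\<eta> + 1))" "1 / (\<eta> - 1) = 1 / \<eta> + 1 / \<eta> * (1 / (\<eta> - 1))"
        using \<eta> by (simp_all add: divide_simps)
      have tq: "\<theta> / (2 * e * \<nu>) = - (A0$1$1 + A1$1$1) * (1 / \<eta>)"
        unfolding diag \<eta>_def using e(2) \<nu>0 by (simp add: divide_simps)
      have "A \<nu> $ 1 $ 1 - (x / 4 - \<theta> / (2 * e * \<nu>)) = (1 / (\<eta> + 1)) * A0$1$1 + (1 / (\<eta> - 1)) * A1$1$1 - (A0$1$1 + A1$1$1) * (1 / \<eta>)"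
        unfolding tq A_def eta_coeff_def \<eta>_def[symmetric] by (simp add: algebra_simps)
      also have "\<dots> = 1 / \<eta> * (A1$1$1 * (1 / (\<eta> - 1)) - A0$1$1 * (1 / (\<eta> + 1)))"
      proof -
        have "u * a + v * b - (a + b) * t = t * (b * v - a * u)"
          if "u = t - t * u" "v = t + t * v" for u v t a b :: complex
        proof -
          have "u * a + v * b - (a + b) * t = (u - t) * a + (v - t) * b" by (simp add: algebra_simps)
          also have "u - t = - (t * u)" using that(1) by (simp add: algebra_simps)
          also have "v - t = t * v" using that(2) by (simp add: algebra_simps)
          finally show ?thesis by (simp add: algebra_simps)
        qed
        from this[OF p] show ?thesis .
      qed
      finally show ?thesis .
    qed
    then have "norm (n11 \<nu>) = 1 / norm \<nu> * norm (A1$1$1 * (1 / (\<eta> - 1)) - A0$1$1 * (1 / (\<eta> + 1)))"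
      unfolding n11_def by (simp add: norm_mult norm_divide e \<eta>_def)
    also have "norm (A1$1$1 * (1 / (\<eta> - 1)) - A0$1$1 * (1 / (\<eta> + 1))) \<le> norm (A1$1$1) * norm (1 / (\<eta> - 1)) + norm (A0$1$1) * norm (1 / (\<eta> + 1))"
      unfolding norm_mult[symmetric] by (rule norm_triangle_ineq4)
    also have "\<dots> \<le> norm (A1$1$1) * (2 / norm \<nu>) + norm (A0$1$1) * (2 / norm \<nu>)"
      unfolding \<eta>_def using inv[OF \<nu>] by (intro add_mono mult_left_mono) auto
    also have "\<dots> = 2 * (norm (A1$1$1) + norm (A0$1$1)) / norm \<nu>" by (simp add: algebra_simps add_divide_distrib)
    finally have "norm (n11 \<nu>) \<le> 1 / norm \<nu> * (2 * (norm (A1$1$1) + norm (A0$1$1)) / norm \<nu>)"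
      by (simp add: mult_left_mono divide_right_mono)
    also have "\<dots> = 2 * (norm (A1$1$1) + norm (A0$1$1)) / (norm \<nu>)\<^sup>2" by (simp add: power2_eq_square)
    also have "\<dots> \<le> K / (norm \<nu>)\<^sup>2" unfolding K_def by (intro divide_right_mono) auto
    finally show "norm (n11 \<nu>) \<le> K / (norm \<nu>)\<^sup>2" .
  next
    show "Re a > 0" using rec by (simp add: a_def e_def mult.commute)
    show "(0::real) < 2" "0 \<le> \<bar>cos \<delta>\<bar>" by simp_all
    have "sin \<delta> > 0" using \<delta> by (intro sin_gt_zero)
    then have "(sin \<delta>)\<^sup>2 > 0" by simp
    then have "(cos \<delta>)\<^sup>2 < 1\<^sup>2" using sin_cos_squared_add[of \<delta>] unfolding one_power2 by linarith
    then show "\<bar>cos \<delta>\<bar> < 1" by (simp add: abs_square_less_1)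
  next
    fix L assume L: "L > max 1 (exp R)"
    then have L': "L > 1" "L > exp R" by auto
    have m: "mm (of_real L) = Complex (ln L) \<beta>" using L' by (simp add: mm_def Ln_of_real complex_eq_iff)
    have "ln L > R" "ln L > 0" using L' ln_less_cancel_iff[of "exp R" L] by auto
    moreover have "exp (- ln L) = 1 / L" using L' by (simp add: exp_minus field_simps)
    ultimately show "norm (G1 (of_real L) - 1) \<le> C / L" "norm (G2 (of_real L)) \<le> C / L"
      using CR[of "mm (of_real L)"] unfolding G1_def G2_def m by auto
  qed
  then obtain C' R' where C': "\<And>\<nu>. norm \<nu> > R' \<and> Re \<nu> \<ge> - \<bar>cos \<delta>\<bar> * norm \<nu> \<Longrightarrow>
           norm (G1 \<nu> - 1) \<le> C' / norm \<nu> \<and> norm (G2 \<nu>) \<le> C' / norm \<nu>" by blast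
  show ?thesis unfolding col_asym_def
  proof (rule exI[of _ C'], rule exI[of _ "ln (max R' 1)"], intro allI impI)
    fix m assume m: "ln (max R' 1) < Re m \<and> 0 < Re m \<and> Im m \<in> {\<beta> - (pi - \<delta>)..\<beta> + (pi - \<delta>)}"
    define \<nu> where "\<nu> = exp (m - \<i> * of_real \<beta>)"
    have n: "norm \<nu> = exp (Re m)" by (simp add: \<nu>_def)
    have "max R' 1 < norm \<nu>" unfolding n using m by (metis exp_less_mono exp_ln max.strict_coboundedI2 zero_less_one)
    moreover have "Re \<nu> \<ge> - \<bar>cos \<delta>\<bar> * norm \<nu>"
    proof -
      have "cos (pi - \<delta>) \<le> cos \<bar>Im m - \<beta>\<bar>" using m \<delta> by (intro cos_monotone_0_pi_le) auto
      then have "- \<bar>cos \<delta>\<bar> \<le> cos (Im m - \<beta>)" by simp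
      then have "- \<bar>cos \<delta>\<bar> * norm \<nu> \<le> cos (Im m - \<beta>) * norm \<nu>" by (intro mult_right_mono) auto
      also have "\<dots> = Re \<nu>" unfolding n by (simp add: \<nu>_def Re_exp)
      finally show ?thesis .
    qed
    ultimately have "norm (G1 \<nu> - 1) \<le> C' / norm \<nu> \<and> norm (G2 \<nu>) \<le> C' / norm \<nu>" by (intro C') auto
    moreover have "mm \<nu> = m"
      unfolding mm_def \<nu>_def using m \<delta> by (subst Ln_exp) auto
    moreover have "C' / norm \<nu> = C' * exp (- Re m)" unfolding n by (simp add: exp_minus field_simps)
    ultimately show "norm (X m $ 1 $ 1 * exp (- qexp \<theta> x m) - 1) \<le> C' * exp (- Re m) \<and>
      norm (X m $ 2 $ 1 * exp (- qexp \<theta> x m)) \<le> C' * exp (- Re m)" by (simp add: G1_def G2_def)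
  qed
qed

text \<open>Let \<open>w\<close> be the most recessive direction. One ray within pi/2 of
  \<open>w\<close> yields all such rays, and each of these carries the asymptotics to every angle
  less than pi. Two rays close to w + pi/2 and w - pi/2 therefore fill |arg - w| < 3 pi/2, which
  contains each required sector with |c - w| \<le> pi/2.\<close>

lemma col_asym_window:
  assumes sol: "system_solution A0 A1 x X" and diag: "A0 $ 1 $ 1 + A1 $ 1 $ 1 = - (\<theta> / 2)"
    and ray: "col_asym \<theta> x X {\<beta>}" and w: "x * cis w = - of_real r" "r > 0" and \<beta>: "\<bar>\<beta> - w\<bar> < pi / 2"
    and c: "\<bar>c - w\<bar> \<le> pi / 2" and \<delta>: "\<delta> > 0"
  shows "col_asym \<theta> x X {c - (pi - \<delta>)..c + (pi - \<delta>)}"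
proof -
  have rec: "Re (x * cis b) < 0" if "\<bar>b - w\<bar> < pi / 2" for b
  proof -
    have "x * cis b = - of_real r * cis (b - w)"
    proof -
      have "cis b = cis w * cis (b - w)" by (simp add: cis_mult)
      then have "x * cis b = (x * cis w) * cis (b - w)" by simp
      then show ?thesis by (simp add: w(1))
    qed
    moreover have "cos (b - w) > 0" using that by (intro cos_gt_zero_pi; linarith)
    ultimately show ?thesis using w(2) by simp
  qed
  define d where "d = min (\<delta> / 2) (pi / 4)"
  have d: "0 < d" "d \<le> \<delta> / 2" "d \<le> pi / 4" "d < pi" using \<delta> by (auto simp: d_def min_def)
  define d' where "d' = (pi / 2 - \<bar>\<beta> - w\<bar>) / 2"
  have d': "0 < d'" "d' < pi" unfolding d'_def using \<beta> pi_gt_zero abs_ge_zero[of "\<beta> - w"] by argo+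
  have base: "col_asym \<theta> x X {\<beta> - (pi - d')..\<beta> + (pi - d')}"
    by (rule col_asym_extend[OF sol diag ray rec[OF \<beta>] d'])
  have side: "col_asym \<theta> x X {b - (pi - d)..b + (pi - d)}" if b: "\<bar>b - w\<bar> < pi / 2" for b
  proof (rule col_asym_extend[OF sol diag _ rec[OF b] d(1) d(4)])
    have "b \<in> {\<beta> - (pi - d')..\<beta> + (pi - d')}"
    proof -
      have "b - w < pi / 2" "w - b < pi / 2" "\<beta> - w \<le> \<bar>\<beta> - w\<bar>" "w - \<beta> \<le> \<bar>\<beta> - w\<bar>" using b by linarith+
      moreover have "2 * d' = pi / 2 - \<bar>\<beta> - w\<bar>" by (simp add: d'_def)
      ultimately show ?thesis using d' unfolding atLeastAtMost_iff by (intro conjI; linarith)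
    qed
    then show "col_asym \<theta> x X {b}" using col_asym_subset[OF base] by simp
  qed
  have "col_asym \<theta> x X ({(w + (pi / 2 - d)) - (pi - d)..(w + (pi / 2 - d)) + (pi - d)} \<union>
      {(w - (pi / 2 - d)) - (pi - d)..(w - (pi / 2 - d)) + (pi - d)})"
    using d by (intro col_asym_Un side) auto
  then show ?thesis
    by (rule col_asym_subset) (use c d in \<open>auto simp: abs_if split: if_splits\<close>)
qed

section \<open>Isomonodromic deformation of canonical solutions\<close>

text \<open>\<open>y\<close> plays the role of x \<eta>, whose argument is pi + \<kappa> (\<tau> h +
  pi/4) during a step, and \<open>D\<close> is nearly i \<kappa> h. So Re (D y) is about h |y| sin
  (\<tau> h + pi/4), with the angle between pi/6 and pi/2. The term \<open>y'\<close> comes from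
  \<xi> = (\<eta> + 1)/2 and is smaller than \<open>y\<close> by the factor N \<ge> 10.\<close>

lemma rotating_step_bound:
  fixes h a \<kappa> \<tau> N E :: real
  assumes "0 < h" "h \<le> 1/10" "\<bar>a\<bar> \<le> 1/10" "\<kappa> = 1 \<or> \<kappa> = -1" "\<tau> \<in> {0..1}" "N \<ge> 10" "E > 0"
    "y = - of_real (N * E) * cis (\<kappa> * (\<tau> * h + pi / 4))" "norm y' \<le> E" "D = of_real h * Complex a \<kappa>"
  shows "Re (D * ((y + y') / 2)) \<ge> h * E / 10 * N"
proof -
  define \<psi> where "\<psi> = \<tau> * h + pi / 4"
  have th: "0 \<le> \<tau> * h" "\<tau> * h \<le> 1 / 10"
    using assms mult_mono[of \<tau> 1 h "1/10"] by auto
  have "pi / 6 \<le> \<psi>" "\<psi> \<le> pi / 2" using th pi_gt3 by (auto simp: \<psi>_def)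
  then have "sin (pi / 6) \<le> sin \<psi>" by (intro sin_monotone_2pi_le) (use pi_gt_zero in linarith)+
  then have s: "sin \<psi> \<ge> 1 / 2" by (simp add: sin_30)
  have "\<bar>a * cos \<psi>\<bar> \<le> 1 / 10 * 1" unfolding abs_mult by (intro mult_mono assms) auto
  then have c: "a * cos \<psi> \<le> 1 / 10" by linarith
  have 1: "Re (D * y) = h * (N * E) * (sin \<psi> - a * cos \<psi>)"
    unfolding assms(8,10) \<psi>_def[symmetric] using assms(4) by (auto simp: algebra_simps)
  have "h * (N * E) * (4 / 10) \<le> h * (N * E) * (sin \<psi> - a * cos \<psi>)"
    using s c assms by (intro mult_left_mono) auto
  then have 2: "Re (D * y) \<ge> h * (N * E) * (4 / 10)" unfolding 1 .
  have "norm (Complex a \<kappa>) \<le> \<bar>a\<bar> + \<bar>\<kappa>\<bar>" using cmod_le[of "Complex a \<kappa>"] by simp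
  then have "norm D \<le> h * 2" unfolding assms(10) norm_mult using assms by (intro mult_mono) auto
  then have "norm (D * y') \<le> h * 2 * E" unfolding norm_mult using assms by (intro mult_mono) auto
  then have 3: "Re (D * y') \<ge> - (h * 2 * E)" using abs_Re_le_cmod[of "D * y'"] by linarith
  have "h * E * 10 \<le> h * E * N" using assms by (intro mult_left_mono) auto
  moreover have "Re (D * ((y + y') / 2)) = (Re (D * y) + Re (D * y')) / 2"
    by (simp add: algebra_simps)
  moreover have "4 / 10 * (h * E * N) \<le> Re (D * y)" "- (2 * (h * E)) \<le> Re (D * y')"
    using 2 3 by (simp_all only: mult_ac)
  moreover have "X / 10 \<le> s" if "10 * Y \<le> X" "s = (A + B) / 2" "4 / 10 * X \<le> A" "- (2 * Y) \<le> B" for X Y A B s :: real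
    using that by argo
  moreover have "h * E * 10 = 10 * (h * E)" "h * E / 10 * N = h * E * N / 10" by simp_all
  ultimately show ?thesis by metis
qed

text \<open>Along a path on which \<open>arg x\<close> moves in the direction \<open>\<kappa>\<close>, the second component is damped
  for \<open>\<xi>\<close> on the ray \<open>Im m = w + \<kappa> \<pi> / 4\<close>, where \<open>w\<close> is the most recessive direction of the column.\<close>
lemma col_asym_step_ray:
  fixes \<sigma> h a \<kappa> w :: real and s0 \<Delta> :: complex and U :: "complex \<Rightarrow> complex \<Rightarrow> cmat"
  assumes dU: "\<And>m s. Re m > 0 \<Longrightarrow> s \<in> S \<Longrightarrow>
       has_mderiv (U m) ((scale_mat ((exp m + 1) / 2) (scale_mat (of_real \<sigma> * exp s / 2) sigma3) + G s) ** U m s) s"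
    and G: "mholo G S" "\<And>s. s \<in> S \<Longrightarrow> G s $ 1 $ 1 = 0" "\<And>s. s \<in> S \<Longrightarrow> G s $ 2 $ 2 = 0"
    and S: "closed_segment s0 (s0 + \<Delta>) \<subseteq> S"
    and \<Delta>: "\<Delta> = of_real h * Complex a \<kappa>" "0 < h" "h \<le> 1/10" "\<bar>a\<bar> \<le> 1/10" "\<kappa> = 1 \<or> \<kappa> = -1"
    and \<sigma>: "\<sigma> = 1 \<or> \<sigma> = -1" and w: "of_real \<sigma> * cis (Im s0 + w) = -1"
    and ini: "col_asym \<theta> (of_real \<sigma> * exp s0) (\<lambda>m. U m s0) {w + \<kappa> * (pi / 4)}"
  shows "col_asym \<theta> (of_real \<sigma> * exp (s0 + \<Delta>)) (\<lambda>m. U m (s0 + \<Delta>)) {w + \<kappa> * (pi / 4)}"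
proof -
  define \<beta> where "\<beta> = w + \<kappa> * (pi / 4)"
  obtain C0 R where CR: "\<And>m. Re m > R \<and> Re m > 0 \<and> Im m \<in> {\<beta>} \<Longrightarrow>
      norm (U m s0 $ 1 $ 1 * exp (- qexp \<theta> (of_real \<sigma> * exp s0) m) - 1) \<le> C0 * exp (- Re m) \<and>
      norm (U m s0 $ 2 $ 1 * exp (- qexp \<theta> (of_real \<sigma> * exp s0) m)) \<le> C0 * exp (- Re m)"
    using ini unfolding col_asym_def \<beta>_def by blast
  have "\<exists>M. \<forall>s\<in>closed_segment s0 (s0 + \<Delta>). norm (G s $ i $ j) \<le> M" for i j
  proof -
    have "continuous_on (closed_segment s0 (s0 + \<Delta>)) (\<lambda>z. G z $ i $ j)"
      using holomorphic_on_imp_continuous_on[OF mholoD[OF G(1)]] S by (rule continuous_on_subset)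
    then have "bounded ((\<lambda>z. G z $ i $ j) ` closed_segment s0 (s0 + \<Delta>))"
      by (intro compact_imp_bounded compact_continuous_image) auto
    then show ?thesis unfolding bounded_iff by blast
  qed
  then obtain M where M: "\<And>i j s. s \<in> closed_segment s0 (s0 + \<Delta>) \<Longrightarrow> norm (G s $ i $ j) \<le> M i j" by metis
  define Mg where "Mg = \<bar>M 1 2\<bar> + \<bar>M 2 1\<bar>"
  have Mg: "norm (G s $ 1 $ 2) \<le> Mg" "norm (G s $ 2 $ 1) \<le> Mg" "Mg \<ge> 0" if "s \<in> closed_segment s0 (s0 + \<Delta>)" for s
    using M[OF that, of 1 2] M[OF that, of 2 1] by (auto simp: Mg_def)
  have Mg0: "Mg \<ge> 0" by (simp add: Mg_def)
  define K where "K = 2 * norm \<Delta> * Mg"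
  define k where "k = h * exp (Re s0 - 1) / 10"
  define C where "C = 2 * \<bar>C0\<bar>"
  have K: "K \<ge> 0" "k > 0" "C \<ge> 0" using Mg0 \<Delta> by (auto simp: K_def k_def C_def)
  define T where "T = 2 * K * (1 + K / k) + 2 * (C + K * C) + 1"
  define C' where "C' = C + K * (3 + C + 3 * K / k) + 3 * K / k"
  have T1: "T \<ge> 1" using K unfolding T_def by simp
  show ?thesis unfolding col_asym_def
  proof (rule exI[of _ "4 * C'"], rule exI[of _ "max R (ln (2 * T + 10))"], intro allI impI)
    fix m assume m: "max R (ln (2 * T + 10)) < Re m \<and> 0 < Re m \<and> Im m \<in> {w + \<kappa> * (pi / 4)}"
    then have m0: "Re m > 0" "Re m > R" "Im m = \<beta>" by (auto simp: \<beta>_def)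
    define N where "N = exp (Re m)"
    have "ln (2 * T + 10) < Re m" using m by auto
    then have N: "N > 2 * T + 10" unfolding N_def using T1 by (metis add_nonneg_pos exp_less_cancel_iff exp_ln mult_nonneg_nonneg order_trans zero_le_one zero_le_numeral zero_less_numeral)
    define \<xi> where "\<xi> = (exp m + 1) / 2"
    have em: "norm (exp m) = N" by (simp add: N_def)
    have \<xi>1: "norm \<xi> \<le> N" "norm \<xi> \<ge> N / 4" "norm \<xi> \<ge> T" "norm \<xi> > 0"
    proof -
      have "norm (exp m + 1) \<le> N + 1" using norm_triangle_ineq[of "exp m" 1] em by simp
      then show "norm \<xi> \<le> N" using N T1 by (simp add: \<xi>_def norm_divide)
      have "norm (exp m + 1) \<ge> N - 1" using norm_triangle_ineq2[of "exp m" "-1"] em by simp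
      then have "norm \<xi> \<ge> (N - 1) / 2" by (simp add: \<xi>_def norm_divide)
      then show "norm \<xi> \<ge> N / 4" "norm \<xi> \<ge> T" "norm \<xi> > 0" using N T1 by auto
    qed
    \<comment> \<open>The step is parametrised backwards by r in [0, n], with r = n at the start
      \<open>s0\<close>. Giving it length n = |\<xi>| turns the coupling |\<Delta>| Mg / n into K /
      (n + r), where the 2 in \<open>K\<close> absorbs n + r \<le> 2 n, and keeps the damping rate
      above \<open>k\<close>. Thus \<open>backward_bound\<close> applies with both l and \<rho>0
      equal to n.\<close>
    define n where "n = norm \<xi>"
    have n: "n > 0" "n \<ge> T" using \<xi>1 by (auto simp: n_def)
    define s where "s r = s0 + of_real (1 - r / n) * \<Delta>" for r
    have sseg: "s r \<in> closed_segment s0 (s0 + \<Delta>)" if "r \<in> {0..n}" for r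
    proof -
      have "s r = (1 - (1 - r / n)) *\<^sub>R s0 + (1 - r / n) *\<^sub>R (s0 + \<Delta>)"
        unfolding s_def scaleR_conv_of_real
        by (simp only: of_real_diff of_real_1 diff_diff_eq2 add_diff_cancel_left') (simp add: algebra_simps del: of_real_divide)
      moreover have "0 \<le> 1 - r / n" "1 - r / n \<le> 1" using that n by auto
      ultimately show ?thesis unfolding closed_segment_def by blast
    qed
    have sS: "s r \<in> S" if "r \<in> {0..n}" for r using sseg[OF that] S by blast
    have ds: "(s has_vector_derivative (- \<Delta> / of_real n)) (at r within {0..n})" for r
      unfolding s_def[abs_def] using n by (auto intro!: derivative_eq_intros simp: field_simps)
    define q where "q z = qexp \<theta> (of_real \<sigma> * exp z) m" for z
    define E where "E z = exp (- q z)" for z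
    have dE: "(E has_field_derivative (- (of_real \<sigma> * exp z * \<xi> / 2) * E z)) (at z)" for z
      unfolding E_def q_def qexp_def \<xi>_def by (auto intro!: derivative_eq_intros simp: field_simps)
    have dUi: "((\<lambda>z. U m z $ 1 $ 1 * E z) has_field_derivative G z $ 1 $ 2 * (U m z $ 2 $ 1 * E z)) (at z)"
       "((\<lambda>z. U m z $ 2 $ 1 * E z) has_field_derivative - (of_real \<sigma> * exp z * \<xi>) * (U m z $ 2 $ 1 * E z) + G z $ 2 $ 1 * (U m z $ 1 $ 1 * E z)) (at z)"
      if "z \<in> S" for z
    proof -
      show "((\<lambda>z. U m z $ 1 $ 1 * E z) has_field_derivative G z $ 1 $ 2 * (U m z $ 2 $ 1 * E z)) (at z)"
        by (rule derivative_eq_intros has_mderivD[OF dU[OF m0(1) that]] dE refl)+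
           (simp add: mmult_nth G(2,3)[OF that] \<xi>_def field_simps)
      show "((\<lambda>z. U m z $ 2 $ 1 * E z) has_field_derivative - (of_real \<sigma> * exp z * \<xi>) * (U m z $ 2 $ 1 * E z) + G z $ 2 $ 1 * (U m z $ 1 $ 1 * E z)) (at z)"
        by (rule derivative_eq_intros has_mderivD[OF dU[OF m0(1) that]] dE refl)+
           (simp add: mmult_nth G(2,3)[OF that] \<xi>_def field_simps)
    qed
    define h1 where "h1 r = U m (s r) $ 1 $ 1 * E (s r)" for r
    define h2 where "h2 r = U m (s r) $ 2 $ 1 * E (s r)" for r
    have dh1: "(h1 has_vector_derivative (0 * h1 r + (- \<Delta> / of_real n * G (s r) $ 1 $ 2) * h2 r)) (at r within {0..n})"
      if "r \<in> {0..n}" for r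
      using field_vector_diff_chain_within[OF ds[of r] has_field_derivative_at_within[OF dUi(1)[OF sS[OF that]]]]
      unfolding h1_def[abs_def] h2_def[abs_def] by (simp add: o_def algebra_simps)
    have dh2: "(h2 has_vector_derivative ((\<Delta> / of_real n * (of_real \<sigma> * exp (s r) * \<xi>)) * h2 r + (- \<Delta> / of_real n * G (s r) $ 2 $ 1) * h1 r)) (at r within {0..n})"
      if "r \<in> {0..n}" for r
      using field_vector_diff_chain_within[OF ds[of r] has_field_derivative_at_within[OF dUi(2)[OF sS[OF that]]]]
      unfolding h1_def[abs_def] h2_def[abs_def] by (simp add: o_def algebra_simps)
    have bG: "norm (- \<Delta> / of_real n * G (s r) $ 1 $ 2) \<le> K / (n + r)" "norm (- \<Delta> / of_real n * G (s r) $ 2 $ 1) \<le> K / (n + r)"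
      if "r \<in> {0..n}" for r
    proof -
      have "norm \<Delta> * Mg / n = K / (n + n)" using n by (simp add: K_def field_simps)
      also have "\<dots> \<le> K / (n + r)" using that n K by (intro divide_left_mono) auto
      finally have 1: "norm \<Delta> * Mg / n \<le> K / (n + r)" .
      have "norm (- \<Delta> / of_real n * G (s r) $ 1 $ 2) = norm \<Delta> * norm (G (s r) $ 1 $ 2) / n"
        "norm (- \<Delta> / of_real n * G (s r) $ 2 $ 1) = norm \<Delta> * norm (G (s r) $ 2 $ 1) / n"
        using n by (simp_all add: norm_mult norm_divide)
      moreover have "norm \<Delta> * norm (G (s r) $ 1 $ 2) / n \<le> norm \<Delta> * Mg / n" "norm \<Delta> * norm (G (s r) $ 2 $ 1) / n \<le> norm \<Delta> * Mg / n"
        using Mg[OF sseg[OF that]] n by (auto intro!: divide_right_mono mult_left_mono)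
      ultimately show "norm (- \<Delta> / of_real n * G (s r) $ 1 $ 2) \<le> K / (n + r)" "norm (- \<Delta> / of_real n * G (s r) $ 2 $ 1) \<le> K / (n + r)"
        using 1 by linarith+
    qed
    have \<gamma>: "Re (\<Delta> / of_real n * (of_real \<sigma> * exp (s r) * \<xi>)) \<ge> k" if r: "r \<in> {0..n}" for r
    proof -
      define \<tau> where "\<tau> = 1 - r / n"
      have \<tau>: "\<tau> \<in> {0..1}" using r n by (auto simp: \<tau>_def)
      define e where "e = exp (Re (s r))"
      have sr: "s r = s0 + of_real \<tau> * \<Delta>" by (simp add: s_def \<tau>_def)
      have Ims: "Im (s r) = Im s0 + \<kappa> * (\<tau> * h)" unfolding sr \<Delta>(1) by simp
      have Res: "Re (s r) = Re s0 + \<tau> * h * a" unfolding sr \<Delta>(1) by simp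
      have "\<bar>\<tau> * h * a\<bar> \<le> 1 * 1 * 1" unfolding abs_mult using \<tau> \<Delta> by (intro mult_mono) auto
      then have e1: "exp (Re s0 - 1) \<le> e" unfolding e_def Res by simp
      have "of_real \<sigma> * exp (s r) * exp m = of_real \<sigma> * (of_real e * cis (Im (s r))) * (of_real N * cis (Im m))"
        unfolding e_def N_def by (simp add: exp_eq_polar)
      also have "\<dots> = of_real (N * e) * (of_real \<sigma> * (cis (Im s0 + w) * cis (\<kappa> * (\<tau> * h + pi / 4))))"
        unfolding cis_mult Ims m0(3) \<beta>_def by (simp add: cis_mult algebra_simps)
      also have "\<dots> = - of_real (N * e) * cis (\<kappa> * (\<tau> * h + pi / 4))"
        using w by (simp add: mult.assoc[symmetric])
      finally have y: "of_real \<sigma> * exp (s r) * exp m = - of_real (N * e) * cis (\<kappa> * (\<tau> * h + pi / 4))" .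
      have y': "norm (of_real \<sigma> * exp (s r)) \<le> e" using \<sigma> by (auto simp: norm_mult e_def)
      have "Re (\<Delta> * ((of_real \<sigma> * exp (s r) * exp m + of_real \<sigma> * exp (s r)) / 2)) \<ge> h * e / 10 * N"
        by (rule rotating_step_bound[OF \<Delta>(2-5) \<tau> _ _ y y' \<Delta>(1)]) (use N T1 in \<open>auto simp: e_def\<close>)
      moreover have "(of_real \<sigma> * exp (s r) * exp m + of_real \<sigma> * exp (s r)) / 2 = of_real \<sigma> * exp (s r) * \<xi>"
        by (simp add: \<xi>_def field_simps)
      ultimately have 1: "Re (\<Delta> * (of_real \<sigma> * exp (s r) * \<xi>)) \<ge> h * e / 10 * N" by simp
      have "k * n \<le> h * e / 10 * N"
        unfolding k_def n_def using \<xi>1(1) e1 \<Delta>(2) by (intro mult_mono) (auto simp: e_def)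
      then have "k * n \<le> Re (\<Delta> * (of_real \<sigma> * exp (s r) * \<xi>))" using 1 by linarith
      moreover have "Re (\<Delta> / of_real n * (of_real \<sigma> * exp (s r) * \<xi>)) = Re (\<Delta> * (of_real \<sigma> * exp (s r) * \<xi>)) / n"
      proof -
        have "\<Delta> / of_real n * (of_real \<sigma> * exp (s r) * \<xi>) = (\<Delta> * (of_real \<sigma> * exp (s r) * \<xi>)) / of_real n" by simp
        then show ?thesis by (simp only: Re_divide_of_real)
      qed
      ultimately show ?thesis using n by (simp add: pos_le_divide_eq)
    qed
    have s_ends: "s n = s0" "s 0 = s0 + \<Delta>" using n by (auto simp: s_def)
    have tt: "norm (h1 n - 1) \<le> C / (n + n)" "norm (h2 n) \<le> C / (n + n)"
    proof -
      have "C0 * exp (- Re m) \<le> \<bar>C0\<bar> * (1 / N)" by (auto simp: N_def exp_minus field_simps)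
      also have "\<dots> \<le> \<bar>C0\<bar> * (1 / n)" using \<xi>1 n N T1 by (intro mult_left_mono divide_left_mono mult_pos_pos) (auto simp: n_def)
      also have "\<dots> = C / (n + n)" by (simp add: C_def field_simps)
      finally have "C0 * exp (- Re m) \<le> C / (n + n)" .
      then show "norm (h1 n - 1) \<le> C / (n + n)" "norm (h2 n) \<le> C / (n + n)"
        using CR[of m] m0 unfolding h1_def h2_def s_ends E_def q_def by auto
    qed
    note bb = backward_bound[where l = n and K = K and \<kappa> = k and C = C and ?h1.0 = h1 and ?h2.0 = h2
        and \<alpha> = "\<lambda>r. 0" and \<beta> = "\<lambda>r. - \<Delta> / of_real n * G (s r) $ 1 $ 2"
        and \<gamma> = "\<lambda>r. \<Delta> / of_real n * (of_real \<sigma> * exp (s r) * \<xi>)"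
        and \<omega> = "\<lambda>r. - \<Delta> / of_real n * G (s r) $ 2 $ 1" and ?\<rho>0.0 = n]
    have n0: "n \<ge> 0" "norm (0::complex) \<le> K / (n + r)\<^sup>2" for r using n K by auto
    have n2: "n \<ge> 2 * K * (1 + K / k) + 2 * (C + K * C) + 1" using n(2) by (simp add: T_def)
    have f1: "norm (h1 0 - 1) \<le> C' / n" unfolding C'_def
      by (rule bb(1)[OF n0(1) K(1,2,3) dh1 dh2 n0(2) bG(1) bG(2) \<gamma> tt n2])
    have f2: "norm (h2 0) \<le> C' / n" unfolding C'_def
      by (rule bb(2)[OF n0(1) K(1,2,3) dh1 dh2 n0(2) bG(1) bG(2) \<gamma> tt n2])
    have C'n: "C' \<ge> 0" using K unfolding C'_def by (intro add_nonneg_nonneg mult_nonneg_nonneg) auto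
    have "C' / n \<le> C' / (N / 4)" using C'n \<xi>1(2) N T1 n by (intro divide_left_mono) (auto simp: n_def)
    also have "\<dots> = 4 * C' * exp (- Re m)" by (simp add: N_def exp_minus field_simps)
    finally show "norm (U m (s0 + \<Delta>) $ 1 $ 1 * exp (- qexp \<theta> (of_real \<sigma> * exp (s0 + \<Delta>)) m) - 1) \<le> 4 * C' * exp (- Re m) \<and>
      norm (U m (s0 + \<Delta>) $ 2 $ 1 * exp (- qexp \<theta> (of_real \<sigma> * exp (s0 + \<Delta>)) m)) \<le> 4 * C' * exp (- Re m)"
      using f1 f2 unfolding h1_def h2_def s_ends E_def q_def by linarith
  qed
qed

text \<open>If arg x = p, then x \<eta> is real in both directions c + pi/2 and c - pi/2, with
  opposite signs. The parity of \<open>k\<close> and the sign \<sigma> decide in which of them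
  \<sigma> x \<eta> is negative.\<close>

lemma recessive_direction:
  fixes \<sigma> c p :: real and k :: int
  assumes a: "\<sigma> = 1 \<or> \<sigma> = -1" "c = pi / 2 + of_int k * pi - p"
  obtains w :: real where "of_real \<sigma> * cis (p + w) = -1" "\<bar>c - w\<bar> = pi / 2"
proof -
  have 1: "cis (of_int j * pi) = (if even j then 1 else -1)" for j :: int
    by (auto simp: complex_eq_iff cos_int_times_real sin_int_times_real mult.commute)
  show thesis
  proof (cases "\<sigma> = 1 \<longleftrightarrow> even k")
    case True
    have "p + (c + pi / 2) = of_int (k + 1) * pi" unfolding a(2) by (simp add: algebra_simps)
    then have "cis (p + (c + pi / 2)) = (if even (k + 1) then 1 else -1)" by (simp only: 1)
    then show thesis
      by (intro that[of "c + pi / 2"]) (use True a(1) in auto)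
  next
    case False
    have "p + (c - pi / 2) = of_int k * pi" unfolding a(2) by (simp add: algebra_simps)
    then have "cis (p + (c - pi / 2)) = (if even k then 1 else -1)" by (simp only: 1)
    then show thesis
      by (intro that[of "c - pi / 2"]) (use False a(1) in auto)
  qed
qed

definition offdiag :: "cmat \<Rightarrow> cmat" where
  "offdiag A = mat2 0 (A$1$2) (A$2$1) 0"

lemma offdiag_nth [simp]: "offdiag A $ 1 $ 1 = 0" "offdiag A $ 2 $ 2 = 0"
  "offdiag A $ 1 $ 2 = A$1$2" "offdiag A $ 2 $ 1 = A$2$1"
  by (simp_all add: offdiag_def)

text \<open>The coefficient of the deformation equation \<open>d\<Xi>/ds = (\<xi> x \<sigma>\<^sub>3 / 2 + G) \<Xi>\<close>.\<close>
definition deform_coeff :: "cmat \<Rightarrow> cmat \<Rightarrow> complex \<Rightarrow> complex \<Rightarrow> cmat" where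
  "deform_coeff A0 A1 x \<xi> = scale_mat \<xi> (scale_mat (x / 2) sigma3) + offdiag (A0 + A1)"

text \<open>The Schlesinger equations in s = ln x. Each residue is commuted with the value of the
  deformation coefficient at its own singular point: \<open>G\<close> at \<xi> = 0 and G + C at
  \<xi> = 1. The diagonal condition fixes the exponent of formal monodromy at infinity.\<close>

definition isomonodromic :: "complex \<Rightarrow> (complex \<Rightarrow> cmat) \<Rightarrow> (complex \<Rightarrow> cmat) \<Rightarrow> complex set \<Rightarrow> bool" where
  "isomonodromic \<theta> A0 A1 S \<longleftrightarrow> open S \<and>
     (\<forall>s\<in>S. trace (A0 s) = 0 \<and> trace (A1 s) = 0 \<and> A0 s $ 1 $ 1 + A1 s $ 1 $ 1 = - (\<theta> / 2) \<and>
        (let G = offdiag (A0 s + A1 s); C = scale_mat (exp s / 2) sigma3 in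
         has_mderiv A0 (G ** A0 s - A0 s ** G) s \<and>
         has_mderiv A1 ((G + C) ** A1 s - A1 s ** (G + C)) s))"

text \<open>Compatibility of the equations in \<eta> and in s. Multiplying 1/(\<eta> + 1) and
  1/(\<eta> - 1) by \<xi> = (\<eta> + 1)/2 gives 1/2 and 1/2 + 1/(\<eta> - 1), so the commutator has
  no poles beyond those on the left.\<close>

lemma zero_curvature:
  fixes A0 A1 :: cmat
  assumes "E + 1 \<noteq> 0" "E - 1 \<noteq> 0"
  shows "scale_mat (1 / 2) C + scale_mat (1 / (E + 1)) (offdiag (A0 + A1) ** A0 - A0 ** offdiag (A0 + A1)) +
     scale_mat (1 / (E - 1)) ((offdiag (A0 + A1) + scale_mat (x / 2) sigma3) ** A1 - A1 ** (offdiag (A0 + A1) + scale_mat (x / 2) sigma3))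
   = scale_mat (1 / 2) C + (deform_coeff A0 A1 x ((E + 1) / 2) ** eta_coeff A0 A1 x E - eta_coeff A0 A1 x E ** deform_coeff A0 A1 x ((E + 1) / 2))"
proof -
  define p where "p = 1 / (E + 1)"
  define r where "r = 1 / (E - 1)"
  define \<xi> where "\<xi> = (E + 1) / 2"
  have pr: "\<xi> * p = 1 / 2" "\<xi> * r = 1 / 2 + r" using assms by (simp_all add: \<xi>_def p_def r_def field_simps)
  have key: "\<xi> * (x * (p * a + r * b)) = x * a / 2 + x * b / 2 + x * r * b" for a b
  proof -
    have "\<xi> * (x * (p * a + r * b)) = x * ((\<xi> * p) * a + (\<xi> * r) * b)" by (simp add: algebra_simps)
    then show ?thesis unfolding pr by (simp add: algebra_simps)
  qed
  show ?thesis
    unfolding p_def[symmetric] r_def[symmetric] \<xi>_def[symmetric] cmat_eq_iff deform_coeff_def eta_coeff_def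
    by (simp add: mmult_nth key) (simp add: algebra_simps)
qed

text \<open>\<open>P\<close> is the fundamental solution of the deformation equation. It is entire
  in \<xi>, since the coefficient is a polynomial in \<xi>; multiplying by it from the left
  therefore creates no new branching.\<close>

lemma isomonodromic_transport:
  assumes iso: "isomonodromic \<theta> A0 A1 S" and S: "convex S" "a \<in> S"
  obtains P :: "complex \<Rightarrow> complex \<Rightarrow> cmat"
  where "\<And>s. s \<in> S \<Longrightarrow> mholo (\<lambda>\<xi>. P \<xi> s) UNIV"
    "\<And>\<xi> s. s \<in> S \<Longrightarrow> det (P \<xi> s) = 1" "\<And>\<xi>. P \<xi> a = mat 1"
    "\<And>\<xi> s. s \<in> S \<Longrightarrow> has_mderiv (\<lambda>s. P \<xi> s) (deform_coeff (A0 s) (A1 s) (exp s) \<xi> ** P \<xi> s) s"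
    "\<And>X s. system_solution (A0 a) (A1 a) (exp a) X \<Longrightarrow> s \<in> S \<Longrightarrow>
        system_solution (A0 s) (A1 s) (exp s) (\<lambda>m. P ((exp m + 1) / 2) s ** X m)"
proof -
  have opS: "open S" using iso by (simp add: isomonodromic_def)
  have conS: "connected S" using S(1) by (rule convex_connected)
  have A: "trace (A0 s) = 0" "trace (A1 s) = 0"
    "has_mderiv A0 (offdiag (A0 s + A1 s) ** A0 s - A0 s ** offdiag (A0 s + A1 s)) s"
    "has_mderiv A1 ((offdiag (A0 s + A1 s) + scale_mat (exp s / 2) sigma3) ** A1 s - A1 s ** (offdiag (A0 s + A1 s) + scale_mat (exp s / 2) sigma3)) s"
    if "s \<in> S" for s
    using iso that by (auto simp: isomonodromic_def Let_def)
  define C where "C s = scale_mat (exp s / 2) sigma3" for s :: complex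
  define G where "G s = offdiag (A0 s + A1 s)" for s
  define F where "F \<xi> s = scale_mat \<xi> (C s) + G s" for \<xi> s
  have F: "F \<xi> s = deform_coeff (A0 s) (A1 s) (exp s) \<xi>" for \<xi> s by (simp add: F_def C_def G_def deform_coeff_def)
  have hA: "mholo A0 S" "mholo A1 S" by (rule mholo_mderiv[OF opS A(3)], assumption, rule mholo_mderiv[OF opS A(4)])
  have hC: "mholo C S" unfolding C_def by (intro mholo_scale mholo_const) (auto intro!: holomorphic_intros)
  have hG: "mholo G S" using hA unfolding G_def mholo_def all_2_iff offdiag_nth vector_add_component
    by (auto intro!: holomorphic_intros)
  have tG: "trace (G s) = 0" for s by (simp add: trace_2 G_def)
  have tF: "trace (F \<xi> s) = 0" for \<xi> s by (simp add: trace_2 F_def G_def C_def)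
  have seg: "\<And>z. z \<in> S \<Longrightarrow> closed_segment a z \<subseteq> S" using S by (simp add: closed_segment_subset)
  obtain P Q where PQ: "\<And>\<xi>. P \<xi> a = mat 1" "\<And>\<xi>. Q \<xi> a = 0"
    "\<And>\<xi> z. z \<in> S \<Longrightarrow> has_mderiv (\<lambda>z. P \<xi> z) (F \<xi> z ** P \<xi> z) z"
    "\<And>\<xi> z. z \<in> S \<Longrightarrow> has_mderiv (\<lambda>\<xi>. P \<xi> z) (Q \<xi> z) \<xi>"
    "\<And>\<xi> z. z \<in> S \<Longrightarrow> has_mderiv (\<lambda>z. Q \<xi> z) (C z ** P \<xi> z + F \<xi> z ** Q \<xi> z) z"
    by (rule lode_pencil[OF opS S(2) seg hC hG tG]) (assumption, rule that, (assumption | simp only: F_def)+)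
  have detP: "det (P \<xi> s) = 1" if "s \<in> S" for \<xi> s
    using lode_det_const[OF opS conS PQ(3)[of _ \<xi>] tF that S(2)] by (simp add: PQ(1))
  have holP: "mholo (\<lambda>\<xi>. P \<xi> s) UNIV" if "s \<in> S" for s
    using PQ(4)[OF that] by (intro mholo_mderiv) auto
  have trans: "system_solution (A0 s) (A1 s) (exp s) (\<lambda>m. P ((exp m + 1) / 2) s ** X m)"
    if X: "system_solution (A0 a) (A1 a) (exp a) X" and s: "s \<in> S" for X s
    unfolding system_solution_def
  proof (intro allI impI)
    fix m assume m: "Re m > 0"
    define E where "E = exp m"
    define \<xi> where "\<xi> = (E + 1) / 2"
    have E: "E + 1 \<noteq> 0" "E - 1 \<noteq> 0"
    proof -
      have "norm E > 1" using m by (simp add: E_def)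
      then have "E \<noteq> 1" "E \<noteq> -1" by auto
      then show "E + 1 \<noteq> 0" "E - 1 \<noteq> 0" by (auto simp: add_eq_0_iff2)
    qed
    define N where "N s = scale_mat E (eta_coeff (A0 s) (A1 s) (exp s) E)" for s
    \<comment> \<open>\<open>W\<close> measures by how much the product of \<open>P\<close> and
      \<open>X\<close> fails the equation in m at the deformed point. Zero curvature makes it a
      solution of the deformation equation, and it vanishes at \<open>a\<close>.\<close>
    define W where "W s = scale_mat (E / 2) (Q \<xi> s ** X m) + P \<xi> s ** (N a ** X m) - N s ** (P \<xi> s ** X m)" for s
    have dN: "has_mderiv N (scale_mat (E / 2) (C z) + (F \<xi> z ** N z - N z ** F \<xi> z)) z" if z: "z \<in> S" for z
    proof -
      define D0 where "D0 = offdiag (A0 z + A1 z) ** A0 z - A0 z ** offdiag (A0 z + A1 z)"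
      define D1 where "D1 = (offdiag (A0 z + A1 z) + scale_mat (exp z / 2) sigma3) ** A1 z - A1 z ** (offdiag (A0 z + A1 z) + scale_mat (exp z / 2) sigma3)"
      have d: "has_mderiv A0 D0 z" "has_mderiv A1 D1 z" using A(3,4)[OF z] by (simp_all add: D0_def D1_def)
      have "has_mderiv N (scale_mat E (scale_mat (1 / 2) (C z) + scale_mat (1 / (E + 1)) D0 + scale_mat (1 / (E - 1)) D1)) z"
        unfolding has_mderiv_def N_def eta_coeff_def C_def scale_mat_nth vector_add_component
      proof (intro allI)
        fix i j
        have "((\<lambda>z. exp z / 4 * sigma3 $ i $ j) has_field_derivative exp z / 4 * sigma3 $ i $ j) (at z)"
          by (intro DERIV_cmult_right DERIV_cdivide DERIV_exp)
        note DERIV_cmult[OF DERIV_add[OF DERIV_add[OF this DERIV_cmult[OF has_mderivD[OF d(1)]]] DERIV_cmult[OF has_mderivD[OF d(2)]]], of E "1 / (E + 1)" i j "1 / (E - 1)" i j]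
        then show "((\<lambda>v. E * (exp v / 4 * sigma3 $ i $ j + 1 / (E + 1) * A0 v $ i $ j + 1 / (E - 1) * A1 v $ i $ j)) has_field_derivative
            E * (1 / 2 * (exp z / 2 * sigma3 $ i $ j) + 1 / (E + 1) * D0 $ i $ j + 1 / (E - 1) * D1 $ i $ j)) (at z)"
          by simp
      qed
      also have "scale_mat (1 / 2) (C z) + scale_mat (1 / (E + 1)) D0 + scale_mat (1 / (E - 1)) D1 =
          scale_mat (1 / 2) (C z) + (F \<xi> z ** eta_coeff (A0 z) (A1 z) (exp z) E - eta_coeff (A0 z) (A1 z) (exp z) E ** F \<xi> z)"
        unfolding D0_def D1_def F \<xi>_def by (rule zero_curvature[OF E])
      finally show ?thesis
        unfolding N_def by (simp add: cmat_eq_iff mmult_nth algebra_simps has_mderiv_def all_2_iff)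
    qed
    have dW: "has_mderiv W (F \<xi> z ** W z) z" if z: "z \<in> S" for z
    proof -
      have "has_mderiv W (scale_mat (E / 2) ((C z ** P \<xi> z + F \<xi> z ** Q \<xi> z) ** X m) + (F \<xi> z ** P \<xi> z) ** (N a ** X m)
         - ((scale_mat (E / 2) (C z) + (F \<xi> z ** N z - N z ** F \<xi> z)) ** (P \<xi> z ** X m) + N z ** ((F \<xi> z ** P \<xi> z) ** X m))) z"
      proof -
        have "has_mderiv (\<lambda>z. Q \<xi> z ** X m) ((C z ** P \<xi> z + F \<xi> z ** Q \<xi> z) ** X m) z"
          using has_mderiv_mult[OF PQ(5)[OF z, of \<xi>] has_mderiv_const[of "X m"]] by simp
        moreover have "has_mderiv (\<lambda>z. P \<xi> z ** (N a ** X m)) ((F \<xi> z ** P \<xi> z) ** (N a ** X m)) z"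
          using has_mderiv_mult[OF PQ(3)[OF z, of \<xi>] has_mderiv_const[of "N a ** X m"]] by simp
        moreover have dPX: "has_mderiv (\<lambda>z. P \<xi> z ** X m) ((F \<xi> z ** P \<xi> z) ** X m) z"
          using has_mderiv_mult[OF PQ(3)[OF z, of \<xi>] has_mderiv_const[of "X m"]] by simp
        moreover note has_mderiv_mult[OF dN[OF z] dPX]
        ultimately show ?thesis
          unfolding W_def has_mderiv_def scale_mat_nth vector_add_component vector_minus_component
          by (auto intro!: derivative_eq_intros)
      qed
      also have "scale_mat (E / 2) ((C z ** P \<xi> z + F \<xi> z ** Q \<xi> z) ** X m) + (F \<xi> z ** P \<xi> z) ** (N a ** X m)
         - ((scale_mat (E / 2) (C z) + (F \<xi> z ** N z - N z ** F \<xi> z)) ** (P \<xi> z ** X m) + N z ** ((F \<xi> z ** P \<xi> z) ** X m))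
         = F \<xi> z ** W z"
        unfolding W_def cmat_eq_iff by (simp add: mmult_nth algebra_simps)
      finally show ?thesis .
    qed
    have "adj2 (P \<xi> s) ** W s = adj2 (P \<xi> a) ** W a"
      by (rule lode_quotient_const[OF opS conS PQ(3) dW tF s S(2)])
    also have "W a = 0" by (simp add: W_def PQ(1,2) cmat_eq_iff mmult_nth)
    finally have "P \<xi> s ** (adj2 (P \<xi> s) ** W s) = 0" by simp
    then have "W s = 0" unfolding matrix_mul_assoc adj2_right detP[OF s] by simp
    then have W0: "scale_mat (E / 2) (Q \<xi> s ** X m) + P \<xi> s ** (N a ** X m) = N s ** (P \<xi> s ** X m)"
      by (simp add: W_def)
    have "((\<lambda>m. (exp m + 1) / 2) has_field_derivative (E / 2)) (at m)"
      unfolding E_def by (auto intro!: derivative_eq_intros)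
    from has_mderiv_chain[OF _ this, of "\<lambda>\<xi>. P \<xi> s" "Q \<xi> s"]
    have "has_mderiv (\<lambda>m. P ((exp m + 1) / 2) s) (scale_mat (E / 2) (Q \<xi> s)) m"
      using PQ(4)[OF s, of \<xi>] by (simp add: \<xi>_def E_def)
    moreover have "has_mderiv X (N a ** X m) m"
      using X m by (simp add: system_solution_def N_def E_def)
    ultimately have "has_mderiv (\<lambda>m. P ((exp m + 1) / 2) s ** X m) (scale_mat (E / 2) (Q \<xi> s) ** X m + P \<xi> s ** (N a ** X m)) m"
      using has_mderiv_mult[of "\<lambda>m. P ((exp m + 1) / 2) s" _ m X] by (simp add: \<xi>_def E_def)
    then show "has_mderiv (\<lambda>m. P ((exp m + 1) / 2) s ** X m)
        (scale_mat (exp m) (eta_coeff (A0 s) (A1 s) (exp s) (exp m)) ** (P ((exp m + 1) / 2) s ** X m)) m"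
      using W0 by (simp add: scale_mat_mult \<xi>_def E_def N_def)
  qed
  show thesis
    by (rule that[of P]) (use holP detP PQ trans F in auto)
qed

text \<open>The test ray lies within 3 pi/4 of the centre \<open>c\<close>, so it belongs to a
  closed subsector at the start. The step moves the most recessive direction by -\<kappa> h, after
  which its angle to the ray is pi/4 + h < pi/2, and the whole sector is recovered. The second
  column is the same argument with \<sigma> = -1.\<close>

lemma canonX_step:
  fixes h a \<kappa> :: real and s0 \<Delta> :: complex
  assumes iso: "isomonodromic \<theta> A0 A1 S"
    and U: "\<And>m s. s \<in> S \<Longrightarrow> Re m > 0 \<Longrightarrow> has_mderiv (U m) (deform_coeff (A0 s) (A1 s) (exp s) ((exp m + 1) / 2) ** U m s) s"
      "system_solution (A0 (s0 + \<Delta>)) (A1 (s0 + \<Delta>)) (exp (s0 + \<Delta>)) (\<lambda>m. U m (s0 + \<Delta>))"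
    and seg: "closed_segment s0 (s0 + \<Delta>) \<subseteq> S"
    and \<Delta>: "\<Delta> = of_real h * Complex a \<kappa>" "0 < h" "h \<le> 1/10" "\<bar>a\<bar> \<le> 1/10" "\<kappa> = 1 \<or> \<kappa> = -1"
    and c: "c = pi / 2 + of_int k * pi - Im s0"
    and can: "canonX \<theta> (A0 s0) (A1 s0) (exp s0) c (\<lambda>m. U m s0)"
  shows "canonX \<theta> (A0 (s0 + \<Delta>)) (A1 (s0 + \<Delta>)) (exp (s0 + \<Delta>)) (c - \<kappa> * h) (\<lambda>m. U m (s0 + \<Delta>))"
proof -
  let ?s1 = "s0 + \<Delta>"
  have opS: "open S" using iso by (simp add: isomonodromic_def)
  have s1: "?s1 \<in> S" using seg by auto
  have A: "trace (A0 s) = 0" "trace (A1 s) = 0" "A0 s $ 1 $ 1 + A1 s $ 1 $ 1 = - (\<theta> / 2)" if "s \<in> S" for s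
    using iso that by (auto simp: isomonodromic_def Let_def)
  have dA: "has_mderiv A0 (offdiag (A0 s + A1 s) ** A0 s - A0 s ** offdiag (A0 s + A1 s)) s"
    "has_mderiv A1 ((offdiag (A0 s + A1 s) + scale_mat (exp s / 2) sigma3) ** A1 s - A1 s ** (offdiag (A0 s + A1 s) + scale_mat (exp s / 2) sigma3)) s"
    if "s \<in> S" for s
    using iso that by (auto simp: isomonodromic_def Let_def)
  have hA: "mholo A0 S" "mholo A1 S" by (rule mholo_mderiv[OF opS dA(1)], assumption, rule mholo_mderiv[OF opS dA(2)])
  define G where "G s = offdiag (A0 s + A1 s)" for s
  have hG: "mholo G S" using hA unfolding G_def mholo_def all_2_iff offdiag_nth vector_add_component
    by (auto intro!: holomorphic_intros)
  have hG': "mholo (\<lambda>s. conj_sigma1 (G s)) S" using hG unfolding mholo_def all_2_iff by simp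
  have Ims1: "Im ?s1 = Im s0 + \<kappa> * h" by (simp add: \<Delta>(1))
  have step: "col_asym \<theta>' (of_real \<sigma> * exp ?s1) (\<lambda>m. V m ?s1) {c - \<kappa> * h - (pi - \<delta>)..c - \<kappa> * h + (pi - \<delta>)}"
    if \<sigma>: "\<sigma> = 1 \<or> \<sigma> = -1" and \<delta>: "\<delta> > 0"
      and dV: "\<And>m s. Re m > 0 \<Longrightarrow> s \<in> S \<Longrightarrow>
       has_mderiv (V m) ((scale_mat ((exp m + 1) / 2) (scale_mat (of_real \<sigma> * exp s / 2) sigma3) + H s) ** V m s) s"
      and H: "mholo H S" "\<And>s. s \<in> S \<Longrightarrow> H s $ 1 $ 1 = 0" "\<And>s. s \<in> S \<Longrightarrow> H s $ 2 $ 2 = 0"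
      and sol: "system_solution B0 B1 (of_real \<sigma> * exp ?s1) (\<lambda>m. V m ?s1)" "B0 $ 1 $ 1 + B1 $ 1 $ 1 = - (\<theta>' / 2)"
      and ini: "\<And>\<delta>. \<delta> > 0 \<Longrightarrow> col_asym \<theta>' (of_real \<sigma> * exp s0) (\<lambda>m. V m s0) {c - (pi - \<delta>)..c + (pi - \<delta>)}"
    for \<sigma> \<delta> :: real and V H B0 B1 \<theta>'
  proof -
    obtain w where w: "of_real \<sigma> * cis (Im s0 + w) = -1" "\<bar>c - w\<bar> = pi / 2"
      using recessive_direction[OF \<sigma> c] by blast
    have "w + \<kappa> * (pi / 4) \<in> {c - (pi - pi / 4)..c + (pi - pi / 4)}"
      using w(2) \<Delta>(5) by (auto simp: abs_if split: if_splits)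
    then have "col_asym \<theta>' (of_real \<sigma> * exp s0) (\<lambda>m. V m s0) {w + \<kappa> * (pi / 4)}"
      using ini[of "pi / 4"] by (intro col_asym_subset[OF ini[of "pi / 4"]]) auto
    from col_asym_step_ray[OF dV H seg \<Delta> \<sigma> w(1) this]
    have ray: "col_asym \<theta>' (of_real \<sigma> * exp ?s1) (\<lambda>m. V m ?s1) {w + \<kappa> * (pi / 4)}" .
    show ?thesis
    proof (rule col_asym_window[OF sol ray, where w = "w - \<kappa> * h" and r = "exp (Re ?s1)"])
      have "of_real \<sigma> * exp ?s1 * cis (w - \<kappa> * h) = of_real (exp (Re ?s1)) * (of_real \<sigma> * (cis (Im ?s1) * cis (w - \<kappa> * h)))"
        by (subst exp_eq_polar) (simp add: mult_ac)
      also have "\<dots> = - of_real (exp (Re ?s1))"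
        unfolding cis_mult Ims1 using w(1) by (simp add: algebra_simps)
      finally show "of_real \<sigma> * exp ?s1 * cis (w - \<kappa> * h) = - of_real (exp (Re ?s1))" .
      have "w + \<kappa> * (pi / 4) - (w - \<kappa> * h) = \<kappa> * (pi / 4 + h)" by (simp add: algebra_simps)
      then have "\<bar>w + \<kappa> * (pi / 4) - (w - \<kappa> * h)\<bar> = pi / 4 + h" using \<Delta>(2,5) by (auto simp: abs_mult)
      then show "\<bar>w + \<kappa> * (pi / 4) - (w - \<kappa> * h)\<bar> < pi / 2" using \<Delta>(3) pi_gt3 by argo
      show "\<bar>c - \<kappa> * h - (w - \<kappa> * h)\<bar> \<le> pi / 2" using w(2) by simp
    qed (use \<delta> in auto)
  qed
  have F: "deform_coeff (A0 s) (A1 s) (exp s) \<xi> = scale_mat \<xi> (scale_mat (of_real 1 * exp s / 2) sigma3) + G s" for s \<xi>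
    by (simp add: deform_coeff_def G_def)
  have F': "conj_sigma1 (deform_coeff (A0 s) (A1 s) (exp s) \<xi>) = scale_mat \<xi> (scale_mat (of_real (-1) * exp s / 2) sigma3) + conj_sigma1 (G s)" for s \<xi>
    by (simp add: deform_coeff_def G_def cmat_eq_iff)
  have "col_asym \<theta> (exp ?s1) (\<lambda>m. U m ?s1) {c - \<kappa> * h - (pi - \<delta>)..c - \<kappa> * h + (pi - \<delta>)}" if "\<delta> > 0" for \<delta>
  proof -
    have 1: "of_real 1 * exp z = exp z" for z :: complex by simp
    show ?thesis
    proof (rule step[of 1 \<delta> U G "A0 ?s1" "A1 ?s1" \<theta>, unfolded 1])
      show "has_mderiv (U m) ((scale_mat ((exp m + 1) / 2) (scale_mat (exp s / 2) sigma3) + G s) ** U m s) s"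
        if "0 < Re m" "s \<in> S" for m s
        using U(1)[OF that(2,1)] unfolding F 1 .
    qed (use that U(2) hG A[OF s1] can in \<open>simp_all add: G_def canonX_def\<close>)
  qed
  moreover have "col_asym (- \<theta>) (- exp ?s1) (\<lambda>m. conj_sigma1 (U m ?s1)) {c - \<kappa> * h - (pi - \<delta>)..c - \<kappa> * h + (pi - \<delta>)}" if "\<delta> > 0" for \<delta>
  proof -
    have "has_mderiv (\<lambda>s. conj_sigma1 (U m s)) ((scale_mat ((exp m + 1) / 2) (scale_mat (of_real (-1) * exp s / 2) sigma3) + conj_sigma1 (G s)) ** conj_sigma1 (U m s)) s"
      if "Re m > 0" "s \<in> S" for m s
      using has_mderiv_conj_sigma1[OF U(1)[OF that(2,1)]] unfolding conj_sigma1_mult F' .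
    moreover have "system_solution (conj_sigma1 (A0 ?s1)) (conj_sigma1 (A1 ?s1)) (of_real (-1) * exp ?s1) (\<lambda>m. conj_sigma1 (U m ?s1))"
      using system_solution_conj_sigma1[OF U(2)] by simp
    moreover have "conj_sigma1 (A0 ?s1) $ 1 $ 1 + conj_sigma1 (A1 ?s1) $ 1 $ 1 = - (- \<theta> / 2)"
    proof -
      have "A0 ?s1 $ 2 $ 2 = - A0 ?s1 $ 1 $ 1" "A1 ?s1 $ 2 $ 2 = - A1 ?s1 $ 1 $ 1"
        using A(1,2)[OF s1] by (simp_all add: trace_2 add_eq_0_iff)
      then have "conj_sigma1 (A0 ?s1) $ 1 $ 1 + conj_sigma1 (A1 ?s1) $ 1 $ 1 = - (A0 ?s1 $ 1 $ 1 + A1 ?s1 $ 1 $ 1)" by simp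
      then show ?thesis unfolding A(3)[OF s1] by simp
    qed
    moreover have "col_asym (- \<theta>) (of_real (-1) * exp s0) (\<lambda>m. conj_sigma1 (U m s0)) {c - (pi - d)..c + (pi - d)}" if "d > 0" for d
      using can that by (simp add: canonX_def)
    ultimately have "col_asym (- \<theta>) (of_real (-1) * exp ?s1) (\<lambda>m. conj_sigma1 (U m ?s1)) {c - \<kappa> * h - (pi - \<delta>)..c - \<kappa> * h + (pi - \<delta>)}"
      using that hG'
      by (intro step[of "-1" \<delta> "\<lambda>m s. conj_sigma1 (U m s)" "\<lambda>s. conj_sigma1 (G s)" "conj_sigma1 (A0 ?s1)" "conj_sigma1 (A1 ?s1)" "- \<theta>"])
         (auto simp: G_def)
    then show ?thesis by simp
  qed
  ultimately show ?thesis using U(2) by (simp add: canonX_def)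
qed

text \<open>A segment is divided into steps of height at most 1/10. One factor \<open>P\<close>
  serves for all sectors \<open>k\<close>, which is what keeps the Stokes matrices unchanged under
  the deformation.\<close>

lemma canonX_transport:
  fixes H a \<kappa> :: real and s0 \<Delta> :: complex
  assumes iso: "isomonodromic \<theta> A0 A1 S" and S: "convex S" "s0 \<in> S" "s0 + \<Delta> \<in> S"
    and \<Delta>: "\<Delta> = of_real H * Complex a \<kappa>" "0 < H" "\<bar>a\<bar> \<le> 1/10" "\<kappa> = 1 \<or> \<kappa> = -1"
  obtains P :: "complex \<Rightarrow> cmat"
  where "mholo P UNIV" "\<And>\<xi>. det (P \<xi>) = 1"
    "\<And>k X. canonX \<theta> (A0 s0) (A1 s0) (exp s0) (pi / 2 + of_int k * pi - Im s0) X \<Longrightarrow>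
       canonX \<theta> (A0 (s0 + \<Delta>)) (A1 (s0 + \<Delta>)) (exp (s0 + \<Delta>)) (pi / 2 + of_int k * pi - Im (s0 + \<Delta>))
         (\<lambda>m. P ((exp m + 1) / 2) ** X m)"
proof -
  obtain P :: "complex \<Rightarrow> complex \<Rightarrow> cmat"
    where P: "\<And>s. s \<in> S \<Longrightarrow> mholo (\<lambda>\<xi>. P \<xi> s) UNIV"
    "\<And>\<xi> s. s \<in> S \<Longrightarrow> det (P \<xi> s) = 1" "\<And>\<xi>. P \<xi> s0 = mat 1"
    "\<And>\<xi> s. s \<in> S \<Longrightarrow> has_mderiv (\<lambda>s. P \<xi> s) (deform_coeff (A0 s) (A1 s) (exp s) \<xi> ** P \<xi> s) s"
    "\<And>X s. system_solution (A0 s0) (A1 s0) (exp s0) X \<Longrightarrow> s \<in> S \<Longrightarrow>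
        system_solution (A0 s) (A1 s) (exp s) (\<lambda>m. P ((exp m + 1) / 2) s ** X m)"
    by (rule isomonodromic_transport[OF iso S(1,2)]) (rule that, assumption+)
  obtain n :: nat where n: "real n > 10 * H" using reals_Archimedean2 by blast
  then have n0: "real n > 0" using \<Delta>(2) by linarith
  define h where "h = H / n"
  have h: "0 < h" "h \<le> 1 / 10" using n n0 \<Delta>(2) by (auto simp: h_def field_simps)
  define st where "st j = s0 + of_nat j * (of_real h * Complex a \<kappa>)" for j :: nat
  have stS: "st j \<in> S" if "j \<le> n" for j
  proof -
    have "st j = (1 - real j / n) *\<^sub>R s0 + (real j / n) *\<^sub>R (s0 + \<Delta>)"
      unfolding st_def h_def \<Delta>(1) scaleR_conv_of_real using n0 by (simp add: field_simps)
    moreover have "0 \<le> real j / n" "real j / n \<le> 1" using that n0 by auto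
    ultimately show ?thesis using S convexD_alt[of S s0 "s0 + \<Delta>" "real j / n"] by simp
  qed
  have stSuc: "st (Suc j) = st j + of_real h * Complex a \<kappa>" for j by (simp add: st_def algebra_simps)
  have main: "canonX \<theta> (A0 (st j)) (A1 (st j)) (exp (st j)) (pi / 2 + of_int k * pi - Im (st j))
       (\<lambda>m. P ((exp m + 1) / 2) (st j) ** X m)"
    if X: "canonX \<theta> (A0 s0) (A1 s0) (exp s0) (pi / 2 + of_int k * pi - Im s0) X" and "j \<le> n" for k X j
    using that(2)
  proof (induction j)
    case 0
    then show ?case using X by (simp add: st_def P(3))
  next
    case (Suc j)
    have ss: "system_solution (A0 s0) (A1 s0) (exp s0) X" using X by (simp add: canonX_def)
    have "canonX \<theta> (A0 (st j + of_real h * Complex a \<kappa>)) (A1 (st j + of_real h * Complex a \<kappa>)) (exp (st j + of_real h * Complex a \<kappa>))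
       (pi / 2 + of_int k * pi - Im (st j) - \<kappa> * h) (\<lambda>m. P ((exp m + 1) / 2) (st j + of_real h * Complex a \<kappa>) ** X m)"
    proof (rule canonX_step[OF iso _ _ _ refl h \<Delta>(3,4) refl])
      fix m s :: complex assume "s \<in> S"
      from has_mderiv_mult[OF P(4)[OF this, of "(exp m + 1) / 2"] has_mderiv_const[of "X m"]]
      show "has_mderiv (\<lambda>s. P ((exp m + 1) / 2) s ** X m) (deform_coeff (A0 s) (A1 s) (exp s) ((exp m + 1) / 2) ** (P ((exp m + 1) / 2) s ** X m)) s"
        by (simp add: matrix_mul_assoc)
    next
      show "system_solution (A0 (st j + of_real h * Complex a \<kappa>)) (A1 (st j + of_real h * Complex a \<kappa>)) (exp (st j + of_real h * Complex a \<kappa>)) (\<lambda>m. P ((exp m + 1) / 2) (st j + of_real h * Complex a \<kappa>) ** X m)"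
        unfolding stSuc[symmetric] by (rule P(5)[OF ss stS[OF Suc.prems]])
      show "closed_segment (st j) (st j + of_real h * Complex a \<kappa>) \<subseteq> S"
        unfolding stSuc[symmetric] using stS Suc.prems S(1) by (intro closed_segment_subset) auto
      show "canonX \<theta> (A0 (st j)) (A1 (st j)) (exp (st j)) (pi / 2 + of_int k * pi - Im (st j)) (\<lambda>m. P ((exp m + 1) / 2) (st j) ** X m)"
        using Suc by simp
    qed
    moreover have "pi / 2 + of_int k * pi - Im (st j) - \<kappa> * h = pi / 2 + of_int k * pi - Im (st (Suc j))"
      by (simp add: stSuc)
    ultimately show ?case unfolding stSuc by simp
  qed
  have stn: "st n = s0 + \<Delta>" using n0 by (simp add: st_def h_def \<Delta>(1))
  show thesis
    by (rule that[of "\<lambda>\<xi>. P \<xi> (s0 + \<Delta>)"]) (use P(1,2) S(3) main[of _ _ n] in \<open>auto simp: stn\<close>)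
qed

section \<open>Regular points and paths through them\<close>

lemma regular_cosparse:
  assumes "PV_system \<theta>0 \<theta>1 \<theta>inf w zf uf"
  shows "eventually (regular_point w zf uf) (cosparse UNIV)"
proof -
  have nm: "w nicely_meromorphic_on UNIV" "zf nicely_meromorphic_on UNIV" "uf nicely_meromorphic_on UNIV"
    and nz: "\<exists>s. w s \<noteq> 0" "\<exists>s. uf s \<noteq> 0"
    using assms by (auto simp: PV_system_def)
  have an: "eventually (\<lambda>z. f analytic_on {z}) (cosparse UNIV)" if "f nicely_meromorphic_on UNIV" for f
    using that by (intro meromorphic_on_imp_analytic_cosparse) (auto simp: nicely_meromorphic_on_def)
  have av: "eventually (\<lambda>z. f z \<noteq> 0) (cosparse UNIV)" if "f nicely_meromorphic_on UNIV" "\<exists>s. f s \<noteq> 0" for f :: "complex \<Rightarrow> complex"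
    using nicely_meromorphic_imp_constant_or_avoid[OF that(1), of 0] that(2) by auto
  show ?thesis
    using an[OF nm(1)] an[OF nm(2)] an[OF nm(3)] av[OF nm(1) nz(1)] av[OF nm(3) nz(2)]
    by eventually_elim (simp add: regular_point_def)
qed

lemma regular_open:
  "PV_system \<theta>0 \<theta>1 \<theta>inf w zf uf \<Longrightarrow> open {s. regular_point w zf uf s}"
  "PV_system \<theta>0 \<theta>1 \<theta>inf w zf uf \<Longrightarrow> countable {s. \<not> regular_point w zf uf s}"
proof -
  assume pv: "PV_system \<theta>0 \<theta>1 \<theta>inf w zf uf"
  have sp: "{s. \<not> regular_point w zf uf s} sparse_in UNIV"
    using regular_cosparse[OF pv] by (simp only: eventually_cosparse)
  then have "open (UNIV - {s. \<not> regular_point w zf uf s})" by (intro open_diff_sparse_pts) auto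
  then show "open {s. regular_point w zf uf s}" by (simp add: Diff_eq Collect_neg_eq[symmetric])
  show "countable {s. \<not> regular_point w zf uf s}"
    using sparse_imp_countable[OF open_UNIV sp] by simp
qed

text \<open>Each point of a countable set is met by at most one of the segments that end at \<open>p\<close> and
  start on a given horizontal line.\<close>
lemma segment_avoiding_countable:
  fixes p :: complex and \<kappa> :: real
  assumes "countable B" "p \<notin> B" "\<kappa> = 1 \<or> \<kappa> = -1"
  obtains t where "0 < t" "t < pi / 10" "closed_segment (p - \<i> * of_real (\<kappa> * pi) + of_real t) p \<inter> B = {}"
proof -
  \<comment> \<open>\<open>f b\<close> is the value of t for which the segment would pass through
    \<open>b\<close>. The bound pi/10 gives the tilt t / pi \<le> 1/10 that the steps of the
    deformation allow.\<close>
  define f where "f b = - \<kappa> * pi * Re (b - p) / Im (b - p)" for b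
  have "uncountable {0<..<pi / 10}" by (simp add: uncountable_open_interval)
  moreover have "countable (f ` B)" using assms(1) by simp
  ultimately have "\<exists>t\<in>{0<..<pi / 10}. t \<notin> f ` B" by (meson countable_subset subsetI)
  then obtain t where t: "0 < t" "t < pi / 10" "t \<notin> f ` B" by auto
  have "b \<notin> closed_segment (p - \<i> * of_real (\<kappa> * pi) + of_real t) p" if b: "b \<in> B" for b
  proof
    assume "b \<in> closed_segment (p - \<i> * of_real (\<kappa> * pi) + of_real t) p"
    then obtain u where u: "b = (1 - u) *\<^sub>R (p - \<i> * of_real (\<kappa> * pi) + of_real t) + u *\<^sub>R p"
      unfolding closed_segment_def by auto
    then have e: "b - p = of_real (1 - u) * (of_real t - \<i> * of_real (\<kappa> * pi))"
      by (simp add: scaleR_conv_of_real algebra_simps)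
    have u1: "1 - u \<noteq> 0" using e b assms(2) by (metis eq_iff_diff_eq_0 mult_zero_left of_real_0)
    have "Re (b - p) = (1 - u) * t" "Im (b - p) = - ((1 - u) * (\<kappa> * pi))" unfolding e by simp_all
    then have "f b = t" unfolding f_def using u1 assms(3) by auto
    then show False using t(3) b by blast
  qed
  then show thesis using that[OF t(1,2)] by blast
qed

text \<open>The union of equal balls about the points of the segment is the Minkowski sum of two
  convex sets. Convexity is what the deformation along straight lines from a base point
  uses.\<close>

lemma convex_neighbourhood_of_segment:
  fixes p q :: complex
  assumes "open T" "closed_segment p q \<subseteq> T"
  obtains S where "open S" "convex S" "p \<in> S" "q \<in> S" "S \<subseteq> T"
proof -
  obtain e where e: "e > 0" "(\<Union>x\<in>closed_segment p q. ball x e) \<subseteq> T"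
    using compact_subset_open_imp_ball_epsilon_subset[OF compact_segment assms] by blast
  let ?S = "\<Union>x\<in>closed_segment p q. ball x e"
  have eq: "?S = (\<Union>x\<in>closed_segment p q. \<Union>y\<in>ball 0 e. {x + y})"
  proof (intro set_eqI iffI)
    fix z assume "z \<in> ?S"
    then obtain x where x: "x \<in> closed_segment p q" "z \<in> ball x e" by blast
    then have "z - x \<in> ball 0 e" by (simp add: dist_norm norm_minus_commute)
    moreover have "z = x + (z - x)" by simp
    ultimately show "z \<in> (\<Union>x\<in>closed_segment p q. \<Union>y\<in>ball 0 e. {x + y})"
      using x(1) by (intro UN_I[of x] UN_I[of "z - x"]) auto
  next
    fix z assume "z \<in> (\<Union>x\<in>closed_segment p q. \<Union>y\<in>ball 0 e. {x + y})"
    then obtain x y where "x \<in> closed_segment p q" "z = x + y" "norm y < e" by auto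
    then show "z \<in> ?S" by (intro UN_I[of x]) (auto simp: dist_norm)
  qed
  have "convex ?S" unfolding eq by (intro convex_sums convex_closed_segment convex_ball)
  moreover have "p \<in> ?S" "q \<in> ?S" using e(1) by (intro UN_I[of p] UN_I[of q]; simp)+
  ultimately show thesis using e(2) by (intro that[of ?S]) auto
qed

text \<open>The three equations of the system are the Schlesinger equations written in the
  coordinates (y, z, u) of the residues; the third one accounts for the off-diagonal normalisation
  of \<open>G\<close>.\<close>

lemma PV_residues_isomonodromic:
  assumes sys: "PV_system \<theta>0 \<theta>1 \<theta>inf w zf uf" and S: "open S" "\<And>s. s \<in> S \<Longrightarrow> regular_point w zf uf s"
  shows "isomonodromic \<theta>inf (\<lambda>s. residue0 \<theta>0 (zf s) (uf s)) (\<lambda>s. residue1 \<theta>0 \<theta>1 \<theta>inf (w s) (zf s) (uf s)) S"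
  unfolding isomonodromic_def Let_def
proof (intro conjI ballI S(1))
  fix s assume "s \<in> S"
  then have reg: "regular_point w zf uf s" by (rule S(2))
  define k1 where "k1 = (\<theta>0 - \<theta>1 + \<theta>inf) / 2"
  define k2 where "k2 = (\<theta>0 + \<theta>1 + \<theta>inf) / 2"
  define k3 where "k3 = (3 * \<theta>0 + \<theta>1 + \<theta>inf) / 2"
  define y where "y = w s" define z where "z = zf s" define u where "u = uf s"
  define x where "x = exp s"
  define y' where "y' = deriv w s" define z' where "z' = deriv zf s" define u' where "u' = deriv uf s"
  have yu: "y \<noteq> 0" "u \<noteq> 0" using reg by (auto simp: regular_point_def y_def u_def)
  \<comment> \<open>The reciprocals become separate unknowns tied by y t = 1 and u v = 1. The matrix
    identities are then consequences of polynomial relations, within reach of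
    \<open>algebra\<close>.\<close>
  define t where "t = 1 / y" define v where "v = 1 / u"
  have tv: "y * t = 1" "u * v = 1" using yu by (auto simp: t_def v_def)
  have dd: "(w has_field_derivative y') (at s)" "(zf has_field_derivative z') (at s)" "(uf has_field_derivative u') (at s)"
    using reg unfolding regular_point_def y'_def z'_def u'_def
    by (auto intro!: DERIV_deriv_iff_field_differentiable[THEN iffD2] analytic_on_imp_differentiable_at)
  have xd: "exp s * xderiv f s = deriv f s" for f by (simp add: xderiv_def)
  have eqs: "y' = x * y - 2 * z * (y - 1)\<^sup>2 - (y - 1) * (k1 * y - k3)"
    "z' = y * z * (z + k1) - t * (z + \<theta>0) * (z + k2)"
    "u' = u * (- 2 * z - \<theta>0 + y * (z + k1) + t * (z + k2))"
  proof -
    have "exp s * xderiv w s = x * y - 2 * z * (y - 1)\<^sup>2 - (y - 1) * (k1 * y - k3) \<and>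
      exp s * xderiv zf s = y * z * (z + k1) - 1 / y * (z + \<theta>0) * (z + k2) \<and>
      exp s * (xderiv uf s / u) = - 2 * z - \<theta>0 + y * (z + k1) + 1 / y * (z + k2)"
      using sys reg unfolding PV_system_def Let_def x_def y_def z_def u_def k1_def k2_def k3_def by blast
    moreover have "exp s * (xderiv uf s / u) = u' / u" by (simp add: xderiv_def u'_def)
    ultimately show "y' = x * y - 2 * z * (y - 1)\<^sup>2 - (y - 1) * (k1 * y - k3)"
      "z' = y * z * (z + k1) - t * (z + \<theta>0) * (z + k2)"
      "u' = u * (- 2 * z - \<theta>0 + y * (z + k1) + t * (z + k2))"
      using yu by (simp_all add: xd y'_def z'_def t_def field_simps)
  qed
  let ?A0 = "residue0 \<theta>0 z u" and ?A1 = "residue1 \<theta>0 \<theta>1 \<theta>inf y z u"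
  have A0: "?A0 $ 1 $ 1 = z + \<theta>0 / 2" "?A0 $ 1 $ 2 = - u * (z + \<theta>0)" "?A0 $ 2 $ 1 = z * v" "?A0 $ 2 $ 2 = - z - \<theta>0 / 2"
    by (simp_all add: residue0_def v_def)
  have A1: "?A1 $ 1 $ 1 = - z - (\<theta>0 + \<theta>inf) / 2" "?A1 $ 1 $ 2 = u * y * (z + k1)" "?A1 $ 2 $ 1 = - (v * t) * (z + k2)" "?A1 $ 2 $ 2 = z + (\<theta>0 + \<theta>inf) / 2"
    by (simp_all add: residue1_def v_def t_def k1_def k2_def field_simps)
  have kk: "k2 + k1 = \<theta>0 + \<theta>inf" "k2 - k1 = \<theta>1" "k3 = k2 + \<theta>0" by (simp_all add: k1_def k2_def k3_def field_simps)
  show "trace (residue0 \<theta>0 (zf s) (uf s)) = 0" "trace (residue1 \<theta>0 \<theta>1 \<theta>inf (w s) (zf s) (uf s)) = 0"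
    by (simp_all add: trace_2 residue0_def residue1_def)
  show "residue0 \<theta>0 (zf s) (uf s) $ 1 $ 1 + residue1 \<theta>0 \<theta>1 \<theta>inf (w s) (zf s) (uf s) $ 1 $ 1 = - (\<theta>inf / 2)"
    by (simp add: residue0_def residue1_def field_simps)
  define v' where "v' = - u' * v * v"
  define t' where "t' = - y' * t * t"
  have dv: "((\<lambda>s. 1 / uf s) has_field_derivative v') (at s)"
    using yu by (auto intro!: derivative_eq_intros dd simp: v'_def u_def[symmetric] v_def power2_eq_square)
  have dt: "((\<lambda>s. 1 / (uf s * w s)) has_field_derivative v' * t + v * t') (at s)"
  proof -
    have "((\<lambda>s. 1 / w s) has_field_derivative t') (at s)"
      using yu by (auto intro!: derivative_eq_intros dd simp: t'_def y_def[symmetric] t_def power2_eq_square)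
    from DERIV_mult[OF dv this] show ?thesis by (simp add: v_def t_def u_def y_def add.commute mult.commute)
  qed
  have d0: "has_mderiv (\<lambda>s. residue0 \<theta>0 (zf s) (uf s)) (mat2 z' (- u' * (z + \<theta>0) - u * z') (z' * v + z * v') (- z')) s"
    unfolding has_mderiv_def all_2_iff residue0_def mat2_nth
  proof (intro conjI)
    show "((\<lambda>s. zf s / uf s) has_field_derivative z' * v + z * v') (at s)"
      using DERIV_mult[OF dd(2) dv] by (simp add: z_def v_def u_def algebra_simps)
  qed (auto intro!: derivative_eq_intros dd simp: z_def u_def algebra_simps)
  have d1: "has_mderiv (\<lambda>s. residue1 \<theta>0 \<theta>1 \<theta>inf (w s) (zf s) (uf s))
     (mat2 (- z') (u' * y * (z + k1) + u * y' * (z + k1) + u * y * z') (- (v' * t + v * t') * (z + k2) - v * t * z') z') s"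
    unfolding has_mderiv_def all_2_iff residue1_def mat2_nth k1_def[symmetric] k2_def[symmetric]
  proof (intro conjI)
    have vt: "1 / (uf s * w s) = v * t" by (simp add: v_def t_def u_def y_def)
    show "((\<lambda>s. - (1 / (uf s * w s)) * (zf s + k2)) has_field_derivative - (v' * t + v * t') * (z + k2) - v * t * z') (at s)"
      by (rule DERIV_cong[OF DERIV_mult[OF DERIV_minus[OF dt] DERIV_add[OF dd(2) DERIV_const[of k2]]]])
         (simp only: vt z_def[symmetric], simp add: algebra_simps)
  qed (auto intro!: derivative_eq_intros dd simp: z_def u_def y_def algebra_simps)
  let ?G = "offdiag (?A0 + ?A1)" and ?C = "scale_mat (exp s / 2) sigma3"
  have "mat2 z' (- u' * (z + \<theta>0) - u * z') (z' * v + z * v') (- z') = ?G ** ?A0 - ?A0 ** ?G"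
    unfolding cmat_eq_iff mat2_nth vector_minus_component mmult_nth offdiag_nth vector_add_component A0 A1 v'_def eqs
    using tv kk by algebra
  with d0 show "has_mderiv (\<lambda>s. residue0 \<theta>0 (zf s) (uf s))
     (offdiag (residue0 \<theta>0 (zf s) (uf s) + residue1 \<theta>0 \<theta>1 \<theta>inf (w s) (zf s) (uf s)) ** residue0 \<theta>0 (zf s) (uf s) -
      residue0 \<theta>0 (zf s) (uf s) ** offdiag (residue0 \<theta>0 (zf s) (uf s) + residue1 \<theta>0 \<theta>1 \<theta>inf (w s) (zf s) (uf s))) s"
    by (simp add: z_def u_def y_def)
  have "mat2 (- z') (u' * y * (z + k1) + u * y' * (z + k1) + u * y * z') (- (v' * t + v * t') * (z + k2) - v * t * z') z'
      = (?G + ?C) ** ?A1 - ?A1 ** (?G + ?C)"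
    unfolding cmat_eq_iff mat2_nth vector_minus_component mmult_nth offdiag_nth vector_add_component A0 A1 scale_mat_nth sigma3_nth x_def[symmetric] v'_def t'_def eqs
    using tv kk by algebra
  with d1 show "has_mderiv (\<lambda>s. residue1 \<theta>0 \<theta>1 \<theta>inf (w s) (zf s) (uf s))
     ((offdiag (residue0 \<theta>0 (zf s) (uf s) + residue1 \<theta>0 \<theta>1 \<theta>inf (w s) (zf s) (uf s)) + ?C) ** residue1 \<theta>0 \<theta>1 \<theta>inf (w s) (zf s) (uf s) -
      residue1 \<theta>0 \<theta>1 \<theta>inf (w s) (zf s) (uf s) ** (offdiag (residue0 \<theta>0 (zf s) (uf s) + residue1 \<theta>0 \<theta>1 \<theta>inf (w s) (zf s) (uf s)) + ?C)) s"
    by (simp add: z_def u_def y_def)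
qed

section \<open>Stokes matrices and monodromy data\<close>

lemma exp_sigma3_mult: "exp_sigma3 a ** exp_sigma3 b = exp_sigma3 (a + b)"
  by (simp add: cmat_eq_iff mmult_nth mult_exp_exp)

lemma exp_sigma3_0 [simp]: "exp_sigma3 0 = mat 1"
  by (simp add: cmat_eq_iff)

lemma exp_sigma3_cancel [simp]: "exp_sigma3 a ** (exp_sigma3 (- a) ** M) = M" "exp_sigma3 (- a) ** (exp_sigma3 a ** M) = M"
  by (simp_all add: matrix_mul_assoc exp_sigma3_mult)

lemma adj2_cancel:
  "det M = 1 \<Longrightarrow> adj2 M ** M = mat 1" "det M = 1 \<Longrightarrow> M ** adj2 M = mat 1"
  "det M = 1 \<Longrightarrow> adj2 M ** (M ** N) = N" "det M = 1 \<Longrightarrow> M ** (adj2 M ** N) = N"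
  by (simp_all add: matrix_mul_assoc adj2_left adj2_right)

lemma has_mderiv_lmult: "has_mderiv F D z \<Longrightarrow> has_mderiv (\<lambda>v. M ** F v) (M ** D) z"
  using has_mderiv_mult[OF has_mderiv_const[of M]] by simp

lemma has_mderiv_rmult: "has_mderiv F D z \<Longrightarrow> has_mderiv (\<lambda>v. F v ** M) (D ** M) z"
  using has_mderiv_mult[OF _ has_mderiv_const[of M]] by simp

lemma has_mderiv_shift: "has_mderiv F D (z + c) \<Longrightarrow> has_mderiv (\<lambda>v. F (v + c)) D z"
proof -
  assume "has_mderiv F D (z + c)"
  then have "has_mderiv (\<lambda>v. F (v + c)) (scale_mat 1 D) z"
    by (rule has_mderiv_chain) (auto intro!: derivative_eq_intros)
  moreover have "scale_mat 1 D = D" by (simp add: cmat_eq_iff)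
  ultimately show ?thesis by simp
qed

lemma norm_entry_le: "norm ((M::cmat) $ i $ j) \<le> norm M"
  by (meson Finite_Cartesian_Product.norm_nth_le order_trans)

lemma norm_le_entries: "norm (M::cmat) \<le> norm (M$1$1) + norm (M$1$2) + norm (M$2$1) + norm (M$2$2)"
proof -
  have "norm M \<le> norm (M$1) + norm (M$2)"
    unfolding norm_vec_def[of M] using L2_set_le_sum[of UNIV "\<lambda>i. norm (M $ i)"] by (simp add: sum_2)
  moreover have "norm (M$i) \<le> norm (M$i$1) + norm (M$i$2)" for i
    unfolding norm_vec_def[of "M$i"] using L2_set_le_sum[of UNIV "\<lambda>j. norm (M $ i $ j)"] by (simp add: sum_2)
  ultimately show ?thesis by (smt (verit))
qed

text \<open>With \<phi> = Im s one has \<lambda> = e^(i \<phi>) \<eta>, so \<lambda> d/d\<lambda>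
  equals \<eta> d/d\<eta>, and the remaining 1/2 is d\<xi>/d\<eta>. Only a constant diagonal
  conjugation separates the two systems.\<close>

lemma lambda_coeff_eta:
  "scale_mat (exp (m + \<i> * of_real (Im s))) (lambda_coeff \<theta>0 \<theta>1 \<theta> s y z u (exp (m + \<i> * of_real (Im s)))) =
     exp_sigma3 (- varpi \<theta> s) ** (scale_mat (exp m) (eta_coeff (residue0 \<theta>0 z u) (residue1 \<theta>0 \<theta>1 \<theta> y z u) (exp s) (exp m))
       ** exp_sigma3 (varpi \<theta> s))"
proof -
  have 1: "cis (- Im s) * exp (m + \<i> * of_real (Im s)) = exp m"
    by (simp add: cis_conv_exp mult_exp_exp)
  have 2: "scale_mat (1 / 2) (xi_coeff \<theta>0 \<theta>1 \<theta> (exp s) y z u ((\<eta> + 1) / 2)) =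
     eta_coeff (residue0 \<theta>0 z u) (residue1 \<theta>0 \<theta>1 \<theta> y z u) (exp s) \<eta>" for \<eta>
  proof -
    have "(\<eta> + 1) / 2 - 1 = (\<eta> - 1) / 2" by (simp add: field_simps)
    then show ?thesis by (simp add: xi_coeff_def eta_coeff_def cmat_eq_iff algebra_simps)
  qed
  have "scale_mat (exp (m + \<i> * of_real (Im s))) (lambda_coeff \<theta>0 \<theta>1 \<theta> s y z u (exp (m + \<i> * of_real (Im s)))) =
     scale_mat (exp (m + \<i> * of_real (Im s)) * cis (- Im s) / 2) (exp_sigma3 (- varpi \<theta> s)
        ** xi_coeff \<theta>0 \<theta>1 \<theta> (exp s) y z u ((exp m + 1) / 2) ** exp_sigma3 (varpi \<theta> s))"
    unfolding lambda_coeff_def 1 by (simp add: cmat_eq_iff)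
  also have "exp (m + \<i> * of_real (Im s)) * cis (- Im s) / 2 = exp m * (1 / 2)" using 1 by (simp add: mult.commute)
  also have "scale_mat (exp m * (1 / 2)) M = scale_mat (exp m) (scale_mat (1 / 2) M)" for M by (simp add: cmat_eq_iff)
  finally show ?thesis unfolding 2[symmetric] by (simp add: scale_mat_mult matrix_mul_assoc)
qed

text \<open>The constant factor exp (\<varpi> \<sigma>_3) on the left leaves the diagonal entries
  normalised after the change of exponent and multiplies the off-diagonal ones by constants, which
  an O(1/\<lambda>) estimate absorbs.\<close>

lemma canonical_iff_canonX:
  "canonical_solution \<theta>0 \<theta>1 \<theta> s y z u k Y \<longleftrightarrow>
     canonX \<theta> (residue0 \<theta>0 z u) (residue1 \<theta>0 \<theta>1 \<theta> y z u) (exp s) (pi / 2 + of_int (k - 2) * pi - Im s)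
       (\<lambda>m. exp_sigma3 (varpi \<theta> s) ** Y (m + \<i> * of_real (Im s)))"
proof -
  define f where "f = \<i> * of_real (Im s)"
  define p where "p = varpi \<theta> s"
  define L where "L l = lambda_coeff \<theta>0 \<theta>1 \<theta> s y z u (exp l)" for l
  define N where "N m = scale_mat (exp m) (eta_coeff (residue0 \<theta>0 z u) (residue1 \<theta>0 \<theta>1 \<theta> y z u) (exp s) (exp m))" for m
  have LN: "scale_mat (exp (m + f)) (L (m + f)) = exp_sigma3 (- p) ** (N m ** exp_sigma3 p)" for m
    using lambda_coeff_eta unfolding L_def N_def f_def p_def .
  have LN': "N m ** exp_sigma3 p = exp_sigma3 p ** scale_mat (exp (m + f)) (L (m + f))" for m
    unfolding LN by simp
  have Ref: "Re (m + f) = Re m" "Im (m + f) = Im m + Im s" for m by (simp_all add: f_def)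
  have ode: "(\<forall>l i j. Re l > 0 \<longrightarrow> ((\<lambda>v. Y v $ i $ j) has_field_derivative exp l * (L l ** Y l) $ i $ j) (at l)) \<longleftrightarrow>
     (\<forall>m. Re m > 0 \<longrightarrow> has_mderiv (\<lambda>m. exp_sigma3 p ** Y (m + f)) (N m ** (exp_sigma3 p ** Y (m + f))) m)"
    (is "?L \<longleftrightarrow> ?R")
  proof -
    have "?L \<longleftrightarrow> (\<forall>l. Re l > 0 \<longrightarrow> has_mderiv Y (scale_mat (exp l) (L l) ** Y l) l)"
      by (auto simp: has_mderiv_def scale_mat_mult)
    also have "\<dots> \<longleftrightarrow> (\<forall>m. Re m > 0 \<longrightarrow> has_mderiv Y (scale_mat (exp (m + f)) (L (m + f)) ** Y (m + f)) (m + f))"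
      by (metis Ref(1) diff_add_cancel)
    also have "\<dots> \<longleftrightarrow> ?R"
    proof (intro all_cong1 imp_cong refl iffI)
      fix m assume "has_mderiv Y (scale_mat (exp (m + f)) (L (m + f)) ** Y (m + f)) (m + f)"
      from has_mderiv_lmult[OF has_mderiv_shift[OF this], of "exp_sigma3 p"]
      show "has_mderiv (\<lambda>m. exp_sigma3 p ** Y (m + f)) (N m ** (exp_sigma3 p ** Y (m + f))) m"
        by (simp add: matrix_mul_assoc LN'[symmetric])
    next
      fix m assume "has_mderiv (\<lambda>m. exp_sigma3 p ** Y (m + f)) (N m ** (exp_sigma3 p ** Y (m + f))) m"
      then have "has_mderiv (\<lambda>m. exp_sigma3 p ** Y (m + f)) (N m ** (exp_sigma3 p ** Y (m + f))) (m + f + (- f))" by simp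
      from has_mderiv_lmult[OF has_mderiv_shift[OF this], of "exp_sigma3 (- p)"]
      show "has_mderiv Y (scale_mat (exp (m + f)) (L (m + f)) ** Y (m + f)) (m + f)"
        by (simp add: LN matrix_mul_assoc[symmetric])
    qed
    finally show ?thesis .
  qed
  define c where "c = pi / 2 + of_int (k - 2) * pi - Im s"
  define W where "W m = Y (m + f) ** exp_sigma3 (- ((of_real (exp (Re s)) * exp (m + f) - 2 * \<theta> * (m + f)) / 4))" for m
  \<comment> \<open>The gap between the exponents is \<open>varpi\<close>: x/4 stems from \<xi> =
    (\<eta> + 1)/2, and \<theta>/2 (i \<phi> + ln 2) from ln \<lambda> = ln \<eta> + i \<phi> and
    from the ln 2 in \<open>qexp\<close>.\<close>
  have q: "(of_real (exp (Re s)) * exp (m + f) - 2 * \<theta> * (m + f)) / 4 = qexp \<theta> (exp s) m - p" for m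
  proof -
    have "of_real (exp (Re s)) * exp (m + f) = exp s * exp m"
      unfolding exp_add f_def by (subst exp_eq_polar[of s]) (simp add: cis_conv_exp)
    then show ?thesis by (simp add: qexp_def p_def varpi_def f_def field_simps)
  qed
  let ?X = "\<lambda>m. exp_sigma3 p ** Y (m + f)"
  let ?q = "qexp \<theta> (exp s)"
  have ent: "?X m $ 1 $ 1 * exp (- ?q m) = W m $ 1 $ 1" "?X m $ 2 $ 1 * exp (- ?q m) = exp (- 2 * p) * W m $ 2 $ 1"
    "?X m $ 2 $ 2 * exp (?q m) = W m $ 2 $ 2" "?X m $ 1 $ 2 * exp (?q m) = exp (2 * p) * W m $ 1 $ 2" for m
  proof -
    have e: "exp a * exp (b - a) = exp b" for a b :: complex by (simp add: exp_add[symmetric])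
    show "?X m $ 1 $ 1 * exp (- ?q m) = W m $ 1 $ 1" "?X m $ 2 $ 1 * exp (- ?q m) = exp (- 2 * p) * W m $ 2 $ 1"
      "?X m $ 2 $ 2 * exp (?q m) = W m $ 2 $ 2" "?X m $ 1 $ 2 * exp (?q m) = exp (2 * p) * W m $ 1 $ 2"
      unfolding W_def q by (simp_all add: mmult_nth exp_diff exp_minus field_simps exp_add[symmetric] mult_exp_exp exp_double power2_eq_square)
  qed
  define I where "I \<delta> = {c - (pi - \<delta>)..c + (pi - \<delta>)}" for \<delta>
  have sec: "\<bar>Im (m + f) - pi / 2 - of_int (k - 2) * pi\<bar> \<le> pi - \<delta> \<longleftrightarrow> Im m \<in> I \<delta>" for m \<delta>
    unfolding Ref I_def c_def by (auto simp: abs_le_iff)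
  have asy: "(\<exists>C R. \<forall>l. Re l > R \<and> Re l > 0 \<and> \<bar>Im l - pi / 2 - of_int (k - 2) * pi\<bar> \<le> pi - \<delta> \<longrightarrow>
        norm (Y l ** exp_sigma3 (- ((of_real (exp (Re s)) * exp l - 2 * \<theta> * l) / 4)) - mat 1) \<le> C * exp (- Re l)) \<longleftrightarrow>
     col_asym \<theta> (exp s) ?X (I \<delta>) \<and> col_asym (- \<theta>) (- exp s) (\<lambda>m. conj_sigma1 (?X m)) (I \<delta>)" (is "?L \<longleftrightarrow> ?R") for \<delta>
  proof -
    have "?L \<longleftrightarrow> (\<exists>C R. \<forall>m. Re m > R \<and> Re m > 0 \<and> Im m \<in> I \<delta> \<longrightarrow> norm (W m - mat 1) \<le> C * exp (- Re m))" (is "_ \<longleftrightarrow> ?M")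
      unfolding W_def sec[symmetric] by (metis (no_types, lifting) Ref(1) diff_add_cancel)
    also have "?M \<longleftrightarrow> ?R"
    proof
      assume ?M
      then obtain C R where CR: "\<And>m. Re m > R \<and> Re m > 0 \<and> Im m \<in> I \<delta> \<Longrightarrow> norm (W m - mat 1) \<le> C * exp (- Re m)" by blast
      define D where "D = C * (1 + norm (exp (- 2 * p)) + norm (exp (2 * p)))"
      have b: "norm ((W m - mat 1) $ i $ j) \<le> C * exp (- Re m)" if "Re m > R \<and> Re m > 0 \<and> Im m \<in> I \<delta>" for m i j
        using CR[OF that] norm_entry_le[of "W m - mat 1" i j] by linarith
      have D: "a * (C * exp (- Re m)) \<le> D * exp (- Re m)" if "0 \<le> a" "a \<le> 1 + norm (exp (- 2 * p)) + norm (exp (2 * p))"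
         "Re m > R \<and> Re m > 0 \<and> Im m \<in> I \<delta>" for a m
      proof -
        have "0 \<le> C * exp (- Re m)" using CR[OF that(3)] norm_ge_zero order_trans by blast
        then have "a * (C * exp (- Re m)) \<le> (1 + norm (exp (- 2 * p)) + norm (exp (2 * p))) * (C * exp (- Re m))"
          using that by (intro mult_right_mono) auto
        then show ?thesis by (simp add: D_def mult_ac)
      qed
      have "norm (W m $ 1 $ 1 - 1) \<le> D * exp (- Re m) \<and> norm (exp (- 2 * p) * W m $ 2 $ 1) \<le> D * exp (- Re m)
         \<and> norm (W m $ 2 $ 2 - 1) \<le> D * exp (- Re m) \<and> norm (exp (2 * p) * W m $ 1 $ 2) \<le> D * exp (- Re m)"
        if m: "Re m > R \<and> Re m > 0 \<and> Im m \<in> I \<delta>" for m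
      proof -
        have "norm (exp (- 2 * p) * W m $ 2 $ 1) \<le> norm (exp (- 2 * p)) * (C * exp (- Re m))"
          "norm (exp (2 * p) * W m $ 1 $ 2) \<le> norm (exp (2 * p)) * (C * exp (- Re m))"
          unfolding norm_mult using b[OF m, of 2 1] b[OF m, of 1 2] by (auto intro!: mult_left_mono)
        moreover have "norm (exp (- 2 * p)) * (C * exp (- Re m)) \<le> D * exp (- Re m)" "norm (exp (2 * p)) * (C * exp (- Re m)) \<le> D * exp (- Re m)"
          "1 * (C * exp (- Re m)) \<le> D * exp (- Re m)"
          by (rule D[OF _ _ m]; simp)+
        moreover have "norm (W m $ 1 $ 1 - 1) \<le> 1 * (C * exp (- Re m))" "norm (W m $ 2 $ 2 - 1) \<le> 1 * (C * exp (- Re m))"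
          using b[OF m, of 1 1] b[OF m, of 2 2] by simp_all
        ultimately show ?thesis by (intro conjI; meson order_trans)
      qed
      then show ?R unfolding col_asym_def ent conj_sigma1_nth qexp_minus minus_minus by blast
    next
      assume ?R
      then obtain C R C' R' where 1: "\<And>m. Re m > R \<and> Re m > 0 \<and> Im m \<in> I \<delta> \<Longrightarrow>
           norm (W m $ 1 $ 1 - 1) \<le> C * exp (- Re m) \<and> norm (exp (- 2 * p) * W m $ 2 $ 1) \<le> C * exp (- Re m)"
        and 2: "\<And>m. Re m > R' \<and> Re m > 0 \<and> Im m \<in> I \<delta> \<Longrightarrow>
           norm (W m $ 2 $ 2 - 1) \<le> C' * exp (- Re m) \<and> norm (exp (2 * p) * W m $ 1 $ 2) \<le> C' * exp (- Re m)"
        unfolding col_asym_def ent conj_sigma1_nth qexp_minus minus_minus by blast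
      define D where "D = C + C' * norm (exp (- 2 * p)) + C * norm (exp (2 * p)) + C'"
      have "norm (W m - mat 1) \<le> D * exp (- Re m)" if m: "Re m > max R R' \<and> Re m > 0 \<and> Im m \<in> I \<delta>" for m
      proof -
        have A: "norm (W m $ 1 $ 1 - 1) \<le> C * exp (- Re m)" "norm (exp (- 2 * p) * W m $ 2 $ 1) \<le> C * exp (- Re m)"
          "norm (W m $ 2 $ 2 - 1) \<le> C' * exp (- Re m)" "norm (exp (2 * p) * W m $ 1 $ 2) \<le> C' * exp (- Re m)"
          using 1[of m] 2[of m] m by auto
        have i: "exp (2 * p) * (exp (- 2 * p) * w) = w" "exp (- 2 * p) * (exp (2 * p) * w) = w" for w :: complex
          by (simp_all add: mult.assoc[symmetric] mult_exp_exp)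
        have "norm (W m $ 2 $ 1) = norm (exp (2 * p)) * norm (exp (- 2 * p) * W m $ 2 $ 1)"
          unfolding norm_mult[symmetric] i ..
        also have "\<dots> \<le> norm (exp (2 * p)) * (C * exp (- Re m))" using A by (intro mult_left_mono) auto
        finally have B1: "norm (W m $ 2 $ 1) \<le> norm (exp (2 * p)) * (C * exp (- Re m))" .
        have "norm (W m $ 1 $ 2) = norm (exp (- 2 * p)) * norm (exp (2 * p) * W m $ 1 $ 2)"
          unfolding norm_mult[symmetric] i ..
        also have "\<dots> \<le> norm (exp (- 2 * p)) * (C' * exp (- Re m))" using A by (intro mult_left_mono) auto
        finally have B2: "norm (W m $ 1 $ 2) \<le> norm (exp (- 2 * p)) * (C' * exp (- Re m))" .
        have "norm (W m - mat 1) \<le> norm (W m $ 1 $ 1 - 1) + norm (W m $ 1 $ 2) + norm (W m $ 2 $ 1) + norm (W m $ 2 $ 2 - 1)"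
          using norm_le_entries[of "W m - mat 1"] by simp
        also have "\<dots> \<le> C * exp (- Re m) + norm (exp (- 2 * p)) * (C' * exp (- Re m)) + norm (exp (2 * p)) * (C * exp (- Re m)) + C' * exp (- Re m)"
          by (intro add_mono A B1 B2)
        also have "\<dots> = D * exp (- Re m)" by (simp add: D_def algebra_simps)
        finally show ?thesis .
      qed
      then show ?M by blast
    qed
    finally show ?thesis .
  qed
  show ?thesis
    unfolding canonical_solution_def canonX_def system_solution_def c_def[symmetric] I_def[symmetric]
      N_def[symmetric] f_def[symmetric] p_def[symmetric] L_def[symmetric] ode asy ..
qed

section \<open>Connection matrices, Stokes matrices and formal monodromy\<close>

lemma col_asym_tendsto:
  assumes "col_asym \<theta> x X S" "b \<in> S"
  shows "((\<lambda>r. X (Complex r b) $ 1 $ 1 * exp (- qexp \<theta> x (Complex r b))) \<longlongrightarrow> 1) at_top"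
    and "((\<lambda>r. X (Complex r b) $ 2 $ 1 * exp (- qexp \<theta> x (Complex r b))) \<longlongrightarrow> 0) at_top"
proof -
  obtain C R where CR: "\<And>m. Re m > R \<and> Re m > 0 \<and> Im m \<in> S \<Longrightarrow>
      norm (X m $ 1 $ 1 * exp (- qexp \<theta> x m) - 1) \<le> C * exp (- Re m) \<and>
      norm (X m $ 2 $ 1 * exp (- qexp \<theta> x m)) \<le> C * exp (- Re m)"
    using assms(1) unfolding col_asym_def by blast
  have lim: "((\<lambda>r. C * exp (- r)) \<longlongrightarrow> 0) at_top" by real_asymp
  have ev: "\<forall>\<^sub>F r in at_top. r > max R 0" by (rule eventually_gt_at_top)
  have "((\<lambda>r. X (Complex r b) $ 1 $ 1 * exp (- qexp \<theta> x (Complex r b)) - 1) \<longlongrightarrow> 0) at_top"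
    by (rule Lim_null_comparison[OF _ lim], rule eventually_mono[OF ev]) (use CR[of "Complex _ b"] assms(2) in auto)
  then show "((\<lambda>r. X (Complex r b) $ 1 $ 1 * exp (- qexp \<theta> x (Complex r b))) \<longlongrightarrow> 1) at_top"
    by (simp add: LIM_zero_iff)
  show "((\<lambda>r. X (Complex r b) $ 2 $ 1 * exp (- qexp \<theta> x (Complex r b))) \<longlongrightarrow> 0) at_top"
    by (rule Lim_null_comparison[OF _ lim], rule eventually_mono[OF ev]) (use CR[of "Complex _ b"] assms(2) in auto)
qed

lemma canonX_tendsto:
  assumes "canonX \<theta> A0 A1 x c X" "\<bar>b - c\<bar> < pi"
  defines "q \<equiv> \<lambda>r. qexp \<theta> x (Complex r b)"
  shows "((\<lambda>r. X (Complex r b) $ 1 $ 1 * exp (- q r)) \<longlongrightarrow> 1) at_top"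
    "((\<lambda>r. X (Complex r b) $ 2 $ 1 * exp (- q r)) \<longlongrightarrow> 0) at_top"
    "((\<lambda>r. X (Complex r b) $ 2 $ 2 * exp (q r)) \<longlongrightarrow> 1) at_top"
    "((\<lambda>r. X (Complex r b) $ 1 $ 2 * exp (q r)) \<longlongrightarrow> 0) at_top"
proof -
  define \<delta> where "\<delta> = pi - \<bar>b - c\<bar>"
  have \<delta>: "\<delta> > 0" "b \<in> {c - (pi - \<delta>)..c + (pi - \<delta>)}" using assms(2) by (auto simp: \<delta>_def)
  have 1: "col_asym \<theta> x X {c - (pi - \<delta>)..c + (pi - \<delta>)}"
    and 2: "col_asym (- \<theta>) (- x) (\<lambda>m. conj_sigma1 (X m)) {c - (pi - \<delta>)..c + (pi - \<delta>)}"
    using assms(1) \<delta>(1) by (auto simp: canonX_def)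
  show "((\<lambda>r. X (Complex r b) $ 1 $ 1 * exp (- q r)) \<longlongrightarrow> 1) at_top"
    "((\<lambda>r. X (Complex r b) $ 2 $ 1 * exp (- q r)) \<longlongrightarrow> 0) at_top"
    "((\<lambda>r. X (Complex r b) $ 2 $ 2 * exp (q r)) \<longlongrightarrow> 1) at_top"
    "((\<lambda>r. X (Complex r b) $ 1 $ 2 * exp (q r)) \<longlongrightarrow> 0) at_top"
    using col_asym_tendsto[OF 1 \<delta>(2)] col_asym_tendsto[OF 2 \<delta>(2)] by (simp_all add: q_def qexp_minus)
qed

lemma half_plane: "open {m. Re m > c}" "connected {m. Re m > c}"
  by (auto simp: open_halfspace_Re_gt convex_halfspace_Re_gt convex_connected)

text \<open>The determinant is constant by tracelessness, and the exponentials of the two columns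
  cancel in it, so its limit along the central ray is 1.\<close>

lemma canonX_det:
  assumes "canonX \<theta> A0 A1 x c X" "trace A0 = 0" "trace A1 = 0" "Re m > 0"
  shows "det (X m) = 1"
proof -
  have const: "det (X a) = det (X m)" if "Re a > 0" for a
    using lode_det_const[OF half_plane[of 0], of X "\<lambda>m. scale_mat (exp m) (eta_coeff A0 A1 x (exp m))" a m] assms that
    by (simp add: trace_eta_coeff canonX_def system_solution_def)
  have "\<bar>c - c\<bar> < pi" by simp
  note t = canonX_tendsto[OF assms(1) this]
  have "((\<lambda>r. (X (Complex r c) $ 1 $ 1 * exp (- qexp \<theta> x (Complex r c))) * (X (Complex r c) $ 2 $ 2 * exp (qexp \<theta> x (Complex r c)))
      - (X (Complex r c) $ 1 $ 2 * exp (qexp \<theta> x (Complex r c))) * (X (Complex r c) $ 2 $ 1 * exp (- qexp \<theta> x (Complex r c)))) \<longlongrightarrow> 1 * 1 - 0 * 0) at_top"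
    by (intro tendsto_intros t)
  moreover have "(X (Complex r c) $ 1 $ 1 * exp (- qexp \<theta> x (Complex r c))) * (X (Complex r c) $ 2 $ 2 * exp (qexp \<theta> x (Complex r c)))
      - (X (Complex r c) $ 1 $ 2 * exp (qexp \<theta> x (Complex r c))) * (X (Complex r c) $ 2 $ 1 * exp (- qexp \<theta> x (Complex r c))) = det (X (Complex r c))" for r
    using mult_exp_exp[of "qexp \<theta> x (Complex r c)" "- qexp \<theta> x (Complex r c)"] unfolding det_2 by simp algebra
  ultimately have "((\<lambda>r. det (X (Complex r c))) \<longlongrightarrow> 1) at_top" by simp
  moreover have "\<forall>\<^sub>F r in at_top. det (X (Complex r c)) = det (X m)"
    using eventually_gt_at_top[of 0] by eventually_elim (simp add: const)
  ultimately have "((\<lambda>r::real. det (X m)) \<longlongrightarrow> 1) at_top" by (rule Lim_transform_eventually)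
  then show ?thesis by (simp add: tendsto_const_iff)
qed

lemma exp_qexp_decay:
  assumes "Re (x * cis b) > 0"
  shows "((\<lambda>r. exp (- 2 * qexp \<theta> x (Complex r b))) \<longlongrightarrow> 0) at_top"
proof (rule tendsto_norm_zero_cancel)
  define A where "A = Re (x * cis b) / 2"
  define B where "B = Re \<theta>"
  define C where "C = Re (\<theta> * (\<i> * of_real b - of_real (ln 2))) - Re x / 2"
  have A: "A > 0" using assms by (simp add: A_def)
  have "norm (exp (- 2 * qexp \<theta> x (Complex r b))) = exp (- (A * exp r - B * r - C))" for r
  proof -
    have "exp (Complex r b) = of_real (exp r) * cis b" by (subst exp_eq_polar) simp
    moreover have "Complex r b - of_real (ln 2) = of_real r + (\<i> * of_real b - of_real (ln 2))" by (simp add: complex_eq_iff)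
    ultimately have "2 * qexp \<theta> x (Complex r b) = of_real (exp r) * (x * cis b) / 2 + x / 2 - of_real r * \<theta> - \<theta> * (\<i> * of_real b - of_real (ln 2))"
      unfolding qexp_def by (simp add: field_simps)
    then have "Re (2 * qexp \<theta> x (Complex r b)) = exp r * Re (x * cis b) / 2 + Re x / 2 - r * Re \<theta> - Re (\<theta> * (\<i> * of_real b - of_real (ln 2)))"
      by simp
    then show ?thesis unfolding norm_exp_eq_Re A_def B_def C_def by (simp add: algebra_simps)
  qed
  moreover have "((\<lambda>r. exp (- (A * exp r - B * r - C))) \<longlongrightarrow> 0) at_top" using A by real_asymp
  ultimately show "((\<lambda>r. norm (exp (- 2 * qexp \<theta> x (Complex r b)))) \<longlongrightarrow> 0) at_top" by simp
qed

text \<open>Both solutions are normalised along the common ray \<open>b\<close>. In X^-1 X' the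
  exponentials cancel on the diagonal, giving 1, whereas an off-diagonal entry keeps a factor exp
  (-2 q) or exp (2 q); the entry whose factor decays must vanish.\<close>

lemma canonX_connection:
  assumes X: "canonX \<theta> A0 A1 x c X" and X': "canonX \<theta> A0 A1 x c' X'" and tr: "trace A0 = 0" "trace A1 = 0"
    and con: "\<And>m. Re m > 0 \<Longrightarrow> X' m = X m ** S" and b: "\<bar>b - c\<bar> < pi" "\<bar>b - c'\<bar> < pi"
  shows "S $ 1 $ 1 = 1" "S $ 2 $ 2 = 1" "Re (x * cis b) > 0 \<Longrightarrow> S $ 1 $ 2 = 0" "Re (x * cis b) < 0 \<Longrightarrow> S $ 2 $ 1 = 0"
proof -
  define q where "q r = qexp \<theta> x (Complex r b)" for r
  note t = canonX_tendsto[OF X b(1), folded q_def] canonX_tendsto[OF X' b(2), folded q_def]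
  define Z where "Z r = X (Complex r b)" for r
  define Z' where "Z' r = X' (Complex r b)" for r
  note t = t[folded Z_def Z'_def]
  have S: "S = adj2 (Z r) ** Z' r" if "r > 0" for r
    using con[of "Complex r b"] canonX_det[OF X tr, of "Complex r b"] that by (simp add: Z_def Z'_def adj2_cancel)
  have ev: "\<forall>\<^sub>F r::real in at_top. r > 0" by (rule eventually_gt_at_top)
  have lim: "S $ i $ j = L" if "(f \<longlongrightarrow> L) at_top" "\<And>r. r > 0 \<Longrightarrow> f r = S $ i $ j" for i j L and f :: "real \<Rightarrow> complex"
  proof -
    have "((\<lambda>r::real. S $ i $ j) \<longlongrightarrow> L) at_top"
      by (rule Lim_transform_eventually[OF that(1)], rule eventually_mono[OF ev]) (simp add: that(2))
    then show ?thesis by (simp add: tendsto_const_iff)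
  qed
  have ee: "exp a * exp (- a) = 1" "exp (- a) * exp a = 1" for a :: complex by (simp_all add: mult_exp_exp)
  show "S $ 1 $ 1 = 1"
  proof (rule lim)
    show "((\<lambda>r. (Z r $ 2 $ 2 * exp (q r)) * (Z' r $ 1 $ 1 * exp (- q r)) - (Z r $ 1 $ 2 * exp (q r)) * (Z' r $ 2 $ 1 * exp (- q r))) \<longlongrightarrow> 1) at_top"
      by (rule tendsto_eq_intros t refl | simp)+
  next
    fix r :: real assume r: "r > 0"
    show "(Z r $ 2 $ 2 * exp (q r)) * (Z' r $ 1 $ 1 * exp (- q r)) - (Z r $ 1 $ 2 * exp (q r)) * (Z' r $ 2 $ 1 * exp (- q r)) = S $ 1 $ 1"
      unfolding S[OF r] using ee[of "q r"] by (simp add: mmult_nth) algebra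
  qed
  show "S $ 2 $ 2 = 1"
  proof (rule lim)
    show "((\<lambda>r. (Z r $ 1 $ 1 * exp (- q r)) * (Z' r $ 2 $ 2 * exp (q r)) - (Z r $ 2 $ 1 * exp (- q r)) * (Z' r $ 1 $ 2 * exp (q r))) \<longlongrightarrow> 1) at_top"
      by (rule tendsto_eq_intros t refl | simp)+
  next
    fix r :: real assume r: "r > 0"
    show "(Z r $ 1 $ 1 * exp (- q r)) * (Z' r $ 2 $ 2 * exp (q r)) - (Z r $ 2 $ 1 * exp (- q r)) * (Z' r $ 1 $ 2 * exp (q r)) = S $ 2 $ 2"
      unfolding S[OF r] using ee[of "q r"] by (simp add: mmult_nth) algebra
  qed
  show "S $ 1 $ 2 = 0" if "Re (x * cis b) > 0"
  proof (rule lim)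
    show "((\<lambda>r. exp (- 2 * q r) * ((Z r $ 2 $ 2 * exp (q r)) * (Z' r $ 1 $ 2 * exp (q r)) - (Z r $ 1 $ 2 * exp (q r)) * (Z' r $ 2 $ 2 * exp (q r)))) \<longlongrightarrow> 0) at_top"
      by (rule tendsto_eq_intros t refl exp_qexp_decay[OF that, of \<theta>, folded q_def] | simp)+
  next
    fix r :: real assume r: "r > 0"
    have "exp (- 2 * q r) = exp (- q r) * exp (- q r)" by (simp add: mult_exp_exp)
    then show "exp (- 2 * q r) * ((Z r $ 2 $ 2 * exp (q r)) * (Z' r $ 1 $ 2 * exp (q r)) - (Z r $ 1 $ 2 * exp (q r)) * (Z' r $ 2 $ 2 * exp (q r))) = S $ 1 $ 2"
      unfolding S[OF r] using ee[of "q r"] by (simp add: mmult_nth) algebra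
  qed
  show "S $ 2 $ 1 = 0" if "Re (x * cis b) < 0"
  proof (rule lim)
    have "Re ((- x) * cis b) > 0" using that by simp
    from exp_qexp_decay[OF this, of "- \<theta>"] have d: "((\<lambda>r. exp (2 * q r)) \<longlongrightarrow> 0) at_top" by (simp add: q_def qexp_minus)
    show "((\<lambda>r. exp (2 * q r) * ((Z r $ 1 $ 1 * exp (- q r)) * (Z' r $ 2 $ 1 * exp (- q r)) - (Z r $ 2 $ 1 * exp (- q r)) * (Z' r $ 1 $ 1 * exp (- q r)))) \<longlongrightarrow> 0) at_top"
      by (rule tendsto_eq_intros t refl d | simp)+
  next
    fix r :: real assume r: "r > 0"
    have "exp (2 * q r) = exp (q r) * exp (q r)" by (simp add: mult_exp_exp)
    then show "exp (2 * q r) * ((Z r $ 1 $ 1 * exp (- q r)) * (Z' r $ 2 $ 1 * exp (- q r)) - (Z r $ 2 $ 1 * exp (- q r)) * (Z' r $ 1 $ 1 * exp (- q r))) = S $ 2 $ 1"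
      unfolding S[OF r] using ee[of "q r"] by (simp add: mmult_nth) algebra
  qed
qed

lemma system_solutions_connected:
  assumes "system_solution A0 A1 x X" "system_solution A0 A1 x X'" "trace A0 = 0" "trace A1 = 0"
    "\<And>m. Re m > 0 \<Longrightarrow> det (X m) = 1"
  obtains S where "\<And>m. Re m > 0 \<Longrightarrow> X' m = X m ** S"
proof -
  define S where "S = adj2 (X 1) ** X' 1"
  have "X' m = X m ** S" if "Re m > 0" for m
  proof -
    have "S = adj2 (X m) ** X' m"
      unfolding S_def
      by (rule lode_quotient_const[OF half_plane[of 0], of X "\<lambda>m. scale_mat (exp m) (eta_coeff A0 A1 x (exp m))"])
         (use assms that in \<open>auto simp: trace_eta_coeff system_solution_def\<close>)
    then show ?thesis using assms(5)[OF that] by (simp add: adj2_cancel)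
  qed
  then show thesis by (rule that)
qed

text \<open>A sector of half-width pi contains a direction with Re (x \<eta>) < 0 and one with Re (x
  \<eta>) > 0. Together they make both off-diagonal entries of the connection matrix vanish.\<close>

lemma canonX_unique:
  assumes X: "canonX \<theta> A0 A1 (exp s) c X" and X': "canonX \<theta> A0 A1 (exp s) c X'" and tr: "trace A0 = 0" "trace A1 = 0"
    and c: "c = pi / 2 + of_int k * pi - Im s" and m: "Re m > 0"
  shows "X' m = X m"
proof -
  obtain S where S: "\<And>m. Re m > 0 \<Longrightarrow> X' m = X m ** S"
    by (rule system_solutions_connected[of A0 A1 "exp s" X X']) (use X X' tr canonX_det[OF X tr] in \<open>auto simp: canonX_def\<close>)
  obtain w1 :: real where w1: "of_real 1 * cis (Im s + w1) = -1" "\<bar>c - w1\<bar> = pi / 2"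
    using recessive_direction[of 1, OF _ c] by auto
  obtain w2 :: real where w2: "of_real (-1) * cis (Im s + w2) = -1" "\<bar>c - w2\<bar> = pi / 2"
    using recessive_direction[of "-1", OF _ c] by auto
  have e: "exp s * cis w = of_real (exp (Re s)) * cis (Im s + w)" for w
    by (subst exp_eq_polar) (simp add: cis_mult mult.assoc)
  have r1: "Re (exp s * cis w1) < 0" unfolding e using w1(1) by simp
  have r2: "Re (exp s * cis w2) > 0" unfolding e using w2(1) by simp
  have b: "\<bar>w1 - c\<bar> < pi" "\<bar>w2 - c\<bar> < pi"
    using w1(2) w2(2) pi_gt_zero abs_minus_commute[of w1 c] abs_minus_commute[of w2 c] by argo+
  note con1 = canonX_connection[OF X X' tr S b(1) b(1)] and con2 = canonX_connection[OF X X' tr S b(2) b(2)]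
  have "S = mat 1" using con1(1,2) con1(4)[OF _ r1] con2(3)[OF _ r2] by (simp add: cmat_eq_iff)
  then show ?thesis using S[OF m] by simp
qed

text \<open>A full turn lowers the exponent by pi i \<theta>; the diagonal factor on the right
  restores the normalisation. This is the formal monodromy.\<close>

lemma canonX_rotate:
  assumes "canonX \<theta> A0 A1 x c X"
  shows "canonX \<theta> A0 A1 x (c - 2 * pi) (\<lambda>m. X (m + 2 * of_real pi * \<i>) ** exp_sigma3 (of_real pi * \<i> * \<theta>))"
proof -
  let ?T = "\<lambda>m. m + 2 * of_real pi * \<i>"
  have ex: "exp (?T m) = exp m" for m by (simp add: exp_add)
  have q: "qexp \<theta> x m = qexp \<theta> x (?T m) + of_real pi * \<i> * \<theta>" for m
    unfolding qexp_def ex by (simp add: field_simps)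
  have "system_solution A0 A1 x (\<lambda>m. X (?T m) ** exp_sigma3 (of_real pi * \<i> * \<theta>))"
    unfolding system_solution_def
  proof (intro allI impI)
    fix m assume "Re m > 0"
    then have "has_mderiv X (scale_mat (exp (?T m)) (eta_coeff A0 A1 x (exp (?T m))) ** X (?T m)) (?T m)"
      using assms unfolding canonX_def system_solution_def by auto
    from has_mderiv_rmult[OF has_mderiv_shift[OF this]]
    show "has_mderiv (\<lambda>m. X (?T m) ** exp_sigma3 (of_real pi * \<i> * \<theta>))
       (scale_mat (exp m) (eta_coeff A0 A1 x (exp m)) ** (X (?T m) ** exp_sigma3 (of_real pi * \<i> * \<theta>))) m"
      unfolding ex by (simp add: matrix_mul_assoc)
  qed
  moreover have shift: "col_asym t y (\<lambda>m. Z (?T m) ** exp_sigma3 p) {c - 2 * pi - (pi - \<delta>)..c - 2 * pi + (pi - \<delta>)}"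
    if q': "\<And>m. qexp t y m = qexp t y (?T m) + p" and Z: "col_asym t y Z {c - (pi - \<delta>)..c + (pi - \<delta>)}" for t y Z p \<delta>
  proof -
    obtain C R where CR: "\<And>m. Re m > R \<and> Re m > 0 \<and> Im m \<in> {c - (pi - \<delta>)..c + (pi - \<delta>)} \<Longrightarrow>
      norm (Z m $ 1 $ 1 * exp (- qexp t y m) - 1) \<le> C * exp (- Re m) \<and>
      norm (Z m $ 2 $ 1 * exp (- qexp t y m)) \<le> C * exp (- Re m)"
      using Z unfolding col_asym_def by blast
    have en: "(Z (?T m) ** exp_sigma3 p) $ i $ 1 * exp (- qexp t y m) = Z (?T m) $ i $ 1 * exp (- qexp t y (?T m))" for m i
      unfolding q'[of m] by (simp add: mmult_nth mult_exp_exp mult.assoc)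
    show ?thesis unfolding col_asym_def en
      by (rule exI[of _ C], rule exI[of _ R], intro allI impI) (use CR[of "?T _"] in auto)
  qed
  moreover have cj: "conj_sigma1 (X (?T m) ** exp_sigma3 (of_real pi * \<i> * \<theta>)) = conj_sigma1 (X (?T m)) ** exp_sigma3 (- (of_real pi * \<i> * \<theta>))" for m
    by (simp add: cmat_eq_iff mmult_nth)
  moreover have q2: "qexp (- \<theta>) (- x) m = qexp (- \<theta>) (- x) (?T m) + - (of_real pi * \<i> * \<theta>)" for m
    unfolding qexp_minus q[of m] by simp
  ultimately show ?thesis
    unfolding canonX_def cj
  proof (intro conjI allI impI)
    fix \<delta> :: real assume "\<delta> > 0"
    then have a: "col_asym \<theta> x X {c - (pi - \<delta>)..c + (pi - \<delta>)}"
      "col_asym (- \<theta>) (- x) (\<lambda>m. conj_sigma1 (X m)) {c - (pi - \<delta>)..c + (pi - \<delta>)}"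
      using assms by (auto simp: canonX_def)
    show "col_asym \<theta> x (\<lambda>m. X (?T m) ** exp_sigma3 (of_real pi * \<i> * \<theta>)) {c - 2 * pi - (pi - \<delta>)..c - 2 * pi + (pi - \<delta>)}"
      by (rule shift[OF q a(1)])
    show "col_asym (- \<theta>) (- x) (\<lambda>m. conj_sigma1 (X (?T m)) ** exp_sigma3 (- (of_real pi * \<i> * \<theta>))) {c - 2 * pi - (pi - \<delta>)..c - 2 * pi + (pi - \<delta>)}"
      by (rule shift[OF q2 a(2)])
  qed
qed

text \<open>The members \<open>X k\<close> of the family are the solutions \<open>Y\<^bsub>k+2\<^esub>\<close> of the paper.\<close>
definition canon_family :: "complex \<Rightarrow> cmat \<Rightarrow> cmat \<Rightarrow> complex \<Rightarrow> (int \<Rightarrow> complex \<Rightarrow> cmat) \<Rightarrow> cmat \<Rightarrow> cmat \<Rightarrow> bool" where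
  "canon_family \<theta> A0 A1 s X S1 S2 \<longleftrightarrow>
     (\<forall>k. canonX \<theta> A0 A1 (exp s) (pi / 2 + of_int k * pi - Im s) (X k)) \<and>
     (\<forall>m. Re m > 0 \<longrightarrow> X 0 m = X (-1) m ** S1 \<and> X 1 m = X 0 m ** S2)"

lemma canon_family_rotate:
  assumes F: "canon_family \<theta> A0 A1 s X S1 S2" and tr: "trace A0 = 0" "trace A1 = 0" and m: "Re m > 0"
  shows "X (k + 2) (m + 2 * of_real pi * \<i>) ** exp_sigma3 (of_real pi * \<i> * \<theta>) = X k m"
proof -
  have "canonX \<theta> A0 A1 (exp s) (pi / 2 + of_int (k + 2) * pi - Im s - 2 * pi)
    (\<lambda>m. X (k + 2) (m + 2 * of_real pi * \<i>) ** exp_sigma3 (of_real pi * \<i> * \<theta>))"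
  proof (rule canonX_rotate)
    show "canonX \<theta> A0 A1 (exp s) (pi / 2 + of_int (k + 2) * pi - Im s) (X (k + 2))"
      using F unfolding canon_family_def by blast
  qed
  also have "pi / 2 + of_int (k + 2) * pi - Im s - 2 * pi = pi / 2 + of_int k * pi - Im s" by (simp add: algebra_simps)
  finally have 2: "canonX \<theta> A0 A1 (exp s) (pi / 2 + of_int k * pi - Im s)
    (\<lambda>m. X (k + 2) (m + 2 * of_real pi * \<i>) ** exp_sigma3 (of_real pi * \<i> * \<theta>))" .
  have 1: "canonX \<theta> A0 A1 (exp s) (pi / 2 + of_int k * pi - Im s) (X k)" using F unfolding canon_family_def by blast
  show ?thesis by (rule canonX_unique[OF 1 2 tr refl m])
qed

lemma canon_family_det:
  assumes F: "canon_family \<theta> A0 A1 s X S1 S2" and tr: "trace A0 = 0" "trace A1 = 0"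
  shows "Re m > 0 \<Longrightarrow> det (X k m) = 1"
  using canonX_det[OF _ tr] F unfolding canon_family_def by blast

text \<open>Neighbouring sectors share the directions where x \<eta> is positive (first pair) or
  negative (second pair). So the triangular shape of \<open>S1\<close> and \<open>S2\<close> is
  derived from the asymptotics and not assumed in the data.\<close>

lemma canon_family_stokes:
  assumes F: "canon_family \<theta> A0 A1 s X S1 S2" and tr: "trace A0 = 0" "trace A1 = 0"
  shows "S1 $ 1 $ 1 = 1" "S1 $ 2 $ 2 = 1" "S1 $ 1 $ 2 = 0" "S2 $ 1 $ 1 = 1" "S2 $ 2 $ 2 = 1" "S2 $ 2 $ 1 = 0"
    "det S1 = 1" "det S2 = 1"
proof -
  have X: "canonX \<theta> A0 A1 (exp s) (- (pi / 2) - Im s) (X (-1))" "canonX \<theta> A0 A1 (exp s) (pi / 2 - Im s) (X 0)"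
    "canonX \<theta> A0 A1 (exp s) (3 * pi / 2 - Im s) (X 1)"
    using F unfolding canon_family_def
    by (auto dest: spec[of _ "-1"] spec[of _ "0::int"] spec[of _ "1::int"] simp: field_simps)
  have con: "\<And>m. Re m > 0 \<Longrightarrow> X 0 m = X (-1) m ** S1" "\<And>m. Re m > 0 \<Longrightarrow> X 1 m = X 0 m ** S2"
    using F by (auto simp: canon_family_def)
  have e: "exp s * cis w = of_real (exp (Re s)) * cis (Im s + w)" for w
    by (subst exp_eq_polar) (simp add: cis_mult mult.assoc)
  have p1: "Re (exp s * cis (- Im s)) > 0" and p2: "Re (exp s * cis (pi - Im s)) < 0" unfolding e by simp_all
  have b1: "\<bar>- Im s - (- (pi / 2) - Im s)\<bar> < pi" "\<bar>- Im s - (pi / 2 - Im s)\<bar> < pi"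
    "\<bar>pi - Im s - (pi / 2 - Im s)\<bar> < pi" "\<bar>pi - Im s - (3 * pi / 2 - Im s)\<bar> < pi"
    by simp_all
  note c1 = canonX_connection[OF X(1,2) tr con(1) b1(1,2)] and c2 = canonX_connection[OF X(2,3) tr con(2) b1(3,4)]
  show "S1 $ 1 $ 1 = 1" "S1 $ 2 $ 2 = 1" "S1 $ 1 $ 2 = 0" "S2 $ 1 $ 1 = 1" "S2 $ 2 $ 2 = 1" "S2 $ 2 $ 1 = 0"
    using c1(1,2,3) c2(1,2,4) p1 p2 by auto
  then show "det S1 = 1" "det S2 = 1" by (simp_all add: det_2)
qed

text \<open>Rotation by 2 pi maps the family to itself up to formal monodromy, which expresses the
  neighbouring Stokes matrices by \<open>S1\<close> and \<open>S2\<close>. The third equation is the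
  circuit around infinity; compared with the two loops it will give the relation for M^1
  M^0.\<close>

lemma canon_family_extra_stokes:
  assumes F: "canon_family \<theta> A0 A1 s X S1 S2" and tr: "trace A0 = 0" "trace A1 = 0" and m: "Re m > 0"
  defines "E \<equiv> exp_sigma3 (of_real pi * \<i> * \<theta>)" and "E' \<equiv> exp_sigma3 (- (of_real pi * \<i> * \<theta>))"
  shows "X 2 m = X 1 m ** (E ** S1 ** E')" "X (-1) m = X (-2) m ** (E' ** S2 ** E)"
    "X 0 (m + 2 * of_real pi * \<i>) = X 0 m ** (adj2 S1 ** E' ** adj2 S2)"
proof -
  let ?T = "2 * of_real pi * \<i>"
  have EE: "E ** E' = mat 1" "E' ** E = mat 1" by (simp_all add: E_def E'_def exp_sigma3_mult)
  have con: "\<And>m. Re m > 0 \<Longrightarrow> X 0 m = X (-1) m ** S1" "\<And>m. Re m > 0 \<Longrightarrow> X 1 m = X 0 m ** S2"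
    using F by (auto simp: canon_family_def)
  have rot: "X (k + 2) (m + ?T) = X k m ** E'" if "Re m > 0" for k m
    using canon_family_rotate[OF F tr that, of k, folded E_def] EE
    by (metis matrix_mul_assoc matrix_mul_rid)
  note st = canon_family_stokes(7,8)[OF F tr]
  have m': "Re (m - ?T) > 0" using m by simp
  have "X 2 m = X 0 (m - ?T) ** E'" using rot[OF m', of 0] by simp
  also have "\<dots> = X (-1) (m - ?T) ** (S1 ** E')" by (simp add: con(1)[OF m'] matrix_mul_assoc)
  also have "X (-1) (m - ?T) = X 1 m ** E" using canon_family_rotate[OF F tr m', of "-1", folded E_def] by simp
  finally show "X 2 m = X 1 m ** (E ** S1 ** E')" by (simp add: matrix_mul_assoc)
  have mT: "Re (m + ?T) > 0" using m by simp
  have "X (-1) m = X 1 (m + ?T) ** E" using canon_family_rotate[OF F tr m, of "-1", folded E_def] by simp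
  also have "\<dots> = X 0 (m + ?T) ** (S2 ** E)" by (simp add: con(2)[OF mT] matrix_mul_assoc)
  also have "X 0 (m + ?T) = X (-2) m ** E'" using rot[OF m, of "-2"] by simp
  finally show "X (-1) m = X (-2) m ** (E' ** S2 ** E)" by (simp add: matrix_mul_assoc)
  have "X 1 (m + ?T) = X (-1) m ** E'" using rot[OF m, of "-1"] by simp
  then have "X 0 (m + ?T) ** S2 = X (-1) m ** E'" using con(2)[OF mT] by simp
  then have "X 0 (m + ?T) = X (-1) m ** E' ** adj2 S2" using st by (metis adj2_cancel(2) matrix_mul_assoc matrix_mul_rid)
  moreover have "X (-1) m = X 0 m ** adj2 S1" using con(1)[OF m] st by (metis adj2_cancel(2) matrix_mul_assoc matrix_mul_rid)
  ultimately show "X 0 (m + ?T) = X 0 m ** (adj2 S1 ** E' ** adj2 S2)" by (simp add: matrix_mul_assoc)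
qed

section \<open>Analytic continuation along loops\<close>

lemma continues_along_mult:
  assumes "continues_along \<gamma> F G" "mholo P UNIV"
  shows "continues_along \<gamma> (\<lambda>v. P v ** F v ** N) (\<lambda>v. P v ** G v ** N)"
proof -
  obtain f :: "real \<Rightarrow> complex \<Rightarrow> cmat" where f:
    "\<forall>\<tau>\<in>{0..1}. \<forall>i j. (\<lambda>v. f \<tau> v $ i $ j) analytic_on {\<gamma> \<tau>}"
    "\<forall>\<tau>\<in>{0..1}. \<exists>\<epsilon>>0. \<forall>\<tau>'\<in>{0..1}. \<bar>\<tau>' - \<tau>\<bar> < \<epsilon> \<longrightarrow> (\<forall>\<^sub>F v in nhds (\<gamma> \<tau>'). f \<tau>' v = f \<tau> v)"
    "\<forall>\<^sub>F v in nhds (\<gamma> 0). f 0 v = F v" "\<forall>\<^sub>F v in nhds (\<gamma> 1). f 1 v = G v"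
    using assms(1) unfolding continues_along_def by blast
  have P: "(\<lambda>v. P v $ i $ j) analytic_on T" for i j T
    using mholoD[OF assms(2), of i j] analytic_on_open[of UNIV] analytic_on_subset by blast
  show ?thesis unfolding continues_along_def
  proof (intro exI[of _ "\<lambda>\<tau> v. P v ** f \<tau> v ** N"] conjI)
    show "\<forall>\<tau>\<in>{0..1}. \<forall>i j. (\<lambda>v. (P v ** f \<tau> v ** N) $ i $ j) analytic_on {\<gamma> \<tau>}"
      using f(1) unfolding mmult_nth by (auto intro!: analytic_intros P)
    show "\<forall>\<^sub>F v in nhds (\<gamma> 0). P v ** f 0 v ** N = P v ** F v ** N"
      using f(3) by eventually_elim simp
    show "\<forall>\<^sub>F v in nhds (\<gamma> 1). P v ** f 1 v ** N = P v ** G v ** N"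
      using f(4) by eventually_elim simp
    show "\<forall>\<tau>\<in>{0..1}. \<exists>\<epsilon>>0. \<forall>\<tau>'\<in>{0..1}. \<bar>\<tau>' - \<tau>\<bar> < \<epsilon> \<longrightarrow> (\<forall>\<^sub>F v in nhds (\<gamma> \<tau>'). P v ** f \<tau>' v ** N = P v ** f \<tau> v ** N)"
    proof
      fix \<tau> :: real assume "\<tau> \<in> {0..1}"
      then obtain \<epsilon> where \<epsilon>: "\<epsilon> > 0" "\<forall>\<tau>'\<in>{0..1}. \<bar>\<tau>' - \<tau>\<bar> < \<epsilon> \<longrightarrow> (\<forall>\<^sub>F v in nhds (\<gamma> \<tau>'). f \<tau>' v = f \<tau> v)"
        using f(2) by blast
      have "\<forall>\<^sub>F v in nhds (\<gamma> \<tau>'). P v ** f \<tau>' v ** N = P v ** f \<tau> v ** N" if "\<tau>' \<in> {0..1}" "\<bar>\<tau>' - \<tau>\<bar> < \<epsilon>" for \<tau>'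
        using \<epsilon>(2)[rule_format, OF that] by eventually_elim simp
      then show "\<exists>\<epsilon>>0. \<forall>\<tau>'\<in>{0..1}. \<bar>\<tau>' - \<tau>\<bar> < \<epsilon> \<longrightarrow> (\<forall>\<^sub>F v in nhds (\<gamma> \<tau>'). P v ** f \<tau>' v ** N = P v ** f \<tau> v ** N)"
        using \<epsilon>(1) by blast
    qed
  qed
qed

lemma continues_along_cong:
  assumes "continues_along \<gamma> F G" "\<forall>\<^sub>F v in nhds (\<gamma> 0). F v = F' v" "\<forall>\<^sub>F v in nhds (\<gamma> 1). G v = G' v"
  shows "continues_along \<gamma> F' G'"
proof -
  obtain f :: "real \<Rightarrow> complex \<Rightarrow> cmat" where f:
    "\<forall>\<tau>\<in>{0..1}. \<forall>i j. (\<lambda>v. f \<tau> v $ i $ j) analytic_on {\<gamma> \<tau>}"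
    "\<forall>\<tau>\<in>{0..1}. \<exists>\<epsilon>>0. \<forall>\<tau>'\<in>{0..1}. \<bar>\<tau>' - \<tau>\<bar> < \<epsilon> \<longrightarrow> (\<forall>\<^sub>F v in nhds (\<gamma> \<tau>'). f \<tau>' v = f \<tau> v)"
    and ends: "\<forall>\<^sub>F v in nhds (\<gamma> 0). f 0 v = F v" "\<forall>\<^sub>F v in nhds (\<gamma> 1). f 1 v = G v"
    using assms(1) unfolding continues_along_def by blast
  have "\<forall>\<^sub>F v in nhds (\<gamma> 0). f 0 v = F' v" "\<forall>\<^sub>F v in nhds (\<gamma> 1). f 1 v = G' v"
    using eventually_conj[OF ends(1) assms(2)] eventually_conj[OF ends(2) assms(3)] by (auto elim!: eventually_mono)
  with f show ?thesis unfolding continues_along_def by blast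
qed

text \<open>Here \<open>X\<close> is a function of \<open>ln \<eta>\<close>, and the loops are those of \<open>e\<^sup>i\<^sup>\<phi> \<eta>\<close>.\<close>
definition loop_data :: "real \<Rightarrow> (complex \<Rightarrow> cmat) \<Rightarrow> cmat \<Rightarrow> cmat \<Rightarrow> bool" where
  "loop_data \<phi> X M0 M1 \<longleftrightarrow> (\<forall>r>100. \<forall>\<rho>. 0 < \<rho> \<and> \<rho> < 1 \<longrightarrow>
      continues_along (lasso (\<i> * of_real r) (- cis \<phi>) \<rho>)
        (\<lambda>v. X (Ln v - \<i> * of_real \<phi>)) (\<lambda>v. X (Ln v - \<i> * of_real \<phi>) ** M0) \<and>
      continues_along (lasso (\<i> * of_real r) (cis \<phi>) \<rho>)
        (\<lambda>v. X (Ln v - \<i> * of_real \<phi>)) (\<lambda>v. X (Ln v - \<i> * of_real \<phi>) ** M1))"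

lemma has_monodromy_data_iff:
  "has_monodromy_data \<theta>0 \<theta>1 \<theta> s y z u S1 S2 M0 M1 \<longleftrightarrow>
    (\<exists>X. canon_family \<theta> (residue0 \<theta>0 z u) (residue1 \<theta>0 \<theta>1 \<theta> y z u) s X S1 S2 \<and> loop_data (Im s) (X 0) M0 M1)"
proof
  define f where "f = \<i> * of_real (Im s)"
  define p where "p = varpi \<theta> s"
  have Ref: "Re (m + f) = Re m" "Re (m - f) = Re m" for m by (simp_all add: f_def)
  {
    assume "has_monodromy_data \<theta>0 \<theta>1 \<theta> s y z u S1 S2 M0 M1"
    then obtain Y where Y: "\<And>k. canonical_solution \<theta>0 \<theta>1 \<theta> s y z u k (Y k)"
      "\<And>l. Re l > 0 \<Longrightarrow> Y 2 l = Y 1 l ** S1 \<and> Y 3 l = Y 2 l ** S2"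
      and L: "\<And>r \<rho>. r > 100 \<Longrightarrow> 0 < \<rho> \<Longrightarrow> \<rho> < 1 \<Longrightarrow>
           continues_along (lasso (\<i> * of_real r) (- cis (Im s)) \<rho>) (\<lambda>v. Y 2 (Ln v)) (\<lambda>v. Y 2 (Ln v) ** M0) \<and>
           continues_along (lasso (\<i> * of_real r) (cis (Im s)) \<rho>) (\<lambda>v. Y 2 (Ln v)) (\<lambda>v. Y 2 (Ln v) ** M1)"
      unfolding has_monodromy_data_def by blast
    define X where "X k m = exp_sigma3 p ** Y (k + 2) (m + f)" for k m
    have "canon_family \<theta> (residue0 \<theta>0 z u) (residue1 \<theta>0 \<theta>1 \<theta> y z u) s X S1 S2"
      unfolding canon_family_def
    proof (intro conjI allI impI)
      fix k show "canonX \<theta> (residue0 \<theta>0 z u) (residue1 \<theta>0 \<theta>1 \<theta> y z u) (exp s) (pi / 2 + of_int k * pi - Im s) (X k)"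
        using Y(1)[of "k + 2", unfolded canonical_iff_canonX] by (simp add: X_def[abs_def] p_def f_def)
    next
      fix m :: complex assume "Re m > 0"
      then show "X 0 m = X (-1) m ** S1" "X 1 m = X 0 m ** S2"
        using Y(2)[of "m + f", unfolded Ref] by (simp_all add: X_def matrix_mul_assoc)
    qed
    moreover have "loop_data (Im s) (X 0) M0 M1"
      unfolding loop_data_def
    proof (intro allI impI)
      fix r \<rho> :: real assume r: "r > 100" "0 < \<rho> \<and> \<rho> < 1"
      have "continues_along (lasso (\<i> * of_real r) (- cis (Im s)) \<rho>) (\<lambda>v. exp_sigma3 p ** Y 2 (Ln v) ** mat 1) (\<lambda>v. exp_sigma3 p ** (Y 2 (Ln v) ** M0) ** mat 1)"
        "continues_along (lasso (\<i> * of_real r) (cis (Im s)) \<rho>) (\<lambda>v. exp_sigma3 p ** Y 2 (Ln v) ** mat 1) (\<lambda>v. exp_sigma3 p ** (Y 2 (Ln v) ** M1) ** mat 1)"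
        using L[of r \<rho>] r by (intro continues_along_mult mholo_const; simp)+
      then show "continues_along (lasso (\<i> * of_real r) (- cis (Im s)) \<rho>)
            (\<lambda>v. X 0 (Ln v - \<i> * of_real (Im s))) (\<lambda>v. X 0 (Ln v - \<i> * of_real (Im s)) ** M0) \<and>
          continues_along (lasso (\<i> * of_real r) (cis (Im s)) \<rho>)
            (\<lambda>v. X 0 (Ln v - \<i> * of_real (Im s))) (\<lambda>v. X 0 (Ln v - \<i> * of_real (Im s)) ** M1)"
        unfolding X_def f_def by (simp add: matrix_mul_assoc)
    qed
    ultimately show "\<exists>X. canon_family \<theta> (residue0 \<theta>0 z u) (residue1 \<theta>0 \<theta>1 \<theta> y z u) s X S1 S2 \<and> loop_data (Im s) (X 0) M0 M1"
      by blast
  }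
  assume "\<exists>X. canon_family \<theta> (residue0 \<theta>0 z u) (residue1 \<theta>0 \<theta>1 \<theta> y z u) s X S1 S2 \<and> loop_data (Im s) (X 0) M0 M1"
  then obtain X where X: "canon_family \<theta> (residue0 \<theta>0 z u) (residue1 \<theta>0 \<theta>1 \<theta> y z u) s X S1 S2"
    and L: "loop_data (Im s) (X 0) M0 M1" by blast
  define Y where "Y k l = exp_sigma3 (- p) ** X (k - 2) (l - f)" for k l
  show "has_monodromy_data \<theta>0 \<theta>1 \<theta> s y z u S1 S2 M0 M1"
    unfolding has_monodromy_data_def
  proof (intro exI[of _ Y] conjI allI impI)
    fix k show "canonical_solution \<theta>0 \<theta>1 \<theta> s y z u k (Y k)"
    proof -
      have "canonX \<theta> (residue0 \<theta>0 z u) (residue1 \<theta>0 \<theta>1 \<theta> y z u) (exp s) (pi / 2 + of_int (k - 2) * pi - Im s) (X (k - 2))"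
        using X unfolding canon_family_def by blast
      then show ?thesis unfolding canonical_iff_canonX by (simp add: Y_def p_def[symmetric] f_def[symmetric])
    qed
  next
    fix l :: complex assume "Re l > 0"
    then have "X 0 (l - f) = X (-1) (l - f) ** S1" "X 1 (l - f) = X 0 (l - f) ** S2"
      using X Ref(2)[of l] unfolding canon_family_def by metis+
    then show "Y 2 l = Y 1 l ** S1" "Y 3 l = Y 2 l ** S2"
      by (simp_all add: Y_def matrix_mul_assoc)
  next
    fix r \<rho> :: real assume r: "r > 100" "0 < \<rho> \<and> \<rho> < 1"
    have L': "continues_along (lasso (\<i> * of_real r) (- cis (Im s)) \<rho>) (\<lambda>v. X 0 (Ln v - f)) (\<lambda>v. X 0 (Ln v - f) ** M0)"
      "continues_along (lasso (\<i> * of_real r) (cis (Im s)) \<rho>) (\<lambda>v. X 0 (Ln v - f)) (\<lambda>v. X 0 (Ln v - f) ** M1)"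
      using L r unfolding loop_data_def f_def by auto
    show "continues_along (lasso (\<i> * of_real r) (- cis (Im s)) \<rho>) (\<lambda>v. Y 2 (Ln v)) (\<lambda>v. Y 2 (Ln v) ** M0)"
      using continues_along_mult[OF L'(1) mholo_const, of "exp_sigma3 (- p)" "mat 1"] by (simp add: Y_def matrix_mul_assoc)
    show "continues_along (lasso (\<i> * of_real r) (cis (Im s)) \<rho>) (\<lambda>v. Y 2 (Ln v)) (\<lambda>v. Y 2 (Ln v) ** M1)"
      using continues_along_mult[OF L'(2) mholo_const, of "exp_sigma3 (- p)" "mat 1"] by (simp add: Y_def matrix_mul_assoc)
  qed
qed

section \<open>The reflection\<close>

lemma residue_reflect:
  "residue0 \<theta>0 (- z - \<theta>0) (1 / u) = conj_sigma1 (residue0 \<theta>0 z u)"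
  "residue1 \<theta>0 \<theta>1 (- \<theta>) (1 / y) (- z - \<theta>0) (1 / u) = conj_sigma1 (residue1 \<theta>0 \<theta>1 \<theta> y z u)"
  by (simp_all add: cmat_eq_iff residue0_def residue1_def field_simps) (simp_all add: minus_divide_left)?

lemma lasso_ends [simp]: "lasso p a \<rho> 0 = p" "lasso p a \<rho> 1 = p"
  by (simp_all add: lasso_def Let_def joinpaths_def linepath_def)

lemma sigma1_sigma1 [simp]: "sigma1 ** sigma1 = mat 1" "sigma1 ** (sigma1 ** M) = M"
proof -
  show 1: "sigma1 ** sigma1 = mat 1" by (simp add: cmat_eq_iff mmult_nth sigma1_def)
  show "sigma1 ** (sigma1 ** M) = M" by (simp add: matrix_mul_assoc 1)
qed

lemma trace_residues [simp]: "trace (residue0 \<theta>0 z u) = 0" "trace (residue1 \<theta>0 \<theta>1 \<theta> y z u) = 0"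
  by (simp_all add: trace_2 residue0_def residue1_def)

text \<open>The entire left factor returns to itself along every loop, so only the constant right
  factor \<open>S\<close>, followed by \<sigma>_1, conjugates the monodromy matrices.\<close>

lemma loop_data_transport:
  assumes L: "loop_data \<phi> X N0 N1" and P: "mholo P UNIV" and S: "det S = 1"
    and X': "\<And>m. Re m > 0 \<Longrightarrow> X' m = conj_sigma1 (P ((exp m + 1) / 2) ** X m ** S)"
  shows "loop_data \<phi> X' (conj_sigma1 (adj2 S ** N0 ** S)) (conj_sigma1 (adj2 S ** N1 ** S))"
  unfolding loop_data_def
proof (intro allI impI)
  fix r \<rho> :: real assume r: "r > 100" "0 < \<rho> \<and> \<rho> < 1"
  let ?m = "\<lambda>v. Ln v - \<i> * of_real \<phi>"
  define R where "R v = sigma1 ** P ((v * cis (- \<phi>) + 1) / 2)" for v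
  have R: "mholo R UNIV" unfolding R_def
    by (intro mholo_mult mholo_const mholo_compose[OF P]) (auto intro!: holomorphic_intros)
  have "\<forall>\<^sub>F v in nhds (\<i> * of_real r). v \<in> {v. norm v > 1}"
    using r by (intro eventually_nhds_in_open) (auto simp: norm_mult intro!: open_Collect_less continuous_intros)
  then have ev: "\<forall>\<^sub>F v in nhds (\<i> * of_real r). R v ** X (?m v) ** (S ** sigma1) = X' (?m v)"
  proof eventually_elim
    case (elim v)
    then have v: "v \<noteq> 0" by auto
    then have v: "v \<noteq> 0" "Re (?m v) > 0" using elim by simp_all
    have "exp (?m v) = v * cis (- \<phi>)" using v(1) by (simp add: exp_diff cis_conv_exp exp_minus field_simps)
    then show ?case using X'[OF v(2)] unfolding R_def by (simp add: conj_sigma1_def matrix_mul_assoc)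
  qed
  have key: "continues_along \<gamma> (\<lambda>v. X' (?m v)) (\<lambda>v. X' (?m v) ** conj_sigma1 (adj2 S ** N ** S))"
    if c: "continues_along \<gamma> (\<lambda>v. X (?m v)) (\<lambda>v. X (?m v) ** N)" and e: "\<gamma> 0 = \<i> * of_real r" "\<gamma> 1 = \<i> * of_real r" for \<gamma> N
  proof (rule continues_along_cong[OF continues_along_mult[OF c R, of "S ** sigma1"]])
    show "\<forall>\<^sub>F v in nhds (\<gamma> 0). R v ** X (?m v) ** (S ** sigma1) = X' (?m v)" using ev e by simp
    have "\<forall>\<^sub>F v in nhds (\<i> * of_real r). R v ** (X (?m v) ** N) ** (S ** sigma1) = X' (?m v) ** conj_sigma1 (adj2 S ** N ** S)"
      using ev
    proof eventually_elim
      case (elim v)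
      have "R v ** X (?m v) ** (S ** sigma1) ** conj_sigma1 (adj2 S ** N ** S) = R v ** (X (?m v) ** N) ** (S ** sigma1)"
        unfolding conj_sigma1_def by (simp add: matrix_mul_assoc[symmetric] adj2_cancel[OF S])
      then show ?case unfolding elim by simp
    qed
    then show "\<forall>\<^sub>F v in nhds (\<gamma> 1). R v ** (X (?m v) ** N) ** (S ** sigma1) = X' (?m v) ** conj_sigma1 (adj2 S ** N ** S)"
      using e by simp
  qed
  show "continues_along (lasso (\<i> * of_real r) (- cis \<phi>) \<rho>) (\<lambda>v. X' (?m v)) (\<lambda>v. X' (?m v) ** conj_sigma1 (adj2 S ** N0 ** S)) \<and>
     continues_along (lasso (\<i> * of_real r) (cis \<phi>) \<rho>) (\<lambda>v. X' (?m v)) (\<lambda>v. X' (?m v) ** conj_sigma1 (adj2 S ** N1 ** S))"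
    using L r by (intro conjI key) (auto simp: loop_data_def)
qed

text \<open>The deformation starts at s + t and ends at p, where exp p = - exp s; conjugation by
  \<sigma>_1 reverses the sign once more and returns to x = exp s with -\<theta>. The shift t is
  real, so Im s and with it the loops are those of the given data.\<close>

lemma transported_monodromy_data:
  fixes \<kappa> t :: real
  assumes sys: "PV_system \<theta>0 \<theta>1 \<theta> w zf uf" and \<kappa>: "\<kappa> = 1 \<or> \<kappa> = -1" and t: "0 < t" "t < pi / 10"
    and p: "p = s + \<i> * of_real (\<kappa> * pi)"
    and seg: "closed_segment (s + of_real t) p \<subseteq> {s. regular_point w zf uf s}"
    and data: "has_monodromy_data \<theta>0 \<theta>1 \<theta> (s + of_real t) (w (s + of_real t)) (zf (s + of_real t)) (uf (s + of_real t)) T1 T2 N0 N1"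
  defines "E \<equiv> exp_sigma3 (of_real pi * \<i> * \<theta>)" and "E' \<equiv> exp_sigma3 (- (of_real pi * \<i> * \<theta>))"
  shows "\<kappa> = 1 \<Longrightarrow> has_monodromy_data \<theta>0 \<theta>1 (- \<theta>) s (1 / w p) (- zf p - \<theta>0) (1 / uf p)
           (conj_sigma1 T2) (conj_sigma1 (E ** T1 ** E')) (conj_sigma1 (adj2 T2 ** N0 ** T2)) (conj_sigma1 (adj2 T2 ** N1 ** T2))"
    and "\<kappa> = -1 \<Longrightarrow> has_monodromy_data \<theta>0 \<theta>1 (- \<theta>) s (1 / w p) (- zf p - \<theta>0) (1 / uf p)
           (conj_sigma1 (E' ** T2 ** E)) (conj_sigma1 T1) (conj_sigma1 (T1 ** N0 ** adj2 T1)) (conj_sigma1 (T1 ** N1 ** adj2 T1))"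
    and "det T1 = 1" "det T2 = 1"
proof -
  define s0 where "s0 = s + of_real t"
  define A0 where "A0 s = residue0 \<theta>0 (zf s) (uf s)" for s
  define A1 where "A1 s = residue1 \<theta>0 \<theta>1 \<theta> (w s) (zf s) (uf s)" for s
  have tr: "trace (A0 s) = 0" "trace (A1 s) = 0" for s by (simp_all add: A0_def A1_def)
  obtain X where F: "canon_family \<theta> (A0 s0) (A1 s0) s0 X T1 T2" and L: "loop_data (Im s) (X 0) N0 N1"
    using data unfolding has_monodromy_data_iff s0_def A0_def A1_def by auto
  obtain \<Omega> where \<Omega>: "open \<Omega>" "convex \<Omega>" "s0 \<in> \<Omega>" "p \<in> \<Omega>" "\<Omega> \<subseteq> {s. regular_point w zf uf s}"
    using convex_neighbourhood_of_segment[OF regular_open(1)[OF sys] seg] unfolding s0_def by blast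
  have iso: "isomonodromic \<theta> A0 A1 \<Omega>"
    unfolding A0_def A1_def using \<Omega> by (intro PV_residues_isomonodromic[OF sys]) auto
  define \<Delta> where "\<Delta> = p - s0"
  have \<Delta>: "\<Delta> = of_real pi * Complex (- t / pi) \<kappa>"
    by (simp add: \<Delta>_def p s0_def complex_eq_iff)
  have a: "\<bar>- t / pi\<bar> \<le> 1 / 10" using t by (simp add: field_simps)
  have p0: "s0 + \<Delta> = p" by (simp add: \<Delta>_def)
  obtain P where P: "mholo P UNIV" "\<And>\<xi>. det (P \<xi>) = 1"
    "\<And>k X. canonX \<theta> (A0 s0) (A1 s0) (exp s0) (pi / 2 + of_int k * pi - Im s0) X \<Longrightarrow>
       canonX \<theta> (A0 p) (A1 p) (exp p) (pi / 2 + of_int k * pi - Im p) (\<lambda>m. P ((exp m + 1) / 2) ** X m)"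
    by (rule canonX_transport[OF iso \<Omega>(2,3) _ \<Delta> pi_gt_zero a \<kappa>, unfolded p0, OF \<Omega>(4)]) (rule that, assumption+)
  have ep: "- exp p = exp s" using \<kappa> by (auto simp: p exp_add exp_minus exp_diff)
  define B0 where "B0 = residue0 \<theta>0 (- zf p - \<theta>0) (1 / uf p)"
  define B1 where "B1 = residue1 \<theta>0 \<theta>1 (- \<theta>) (1 / w p) (- zf p - \<theta>0) (1 / uf p)"
  have B: "B0 = conj_sigma1 (A0 p)" "B1 = conj_sigma1 (A1 p)"
    by (simp_all add: B0_def B1_def A0_def A1_def residue_reflect)
  \<comment> \<open>Turning x by \<kappa> pi turns the sectors back by the same angle. Member k + j
    of the transported family, with j = \<kappa>, therefore occupies sector k for x = exp s; member
    0 comes from X_1 = X_0 S_2 or X_-1 = X_0 S_1^-1.\<close>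
  define V where "V j k m = conj_sigma1 (P ((exp m + 1) / 2) ** X (k + j) m)" for j k m
  have V: "canonX (- \<theta>) B0 B1 (exp s) (pi / 2 + of_int k * pi - Im s) (V j k)" if "of_int j = \<kappa>" for j k
  proof -
    have "canonX \<theta> (A0 p) (A1 p) (exp p) (pi / 2 + of_int (k + j) * pi - Im p) (\<lambda>m. P ((exp m + 1) / 2) ** X (k + j) m)"
      by (rule P(3)) (use F in \<open>unfold canon_family_def, blast\<close>)
    from canonX_conj_sigma1[OF this]
    have "canonX (- \<theta>) B0 B1 (exp s) (pi / 2 + of_int (k + j) * pi - Im p) (V j k)"
      unfolding B V_def[abs_def] ep .
    also have "pi / 2 + of_int (k + j) * pi - Im p = pi / 2 + of_int k * pi - Im s"
      using that by (simp add: p algebra_simps)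
    finally show ?thesis .
  qed
  have con: "X 0 m = X (-1) m ** T1" "X 1 m = X 0 m ** T2" if "Re m > 0" for m
    using F that by (auto simp: canon_family_def)
  note st = canon_family_stokes(7,8)[OF F tr]
  note ex = canon_family_extra_stokes(1,2)[OF F tr, folded E_def E'_def]
  show "det T1 = 1" "det T2 = 1" by (rule st)+
  have reg: "canon_family (- \<theta>) B0 B1 s (V j) T1' T2' \<Longrightarrow> loop_data (Im s) (V j 0) N0' N1' \<Longrightarrow>
     has_monodromy_data \<theta>0 \<theta>1 (- \<theta>) s (1 / w p) (- zf p - \<theta>0) (1 / uf p) T1' T2' N0' N1'" for j T1' T2' N0' N1'
    unfolding has_monodromy_data_iff B0_def B1_def by blast
  show "has_monodromy_data \<theta>0 \<theta>1 (- \<theta>) s (1 / w p) (- zf p - \<theta>0) (1 / uf p)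
           (conj_sigma1 T2) (conj_sigma1 (E ** T1 ** E')) (conj_sigma1 (adj2 T2 ** N0 ** T2)) (conj_sigma1 (adj2 T2 ** N1 ** T2))"
    if "\<kappa> = 1"
  proof (rule reg)
    show "canon_family (- \<theta>) B0 B1 s (V 1) (conj_sigma1 T2) (conj_sigma1 (E ** T1 ** E'))"
      unfolding canon_family_def
    proof (intro conjI allI impI)
      fix k show "canonX (- \<theta>) B0 B1 (exp s) (pi / 2 + of_int k * pi - Im s) (V 1 k)" using V that by simp
    next
      fix m :: complex assume m: "Re m > 0"
      show "V 1 0 m = V 1 (-1) m ** conj_sigma1 T2" "V 1 1 m = V 1 0 m ** conj_sigma1 (E ** T1 ** E')"
        using con[OF m] ex(1)[OF m] unfolding V_def conj_sigma1_mult[symmetric] by (simp_all add: matrix_mul_assoc)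
    qed
    show "loop_data (Im s) (V 1 0) (conj_sigma1 (adj2 T2 ** N0 ** T2)) (conj_sigma1 (adj2 T2 ** N1 ** T2))"
      by (rule loop_data_transport[OF L P(1) st(2)]) (simp add: V_def con(2) matrix_mul_assoc)
  qed
  show "has_monodromy_data \<theta>0 \<theta>1 (- \<theta>) s (1 / w p) (- zf p - \<theta>0) (1 / uf p)
           (conj_sigma1 (E' ** T2 ** E)) (conj_sigma1 T1) (conj_sigma1 (T1 ** N0 ** adj2 T1)) (conj_sigma1 (T1 ** N1 ** adj2 T1))"
    if "\<kappa> = -1"
  proof (rule reg)
    show "canon_family (- \<theta>) B0 B1 s (V (-1)) (conj_sigma1 (E' ** T2 ** E)) (conj_sigma1 T1)"
      unfolding canon_family_def
    proof (intro conjI allI impI)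
      fix k show "canonX (- \<theta>) B0 B1 (exp s) (pi / 2 + of_int k * pi - Im s) (V (-1) k)" using V that by simp
    next
      fix m :: complex assume m: "Re m > 0"
      show "V (-1) 0 m = V (-1) (-1) m ** conj_sigma1 (E' ** T2 ** E)" "V (-1) 1 m = V (-1) 0 m ** conj_sigma1 T1"
        using con[OF m] ex(2)[OF m] unfolding V_def conj_sigma1_mult[symmetric] by (simp_all add: matrix_mul_assoc)
    qed
    have aT: "adj2 (adj2 T1) = T1" by (simp add: cmat_eq_iff)
    have "X (-1) m = X 0 m ** adj2 T1" if "Re m > 0" for m
      using con(1)[OF that] adj2_cancel(2)[OF st(1)] by (simp add: matrix_mul_assoc[symmetric])
    then show "loop_data (Im s) (V (-1) 0) (conj_sigma1 (T1 ** N0 ** adj2 T1)) (conj_sigma1 (T1 ** N1 ** adj2 T1))"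
      using loop_data_transport[OF L P(1), of "adj2 T1" "V (-1) 0"] st(1) by (simp add: V_def matrix_mul_assoc aT)
  qed
qed

section \<open>Reflection of the nonlinear system and of the scalar equation\<close>

lemma filterlim_at_shift:
  fixes f :: "complex \<Rightarrow> 'a"
  shows "filterlim f F (at (z + c)) \<longleftrightarrow> filterlim (\<lambda>s. f (s + c)) F (at z)"
  unfolding filterlim_at_to_0[of f F "z + c"] filterlim_at_to_0[of "\<lambda>s. f (s + c)" F z] by (simp add: add.assoc)

lemma nicely_meromorphic_shift:
  assumes "f nicely_meromorphic_on UNIV"
  shows "(\<lambda>s. f (s + c)) nicely_meromorphic_on UNIV"
proof -
  have "f meromorphic_on UNIV" using assms by (simp add: nicely_meromorphic_on_def)
  then have "(\<lambda>s. f (s + c)) meromorphic_on UNIV"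
    by (rule meromorphic_on_compose) (auto intro!: analytic_intros)
  then show ?thesis
    using assms unfolding nicely_meromorphic_on_def is_pole_def filterlim_at_shift[symmetric] by auto
qed

lemma nicely_meromorphic_recip:
  "f nicely_meromorphic_on UNIV \<Longrightarrow> (\<lambda>s. 1 / f s :: complex) nicely_meromorphic_on UNIV"
  using nicely_meromorphic_on_inverse[of f UNIV] by (simp add: inverse_eq_divide)

lemma analytic_shift_iff: "(\<lambda>s. f (s + c)) analytic_on {s} \<longleftrightarrow> f analytic_on {s + c}" for f :: "complex \<Rightarrow> complex"
proof
  assume "f analytic_on {s + c}"
  then show "(\<lambda>s. f (s + c)) analytic_on {s}"
    using analytic_on_compose[of "\<lambda>s. s + c" "{s}" f] by (simp add: o_def analytic_intros)
next
  assume "(\<lambda>s. f (s + c)) analytic_on {s}"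
  then show "f analytic_on {s + c}"
    using analytic_on_compose[of "\<lambda>s. s - c" "{s + c}" "\<lambda>s. f (s + c)"] by (simp add: o_def analytic_intros)
qed

lemma analytic_recip_shift_iff:
  fixes f :: "complex \<Rightarrow> complex"
  shows "(\<lambda>s. 1 / f (s + c)) analytic_on {s} \<and> 1 / f (s + c) \<noteq> 0 \<longleftrightarrow> f analytic_on {s + c} \<and> f (s + c) \<noteq> 0"
proof -
  have "(\<lambda>s. 1 / f (s + c)) analytic_on {s}" if "f analytic_on {s + c}" "f (s + c) \<noteq> 0"
    using that analytic_shift_iff[of f c s] by (auto intro!: analytic_intros)
  moreover have "f analytic_on {s + c}" if a: "(\<lambda>s. 1 / f (s + c)) analytic_on {s}" "1 / f (s + c) \<noteq> 0"
  proof -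
    have "(\<lambda>s. 1 / (1 / f (s + c))) analytic_on {s}" using a by (intro analytic_on_divide[OF analytic_on_const a(1)]) auto
    then show ?thesis using analytic_shift_iff[of f c s] by simp
  qed
  ultimately show ?thesis by auto
qed

lemma analytic_ev: "f analytic_on {s} \<Longrightarrow> \<forall>\<^sub>F v in nhds s. f analytic_on {v}" for f :: "complex \<Rightarrow> complex"
proof -
  assume "f analytic_on {s}"
  then obtain A where "open A" "s \<in> A" "f analytic_on A" using analytic_at_two analytic_at by (metis analytic_on_open)
  then show ?thesis by (auto simp: eventually_nhds intro: analytic_on_subset)
qed

lemma deriv_recip_shift:
  fixes f :: "complex \<Rightarrow> complex"
  assumes "f analytic_on {s + c}" "f (s + c) \<noteq> 0"
  shows "((\<lambda>s. 1 / f (s + c)) has_field_derivative - deriv f (s + c) / (f (s + c))\<^sup>2) (at s)"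
proof -
  have "(f has_field_derivative deriv f (s + c)) (at (s + c))"
    using assms(1) by (simp add: DERIV_deriv_iff_field_differentiable analytic_on_imp_differentiable_at)
  then have d: "((\<lambda>s. f (s + c)) has_field_derivative deriv f (s + c)) (at s)"
    by (simp add: DERIV_shift)
  show ?thesis using assms(2) by (auto intro!: derivative_eq_intros d simp: power2_eq_square)
qed

text \<open>At a pole of \<open>zf\<close> the expression - zf - \<theta>0 would take the value
  -\<theta>0 instead of 0. \<open>remove_sings\<close> restores the normalised value, and the second
  part shows that at regular points nothing has been altered.\<close>

lemma PV_system_reflect:
  assumes sys: "PV_system \<theta>0 \<theta>1 \<theta> w zf uf" and c: "exp c = -1"
  defines "zf' \<equiv> remove_sings (\<lambda>s. - zf (s + c) - \<theta>0)"
  shows "PV_system \<theta>0 \<theta>1 (- \<theta>) (\<lambda>s. 1 / w (s + c)) zf' (\<lambda>s. 1 / uf (s + c))"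
    and "regular_point (\<lambda>s. 1 / w (s + c)) zf' (\<lambda>s. 1 / uf (s + c)) s \<Longrightarrow> regular_point w zf uf (s + c) \<and> zf' s = - zf (s + c) - \<theta>0"
proof -
  define g where "g s = - zf (s + c) - \<theta>0" for s
  have nm: "w nicely_meromorphic_on UNIV" "zf nicely_meromorphic_on UNIV" "uf nicely_meromorphic_on UNIV"
    and nz: "\<exists>s. w s \<noteq> 0" "\<exists>s. uf s \<noteq> 0"
    using sys by (auto simp: PV_system_def)
  have gm: "g meromorphic_on UNIV"
    using nicely_meromorphic_shift[OF nm(2), of c] unfolding g_def[abs_def] nicely_meromorphic_on_def
    by (intro meromorphic_intros) auto
  have zf': "zf' = remove_sings g" by (simp add: zf'_def g_def[abs_def])
  have nm': "(\<lambda>s. 1 / w (s + c)) nicely_meromorphic_on UNIV" "zf' nicely_meromorphic_on UNIV" "(\<lambda>s. 1 / uf (s + c)) nicely_meromorphic_on UNIV"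
    unfolding zf' using nicely_meromorphic_recip nicely_meromorphic_shift nm remove_sings_nicely_meromorphic[OF gm] by blast+
  have reg: "regular_point w zf uf (s + c) \<and> g analytic_on {s} \<and> zf' s = - zf (s + c) - \<theta>0"
    if r: "regular_point (\<lambda>s. 1 / w (s + c)) zf' (\<lambda>s. 1 / uf (s + c)) s" for s
  proof -
    have wu: "w analytic_on {s + c} \<and> w (s + c) \<noteq> 0" "uf analytic_on {s + c} \<and> uf (s + c) \<noteq> 0"
      using r analytic_recip_shift_iff unfolding regular_point_def by blast+
    have za: "zf' analytic_on {s}" using r by (simp add: regular_point_def)
    \<comment> \<open>Were there a pole, the analytic function \<open>zf'\<close> would have to
      agree with - zf - \<theta>0 near it.\<close>
    have "\<not> is_pole zf (s + c)"
    proof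
      assume "is_pole zf (s + c)"
      then have pole: "is_pole (\<lambda>s. zf (s + c)) s" unfolding is_pole_def filterlim_at_shift .
      have "isolated_singularity_at g s" using gm by (meson UNIV_I meromorphic_on_altdef)
      from eventually_remove_sings_eq_at[OF this] have "\<forall>\<^sub>F v in at s. - zf' v - \<theta>0 = zf (v + c)"
        unfolding zf' by eventually_elim (simp add: g_def)
      then have "is_pole (\<lambda>s. - zf' s - \<theta>0) s" using pole is_pole_cong[of "\<lambda>s. - zf' s - \<theta>0" "\<lambda>s. zf (s + c)" s s] by auto
      moreover have "(\<lambda>s. - zf' s - \<theta>0) analytic_on {s}" using za by (auto intro!: analytic_intros)
      ultimately show False using analytic_at_imp_no_pole by blast
    qed
    then have z: "zf analytic_on {s + c}" using nm(2) nicely_meromorphic_on_imp_analytic_at by blast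
    then have "g analytic_on {s}" using analytic_shift_iff[of zf c s] unfolding g_def[abs_def] by (auto intro!: analytic_intros)
    then show ?thesis using wu z by (simp add: zf' remove_sings_at_analytic regular_point_def g_def)
  qed
  show "regular_point (\<lambda>s. 1 / w (s + c)) zf' (\<lambda>s. 1 / uf (s + c)) s \<Longrightarrow> regular_point w zf uf (s + c) \<and> zf' s = - zf (s + c) - \<theta>0"
    using reg by blast
  show "PV_system \<theta>0 \<theta>1 (- \<theta>) (\<lambda>s. 1 / w (s + c)) zf' (\<lambda>s. 1 / uf (s + c))"
    unfolding PV_system_def
  proof (intro conjI allI impI nm')
    show "\<exists>s. 1 / w (s + c) \<noteq> 0" "\<exists>s. 1 / uf (s + c) \<noteq> 0"
      using nz by (metis add_diff_cancel_right' diff_add_cancel divide_eq_0_iff one_neq_zero)+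
    fix s assume "regular_point (\<lambda>s. 1 / w (s + c)) zf' (\<lambda>s. 1 / uf (s + c)) s"
    note r = reg[OF this]
    define p where "p = s + c"
    have rp: "regular_point w zf uf p" using r by (simp add: p_def)
    then have ne: "w p \<noteq> 0" "uf p \<noteq> 0" and an: "w analytic_on {p}" "zf analytic_on {p}" "uf analytic_on {p}" by (auto simp: regular_point_def)
    have zs: "zf' s = - zf p - \<theta>0" using r by (simp add: p_def)
    have dz: "deriv zf' s = - deriv zf p"
    proof -
      have "\<forall>\<^sub>F v in nhds s. g analytic_on {v}" using r by (intro analytic_ev) auto
      then have "\<forall>\<^sub>F v in nhds s. zf' v = g v" unfolding zf' by eventually_elim (rule remove_sings_at_analytic)
      then have "deriv zf' s = deriv g s" by (intro deriv_cong_ev) auto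
      also have "(zf has_field_derivative deriv zf p) (at (s + c))"
        using an(2) by (simp add: DERIV_deriv_iff_field_differentiable analytic_on_imp_differentiable_at p_def)
      then have "((\<lambda>s. zf (s + c)) has_field_derivative deriv zf p) (at s)" by (simp add: DERIV_shift)
      then have "(g has_field_derivative - deriv zf p) (at s)" unfolding g_def[abs_def] by (auto intro!: derivative_eq_intros)
      then have "deriv g s = - deriv zf p" by (rule DERIV_imp_deriv)
      finally show ?thesis .
    qed
    have dw: "deriv (\<lambda>s. 1 / w (s + c)) s = - deriv w p / (w p)\<^sup>2" "deriv (\<lambda>s. 1 / uf (s + c)) s = - deriv uf p / (uf p)\<^sup>2"
      using deriv_recip_shift[of w s c] deriv_recip_shift[of uf s c] an ne by (auto simp: p_def intro: DERIV_imp_deriv)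
    have xd: "exp s * xderiv f s = deriv f s" "exp s * (xderiv f s / a) = deriv f s / a" for f a s by (simp_all add: xderiv_def)
    have ep: "exp s = - exp p" by (simp add: p_def exp_add c)
    define y where "y = w p" define z where "z = zf p" define u where "u = uf p"
    define x where "x = exp p"
    have eqs: "deriv w p = x * y - 2 * z * (y - 1)\<^sup>2 - (y - 1) * ((\<theta>0 - \<theta>1 + \<theta>) / 2 * y - (3 * \<theta>0 + \<theta>1 + \<theta>) / 2)"
      "deriv zf p = y * z * (z + (\<theta>0 - \<theta>1 + \<theta>) / 2) - 1 / y * (z + \<theta>0) * (z + (\<theta>0 + \<theta>1 + \<theta>) / 2)"
      "deriv uf p / u = - 2 * z - \<theta>0 + y * (z + (\<theta>0 - \<theta>1 + \<theta>) / 2) + 1 / y * (z + (\<theta>0 + \<theta>1 + \<theta>) / 2)"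
      using sys[unfolded PV_system_def Let_def] rp unfolding xd y_def z_def u_def x_def by blast+
    have ne': "y \<noteq> 0" "u \<noteq> 0" using ne by (simp_all add: y_def u_def)
    have du: "(- deriv uf p / u\<^sup>2) / (1 / u) = - (deriv uf p / u)" using ne' by (simp add: field_simps power2_eq_square)
    show "let x = exp s; y = 1 / w (s + c); z = zf' s; u = 1 / uf (s + c)
        in x * xderiv (\<lambda>s. 1 / w (s + c)) s =
              x * y - 2 * z * (y - 1)\<^sup>2 - (y - 1) * ((\<theta>0 - \<theta>1 + - \<theta>) / 2 * y - (3 * \<theta>0 + \<theta>1 + - \<theta>) / 2) \<and>
            x * xderiv zf' s =
              y * z * (z + (\<theta>0 - \<theta>1 + - \<theta>) / 2) - 1 / y * (z + \<theta>0) * (z + (\<theta>0 + \<theta>1 + - \<theta>) / 2) \<and>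
            x * (xderiv (\<lambda>s. 1 / uf (s + c)) s / u) =
              - 2 * z - \<theta>0 + y * (z + (\<theta>0 - \<theta>1 + - \<theta>) / 2) + 1 / y * (z + (\<theta>0 + \<theta>1 + - \<theta>) / 2)"
      unfolding Let_def xd unfolding dw dz zs p_def[symmetric] y_def[symmetric] z_def[symmetric] u_def[symmetric] ep x_def[symmetric] du eqs
      using ne' by (intro conjI) (simp_all add: divide_simps, simp_all add: algebra_simps power2_eq_square)
  qed
qed

lemma xderiv_xderiv:
  assumes "f analytic_on {s}"
  shows "xderiv (xderiv f) s = (deriv (deriv f) s - deriv f s) / (exp s)\<^sup>2"
proof -
  have "(deriv f has_field_derivative deriv (deriv f) s) (at s)"
    using analytic_deriv[OF assms] by (simp add: DERIV_deriv_iff_field_differentiable analytic_on_imp_differentiable_at)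
  then have "((\<lambda>s. deriv f s / exp s) has_field_derivative (deriv (deriv f) s * exp s - deriv f s * exp s) / (exp s * exp s)) (at s)"
    by (auto intro!: derivative_eq_intros)
  then have "deriv (xderiv f) s = (deriv (deriv f) s * exp s - deriv f s * exp s) / (exp s * exp s)"
    unfolding xderiv_def[abs_def] by (rule DERIV_imp_deriv)
  then have "xderiv (xderiv f) s = (deriv (deriv f) s * exp s - deriv f s * exp s) / (exp s * exp s) / exp s"
    by (simp add: xderiv_def[of "xderiv f"])
  also have "\<dots> = (deriv (deriv f) s - deriv f s) / (exp s)\<^sup>2"
    by (simp add: power2_eq_square divide_simps) (simp add: algebra_simps)?
  finally show ?thesis .
qed

text \<open>Changing the sign of \<theta>_\<infinity> exchanges the constants a and b, and y -> 1/y
  exchanges the terms that carry them. The term c y / x is the one odd in x, and x -> -x compensates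
  its sign.\<close>

lemma PV_solution_reflect:
  assumes sol: "PV_solution \<theta>0 \<theta>1 \<theta> w" and c: "exp c = -1"
  shows "PV_solution \<theta>0 \<theta>1 (- \<theta>) (\<lambda>s. 1 / w (s + c))"
  unfolding PV_solution_def
proof (intro conjI allI impI)
  have nm: "w nicely_meromorphic_on UNIV" and nz: "\<exists>s. w s \<noteq> 0" "\<exists>s. w s \<noteq> 1" using sol by (auto simp: PV_solution_def)
  show "(\<lambda>s. 1 / w (s + c)) nicely_meromorphic_on UNIV"
    by (intro nicely_meromorphic_recip nicely_meromorphic_shift nm)
  show "\<exists>s. 1 / w (s + c) \<noteq> 0"
    using nz(1) by (metis add_diff_cancel_right' diff_add_cancel divide_eq_0_iff one_neq_zero)
  show "\<exists>s. 1 / w (s + c) \<noteq> 1"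
  proof -
    obtain s where "w s \<noteq> 1" using nz(2) by blast
    then show ?thesis by (intro exI[of _ "s - c"]) auto
  qed
  fix s assume s: "(\<lambda>s. 1 / w (s + c)) analytic_on {s} \<and> 1 / w (s + c) \<noteq> 0 \<and> 1 / w (s + c) \<noteq> 1"
  define p where "p = s + c"
  have an: "w analytic_on {p}" "w p \<noteq> 0" using s analytic_recip_shift_iff[of w c s] by (auto simp: p_def)
  have n1: "w p \<noteq> 1" using s by (auto simp: p_def)
  have ep: "exp s = - exp p" by (simp add: p_def exp_add c)
  define y where "y = w p" define W1 where "W1 = deriv w p" define W2 where "W2 = deriv (deriv w) p"
  define x where "x = exp p"
  have "(let x = exp p; y = w p; y' = xderiv w p; y'' = xderiv (xderiv w) p;
             a = (\<theta>0 - \<theta>1 + \<theta>)\<^sup>2 / 8; b = (\<theta>0 - \<theta>1 - \<theta>)\<^sup>2 / 8; c = 1 - \<theta>0 - \<theta>1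
         in y'' = (1 / (2 * y) + 1 / (y - 1)) * y'\<^sup>2 - y' / x
                  + (y - 1)\<^sup>2 / x\<^sup>2 * (a * y - b / y) + c * y / x
                  - y * (y + 1) / (2 * (y - 1)))"
    using sol an n1 unfolding PV_solution_def by blast
  then have eq: "(W2 - W1) / x\<^sup>2 = (1 / (2 * y) + 1 / (y - 1)) * (W1 / x)\<^sup>2 - W1 / x / x
                  + (y - 1)\<^sup>2 / x\<^sup>2 * ((\<theta>0 - \<theta>1 + \<theta>)\<^sup>2 / 8 * y - (\<theta>0 - \<theta>1 - \<theta>)\<^sup>2 / 8 / y) + (1 - \<theta>0 - \<theta>1) * y / x
                  - y * (y + 1) / (2 * (y - 1))"
    unfolding Let_def xderiv_xderiv[OF an(1)] xderiv_def[of w] y_def W1_def W2_def x_def .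
  have x0: "x \<noteq> 0" "y \<noteq> 0" "y - 1 \<noteq> 0" "1 - y \<noteq> 0" using an n1 by (auto simp: x_def y_def)
  define v where "v s = 1 / w (s + c)" for s
  have van: "v analytic_on {s}" using s by (simp add: v_def[abs_def])
  have "isCont w p" using an(1) by (rule analytic_at_imp_isCont)
  then have "\<forall>\<^sub>F q in nhds p. w q \<noteq> 0" using an(2) by (simp add: isCont_def tendsto_imp_eventually_ne eventually_nhds_conv_at)
  then have evp: "\<forall>\<^sub>F q in nhds p. w analytic_on {q} \<and> w q \<noteq> 0" using analytic_ev[OF an(1)] by eventually_elim simp
  have "filterlim (\<lambda>q. q + c) (nhds p) (nhds s)" unfolding p_def by (intro tendsto_intros filterlim_ident)
  from eventually_compose_filterlim[OF evp this]
  have "\<forall>\<^sub>F q in nhds s. w analytic_on {q + c} \<and> w (q + c) \<noteq> 0" .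
  then have evd: "\<forall>\<^sub>F q in nhds s. deriv v q = - deriv w (q + c) / (w (q + c))\<^sup>2"
    unfolding v_def[abs_def] by eventually_elim (rule DERIV_imp_deriv[OF deriv_recip_shift], auto)
  have d1: "deriv v s = - W1 / y\<^sup>2" using eventually_nhds_x_imp_x[OF evd] by (simp add: W1_def y_def p_def)
  have d2: "deriv (deriv v) s = - W2 / y\<^sup>2 + 2 * W1\<^sup>2 / y ^ 3"
  proof -
    have "deriv (deriv v) s = deriv (\<lambda>q. - deriv w (q + c) / (w (q + c))\<^sup>2) s" by (rule deriv_cong_ev[OF evd refl])
    also have dw: "(w has_field_derivative W1) (at (s + c))" "(deriv w has_field_derivative W2) (at (s + c))"
      using an(1) analytic_deriv[OF an(1)] unfolding W1_def W2_def p_def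
      by (simp_all add: DERIV_deriv_iff_field_differentiable analytic_on_imp_differentiable_at)
    have dw': "((\<lambda>q. w (q + c)) has_field_derivative W1) (at s)" "((\<lambda>q. deriv w (q + c)) has_field_derivative W2) (at s)"
      using dw by (simp_all add: DERIV_shift)
    have "((\<lambda>q. - deriv w (q + c) / (w (q + c))\<^sup>2) has_field_derivative - W2 / y\<^sup>2 + 2 * W1\<^sup>2 / y ^ 3) (at s)"
    proof -
      have wp: "w (s + c) = y" "deriv w (s + c) = W1" by (simp_all add: y_def W1_def p_def)
      have d: "((\<lambda>q. (w (q + c))\<^sup>2) has_field_derivative 2 * y * W1) (at s)"
        using DERIV_power[OF dw'(1), of 2] wp by (simp add: mult_ac)
      have "(w (s + c))\<^sup>2 \<noteq> 0" using x0(2) wp by simp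
      from DERIV_divide[OF DERIV_minus[OF dw'(2)] d this] show ?thesis
        unfolding wp by (rule DERIV_cong) (use x0(2) in \<open>simp add: field_simps power2_eq_square power3_eq_cube\<close>)
    qed
    then have "deriv (\<lambda>q. - deriv w (q + c) / (w (q + c))\<^sup>2) s = - W2 / y\<^sup>2 + 2 * W1\<^sup>2 / y ^ 3" by (rule DERIV_imp_deriv)
    finally show ?thesis .
  qed
  have vs: "v s = 1 / y" by (simp add: v_def y_def p_def)
  have W2: "W2 = W1 + x\<^sup>2 * ((1 / (2 * y) + 1 / (y - 1)) * (W1 / x)\<^sup>2 - W1 / x / x
                  + (y - 1)\<^sup>2 / x\<^sup>2 * ((\<theta>0 - \<theta>1 + \<theta>)\<^sup>2 / 8 * y - (\<theta>0 - \<theta>1 - \<theta>)\<^sup>2 / 8 / y) + (1 - \<theta>0 - \<theta>1) * y / x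
                  - y * (y + 1) / (2 * (y - 1)))"
    unfolding eq[symmetric] using x0 by simp
  have "let x = exp s; y = v s; y' = xderiv v s; y'' = xderiv (xderiv v) s;
             a = (\<theta>0 - \<theta>1 + - \<theta>)\<^sup>2 / 8; b = (\<theta>0 - \<theta>1 - - \<theta>)\<^sup>2 / 8; c = 1 - \<theta>0 - \<theta>1
         in y'' = (1 / (2 * y) + 1 / (y - 1)) * y'\<^sup>2 - y' / x
                  + (y - 1)\<^sup>2 / x\<^sup>2 * (a * y - b / y) + c * y / x
                  - y * (y + 1) / (2 * (y - 1))"
    unfolding Let_def xderiv_xderiv[OF van] xderiv_def[of v] d1 d2 vs ep x_def[symmetric]
  proof -
    \<comment> \<open>All denominators become inverses with polynomial relations, so that the
      identity for the second derivative can be left to \<open>algebra\<close>.\<close>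
    define t where "t = inverse y" define q where "q = inverse (y - 1)" define X where "X = inverse x"
    define h where "h = inverse (2::complex)" define e where "e = inverse (8::complex)"
    have rel: "y * t = 1" "(y - 1) * q = 1" "x * X = 1" "2 * h = 1" "8 * e = 1"
      using x0 by (simp_all add: t_def q_def X_def h_def e_def)
    have inv: "inverse (t - 1) = - (y * q)" using x0 by (simp add: t_def q_def field_simps)
    have inv2: "inverse t = y" "inverse (2 * t) = h * y" "inverse (2 * (t - 1)) = - (h * y * q)" "inverse (2 * y) = h * t" "inverse (2 * (y - 1)) = h * q"
    proof -
      have h2: "inverse (2 * a) = h * inverse a" for a by (simp only: h_def inverse_mult_distrib)
      show "inverse t = y" by (simp add: t_def)
      then show "inverse (2 * t) = h * y" by (simp only: h2)
      show "inverse (2 * (t - 1)) = - (h * y * q)" by (simp only: h2 inv) simp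
      show "inverse (2 * y) = h * t" "inverse (2 * (y - 1)) = h * q" by (simp_all only: h2 t_def q_def)
    qed
    note W2' = W2[unfolded divide_inverse, folded t_def q_def X_def h_def e_def, unfolded inv2,
        unfolded power_inverse[symmetric], folded X_def]
    show "(- W2 / y\<^sup>2 + 2 * W1\<^sup>2 / y ^ 3 - - W1 / y\<^sup>2) / (- x)\<^sup>2 =
        (1 / (2 * (1 / y)) + 1 / (1 / y - 1)) * (- W1 / y\<^sup>2 / - x)\<^sup>2 - - W1 / y\<^sup>2 / - x / - x +
        (1 / y - 1)\<^sup>2 / (- x)\<^sup>2 * ((\<theta>0 - \<theta>1 + - \<theta>)\<^sup>2 / 8 * (1 / y) - (\<theta>0 - \<theta>1 - - \<theta>)\<^sup>2 / 8 / (1 / y)) +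
        (1 - \<theta>0 - \<theta>1) * (1 / y) / - x - 1 / y * (1 / y + 1) / (2 * (1 / y - 1))"
      unfolding divide_inverse mult_1_left inverse_minus_eq power2_minus power_inverse[symmetric] t_def[symmetric] X_def[symmetric] inv inv2 e_def[symmetric]
      using rel W2' by algebra
  qed
  then show "let x = exp s; y = 1 / w (s + c); y' = xderiv (\<lambda>s. 1 / w (s + c)) s; y'' = xderiv (xderiv (\<lambda>s. 1 / w (s + c))) s;
             a = (\<theta>0 - \<theta>1 + - \<theta>)\<^sup>2 / 8; b = (\<theta>0 - \<theta>1 - - \<theta>)\<^sup>2 / 8; c = 1 - \<theta>0 - \<theta>1
         in y'' = (1 / (2 * y) + 1 / (y - 1)) * y'\<^sup>2 - y' / x
                  + (y - 1)\<^sup>2 / x\<^sup>2 * (a * y - b / y) + c * y / x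
                  - y * (y + 1) / (2 * (y - 1))"
    unfolding v_def[abs_def] .
qed

section \<open>Continuation around the singular points on the real axis\<close>

lemma midentity:
  assumes "mholo F S" "mholo G S" "open S" "connected S" "open T" "T \<subseteq> S" "T \<noteq> {}"
    "\<And>z. z \<in> T \<Longrightarrow> F z = G z" "z \<in> S"
  shows "F z = G z"
proof -
  have "F z $ i $ j = G z $ i $ j" for i j
    by (rule analytic_continuation_open[of T S]) (use assms mholoD in auto)
  then show ?thesis by (simp add: vec_eq_iff)
qed

text \<open>Analytic continuation along \<open>p \<circ> z\<close> is unique: \<open>H\<close> is the single-valued lift of the continued germ.\<close>
lemma continuation_along_lift:
  fixes f :: "real \<Rightarrow> complex \<Rightarrow> cmat"
  assumes an: "\<And>\<tau> i j. \<tau> \<in> {0..1} \<Longrightarrow> (\<lambda>v. f \<tau> v $ i $ j) analytic_on {\<gamma> \<tau>}"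
    and loc: "\<And>\<tau>. \<tau> \<in> {0..1} \<Longrightarrow> \<exists>\<epsilon>>0. \<forall>\<tau>'\<in>{0..1}. \<bar>\<tau>' - \<tau>\<bar> < \<epsilon> \<longrightarrow> (\<forall>\<^sub>F v in nhds (\<gamma> \<tau>'). f \<tau>' v = f \<tau> v)"
    and I: "{a..b} \<subseteq> {0..1}" and z: "continuous_on {a..b} z" and \<gamma>: "\<And>\<tau>. \<tau> \<in> {a..b} \<Longrightarrow> \<gamma> \<tau> = p (z \<tau>)"
    and p: "p holomorphic_on UNIV" and Z: "open Z" "mholo H Z" "\<And>\<tau>. \<tau> \<in> {a..b} \<Longrightarrow> z \<tau> \<in> Z"
    and start: "\<tau>0 \<in> {a..b}" "\<forall>\<^sub>F \<zeta> in nhds (z \<tau>0). f \<tau>0 (p \<zeta>) = H \<zeta>" and \<tau>: "\<tau> \<in> {a..b}"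
  shows "\<forall>\<^sub>F \<zeta> in nhds (z \<tau>). f \<tau> (p \<zeta>) = H \<zeta>"
proof -
  define P where "P \<tau> \<longleftrightarrow> (\<forall>\<^sub>F \<zeta> in nhds (z \<tau>). f \<tau> (p \<zeta>) = H \<zeta>)" for \<tau>
  have contp: "filterlim p (nhds (p \<zeta>)) (nhds \<zeta>)" for \<zeta>
  proof -
    have "isCont p \<zeta>" using holomorphic_on_imp_continuous_on[OF p] by (simp add: continuous_on_eq_continuous_at)
    then show ?thesis by (simp add: isCont_def tendsto_at_iff_tendsto_nhds)
  qed
  \<comment> \<open>Agreement of the continued germ with \<open>H\<close> is locally constant in
    \<tau>: on a small ball the identity theorem makes it independent of the point at which it is
    tested.\<close>
  have "P constant_on {a..b}"
  proof (rule locally_constant_imp_constant[OF connected_Icc])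
    fix \<tau> assume t: "\<tau> \<in> {a..b}"
    then have t01: "\<tau> \<in> {0..1}" using I by auto
    obtain \<epsilon>1 where e1: "\<epsilon>1 > 0" "\<And>\<tau>'. \<tau>' \<in> {0..1} \<Longrightarrow> \<bar>\<tau>' - \<tau>\<bar> < \<epsilon>1 \<Longrightarrow> (\<forall>\<^sub>F v in nhds (\<gamma> \<tau>'). f \<tau>' v = f \<tau> v)"
      using loc[OF t01] by blast
    have "\<exists>e>0. (\<lambda>v. f \<tau> v $ i $ j) holomorphic_on ball (\<gamma> \<tau>) e" for i j
      using an[OF t01, of i j] analytic_at_ball[of "\<lambda>v. f \<tau> v $ i $ j" "\<gamma> \<tau>"] by blast
    then obtain e where e: "\<And>i j. e i j > 0" "\<And>i j. (\<lambda>v. f \<tau> v $ i $ j) holomorphic_on ball (\<gamma> \<tau>) (e i j)" by metis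
    define d where "d = min (min (e 1 1) (e 1 2)) (min (e 2 1) (e 2 2))"
    have d: "d > 0" "ball (\<gamma> \<tau>) d \<subseteq> ball (\<gamma> \<tau>) (e i j)" for i j
    proof -
      show "d > 0" using e(1) by (simp add: d_def)
      have "d \<le> e i j" using exhaust_2[of i] exhaust_2[of j] by (auto simp: d_def)
      then show "ball (\<gamma> \<tau>) d \<subseteq> ball (\<gamma> \<tau>) (e i j)" by (rule subset_ball)
    qed
    have hf: "mholo (f \<tau>) (ball (\<gamma> \<tau>) d)" unfolding mholo_def using e(2) d(2) holomorphic_on_subset by blast
    have "open (p -` ball (\<gamma> \<tau>) d)" using holomorphic_on_imp_continuous_on[OF p] by (intro continuous_open_vimage) (auto simp: continuous_on_eq_continuous_at)
    then have "open (Z \<inter> p -` ball (\<gamma> \<tau>) d)" using Z(1) by blast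
    moreover have "z \<tau> \<in> Z \<inter> p -` ball (\<gamma> \<tau>) d" using Z(3)[OF t] \<gamma>[OF t] d(1) by simp
    ultimately obtain r where r: "r > 0" "ball (z \<tau>) r \<subseteq> Z \<inter> p -` ball (\<gamma> \<tau>) d" using open_contains_ball by metis
    define B where "B = ball (z \<tau>) r"
    have hH: "mholo H B" using Z(2) r(2) unfolding B_def by (meson Int_lower1 mholo_subset subset_trans)
    have hfp: "mholo (\<lambda>\<zeta>. f \<tau> (p \<zeta>)) B"
      by (rule mholo_compose[OF hf]) (use p r(2) in \<open>auto simp: B_def intro: holomorphic_on_subset\<close>)
    have B: "open B" "connected B" by (simp_all add: B_def)
    have eqB: "(\<forall>\<^sub>F \<zeta> in nhds \<zeta>0. f \<tau> (p \<zeta>) = H \<zeta>) \<longleftrightarrow> (\<forall>\<zeta>\<in>B. f \<tau> (p \<zeta>) = H \<zeta>)" if "\<zeta>0 \<in> B" for \<zeta>0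
    proof
      assume "\<forall>\<^sub>F \<zeta> in nhds \<zeta>0. f \<tau> (p \<zeta>) = H \<zeta>"
      then obtain T where T: "open T" "\<zeta>0 \<in> T" "\<And>\<zeta>. \<zeta> \<in> T \<Longrightarrow> f \<tau> (p \<zeta>) = H \<zeta>" unfolding eventually_nhds by blast
      show "\<forall>\<zeta>\<in>B. f \<tau> (p \<zeta>) = H \<zeta>"
      proof
        fix \<zeta> assume "\<zeta> \<in> B"
        then show "f \<tau> (p \<zeta>) = H \<zeta>"
          by (rule midentity[OF hfp hH B, of "T \<inter> B", rotated -1]) (use T B that in auto)
      qed
    next
      assume "\<forall>\<zeta>\<in>B. f \<tau> (p \<zeta>) = H \<zeta>"
      then show "\<forall>\<^sub>F \<zeta> in nhds \<zeta>0. f \<tau> (p \<zeta>) = H \<zeta>"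
        using eventually_nhds_in_open[OF B(1) that] by (auto elim!: eventually_mono)
    qed
    obtain \<epsilon>2 where e2: "\<epsilon>2 > 0" "\<And>\<tau>'. \<tau>' \<in> {a..b} \<Longrightarrow> \<bar>\<tau>' - \<tau>\<bar> < \<epsilon>2 \<Longrightarrow> z \<tau>' \<in> B"
      using z[unfolded continuous_on_iff, rule_format, OF t r(1)] unfolding B_def by (auto simp: dist_commute dist_real_def)
    have "P \<tau>' = P \<tau>" if "\<tau>' \<in> {a..b} \<inter> ball \<tau> (min \<epsilon>1 \<epsilon>2)" for \<tau>'
    proof -
      have t': "\<tau>' \<in> {a..b}" "\<bar>\<tau>' - \<tau>\<bar> < \<epsilon>1" "\<bar>\<tau>' - \<tau>\<bar> < \<epsilon>2" using that by (auto simp: dist_real_def)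
      have "\<forall>\<^sub>F v in nhds (p (z \<tau>')). f \<tau>' v = f \<tau> v" using e1(2)[of \<tau>'] t' I \<gamma>[OF t'(1)] by auto
      from eventually_compose_filterlim[OF this contp]
      have ev: "\<forall>\<^sub>F \<zeta> in nhds (z \<tau>'). f \<tau>' (p \<zeta>) = f \<tau> (p \<zeta>)" .
      have "P \<tau>' \<longleftrightarrow> (\<forall>\<^sub>F \<zeta> in nhds (z \<tau>'). f \<tau> (p \<zeta>) = H \<zeta>)"
        unfolding P_def by (rule eventually_cong[OF ev]) simp
      also have "\<dots> \<longleftrightarrow> P \<tau>" unfolding P_def using eqB[OF e2(2)[OF t'(1,3)]] eqB[OF e2(2)[OF t]] e2(1) by simp
      finally show ?thesis by simp
    qed
    moreover have "openin (top_of_set {a..b}) ({a..b} \<inter> ball \<tau> (min \<epsilon>1 \<epsilon>2))" by (rule openin_open_Int) simp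
    moreover have "\<tau> \<in> {a..b} \<inter> ball \<tau> (min \<epsilon>1 \<epsilon>2)" using t e1(1) e2(1) by simp
    ultimately show "\<exists>T. openin (top_of_set {a..b}) T \<and> \<tau> \<in> T \<and> (\<forall>x\<in>T. P x = P \<tau>)" by blast
  qed
  then show ?thesis using start \<tau> unfolding constant_on_def P_def by metis
qed

text \<open>On the two straight pieces the germ is compared with \<open>F\<close> on the domain
  \<open>D\<close>, on the circle with the lift \<open>H\<close> in the coordinate \<zeta> = ln
  (\<eta> - a). The circle adds 2 pi i to \<zeta>, and on the way back the germ at the end of the
  loop is known to be \<open>F\<close> times \<open>M\<close>.\<close>

lemma lasso_continuation:
  fixes H :: "complex \<Rightarrow> cmat"
  assumes con: "continues_along (lasso b a \<rho>) F0 G0" and \<rho>: "0 < \<rho>" "ln \<rho> < c"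
  defines "\<alpha> \<equiv> Arg (b - a)"
  defines "\<zeta>0 \<equiv> Complex (ln \<rho>) \<alpha>"
  assumes D: "open D" "mholo F D" "closed_segment b (a + of_real \<rho> * cis \<alpha>) \<subseteq> D"
    and F0: "\<forall>\<^sub>F v in nhds b. F0 v = F v" and G0: "\<forall>\<^sub>F v in nhds b. G0 v = F v ** M"
    and H: "mholo H {\<zeta>. Re \<zeta> < c}" "\<forall>\<^sub>F \<zeta> in nhds \<zeta>0. H \<zeta> = F (a + exp \<zeta>)"
  shows "\<forall>\<^sub>F \<zeta> in nhds \<zeta>0. H (\<zeta> + 2 * of_real pi * \<i>) = F (a + exp \<zeta>) ** M"
proof -
  define q where "q = a + of_real \<rho> * cis \<alpha>"
  define \<gamma> where "\<gamma> = lasso b a \<rho>"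
  have \<gamma>eq: "\<gamma> = linepath b q +++ (part_circlepath a \<rho> \<alpha> (\<alpha> + 2 * pi) +++ linepath q b)"
    by (simp add: \<gamma>_def lasso_def Let_def q_def \<alpha>_def)
  obtain f where f:
    "\<And>\<tau> i j. \<tau> \<in> {0..1} \<Longrightarrow> (\<lambda>v. f \<tau> v $ i $ j) analytic_on {\<gamma> \<tau>}"
    "\<And>\<tau>. \<tau> \<in> {0..1} \<Longrightarrow> \<exists>\<epsilon>>0. \<forall>\<tau>'\<in>{0..1}. \<bar>\<tau>' - \<tau>\<bar> < \<epsilon> \<longrightarrow> (\<forall>\<^sub>F v in nhds (\<gamma> \<tau>'). f \<tau>' v = f \<tau> v)"
    and f01: "\<forall>\<^sub>F v in nhds b. f 0 v = F0 v" "\<forall>\<^sub>F v in nhds b. f 1 v = G0 v"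
  proof -
    have g: "\<gamma> 0 = b" "\<gamma> 1 = b" by (simp_all add: \<gamma>_def)
    from con show thesis unfolding continues_along_def \<gamma>_def[symmetric] g using that by blast
  qed
  have exp\<zeta>0: "a + exp \<zeta>0 = q" unfolding q_def \<zeta>0_def using \<rho>(1) by (subst exp_eq_polar) simp
  \<comment> \<open>Joining the three pieces gives the first segment the times [0, 1/2], the circle
    [1/2, 3/4] and the return [3/4, 1].\<close>
  have g1: "\<gamma> \<tau> = linepath b q (2 * \<tau>)" if "\<tau> \<in> {0..1/2}" for \<tau> using that by (simp add: \<gamma>eq joinpaths_def)
  have g2: "\<gamma> \<tau> = a + exp (Complex (ln \<rho>) (\<alpha> + 2 * pi * (4 * \<tau> - 2)))" if "\<tau> \<in> {1/2..3/4}" for \<tau>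
  proof -
    have e: "exp (Complex (ln \<rho>) (\<alpha> + 2 * pi * (4 * \<tau> - 2))) = of_real \<rho> * cis (\<alpha> + 2 * pi * (4 * \<tau> - 2))"
      using \<rho>(1) by (subst exp_eq_polar) simp
    show ?thesis
    proof (cases "\<tau> = 1/2")
      case True
      show ?thesis unfolding e by (simp add: True \<gamma>eq joinpaths_def linepath_def q_def)
    next
      case False
      then have "\<gamma> \<tau> = part_circlepath a \<rho> \<alpha> (\<alpha> + 2 * pi) (2 * (2 * \<tau> - 1))" using that by (simp add: \<gamma>eq joinpaths_def)
      then show ?thesis unfolding e part_circlepath_def linepath_def
        by (simp add: cis_conv_exp scaleR_conv_of_real algebra_simps)
    qed
  qed
  have g3: "\<gamma> \<tau> = linepath q b (4 * \<tau> - 3)" if "\<tau> \<in> {3/4..1}" for \<tau>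
  proof (cases "\<tau> = 3/4")
    case True
    have "\<gamma> (3/4) = a + exp (Complex (ln \<rho>) (\<alpha> + 2 * pi))" using g2[of "3/4"] by simp
    also have "Complex (ln \<rho>) (\<alpha> + 2 * pi) = \<zeta>0 + 2 * of_real pi * \<i>" by (simp add: \<zeta>0_def complex_eq_iff)
    also have "a + exp (\<zeta>0 + 2 * of_real pi * \<i>) = q" using exp\<zeta>0 by (simp add: exp_add)
    finally show ?thesis unfolding True by (simp add: linepath_def)
  next
    case False
    then show ?thesis using that by (simp add: \<gamma>eq joinpaths_def)
  qed
  have seg: "linepath b q t \<in> D" "linepath q b t \<in> D" if "t \<in> {0..1}" for t
    using D(3) that linepath_in_path[of t b q] linepath_in_path[of t q b] unfolding q_def[symmetric] by (auto simp: closed_segment_commute)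
  have F1: "\<forall>\<^sub>F v in nhds (linepath b q (2 * (1/2))). f (1/2) v = F v"
    by (rule continuation_along_lift[where f = f and \<gamma> = \<gamma> and a = 0 and b = "1/2" and p = "\<lambda>v. v" and ?\<tau>0.0 = 0 and Z = D, OF f])
       (use D seg g1 eventually_conj[OF f01(1) F0] in \<open>auto intro!: continuous_intros simp: linepath_def elim!: eventually_mono\<close>)
  then have F1: "\<forall>\<^sub>F v in nhds (a + exp \<zeta>0). f (1/2) v = F v" by (simp add: exp\<zeta>0 linepath_def)
  have lim: "filterlim (\<lambda>\<zeta>. a + exp \<zeta>) (nhds (a + exp \<zeta>0)) (nhds \<zeta>0)" by (intro tendsto_intros filterlim_ident)
  have F1': "\<forall>\<^sub>F \<zeta> in nhds \<zeta>0. f (1/2) (a + exp \<zeta>) = H \<zeta>"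
    using eventually_compose_filterlim[OF F1 lim] H(2) by eventually_elim simp
  have F2: "\<forall>\<^sub>F \<zeta> in nhds (Complex (ln \<rho>) (\<alpha> + 2 * pi * (4 * (3/4) - 2))). f (3/4) (a + exp \<zeta>) = H \<zeta>"
    by (rule continuation_along_lift[where f = f and \<gamma> = \<gamma> and a = "1/2" and b = "3/4" and p = "\<lambda>\<zeta>. a + exp \<zeta>" and ?\<tau>0.0 = "1/2" and Z = "{\<zeta>. Re \<zeta> < c}" and z = "\<lambda>\<tau>. Complex (ln \<rho>) (\<alpha> + 2 * pi * (4 * \<tau> - 2))", OF f])
       (use H(1) g2 \<rho>(2) F1' in \<open>auto intro!: continuous_intros holomorphic_intros open_halfspace_Re_lt simp: \<zeta>0_def\<close>)
  have seg3: "(4 - 4 * \<tau>) *\<^sub>R q + (4 * \<tau> - 3) *\<^sub>R b \<in> D" if "3 \<le> \<tau> * 4" "\<tau> \<le> 1" for \<tau>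
    using seg(2)[of "4 * \<tau> - 3"] that by (simp add: linepath_def)
  have F3: "\<forall>\<^sub>F v in nhds (linepath q b (4 * (3/4) - 3)). f (3/4) v = F v ** M"
    by (rule continuation_along_lift[where f = f and \<gamma> = \<gamma> and a = "3/4" and b = 1 and p = "\<lambda>v. v" and ?\<tau>0.0 = 1 and Z = D and z = "\<lambda>\<tau>. linepath q b (4 * \<tau> - 3)", OF f])
       (use D seg3 g3 eventually_conj[OF f01(2) G0] in \<open>auto intro!: continuous_intros mholo_mult mholo_const simp: linepath_def elim!: eventually_mono\<close>)
  then have F3: "\<forall>\<^sub>F v in nhds (a + exp \<zeta>0). f (3/4) v = F v ** M" by (simp add: exp\<zeta>0 linepath_def)
  have e: "Complex (ln \<rho>) (\<alpha> + 2 * pi * (4 * (3/4) - 2)) = \<zeta>0 + 2 * of_real pi * \<i>" by (simp add: \<zeta>0_def complex_eq_iff)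
  have lim2: "filterlim (\<lambda>\<zeta>. \<zeta> + 2 * of_real pi * \<i>) (nhds (\<zeta>0 + 2 * of_real pi * \<i>)) (nhds \<zeta>0)" by (intro tendsto_intros filterlim_ident)
  show ?thesis
    using eventually_compose_filterlim[OF F2[unfolded e] lim2] eventually_compose_filterlim[OF F3 lim]
    by eventually_elim (simp add: exp_add)
qed

text \<open>The plane cut along the real half-lines from -1 to the left and from 1 to the right. It
  is starlike about 0 and avoids both singular points, so the system has single-valued fundamental
  solutions there.\<close>

definition slit_plane :: "complex set" where
  "slit_plane = {\<eta>. Im \<eta> \<noteq> 0 \<or> \<bar>Re \<eta>\<bar> < 1}"

lemma slit_plane_open: "open slit_plane"
proof -
  have "slit_plane = {\<eta>. Im \<eta> < 0} \<union> {\<eta>. Im \<eta> > 0} \<union> {\<eta>. \<bar>Re \<eta>\<bar> < 1}"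
    by (auto simp: slit_plane_def)
  moreover have "open \<dots>" by (intro open_Un open_Collect_less continuous_intros)
  ultimately show ?thesis by simp
qed

lemma slit_plane_starlike: "z \<in> slit_plane \<Longrightarrow> closed_segment 0 z \<subseteq> slit_plane"
proof
  fix v assume z: "z \<in> slit_plane" and "v \<in> closed_segment 0 z"
  then obtain u where u: "0 \<le> u" "u \<le> 1" "v = u *\<^sub>R z" unfolding closed_segment_def by auto
  have "\<bar>u * Re z\<bar> < 1" if "\<bar>Re z\<bar> < 1"
    using mult_le_one[of u "\<bar>Re z\<bar>"] u that mult_left_le_one_le[of "\<bar>Re z\<bar>" u] by (simp add: abs_mult)
  then show "v \<in> slit_plane" using z u unfolding slit_plane_def by (cases "u = 0") auto
qed

lemma eta_coeff_holo: "-1 \<notin> S \<Longrightarrow> 1 \<notin> S \<Longrightarrow> mholo (eta_coeff A0 A1 x) S"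
  unfolding eta_coeff_def[abs_def] mholo_def vector_add_component scale_mat_nth
  by (intro allI holomorphic_intros) (auto simp: add_eq_0_iff2)

text \<open>The strip \<open>o' < Im \<zeta> < o' + 2 \<pi>\<close> parametrises the disc of radius 2 around \<open>a\<close> slit along
  the part of the real axis that points away from the other singular point.\<close>
lemma strip_to_slit_plane:
  assumes "a = -1 \<and> o' = - pi \<or> a = 1 \<and> o' = 0" "Re \<zeta> < ln 2" "o' < Im \<zeta>" "Im \<zeta> < o' + 2 * pi"
  shows "a + exp \<zeta> \<in> slit_plane"
proof (cases "Im (a + exp \<zeta>) = 0")
  case False
  then show ?thesis by (simp add: slit_plane_def)
next
  case True
  have Ima: "Im a = 0" using assms(1) by auto
  then have "sin (Im \<zeta>) = 0" using True by (simp add: Im_exp)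
  then obtain k where k: "Im \<zeta> = of_int k * pi" using sin_zero_iff_int2 by blast
  have e2: "exp (Re \<zeta>) < 2" using assms(2) by (metis exp_less_cancel_iff exp_ln zero_less_numeral)
  from assms(1) show ?thesis
  proof
    assume a: "a = -1 \<and> o' = - pi"
    have "- 1 < (of_int k :: real)" "(of_int k :: real) < 1" using assms(3,4) a k
      mult_less_cancel_right_pos[of pi "-1" "of_int k"] mult_less_cancel_right_pos[of pi "of_int k" 1] by auto
    then have "k = 0" by linarith
    then have "Re (a + exp \<zeta>) = exp (Re \<zeta>) - 1" using a k by (simp add: Re_exp)
    then have "\<bar>Re (a + exp \<zeta>)\<bar> < 1" using e2 exp_gt_zero[of "Re \<zeta>"] by linarith
    then show ?thesis by (simp add: slit_plane_def)
  next
    assume a: "a = 1 \<and> o' = 0"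
    have "0 < (of_int k :: real)" "(of_int k :: real) < 2" using assms(3,4) a k
      mult_less_cancel_right_pos[of pi "of_int k" 2] zero_less_mult_iff[of "of_int k" pi] by auto
    then have "k = 1" by linarith
    then have "Re (a + exp \<zeta>) = 1 - exp (Re \<zeta>)" using a k by (simp add: Re_exp)
    then have "\<bar>Re (a + exp \<zeta>)\<bar> < 1" using e2 exp_gt_zero[of "Re \<zeta>"] by linarith
    then show ?thesis by (simp add: slit_plane_def)
  qed
qed

definition plane_solution :: "cmat \<Rightarrow> cmat \<Rightarrow> complex \<Rightarrow> (complex \<Rightarrow> cmat) \<Rightarrow> bool" where
  "plane_solution A0 A1 x F \<longleftrightarrow> (\<forall>\<eta>\<in>slit_plane. has_mderiv F (eta_coeff A0 A1 x \<eta> ** F \<eta>) \<eta> \<and> det (F \<eta>) = 1)"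

text \<open>\<open>H\<close> continues \<open>F\<close> around the singular point \<open>a\<close>
  in the coordinate \<zeta> = ln (\<eta> - a). The bound ln 2 is the distance 2 to the other
  singular point, and o' is the lower edge of the strip that corresponds to one sheet of the cut
  disc.\<close>

definition local_lift :: "cmat \<Rightarrow> cmat \<Rightarrow> complex \<Rightarrow> complex \<Rightarrow> real \<Rightarrow> (complex \<Rightarrow> cmat) \<Rightarrow> (complex \<Rightarrow> cmat) \<Rightarrow> bool" where
  "local_lift A0 A1 x a o' F H \<longleftrightarrow>
     (\<forall>\<zeta>. Re \<zeta> < ln 2 \<longrightarrow> has_mderiv H (scale_mat (exp \<zeta>) (eta_coeff A0 A1 x (a + exp \<zeta>)) ** H \<zeta>) \<zeta> \<and> det (H \<zeta>) = 1) \<and>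
     (\<forall>\<zeta>. Re \<zeta> < ln 2 \<and> o' < Im \<zeta> \<and> Im \<zeta> < o' + 2 * pi \<longrightarrow> H \<zeta> = F (a + exp \<zeta>))"

lemma convex_halfplane_lt: "convex {\<zeta>. Re \<zeta> < c}" "open {\<zeta>. Re \<zeta> < c}"
  by (auto simp: convex_halfspace_Re_lt open_halfspace_Re_lt)

lemma strip_convex_open:
  "convex {m. Re m > c \<and> p < Im m \<and> Im m < q}" "open {m. Re m > c \<and> p < Im m \<and> Im m < q}"
  "convex {m. Re m < c \<and> p < Im m \<and> Im m < q}" "open {m. Re m < c \<and> p < Im m \<and> Im m < q}"
proof -
  have 1: "{m. Re m > c \<and> p < Im m \<and> Im m < q} = {m. Re m > c} \<inter> ({m. Im m > p} \<inter> {m. Im m < q})"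
    "{m. Re m < c \<and> p < Im m \<and> Im m < q} = {m. Re m < c} \<inter> ({m. Im m > p} \<inter> {m. Im m < q})" by auto
  show "convex {m. Re m > c \<and> p < Im m \<and> Im m < q}" "convex {m. Re m < c \<and> p < Im m \<and> Im m < q}"
    unfolding 1 by (intro convex_Int convex_halfspace_Re_gt convex_halfspace_Re_lt convex_halfspace_Im_gt convex_halfspace_Im_lt)+
  show "open {m. Re m > c \<and> p < Im m \<and> Im m < q}" "open {m. Re m < c \<and> p < Im m \<and> Im m < q}"
    unfolding 1 by (intro open_Int open_halfspace_Re_gt open_halfspace_Re_lt open_halfspace_Im_gt open_halfspace_Im_lt)+
qed

lemma plane_solution_exists:
  assumes X: "system_solution A0 A1 x X" and det: "\<And>m. Re m > 0 \<Longrightarrow> det (X m) = 1" and tr: "trace A0 = 0" "trace A1 = 0"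
  obtains F where "plane_solution A0 A1 x F" "\<And>m. Re m > 0 \<Longrightarrow> 0 < Im m \<Longrightarrow> Im m < pi \<Longrightarrow> F (exp m) = X m"
proof -
  have z0: "0 \<in> slit_plane" by (simp add: slit_plane_def)
  obtain \<Phi> where \<Phi>: "\<Phi> 0 = mat 1" "\<And>\<eta>. \<eta> \<in> slit_plane \<Longrightarrow> has_mderiv \<Phi> (eta_coeff A0 A1 x \<eta> ** \<Phi> \<eta>) \<eta>"
  proof (rule lode_starlike[OF slit_plane_open z0 slit_plane_starlike eta_coeff_holo, of A0 A1 x])
    fix \<Phi> assume "\<Phi> 0 = mat 1" "\<And>\<eta>. \<eta> \<in> slit_plane \<Longrightarrow> has_mderiv \<Phi> (eta_coeff A0 A1 x \<eta> ** \<Phi> \<eta>) \<eta>"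
    then show thesis by (rule that)
  qed (auto simp: slit_plane_def)
  have con: "connected slit_plane"
    by (rule starlike_imp_connected) (use z0 slit_plane_starlike in \<open>auto simp: starlike_def\<close>)
  have te: "trace (eta_coeff A0 A1 x \<eta>) = 0" for \<eta>
    using trace_eta_coeff[OF tr, of 1 x \<eta>] by (simp add: trace_2)
  have d\<Phi>: "det (\<Phi> \<eta>) = 1" if "\<eta> \<in> slit_plane" for \<eta>
    using lode_det_const[OF slit_plane_open con \<Phi>(2) te that z0] by (simp add: \<Phi>(1))
  define W where "W = {m. Re m > 0 \<and> 0 < Im m \<and> Im m < pi}"
  define m0 where "m0 = Complex 1 (pi / 2)"
  have m0: "m0 \<in> W" by (simp add: W_def m0_def)
  have Wd: "exp m \<in> slit_plane" if "m \<in> W" for m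
    using that sin_gt_zero[of "Im m"] by (auto simp: W_def slit_plane_def Im_exp)
  define c0 where "c0 = adj2 (\<Phi> (exp m0)) ** X m0"
  define F where "F \<eta> = \<Phi> \<eta> ** c0" for \<eta>
  have dc0: "det c0 = 1" unfolding c0_def det_mul using d\<Phi>[OF Wd[OF m0]] det[of m0] by (simp add: m0_def)
  have "plane_solution A0 A1 x F"
    unfolding plane_solution_def F_def using has_mderiv_rmult[OF \<Phi>(2)] d\<Phi> dc0 by (simp add: det_mul matrix_mul_assoc)
  moreover have "F (exp m) = X m" if m: "Re m > 0" "0 < Im m" "Im m < pi" for m
  proof -
    have mW: "m \<in> W" using m by (simp add: W_def)
    have d: "has_mderiv (\<lambda>m. \<Phi> (exp m)) (scale_mat (exp m) (eta_coeff A0 A1 x (exp m)) ** \<Phi> (exp m)) m" if "m \<in> W" for m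
      using has_mderiv_chain[where g = exp, OF \<Phi>(2)[OF Wd[OF that]] DERIV_exp] by (simp add: scale_mat_mult)
    have "adj2 (\<Phi> (exp m)) ** X m = c0"
      unfolding c0_def
      by (rule lode_quotient_const[of W _ "\<lambda>m. scale_mat (exp m) (eta_coeff A0 A1 x (exp m))"])
         (use strip_convex_open(1,2)[of 0 0 pi] d X mW m0 trace_eta_coeff[OF tr] in \<open>auto simp: W_def convex_connected system_solution_def\<close>)
    then have "F (exp m) = \<Phi> (exp m) ** (adj2 (\<Phi> (exp m)) ** X m)" by (simp add: F_def)
    then show ?thesis by (simp add: adj2_cancel d\<Phi>[OF Wd[OF mW]])
  qed
  ultimately show thesis by (rule that)
qed

lemma local_lift_exists:
  assumes F: "plane_solution A0 A1 x F" and tr: "trace A0 = 0" "trace A1 = 0"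
    and a: "a = -1 \<and> o' = - pi \<or> a = 1 \<and> o' = 0"
  obtains H where "local_lift A0 A1 x a o' F H"
proof -
  let ?S = "{\<zeta>. Re \<zeta> < ln 2}" and ?A = "\<lambda>\<zeta>. scale_mat (exp \<zeta>) (eta_coeff A0 A1 x (a + exp \<zeta>))"
  define W where "W = {\<zeta>. Re \<zeta> < ln 2 \<and> o' < Im \<zeta> \<and> Im \<zeta> < o' + 2 * pi}"
  define z0 where "z0 = Complex 0 (o' + pi)"
  have z0: "z0 \<in> W" "z0 \<in> ?S" by (auto simp: z0_def W_def)
  have Wd: "a + exp \<zeta> \<in> slit_plane" if "\<zeta> \<in> W" for \<zeta>
    using strip_to_slit_plane[OF a] that by (auto simp: W_def)
  have ne: "a + exp \<zeta> \<noteq> 1 \<and> a + exp \<zeta> \<noteq> -1" if "Re \<zeta> < ln 2" for \<zeta>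
  proof -
    have "norm (exp \<zeta>) < 2" using that by (metis exp_less_cancel_iff exp_ln norm_exp_eq_Re zero_less_numeral)
    then have "exp \<zeta> \<noteq> 2" "exp \<zeta> \<noteq> -2" by (metis norm_numeral norm_minus_cancel order_less_irrefl)+
    moreover have "exp \<zeta> = 1 - a" if "a + exp \<zeta> = 1" using that by (metis add_diff_cancel_left')
    moreover have "exp \<zeta> = -1 - a" if "a + exp \<zeta> = -1" using that by (metis add_diff_cancel_left')
    moreover have "1 - a \<in> {0, 2}" "-1 - a \<in> {0, -2}" using a by auto
    ultimately show ?thesis using exp_not_eq_zero[of \<zeta>] by (metis insert_iff singletonD)
  qed
  have hA: "mholo ?A ?S"
  proof (rule mholo_scale)
    show "exp holomorphic_on ?S" by (intro holomorphic_intros)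
    have g: "(\<lambda>\<zeta>. a + exp \<zeta>) holomorphic_on ?S" by (intro holomorphic_intros)
    have img: "(\<lambda>\<zeta>. a + exp \<zeta>) ` ?S \<subseteq> - {1, -1}" by (rule image_subsetI) (use ne in simp)
    show "mholo (\<lambda>\<zeta>. eta_coeff A0 A1 x (a + exp \<zeta>)) ?S"
      by (rule mholo_compose[where F = "eta_coeff A0 A1 x", OF eta_coeff_holo g img]) auto
  qed
  obtain \<Psi> where \<Psi>: "\<Psi> z0 = mat 1" "\<And>\<zeta>. \<zeta> \<in> ?S \<Longrightarrow> has_mderiv \<Psi> (?A \<zeta> ** \<Psi> \<zeta>) \<zeta>"
  proof (rule lode_starlike[OF convex_halfplane_lt(2)[of "ln 2"] z0(2) _ hA])
    show "\<And>z. z \<in> ?S \<Longrightarrow> closed_segment z0 z \<subseteq> ?S"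
      using convex_halfplane_lt(1)[of "ln 2"] z0(2) by (simp add: convex_contains_segment)
    fix \<Psi> assume "\<Psi> z0 = mat 1" "\<And>\<zeta>. \<zeta> \<in> ?S \<Longrightarrow> has_mderiv \<Psi> (?A \<zeta> ** \<Psi> \<zeta>) \<zeta>"
    then show thesis by (rule that)
  qed
  have d\<Psi>: "det (\<Psi> \<zeta>) = 1" if "Re \<zeta> < ln 2" for \<zeta>
    using lode_det_const[OF convex_halfplane_lt(2)[of "ln 2"] convex_connected[OF convex_halfplane_lt(1)] \<Psi>(2) trace_eta_coeff[OF tr], of \<zeta> z0]
      that z0(2) by (simp add: \<Psi>(1))
  define c0 where "c0 = adj2 (\<Psi> z0) ** F (a + exp z0)"
  have dc0: "det c0 = 1" unfolding c0_def det_mul using F Wd[OF z0(1)] by (simp add: \<Psi>(1) plane_solution_def)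
  have "local_lift A0 A1 x a o' F (\<lambda>\<zeta>. \<Psi> \<zeta> ** c0)"
    unfolding local_lift_def
  proof (intro conjI allI impI)
    fix \<zeta> :: complex assume z: "Re \<zeta> < ln 2"
    show "has_mderiv (\<lambda>\<zeta>. \<Psi> \<zeta> ** c0) (?A \<zeta> ** (\<Psi> \<zeta> ** c0)) \<zeta>"
      using has_mderiv_rmult[OF \<Psi>(2)[of \<zeta>], of c0] z by (simp add: matrix_mul_assoc)
    show "det (\<Psi> \<zeta> ** c0) = 1" using d\<Psi>[OF z] dc0 by (simp add: det_mul)
  next
    fix \<zeta> assume z: "Re \<zeta> < ln 2 \<and> o' < Im \<zeta> \<and> Im \<zeta> < o' + 2 * pi"
    have d: "has_mderiv (\<lambda>\<zeta>. F (a + exp \<zeta>)) (?A \<zeta> ** F (a + exp \<zeta>)) \<zeta>" if "\<zeta> \<in> W" for \<zeta>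
    proof -
      have "has_mderiv F (eta_coeff A0 A1 x (a + exp \<zeta>) ** F (a + exp \<zeta>)) (a + exp \<zeta>)"
        using F Wd[OF that] by (simp add: plane_solution_def)
      moreover have "((\<lambda>\<zeta>. a + exp \<zeta>) has_field_derivative exp \<zeta>) (at \<zeta>)" by (auto intro!: derivative_eq_intros)
      ultimately show ?thesis
        using has_mderiv_chain[where g = "\<lambda>\<zeta>. a + exp \<zeta>" and F = F and z = \<zeta>] by (simp add: scale_mat_mult)
    qed
    have "adj2 (\<Psi> \<zeta>) ** F (a + exp \<zeta>) = c0"
      unfolding c0_def
      by (rule lode_quotient_const[of W _ ?A])
         (use strip_convex_open(3,4)[of "ln 2" o' "o' + 2 * pi"] d \<Psi>(2) z z0 trace_eta_coeff[OF tr] in \<open>auto simp: W_def convex_connected\<close>)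
    then have "\<Psi> \<zeta> ** c0 = \<Psi> \<zeta> ** (adj2 (\<Psi> \<zeta>) ** F (a + exp \<zeta>))" by simp
    then show "\<Psi> \<zeta> ** c0 = F (a + exp \<zeta>)" using d\<Psi> z by (simp add: adj2_cancel)
  qed
  then show thesis by (rule that)
qed

lemma local_lift_holo: "local_lift A0 A1 x a o' F H \<Longrightarrow> mholo H {\<zeta>. Re \<zeta> < ln 2}"
  by (intro mholo_mderiv convex_halfplane_lt(2)) (auto simp: local_lift_def)

text \<open>One admissible loop suffices: base point 101 i, beyond the required 100, and radius 1/2.
  It gives the relation near one point, and the identity theorem spreads it over the
  half-plane.\<close>

lemma local_lift_monodromy:
  assumes F: "plane_solution A0 A1 x F" and FX: "\<And>m. Re m > 0 \<Longrightarrow> 0 < Im m \<Longrightarrow> Im m < pi \<Longrightarrow> F (exp m) = X m"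
    and a: "a = -1 \<and> o' = - pi \<or> a = 1 \<and> o' = 0" and H: "local_lift A0 A1 x a o' F H"
    and con: "continues_along (lasso (\<i> * 101) a (1/2)) (\<lambda>v. X (Ln v)) (\<lambda>v. X (Ln v) ** M)"
    and \<zeta>: "Re \<zeta> < ln 2"
  shows "H (\<zeta> + 2 * of_real pi * \<i>) = H \<zeta> ** M"
proof -
  define b where "b = \<i> * 101"
  define \<alpha> where "\<alpha> = Arg (b - a)"
  define \<zeta>0 where "\<zeta>0 = Complex (ln (1/2)) \<alpha>"
  have "Im (b - a) > 0" using a by (auto simp: b_def)
  then have \<alpha>: "0 < \<alpha>" "\<alpha> < pi" unfolding \<alpha>_def using Im_Ln_pos_lt_imp[of "b - a"] Arg_eq_Im_Ln[of "b - a"] by (metis complex.sel(2) order_less_irrefl zero_complex.sel(2))+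
  have l12: "ln (1/2) < ln (2::real)" by simp
  have z0: "Re \<zeta>0 < ln 2" "o' < Im \<zeta>0" "Im \<zeta>0 < o' + 2 * pi" using \<alpha> a l12 by (auto simp: \<zeta>0_def)
  have upper: "v \<in> slit_plane" if "Im v > 0" for v using that by (auto simp: slit_plane_def)
  have Ib: "Im b > 0" by (simp add: b_def)
  have seg: "closed_segment b (a + of_real (1/2) * cis \<alpha>) \<subseteq> slit_plane"
  proof -
    have "Im (a + of_real (1/2) * cis \<alpha>) > 0" using a \<alpha> sin_gt_zero[of \<alpha>] by auto
    then have "closed_segment b (a + of_real (1/2) * cis \<alpha>) \<subseteq> {v. Im v > 0}"
      using Ib by (intro closed_segment_subset) (auto simp: convex_halfspace_Im_gt)
    then show ?thesis using upper by blast
  qed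
  have hF: "mholo F slit_plane" using F by (intro mholo_mderiv slit_plane_open) (auto simp: plane_solution_def)
  have ev: "\<forall>\<^sub>F v in nhds b. X (Ln v) = F v"
  proof -
    have "open ({v. Im v > 0} \<inter> {v. norm v > 1})" by (intro open_Int open_halfspace_Im_gt open_Collect_less continuous_intros)
    then have "\<forall>\<^sub>F v in nhds b. v \<in> {v. Im v > 0} \<inter> {v. norm v > 1}"
      by (rule eventually_nhds_in_open) (simp add: b_def norm_mult)
    then show ?thesis
    proof eventually_elim
      case (elim v)
      then have v: "v \<noteq> 0" by auto
      then have "Re (Ln v) > 0" using elim by simp
      moreover have "0 < Im (Ln v) \<and> Im (Ln v) < pi" using elim by (intro Im_Ln_pos_lt_imp) auto
      ultimately have "F (exp (Ln v)) = X (Ln v)" by (intro FX) auto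
      then show ?case using v by simp
    qed
  qed
  have hH: "mholo H {\<zeta>. Re \<zeta> < ln 2}" by (rule local_lift_holo[OF H])
  have evH: "\<forall>\<^sub>F \<zeta> in nhds \<zeta>0. H \<zeta> = F (a + exp \<zeta>)"
    using eventually_nhds_in_open[OF strip_convex_open(4)[of "ln 2" o' "o' + 2 * pi"], of \<zeta>0] z0
    by (auto elim!: eventually_mono simp: H[unfolded local_lift_def])
  have "\<forall>\<^sub>F \<zeta> in nhds \<zeta>0. H (\<zeta> + 2 * of_real pi * \<i>) = F (a + exp \<zeta>) ** M"
    unfolding \<zeta>0_def \<alpha>_def
    by (rule lasso_continuation[where c = "ln 2" and D = slit_plane and ?F0.0 = "\<lambda>v. X (Ln v)" and ?G0.0 = "\<lambda>v. X (Ln v) ** M"])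
       (use con l12 slit_plane_open hF seg ev hH evH in \<open>auto simp: b_def \<alpha>_def \<zeta>0_def elim!: eventually_mono\<close>)
  then have "\<forall>\<^sub>F \<zeta> in nhds \<zeta>0. H (\<zeta> + 2 * of_real pi * \<i>) = H \<zeta> ** M" using evH by eventually_elim simp
  then obtain T where T: "open T" "\<zeta>0 \<in> T" "\<And>\<zeta>. \<zeta> \<in> T \<Longrightarrow> H (\<zeta> + 2 * of_real pi * \<i>) = H \<zeta> ** M" unfolding eventually_nhds by blast
  show ?thesis
  proof (rule midentity[where T = "T \<inter> {\<zeta>. Re \<zeta> < ln 2}" and S = "{\<zeta>. Re \<zeta> < ln 2}"])
    show "mholo (\<lambda>\<zeta>. H (\<zeta> + 2 * of_real pi * \<i>)) {\<zeta>. Re \<zeta> < ln 2}"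
      by (rule mholo_compose[OF hH]) (auto intro!: holomorphic_intros)
    show "mholo (\<lambda>\<zeta>. H \<zeta> ** M) {\<zeta>. Re \<zeta> < ln 2}" by (intro mholo_mult hH mholo_const)
  qed (use T z0 \<zeta> convex_halfplane_lt[of "ln 2"] in \<open>auto simp: convex_connected\<close>)
qed

text \<open>As Im m increases through \<open>p\<close>, the point \<eta> crosses the cut that starts
  at \<open>a\<close>. Near \<open>a\<close> both sides are visible to the lift \<open>H\<close>,
  whose 2 pi i shift is \<open>M\<close>; hence exactly one factor \<open>M\<close> appears.\<close>

lemma crossing:
  assumes a: "a = -1 \<and> o' = - pi \<or> a = 1 \<and> o' = 0" and p: "p = o' + 2 * pi"
    and F: "plane_solution A0 A1 x F" and H: "local_lift A0 A1 x a o' F H"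
    and mon: "\<And>\<zeta>. Re \<zeta> < ln 2 \<Longrightarrow> H (\<zeta> + 2 * of_real pi * \<i>) = H \<zeta> ** M"
    and X: "mholo X {m. Re m > 0}"
    and below: "\<And>m. Re m > 0 \<Longrightarrow> p - pi < Im m \<Longrightarrow> Im m < p \<Longrightarrow> X m = F (exp m) ** N"
    and m: "Re m > 0" "p < Im m" "Im m < p + pi"
  shows "X m = F (exp m) ** (M ** N)"
proof -
  define ip where "ip = \<i> * of_real p"
  have eip: "exp ip = a" and a2: "a * a = 1"
    using a by (auto simp: ip_def p exp_Euler exp_add distrib_left complex_eq_iff Re_exp Im_exp)
  have a0: "a \<noteq> 0" using a by auto
  have em: "exp m - a = a * (exp (m - ip) - 1)" for m
    using a0 by (simp add: exp_diff eip field_simps)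
  have na: "norm a = 1" using a by auto
  \<comment> \<open>The point \<eta> = 3a/2 on the cut lies outside the unit disc, where
    \<open>X\<close> lives, and at distance 1/2 from \<open>a\<close>, where the lift lives.\<close>
  define m1 where "m1 = of_real (ln (3/2)) + ip"
  have em1: "exp (m1 - ip) = 3/2" using exp_of_real[of "ln (3/2)", where 'a = complex] by (simp add: m1_def)
  define V where "V = {m. Re m > 0} \<inter> {m. Re (exp (m - ip) - 1) > 0} \<inter> {m. norm (exp (m - ip) - 1) < 2} \<inter> {m. \<bar>Im m - p\<bar> < pi}"
  have "open V" unfolding V_def by (intro open_Int open_Collect_less continuous_intros open_halfspace_Re_gt)
  moreover have "m1 \<in> V" by (simp add: V_def em1, simp add: m1_def ip_def)
  ultimately obtain r where r: "r > 0" "ball m1 r \<subseteq> V" using open_contains_ball by blast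
  define B where "B = ball m1 r"
  have BV: "B \<subseteq> V" using r by (simp add: B_def)
  define z where "z m = ip + Ln (exp (m - ip) - 1)" for m
  have zB: "Re (z m) < ln 2" "a + exp (z m) = exp m" "\<bar>Im m - p\<bar> < pi" "exp (m - ip) - 1 \<notin> \<real>\<^sub>\<le>\<^sub>0" if "m \<in> B" for m
  proof -
    have v: "Re (exp (m - ip) - 1) > 0" "norm (exp (m - ip) - 1) < 2" "\<bar>Im m - p\<bar> < pi" using that BV by (auto simp: V_def)
    then have n0: "exp (m - ip) - 1 \<noteq> 0" by auto
    have "ln (norm (exp (m - ip) - 1)) < ln 2" using v(2) n0 by simp
    then show "Re (z m) < ln 2" using n0 by (simp add: z_def ip_def)
    show "a + exp (z m) = exp m" using n0 by (simp add: z_def exp_add eip em[symmetric])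
    show "\<bar>Im m - p\<bar> < pi" by (rule v(3))
    show "exp (m - ip) - 1 \<notin> \<real>\<^sub>\<le>\<^sub>0" using v(1) by (auto simp: complex_nonpos_Reals_iff)
  qed
  have Im_exp: "Im (exp (m - ip) - 1) = exp (Re m) * sin (Im m - p)" for m by (simp add: Im_exp ip_def)
  have zlow: "p - pi < Im (z m) \<and> Im (z m) < p" if "m \<in> B" "Im m < p" for m
  proof -
    have "sin (p - Im m) > 0" using zB(3)[OF that(1)] that(2) by (intro sin_gt_zero) auto
    then have "Im (exp (m - ip) - 1) < 0" unfolding Im_exp using sin_minus[of "p - Im m"] by (simp add: mult_pos_neg)
    then have "Im (Ln (exp (m - ip) - 1)) < 0" using Im_Ln_pos_le[of "exp (m - ip) - 1"] zB(4)[OF that(1)]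
      mpi_less_Im_Ln[of "exp (m - ip) - 1"] Im_Ln_le_pi[of "exp (m - ip) - 1"] by (metis nonpos_Reals_zero_I not_le)
    moreover have "exp (m - ip) - 1 \<noteq> 0" using zB(4)[OF that(1)] by auto
    then have "- pi < Im (Ln (exp (m - ip) - 1))" by (rule mpi_less_Im_Ln)
    ultimately show ?thesis by (simp add: z_def ip_def)
  qed
  have zup: "p < Im (z m) \<and> Im (z m) < p + pi" if "m \<in> B" "Im m > p" for m
  proof -
    have "sin (Im m - p) > 0" using zB(3)[OF that(1)] that(2) by (intro sin_gt_zero) auto
    then have "Im (exp (m - ip) - 1) > 0" unfolding Im_exp by simp
    from Im_Ln_pos_lt_imp[OF this] show ?thesis by (simp add: z_def ip_def)
  qed
  have hH: "mholo H {\<zeta>. Re \<zeta> < ln 2}" by (rule local_lift_holo[OF H])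
  have hz: "z holomorphic_on B" unfolding z_def[abs_def] by (intro holomorphic_intros) (use zB(4) in auto)
  have hHz: "mholo (\<lambda>m. H (z m) ** N) B"
    by (intro mholo_mult mholo_const mholo_compose[OF hH hz]) (use zB(1) in auto)
  have B: "open B" "connected B" "B \<subseteq> {m. Re m > 0}" using BV by (auto simp: B_def V_def)
  have Hstrip: "H \<zeta> = F (a + exp \<zeta>)" if "Re \<zeta> < ln 2" "o' < Im \<zeta>" "Im \<zeta> < o' + 2 * pi" for \<zeta>
    using H that by (simp add: local_lift_def)
  have ball_side: "ball m1 r \<inter> {m. Im m < p} \<noteq> {}" "ball m1 r \<inter> {m. Im m > p} \<noteq> {}"
  proof -
    have "m1 - \<i> * of_real (r/2) \<in> ball m1 r \<inter> {m. Im m < p}" "m1 + \<i> * of_real (r/2) \<in> ball m1 r \<inter> {m. Im m > p}"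
      using r(1) by (auto simp: m1_def ip_def dist_norm norm_mult)
    then show "ball m1 r \<inter> {m. Im m < p} \<noteq> {}" "ball m1 r \<inter> {m. Im m > p} \<noteq> {}" by blast+
  qed
  have XB: "X m = H (z m) ** N" if "m \<in> B" for m
  proof (rule midentity[where S = B and T = "B \<inter> {m. Im m < p}" and F = X and G = "\<lambda>m. H (z m) ** N" and z = m])
    show "mholo X B" using X B(3) by (rule mholo_subset)
    show "X m = H (z m) ** N" if "m \<in> B \<inter> {m. Im m < p}" for m
    proof -
      have mB: "m \<in> B" "Im m < p" using that by auto
      have "H (z m) = F (exp m)" using Hstrip[of "z m"] zB[OF mB(1)] zlow[OF mB] p by simp
      moreover have "X m = F (exp m) ** N" using below[of m] mB B(3) zB(3)[OF mB(1)] by auto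
      ultimately show ?thesis by simp
    qed
  qed (use B hHz that ball_side in \<open>auto simp: B_def intro: open_halfspace_Im_lt\<close>)
  have Xup: "X m = F (exp m) ** (M ** N)" if "m \<in> B \<inter> {m. Im m > p}" for m
  proof -
    have mB: "m \<in> B" "Im m > p" using that by auto
    \<comment> \<open>Above the cut z m has left the strip on which \<open>H\<close> equals
      \<open>F\<close>; subtracting one period brings it back and costs the factor
      \<open>M\<close>.\<close>
    let ?\<zeta> = "z m - 2 * of_real pi * \<i>"
    have "H (?\<zeta> + 2 * of_real pi * \<i>) = H ?\<zeta> ** M" by (rule mon) (use zB(1)[OF mB(1)] in simp)
    moreover have "H ?\<zeta> = F (exp m)"
      using Hstrip[of ?\<zeta>] zB[OF mB(1)] zup[OF mB] p by (simp add: exp_diff)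
    ultimately show ?thesis using XB[OF mB(1)] by (simp add: matrix_mul_assoc)
  qed
  define W where "W = {m. Re m > 0 \<and> p < Im m \<and> Im m < p + pi}"
  have sW: "exp m \<in> slit_plane" if "m \<in> W" for m
  proof -
    have "sin (Im m - p) > 0" using that by (intro sin_gt_zero) (auto simp: W_def)
    moreover have "a * exp m = exp (m - ip)" using a by (auto simp: exp_diff eip)
    then have "Im (a * exp m) = exp (Re m) * sin (Im m - p)" by (simp add: Im_exp[of m, symmetric])
    ultimately have "Im (a * exp m) \<noteq> 0" by simp
    then show ?thesis using a by (auto simp: slit_plane_def)
  qed
  have hF: "mholo F slit_plane" using F by (intro mholo_mderiv slit_plane_open) (auto simp: plane_solution_def)
  show ?thesis
  proof (rule midentity[where S = W and T = "W \<inter> (B \<inter> {m. Im m > p})" and F = X and G = "\<lambda>m. F (exp m) ** (M ** N)" and z = m])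
    show "mholo X W" using X by (rule mholo_subset) (auto simp: W_def)
    show "mholo (\<lambda>m. F (exp m) ** (M ** N)) W"
      by (intro mholo_mult mholo_const mholo_compose[OF hF]) (use sW in \<open>auto intro!: holomorphic_intros\<close>)
    show "open W" "connected W" using strip_convex_open(1,2)[of 0 p "p + pi"] by (auto simp: W_def convex_connected)
    then show "open (W \<inter> (B \<inter> {m. Im m > p}))" using B(1) by (intro open_Int open_halfspace_Im_gt)
    have "B \<inter> {m. Im m > p} \<subseteq> W" using B(3) zB(3) by (fastforce simp: W_def)
    then show "W \<inter> (B \<inter> {m. Im m > p}) \<noteq> {}" using ball_side(2) by (auto simp: B_def)
    show "m \<in> W" using m by (simp add: W_def)
  qed (use Xup in auto)
qed

text \<open>Starting in the upper half-plane, a positive circuit first crosses the cut of -1, at Im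
  m = pi, and then the cut of 1, at Im m = 2 pi. This fixes the order of the product.\<close>

lemma circle_monodromy:
  assumes F: "plane_solution A0 A1 x F" and FX: "\<And>m. Re m > 0 \<Longrightarrow> 0 < Im m \<Longrightarrow> Im m < pi \<Longrightarrow> F (exp m) = X m"
    and H0: "local_lift A0 A1 x (-1) (- pi) F H0" "\<And>\<zeta>. Re \<zeta> < ln 2 \<Longrightarrow> H0 (\<zeta> + 2 * of_real pi * \<i>) = H0 \<zeta> ** M0"
    and H1: "local_lift A0 A1 x 1 0 F H1" "\<And>\<zeta>. Re \<zeta> < ln 2 \<Longrightarrow> H1 (\<zeta> + 2 * of_real pi * \<i>) = H1 \<zeta> ** M1"
    and X: "mholo X {m. Re m > 0}" and m: "Re m > 0"
  shows "X (m + 2 * of_real pi * \<i>) = X m ** (M1 ** M0)"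
proof -
  have c1: "X m = F (exp m) ** M0" if "Re m > 0" "pi < Im m" "Im m < 2 * pi" for m
    using crossing[OF _ _ F H0 X, of pi "mat 1" m] FX that by simp
  have c2: "X m = F (exp m) ** (M1 ** M0)" if "Re m > 0" "2 * pi < Im m" "Im m < 3 * pi" for m
    using crossing[OF _ _ F H1 X, of "2 * pi" M0 m] c1 that by simp
  let ?W = "{m. Re m > 0 \<and> 0 < Im m \<and> Im m < pi}"
  show ?thesis
  proof (rule midentity[where S = "{m. Re m > 0}" and T = ?W and F = "\<lambda>m. X (m + 2 * of_real pi * \<i>)" and G = "\<lambda>m. X m ** (M1 ** M0)" and z = m])
    show "mholo (\<lambda>m. X (m + 2 * of_real pi * \<i>)) {m. Re m > 0}"
      by (rule mholo_compose[OF X]) (auto intro!: holomorphic_intros)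
    show "mholo (\<lambda>m. X m ** (M1 ** M0)) {m. Re m > 0}" by (intro mholo_mult X mholo_const)
    show "open ?W" by (rule strip_convex_open)
    have "Complex 1 (pi / 2) \<in> ?W" by simp
    then show "?W \<noteq> {}" by blast
    show "X (m + 2 * of_real pi * \<i>) = X m ** (M1 ** M0)" if "m \<in> ?W" for m
      using c2[of "m + 2 * of_real pi * \<i>"] FX[of m] that by (simp add: exp_add)
  qed (use m half_plane[of 0] in auto)
qed

section \<open>Local form at a singular point\<close>

lemma norm_square_derivative:
  fixes f :: "complex \<Rightarrow> complex" and b t :: real
  assumes "(f has_field_derivative D) (at (Complex (- t) b))"
  shows "((\<lambda>t. (norm (f (Complex (- t) b)))\<^sup>2) has_real_derivative (- 2 * (f (Complex (- t) b) \<bullet> D))) (at t)"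
proof -
  have "((\<lambda>t. Complex (- t) b) has_vector_derivative - 1) (at t)"
  proof -
    have "((\<lambda>t. - of_real t + \<i> * of_real b) has_vector_derivative - 1 + 0) (at t)"
      by (auto intro!: derivative_eq_intros simp: has_vector_derivative_def scaleR_conv_of_real)
    moreover have "(\<lambda>t. - of_real t + \<i> * of_real b) = (\<lambda>t. Complex (- t) b)" by (simp add: fun_eq_iff complex_eq_iff)
    ultimately show ?thesis by simp
  qed
  from field_vector_diff_chain_at[OF this assms]
  have "((\<lambda>t. f (Complex (- t) b)) has_vector_derivative - D) (at t)" by (simp add: o_def)
  then have d: "((\<lambda>t. f (Complex (- t) b)) has_derivative (\<lambda>h. h *\<^sub>R (- D))) (at t)" by (simp add: has_vector_derivative_def)
  have "((\<lambda>t. f (Complex (- t) b) \<bullet> f (Complex (- t) b)) has_derivative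
      (\<lambda>h. f (Complex (- t) b) \<bullet> (h *\<^sub>R (- D)) + (h *\<^sub>R (- D)) \<bullet> f (Complex (- t) b))) (at t)"
    by (rule has_derivative_inner[OF d d])
  moreover have "(\<lambda>h. f (Complex (- t) b) \<bullet> (h *\<^sub>R (- D)) + (h *\<^sub>R (- D)) \<bullet> f (Complex (- t) b)) = (*) (- 2 * (f (Complex (- t) b) \<bullet> D))"
    by (simp add: fun_eq_iff inner_commute)
  ultimately show ?thesis by (simp add: has_field_derivative_def power2_norm_eq_inner)
qed

text \<open>With v = exp \<zeta> this says that the entries are O(|v|^-k) on the unit disc, on one
  sheet of the logarithm.\<close>

definition moderate :: "(complex \<Rightarrow> cmat) \<Rightarrow> bool" where
  "moderate G \<longleftrightarrow> (\<exists>C k. 0 \<le> C \<and> (\<forall>\<zeta> i j. Re \<zeta> \<le> 0 \<longrightarrow> \<bar>Im \<zeta>\<bar> \<le> pi \<longrightarrow> norm (G \<zeta> $ i $ j) \<le> C * exp (- real k * Re \<zeta>)))"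

lemma moderate_mult:
  assumes "moderate F" "moderate G"
  shows "moderate (\<lambda>\<zeta>. F \<zeta> ** G \<zeta>)"
proof -
  obtain C k where F: "0 \<le> C" "\<And>\<zeta> i j. Re \<zeta> \<le> 0 \<Longrightarrow> \<bar>Im \<zeta>\<bar> \<le> pi \<Longrightarrow> norm (F \<zeta> $ i $ j) \<le> C * exp (- real k * Re \<zeta>)"
    using assms(1) unfolding moderate_def by blast
  obtain D l where G: "0 \<le> D" "\<And>\<zeta> i j. Re \<zeta> \<le> 0 \<Longrightarrow> \<bar>Im \<zeta>\<bar> \<le> pi \<Longrightarrow> norm (G \<zeta> $ i $ j) \<le> D * exp (- real l * Re \<zeta>)"
    using assms(2) unfolding moderate_def by blast
  have "norm ((F \<zeta> ** G \<zeta>) $ i $ j) \<le> (2 * (C * D)) * exp (- real (k + l) * Re \<zeta>)" if z: "Re \<zeta> \<le> 0" "\<bar>Im \<zeta>\<bar> \<le> pi" for \<zeta> i j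
  proof -
    have e: "exp (- real (k + l) * Re \<zeta>) = exp (- real k * Re \<zeta>) * exp (- real l * Re \<zeta>)"
      by (simp add: exp_add[symmetric] algebra_simps)
    have m: "norm (F \<zeta> $ i $ q * G \<zeta> $ q $ j) \<le> (C * exp (- real k * Re \<zeta>)) * (D * exp (- real l * Re \<zeta>))" for q
      unfolding norm_mult by (rule mult_mono[OF F(2)[OF z] G(2)[OF z]]) (use F(1) in auto)
    show ?thesis unfolding mmult_nth e
      using norm_triangle_ineq[of "F \<zeta> $ i $ 1 * G \<zeta> $ 1 $ j" "F \<zeta> $ i $ 2 * G \<zeta> $ 2 $ j"] m[of 1] m[of 2]
      by (simp add: algebra_simps)
  qed
  moreover have "0 \<le> 2 * (C * D)" using F(1) G(1) by simp
  ultimately show ?thesis unfolding moderate_def by blast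
qed

lemma moderate_adj2: "moderate F \<Longrightarrow> moderate (\<lambda>\<zeta>. adj2 (F \<zeta>))"
  unfolding moderate_def all_2_iff adj2_nth norm_minus_cancel by blast

text \<open>Gronwall's argument along the lines of constant Im \<zeta>: the sum of the squared
  entries grows at most like exp (4 K t) as Re \<zeta> = -t decreases, and its value at t = 0 is
  bounded on the compact interval |Im \<zeta>| \<le> pi.\<close>

lemma moderate_solution:
  assumes H: "\<And>\<zeta>. Re \<zeta> < c \<Longrightarrow> has_mderiv H (B \<zeta> ** H \<zeta>) \<zeta>" and c: "0 < c"
    and B: "\<And>\<zeta> i j. Re \<zeta> \<le> 0 \<Longrightarrow> norm (B \<zeta> $ i $ j) \<le> K"
  shows "moderate H"
proof -
  define q where "q b t = (\<Sum>i\<in>UNIV. \<Sum>j\<in>UNIV. (norm (H (Complex (- t) b) $ i $ j))\<^sup>2)" for b t :: real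
  have K0: "0 \<le> K" by (rule order_trans[OF norm_ge_zero B[of 0 1 1]]) simp
  have decay: "q b t \<le> q b 0 * exp (4 * K * t)" if t: "0 \<le> t" for b t
  proof -
    define q' where "q' t = (\<Sum>i\<in>UNIV. \<Sum>j\<in>UNIV. - 2 * (H (Complex (- t) b) $ i $ j \<bullet> (B (Complex (- t) b) ** H (Complex (- t) b)) $ i $ j))" for t
    have d: "(q b has_real_derivative q' t) (at t)" if "0 \<le> t" for t
      unfolding q_def q'_def
      by (intro DERIV_sum norm_square_derivative has_mderivD[OF H]) (use that c in auto)
    have bound: "q' t \<le> 4 * K * q b t" if "0 \<le> t" for t
    proof -
      define z where "z = Complex (- t) b"
      have z: "Re z \<le> 0" using that by (simp add: z_def)
      define h where "h i j = norm (H z $ i $ j)" for i j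
      have e: "- 2 * (H z $ i $ j \<bullet> (B z ** H z) $ i $ j) \<le> 2 * K * (h i j * (h 1 j + h 2 j))" for i j
      proof -
        have "\<bar>H z $ i $ j \<bullet> (B z ** H z) $ i $ j\<bar> \<le> h i j * norm ((B z ** H z) $ i $ j)"
          unfolding h_def by (rule Cauchy_Schwarz_ineq2)
        also have "norm ((B z ** H z) $ i $ j) \<le> K * h 1 j + K * h 2 j"
          unfolding mmult_nth h_def
          by (rule norm_triangle_le) (intro add_mono; simp add: norm_mult mult_right_mono B[OF z])
        finally have "\<bar>H z $ i $ j \<bullet> (B z ** H z) $ i $ j\<bar> \<le> h i j * (K * h 1 j + K * h 2 j)"
          by (simp add: h_def mult_left_mono)
        then have "- 2 * (H z $ i $ j \<bullet> (B z ** H z) $ i $ j) \<le> 2 * (h i j * (K * h 1 j + K * h 2 j))" by linarith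
        then show ?thesis by (simp add: algebra_simps)
      qed
      have "q' t \<le> (\<Sum>i\<in>UNIV. \<Sum>j\<in>UNIV. 2 * K * (h i j * (h 1 j + h 2 j)))"
        unfolding q'_def z_def[symmetric] by (intro sum_mono e)
      also have "\<dots> = 2 * K * ((h 1 1 + h 2 1)\<^sup>2 + (h 1 2 + h 2 2)\<^sup>2)" by (simp add: sum_2 power2_eq_square algebra_simps)
      also have "\<dots> \<le> 2 * K * (2 * ((h 1 1)\<^sup>2 + (h 2 1)\<^sup>2 + (h 1 2)\<^sup>2 + (h 2 2)\<^sup>2))"
      proof (intro mult_left_mono)
        show "(h 1 1 + h 2 1)\<^sup>2 + (h 1 2 + h 2 2)\<^sup>2 \<le> 2 * ((h 1 1)\<^sup>2 + (h 2 1)\<^sup>2 + (h 1 2)\<^sup>2 + (h 2 2)\<^sup>2)"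
          using zero_le_power2[of "h 1 1 - h 2 1"] zero_le_power2[of "h 1 2 - h 2 2"] by (simp add: power2_eq_square algebra_simps)
      qed (use K0 in simp)
      also have "\<dots> = 4 * K * q b t" by (simp add: q_def h_def z_def sum_2 algebra_simps)
      finally show ?thesis .
    qed
    have "q b t * exp (- (4 * K * t)) \<le> q b 0 * exp (- (4 * K * 0))"
    proof (rule DERIV_nonpos_imp_nonincreasing[OF t])
      fix s assume s: "0 \<le> s" "s \<le> t"
      have "((\<lambda>t. q b t * exp (- (4 * K * t))) has_real_derivative (q' s - 4 * K * q b s) * exp (- (4 * K * s))) (at s)"
        by (rule derivative_eq_intros d s refl)+ (simp add: algebra_simps)
      moreover have "(q' s - 4 * K * q b s) * exp (- (4 * K * s)) \<le> 0" using bound[OF s(1)] by (intro mult_nonpos_nonneg) auto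
      ultimately show "\<exists>y. ((\<lambda>t. q b t * exp (- (4 * K * t))) has_real_derivative y) (at s) \<and> y \<le> 0" by blast
    qed
    then show ?thesis by (simp add: exp_minus field_simps)
  qed
  have hH: "mholo H {\<zeta>. Re \<zeta> < c}" by (rule mholo_mderiv[OF _ H]) (auto simp: open_halfspace_Re_lt)
  have cH: "continuous_on {- pi..pi} (\<lambda>b. H (Complex (- 0) b) $ i $ j)" for i j
    by (rule continuous_on_compose2[OF holomorphic_on_imp_continuous_on[OF mholoD[OF hH, of i j]], where f = "\<lambda>b. Complex (- 0) b"])
       (use c in \<open>auto intro!: continuous_intros\<close>)
  have cont: "continuous_on {- pi..pi} (\<lambda>b. q b 0)"
    unfolding q_def sum_2 by (intro continuous_on_add continuous_on_power continuous_on_norm cH)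
  then have "compact ((\<lambda>b. q b 0) ` {- pi..pi})" by (rule compact_continuous_image) simp
  then have "bdd_above ((\<lambda>b. q b 0) ` {- pi..pi})" by (intro bounded_imp_bdd_above compact_imp_bounded)
  then obtain C where "\<forall>y\<in>(\<lambda>b. q b 0) ` {- pi..pi}. y \<le> C" unfolding bdd_above_def by blast
  then have C: "q b 0 \<le> C" if "- pi \<le> b" "b \<le> pi" for b using that by auto
  have "0 \<le> q 0 0" unfolding q_def by (intro sum_nonneg) auto
  then have C0: "0 \<le> C" using C[of 0] by simp
  obtain k :: nat where k: "4 * K \<le> real k" using real_arch_simple by blast
  have "norm (H \<zeta> $ i $ j) \<le> (1 + C) * exp (- real k * Re \<zeta>)" if z: "Re \<zeta> \<le> 0" "\<bar>Im \<zeta>\<bar> \<le> pi" for \<zeta> i j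
  proof -
    have "(norm (H \<zeta> $ i $ j))\<^sup>2 \<le> (\<Sum>j\<in>UNIV. (norm (H \<zeta> $ i $ j))\<^sup>2)" by (rule member_le_sum[where f = "\<lambda>j. (norm (H \<zeta> $ i $ j))\<^sup>2"]) auto
    also have "\<dots> \<le> q (Im \<zeta>) (- Re \<zeta>)" unfolding q_def by (simp, rule member_le_sum[where f = "\<lambda>i. \<Sum>j\<in>UNIV. (norm (H \<zeta> $ i $ j))\<^sup>2"]) (auto intro: sum_nonneg)
    also have "\<dots> \<le> q (Im \<zeta>) 0 * exp (4 * K * (- Re \<zeta>))" by (rule decay) (use z in simp)
    also have "\<dots> \<le> C * exp (real k * (- Re \<zeta>))"
      using C[of "Im \<zeta>"] z C0 k by (intro mult_mono) (auto intro: mult_right_mono mult_right_mono_neg)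
    finally have s: "(norm (H \<zeta> $ i $ j))\<^sup>2 \<le> C * exp (- real k * Re \<zeta>)" by simp
    have "2 * norm (H \<zeta> $ i $ j) \<le> 1 + (norm (H \<zeta> $ i $ j))\<^sup>2"
      using zero_le_power2[of "norm (H \<zeta> $ i $ j) - 1"] by (simp add: power2_eq_square algebra_simps)
    then have "norm (H \<zeta> $ i $ j) \<le> 1 + (norm (H \<zeta> $ i $ j))\<^sup>2"
      using norm_ge_zero[of "H \<zeta> $ i $ j"] by linarith
    moreover have "1 \<le> exp (- real k * Re \<zeta>)" using z by (simp add: mult_nonneg_nonpos)
    ultimately have "norm (H \<zeta> $ i $ j) \<le> exp (- real k * Re \<zeta>) + C * exp (- real k * Re \<zeta>)" using s by linarith
    then show ?thesis by (simp add: algebra_simps)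
  qed
  then show ?thesis unfolding moderate_def using C0 by (intro exI[of _ "1 + C"] exI[of _ k]) auto
qed

section \<open>Poles of single-valued functions at a singular point\<close>

lemma periodic_int:
  assumes "\<And>\<zeta>. P (Re \<zeta>) \<Longrightarrow> G (\<zeta> + 2 * of_real pi * \<i>) = G \<zeta>" "P (Re \<zeta>)"
  shows "G (\<zeta> + of_int k * (2 * of_real pi * \<i>)) = G \<zeta>"
proof (induction k rule: int_induct[where k = 0])
  case (step1 k)
  have e: "\<zeta> + of_int (k + 1) * (2 * of_real pi * \<i>) = (\<zeta> + of_int k * (2 * of_real pi * \<i>)) + 2 * of_real pi * \<i>" by (simp add: algebra_simps)
  have "G (\<zeta> + of_int (k + 1) * (2 * of_real pi * \<i>)) = G (\<zeta> + of_int k * (2 * of_real pi * \<i>))"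
    unfolding e by (rule assms(1)) (use assms(2) in simp)
  then show ?case using step1 by simp
next
  case (step2 k)
  have e: "\<zeta> + of_int k * (2 * of_real pi * \<i>) = (\<zeta> + of_int (k - 1) * (2 * of_real pi * \<i>)) + 2 * of_real pi * \<i>" by (simp add: algebra_simps)
  have "G (\<zeta> + of_int k * (2 * of_real pi * \<i>)) = G (\<zeta> + of_int (k - 1) * (2 * of_real pi * \<i>))"
    unfolding e by (rule assms(1)) (use assms(2) in simp)
  then show ?case using step2 by simp
qed simp

lemma periodic_exp:
  assumes "\<And>\<zeta>. P (Re \<zeta>) \<Longrightarrow> G (\<zeta> + 2 * of_real pi * \<i>) = G \<zeta>" "P (Re \<zeta>)" "exp \<zeta>' = exp \<zeta>"
  shows "G \<zeta>' = G \<zeta>"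
proof -
  obtain n :: int where "\<zeta>' = \<zeta> + (of_int (2 * n) * pi) * \<i>" using assms(3) unfolding exp_eq by blast
  then have "\<zeta>' = \<zeta> + of_int n * (2 * of_real pi * \<i>)" by simp
  then show ?thesis using periodic_int[of P G, OF assms(1,2)] by simp
qed

text \<open>By periodicity \<open>G\<close> is a function of v = exp \<zeta> in the punctured disc;
  moderate growth bounds v^k \<open>G\<close>, and the removable singularity theorem turns this into
  a pole of finite order.\<close>

lemma periodic_pole:
  assumes hG: "mholo G {\<zeta>. Re \<zeta> < ln 2}" and per: "\<And>\<zeta>. Re \<zeta> < ln 2 \<Longrightarrow> G (\<zeta> + 2 * of_real pi * \<i>) = G \<zeta>"
    and mod: "moderate G"
  obtains N :: nat and g where "mholo g (ball 0 2)"
    "\<And>\<zeta>. Re \<zeta> < ln 2 \<Longrightarrow> G \<zeta> = scale_mat (exp (- (of_nat N * \<zeta>))) (g (exp \<zeta>))"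
proof -
  obtain C k where C: "0 \<le> C" "\<And>\<zeta> i j. Re \<zeta> \<le> 0 \<Longrightarrow> \<bar>Im \<zeta>\<bar> \<le> pi \<Longrightarrow> norm (G \<zeta> $ i $ j) \<le> C * exp (- real k * Re \<zeta>)"
    using mod unfolding moderate_def by blast
  have Re_Ln: "Re (Ln v) < ln 2" if "v \<in> ball 0 2 - {0}" for v
    using that by simp
  have "\<exists>g. g holomorphic_on ball 0 2 \<and> (\<forall>v\<in>ball 0 2 - {0}. g v = v ^ k * G (Ln v) $ i $ j)" for i j
  proof (subst holomorphic_on_extend_bounded)
    let ?B = "ball 0 2 - {0} :: complex set" and ?h = "\<lambda>v. v ^ k * G (Ln v) $ i $ j"
    \<comment> \<open>\<open>Ln\<close> jumps on the negative axis. There the branch Ln (-v) + pi i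
      is holomorphic, and periodicity shows that both branches give the same value of
      \<open>G\<close>.\<close>
    have "?h holomorphic_on (?B - \<real>\<^sub>\<le>\<^sub>0) \<union> (?B \<inter> {v. Re v < 0})"
    proof (rule holomorphic_on_Un)
      have "mholo (\<lambda>v. G (Ln v)) (?B - \<real>\<^sub>\<le>\<^sub>0)"
        by (rule mholo_compose[OF hG]) (use Re_Ln in \<open>auto intro!: holomorphic_intros\<close>)
      then show "?h holomorphic_on ?B - \<real>\<^sub>\<le>\<^sub>0" by (intro holomorphic_intros mholoD)
      have "mholo (\<lambda>v. G (Ln (- v) + of_real pi * \<i>)) (?B \<inter> {v. Re v < 0})"
      proof (rule mholo_compose[OF hG])
        show "(\<lambda>v. Ln (- v) + of_real pi * \<i>) holomorphic_on ?B \<inter> {v. Re v < 0}"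
          by (intro holomorphic_intros) (auto simp: complex_nonpos_Reals_iff)
      qed auto
      then have "(\<lambda>v. v ^ k * G (Ln (- v) + of_real pi * \<i>) $ i $ j) holomorphic_on ?B \<inter> {v. Re v < 0}"
        by (intro holomorphic_intros mholoD)
      moreover have "v ^ k * G (Ln (- v) + of_real pi * \<i>) $ i $ j = ?h v" if "v \<in> ?B \<inter> {v. Re v < 0}" for v
      proof -
        have "G (Ln (- v) + of_real pi * \<i>) = G (Ln v)"
          by (rule periodic_exp[where P = "\<lambda>r. r < ln 2" and G = G, OF per]) (use Re_Ln that in \<open>auto simp: exp_add\<close>)
        then show ?thesis by simp
      qed
      ultimately show "?h holomorphic_on ?B \<inter> {v. Re v < 0}" by (rule holomorphic_transform)
    qed (auto intro!: open_Diff open_Int open_halfspace_Re_lt)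
    moreover have "(?B - \<real>\<^sub>\<le>\<^sub>0) \<union> (?B \<inter> {v. Re v < 0}) = ?B"
      by (auto simp: complex_nonpos_Reals_iff complex_eq_iff)
    ultimately show "?h holomorphic_on ?B" by simp
    have "\<forall>\<^sub>F v in at 0. v \<in> ball 0 1 - {0}" by (intro eventually_at_in_open) auto
    then have "\<forall>\<^sub>F v in at 0. norm (?h v) \<le> C"
    proof eventually_elim
      case (elim v)
      have n: "0 < norm v" "norm v < 1" using elim by auto
      have "norm (G (Ln v) $ i $ j) \<le> C * exp (- real k * Re (Ln v))"
        by (rule C(2)) (use n mpi_less_Im_Ln[of v] Im_Ln_le_pi[of v] in auto)
      also have "exp (- real k * Re (Ln v)) = inverse (norm v) ^ k"
        using n by (simp add: exp_of_nat_mult exp_minus power_inverse)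
      finally have "norm (?h v) \<le> norm v ^ k * (C * inverse (norm v) ^ k)"
        by (simp add: norm_mult norm_power mult_left_mono)
      also have "\<dots> = C" using n by (simp add: field_simps)
      finally show ?case .
    qed
    then show "\<exists>B. \<forall>\<^sub>F v in at 0. norm (?h v) \<le> B" by blast
  qed simp
  then obtain g' where g': "\<And>i j. g' i j holomorphic_on ball 0 2" "\<And>i j v. v \<in> ball 0 2 - {0} \<Longrightarrow> g' i j v = v ^ k * G (Ln v) $ i $ j" by metis
  define g where "g v = (\<chi> i j. g' i j v)" for v
  show thesis
  proof (rule that[of g k])
    show "mholo g (ball 0 2)" using g'(1) by (simp add: mholo_def g_def)
    fix \<zeta> :: complex assume z: "Re \<zeta> < ln 2"
    have "norm (exp \<zeta>) < 2" using z by (metis exp_less_cancel_iff exp_ln norm_exp_eq_Re zero_less_numeral)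
    then have b: "exp \<zeta> \<in> ball 0 2 - {0}" by simp
    have "G (Ln (exp \<zeta>)) = G \<zeta>" by (rule periodic_exp[where P = "\<lambda>r. r < ln 2" and G = G, OF per z]) auto
    then have "g (exp \<zeta>) $ i $ j = exp (of_nat k * \<zeta>) * G \<zeta> $ i $ j" for i j
      using g'(2)[OF b, of i j] by (simp add: g_def exp_of_nat_mult)
    then show "G \<zeta> = scale_mat (exp (- (of_nat k * \<zeta>))) (g (exp \<zeta>))"
      by (simp add: vec_eq_iff exp_minus)
  qed
qed

text \<open>Insert v^-N g(v) into v R' = P R - R Q and compare the lowest coefficients. Off 0 the
  relation is an identity between holomorphic functions, and analytic continuation evaluates it at
  0.\<close>

lemma leading_coefficient:
  assumes G: "\<And>\<zeta>. Re \<zeta> < ln 2 \<Longrightarrow> has_mderiv G (P (exp \<zeta>) ** G \<zeta> - G \<zeta> ** Q (exp \<zeta>)) \<zeta>"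
    and h: "mholo P (ball 0 2)" "mholo Q (ball 0 2)" "mholo g (ball 0 2)"
    and Gg: "\<And>\<zeta>. Re \<zeta> < ln 2 \<Longrightarrow> G \<zeta> = scale_mat (exp (- (of_nat N * \<zeta>))) (g (exp \<zeta>))"
  shows "P 0 ** g 0 + scale_mat (of_nat N) (g 0) = g 0 ** Q 0"
proof -
  have "(P 0 ** g 0 + scale_mat (of_nat N) (g 0)) $ i $ j = (g 0 ** Q 0) $ i $ j" for i j
  proof -
    let ?d = "deriv (\<lambda>v. g v $ i $ j)"
    let ?f = "\<lambda>v. (P v ** g v + scale_mat (of_nat N) (g v)) $ i $ j - (g v ** Q v) $ i $ j"
    have hg: "(\<lambda>v. g v $ i $ j) holomorphic_on ball 0 2" using h(3) by (rule mholoD)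
    have "0 * ?d 0 = ?f 0"
    proof (rule analytic_continuation_open[where f = "\<lambda>v. v * ?d v" and g = ?f and s = "ball 0 2 - {0}" and s' = "ball 0 2" and z = 0])
      show "(\<lambda>v. v * ?d v) holomorphic_on ball 0 2" using hg by (intro holomorphic_intros) auto
      have "mholo (\<lambda>v. P v ** g v) (ball 0 2)" "mholo (\<lambda>v. g v ** Q v) (ball 0 2)" by (intro mholo_mult h)+
      then show "?f holomorphic_on ball 0 2"
        unfolding vector_add_component scale_mat_nth using hg by (intro holomorphic_intros) (auto intro: mholoD)
      have "(1::complex) \<in> ball 0 2 - {0}" by simp
      then show "ball 0 2 - {0} \<noteq> ({} :: complex set)" by blast
    next
      fix v :: complex assume l: "v \<in> ball 0 2 - {0}"
      define \<zeta> where "\<zeta> = Ln v"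
      have z: "Re \<zeta> < ln 2" "exp \<zeta> = v" using l by (auto simp: \<zeta>_def)
      have "((\<lambda>v. g v $ i $ j) has_field_derivative ?d (exp \<zeta>)) (at (exp \<zeta>))"
        by (rule holomorphic_derivI[OF hg]) (use l z in auto)
      then have d1: "((\<lambda>\<zeta>. g (exp \<zeta>) $ i $ j) has_field_derivative ?d (exp \<zeta>) * exp \<zeta>) (at \<zeta>)"
        by (rule DERIV_chain2) (rule DERIV_exp)
      have "((\<lambda>\<zeta>. exp (- (of_nat N * \<zeta>)) * g (exp \<zeta>) $ i $ j) has_field_derivative
         exp (- (of_nat N * \<zeta>)) * (v * ?d v - of_nat N * g v $ i $ j)) (at \<zeta>)"
        by (rule derivative_eq_intros d1 refl)+ (simp add: z(2) algebra_simps)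
      moreover have "((\<lambda>\<zeta>. exp (- (of_nat N * \<zeta>)) * g (exp \<zeta>) $ i $ j) has_field_derivative
         (P (exp \<zeta>) ** G \<zeta> - G \<zeta> ** Q (exp \<zeta>)) $ i $ j) (at \<zeta>)"
      proof (rule has_field_derivative_transform_within_open[OF has_mderivD[OF G[OF z(1)], of i j]])
        show "open {\<zeta>. Re \<zeta> < ln 2}" by (rule open_halfspace_Re_lt)
      qed (use z Gg in auto)
      ultimately have "exp (- (of_nat N * \<zeta>)) * (v * ?d v - of_nat N * g v $ i $ j) = (P (exp \<zeta>) ** G \<zeta> - G \<zeta> ** Q (exp \<zeta>)) $ i $ j"
        by (rule DERIV_unique)
      also have "\<dots> = exp (- (of_nat N * \<zeta>)) * ((P v ** g v) $ i $ j - (g v ** Q v) $ i $ j)"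
        unfolding Gg[OF z(1)] z(2) scale_mat_mult by (simp add: algebra_simps)
      finally have "v * ?d v - of_nat N * g v $ i $ j = (P v ** g v) $ i $ j - (g v ** Q v) $ i $ j" by simp
      then show "v * ?d v = ?f v" by (simp add: algebra_simps)
    qed auto
    then show ?thesis by simp
  qed
  then show ?thesis by (simp add: vec_eq_iff)
qed

lemma mholo_divide_zero:
  assumes g: "mholo g (ball 0 2)" and g0: "g 0 = 0"
  obtains g' where "mholo g' (ball 0 2)" "\<And>v. g v = scale_mat v (g' v)"
proof -
  define g' where "g' v = (\<chi> i j. if v = 0 then deriv (\<lambda>v. g v $ i $ j) 0 else (g v $ i $ j - g 0 $ i $ j) / (v - 0))" for v
  show thesis
  proof (rule that[of g'])
    show "mholo g' (ball 0 2)" unfolding mholo_def g'_def using pole_lemma_open[OF mholoD[OF g], where a = 0] by simp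
    show "g v = scale_mat v (g' v)" for v using g0 by (simp add: vec_eq_iff g'_def)
  qed
qed

text \<open>As long as the Sylvester equation for the current order has only the zero solution, the
  leading coefficient vanishes and the order drops by one; induction removes the pole.\<close>

lemma pole_removal:
  assumes G: "\<And>\<zeta>. Re \<zeta> < ln 2 \<Longrightarrow> has_mderiv G (P (exp \<zeta>) ** G \<zeta> - G \<zeta> ** Q (exp \<zeta>)) \<zeta>"
    and h: "mholo P (ball 0 2)" "mholo Q (ball 0 2)"
  shows "mholo g (ball 0 2) \<Longrightarrow>
    (\<And>\<zeta>. Re \<zeta> < ln 2 \<Longrightarrow> G \<zeta> = scale_mat (exp (- (of_nat N * \<zeta>))) (g (exp \<zeta>))) \<Longrightarrow>
    (\<And>k a. 0 < k \<Longrightarrow> k \<le> N \<Longrightarrow> P 0 ** a + scale_mat (of_nat k) a = a ** Q 0 \<Longrightarrow> a = 0) \<Longrightarrow>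
    \<exists>g. mholo g (ball 0 2) \<and> (\<forall>\<zeta>. Re \<zeta> < ln 2 \<longrightarrow> G \<zeta> = g (exp \<zeta>))"
proof (induction N arbitrary: g)
  case 0
  have "G \<zeta> = g (exp \<zeta>)" if "Re \<zeta> < ln 2" for \<zeta> using 0(2)[OF that] by (simp add: vec_eq_iff)
  then show ?case using 0(1) by blast
next
  case (Suc N)
  have "P 0 ** g 0 + scale_mat (of_nat (Suc N)) (g 0) = g 0 ** Q 0"
    by (rule leading_coefficient[OF G h Suc.prems(1,2)])
  then have "g 0 = 0" by (rule Suc.prems(3)[rotated -1]) auto
  then obtain g' where g': "mholo g' (ball 0 2)" "\<And>v. g v = scale_mat v (g' v)" using mholo_divide_zero[OF Suc.prems(1)] by metis
  show ?case
  proof (rule Suc.IH[OF g'(1)])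
    fix \<zeta> :: complex assume z: "Re \<zeta> < ln 2"
    have "exp (- (of_nat (Suc N) * \<zeta>)) * exp \<zeta> = exp (- (of_nat N * \<zeta>))" by (simp add: exp_add[symmetric] algebra_simps)
    then show "G \<zeta> = scale_mat (exp (- (of_nat N * \<zeta>))) (g' (exp \<zeta>))"
      unfolding Suc.prems(2)[OF z] g'(2)[of "exp \<zeta>"] by (simp add: vec_eq_iff mult.assoc[symmetric])
  qed (use Suc.prems(3) in auto)
qed

text \<open>Both matrices have eigenvalues \<theta>/2 and -\<theta>/2, so a -> A a - a B has the
  eigenvalues 0, \<theta> and -\<theta>. Adding N times the identity leaves it invertible unless N =
  0 or N^2 = \<theta>^2.\<close>

lemma sylvester_traceless:
  assumes "trace A = 0" "trace B = 0" "det A = - (\<theta>\<^sup>2 / 4)" "det B = - (\<theta>\<^sup>2 / 4)" "N \<noteq> 0" "N\<^sup>2 \<noteq> \<theta>\<^sup>2"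
    and a: "A ** a + scale_mat N a = a ** B"
  shows "a = 0"
proof -
  have A: "A$2$2 = - A$1$1" "B$2$2 = - B$1$1" using assms(1,2) by (simp_all add: trace_2 add_eq_0_iff)
  have d: "4 * (A$1$1 * A$1$1 + A$1$2 * A$2$1) = \<theta>\<^sup>2" "4 * (B$1$1 * B$1$1 + B$1$2 * B$2$1) = \<theta>\<^sup>2"
    using assms(3)[unfolded det_2 A] assms(4)[unfolded det_2 A] by (simp_all add: eq_neg_iff_add_eq_0 field_simps)
  have e: "A$i$1 * a$1$j + A$i$2 * a$2$j + N * a$i$j = a$i$1 * B$1$j + a$i$2 * B$2$j" for i j
    using arg_cong[OF a, of "\<lambda>M. M $ i $ j"] by (simp add: mmult_nth)
  note e' = e[of 1 1] e[of 1 2] e[of 2 1] e[of 2 2]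
  have z: "N * ((N\<^sup>2 - \<theta>\<^sup>2) * a$1$1) = 0" "N * ((N\<^sup>2 - \<theta>\<^sup>2) * a$1$2) = 0"
    "N * ((N\<^sup>2 - \<theta>\<^sup>2) * a$2$1) = 0" "N * ((N\<^sup>2 - \<theta>\<^sup>2) * a$2$2) = 0"
    using e' d unfolding A by algebra+
  then show ?thesis using assms(5,6) by (simp add: cmat_eq_iff)
qed

text \<open>With C = A + n/2 + N the hypothesis reads C a = a L, whence C^2 a = a L^2 = 0. If det C
  = N (N + n) is nonzero, then a = 0. For N = 0 the Cayley-Hamilton theorem gives C^2 = n C, so a L
  = C a = 0.\<close>

lemma nilpotent_sylvester:
  assumes A: "trace A = 0" "det A = - (n\<^sup>2 / 4)" and L: "L ** L = 0"
    and a: "A ** a + scale_mat (n / 2 + N) a = a ** L"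
  shows "N * (N + n) \<noteq> 0 \<Longrightarrow> a = 0" and "N = 0 \<Longrightarrow> n \<noteq> 0 \<Longrightarrow> a ** L = 0"
proof -
  define C where "C = A + mat (n / 2 + N)"
  define b where "b = a ** L"
  have Ca: "C ** a = b" using a by (simp add: C_def b_def cmat_eq_iff mmult_nth mat_def algebra_simps)
  have "C ** b = (C ** a) ** L" by (simp add: b_def matrix_mul_assoc)
  also have "\<dots> = a ** (L ** L)" by (simp add: Ca b_def matrix_mul_assoc)
  finally have Cb: "C ** b = 0" by (simp add: L)
  have A': "A$2$2 = - A$1$1" using A(1) by (simp add: trace_2 add_eq_0_iff)
  have dA: "A$1$1 * A$1$1 + A$1$2 * A$2$1 = n\<^sup>2 / 4" using A(2)[unfolded det_2 A'] by (simp add: eq_neg_iff_add_eq_0 field_simps)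
  have dC: "det C = N * (N + n)" "trace C = n + 2 * N"
    using dA by (simp_all add: det_2 trace_2 C_def mat_def A' power2_eq_square field_simps)
  have adj: "scale_mat (det C) M = adj2 C ** (C ** M)" for M by (simp add: matrix_mul_assoc adj2_left mat_mult_left(1))
  show "a = 0" if "N * (N + n) \<noteq> 0"
  proof -
    have "scale_mat (det C) b = 0" by (simp add: adj Cb)
    then have "b = 0" using that dC(1) by (simp add: cmat_eq_iff)
    then have "scale_mat (det C) a = 0" by (simp add: adj Ca)
    then show ?thesis using that dC(1) by (simp add: cmat_eq_iff)
  qed
  show "a ** L = 0" if "N = 0" "n \<noteq> 0"
  proof -
    have "C ** (C ** a) = scale_mat (trace C) (C ** a) - scale_mat (det C) a"
      by (simp add: cmat_eq_iff mmult_nth trace_2 det_2 algebra_simps)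
    then have "scale_mat n b = 0" using Cb that dC by (simp add: Ca cmat_eq_iff)
    then show ?thesis using that by (simp add: b_def cmat_eq_iff)
  qed
qed

lemma has_mderiv_scale:
  assumes "(f has_field_derivative f') (at z)" "has_mderiv F D z"
  shows "has_mderiv (\<lambda>v. scale_mat (f v) (F v)) (scale_mat f' (F z) + scale_mat (f z) D) z"
  unfolding has_mderiv_def scale_mat_nth vector_add_component
proof (intro allI)
  fix i j
  show "((\<lambda>v. f v * F v $ i $ j) has_field_derivative f' * F z $ i $ j + f z * D $ i $ j) (at z)"
    by (rule derivative_eq_intros assms(1) has_mderivD[OF assms(2)] refl)+ (simp add: algebra_simps)
qed

lemma has_mderiv_linear: "has_mderiv (\<lambda>v. mat 1 - scale_mat v L) (- L) z"
  unfolding has_mderiv_def vector_minus_component scale_mat_nth vector_uminus_component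
  by (auto intro!: derivative_eq_intros)

lemma moderate_linear:
  fixes L :: cmat and a :: real
  assumes "a \<ge> 0"
  shows "moderate (\<lambda>\<zeta>. scale_mat (exp (of_real a * \<zeta>)) (mat 1 - scale_mat \<zeta> L))"
proof -
  define C where "C = 1 + (1 + pi) * norm L"
  have "norm (exp (of_real a * \<zeta>) * (mat 1 - scale_mat \<zeta> L) $ i $ j) \<le> C * exp (- real 1 * Re \<zeta>)" if z: "Re \<zeta> \<le> 0" "\<bar>Im \<zeta>\<bar> \<le> pi" for \<zeta> i j
  proof -
    have E: "1 - Re \<zeta> \<le> exp (- Re \<zeta>)" using exp_ge_add_one_self[of "- Re \<zeta>"] by simp
    have e1: "norm (exp (of_real a * \<zeta>)) \<le> 1" using z assms by (simp add: mult_nonneg_nonpos)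
    have e2: "norm ((mat 1 :: cmat) $ i $ j) \<le> 1" by (simp add: mat_def)
    have e3: "norm \<zeta> \<le> (1 + pi) * exp (- Re \<zeta>)"
    proof -
      have "norm \<zeta> \<le> - Re \<zeta> + pi" using cmod_le[of \<zeta>] z by linarith
      also have "\<dots> \<le> exp (- Re \<zeta>) + pi * exp (- Re \<zeta>)"
        using E z mult_left_mono[of 1 "exp (- Re \<zeta>)" pi] by (intro add_mono) auto
      finally show ?thesis by (simp add: algebra_simps)
    qed
    have "norm ((mat 1 - scale_mat \<zeta> L) $ i $ j) \<le> norm ((mat 1 :: cmat) $ i $ j) + norm (\<zeta> * L $ i $ j)"
      unfolding vector_minus_component scale_mat_nth by (rule norm_triangle_ineq4)
    also have "\<dots> \<le> exp (- Re \<zeta>) + (1 + pi) * exp (- Re \<zeta>) * norm L"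
      using e2 e3 E z norm_entry_le[of L i j] by (intro add_mono) (auto simp: norm_mult intro!: mult_mono)
    finally have "norm ((mat 1 - scale_mat \<zeta> L) $ i $ j) \<le> C * exp (- Re \<zeta>)" by (simp add: C_def algebra_simps)
    moreover have "norm (exp (of_real a * \<zeta>) * (mat 1 - scale_mat \<zeta> L) $ i $ j) \<le> 1 * norm ((mat 1 - scale_mat \<zeta> L) $ i $ j)"
      unfolding norm_mult by (rule mult_right_mono[OF e1]) simp
    ultimately show ?thesis by simp
  qed
  moreover have "0 \<le> C" by (simp add: C_def)
  ultimately show ?thesis unfolding moderate_def scale_mat_nth by blast
qed

lemma moderate_local_solution:
  assumes H: "\<And>\<zeta>. Re \<zeta> < ln 2 \<Longrightarrow> has_mderiv H (P (exp \<zeta>) ** H \<zeta>) \<zeta>" and P: "mholo P (ball 0 2)"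
  shows "moderate H"
proof -
  have "\<exists>K. \<forall>v\<in>cball 0 1. norm (P v $ i $ j) \<le> K" for i j
  proof -
    have "continuous_on (cball 0 1) (\<lambda>v. P v $ i $ j)"
      by (rule continuous_on_subset[OF holomorphic_on_imp_continuous_on[OF mholoD[OF P]]]) auto
    then have "compact ((\<lambda>v. P v $ i $ j) ` cball 0 1)" by (rule compact_continuous_image) simp
    then have "bounded ((\<lambda>v. P v $ i $ j) ` cball 0 1)" by (rule compact_imp_bounded)
    then show ?thesis by (simp add: bounded_iff)
  qed
  then obtain K where K: "\<And>i j v. v \<in> cball 0 1 \<Longrightarrow> norm (P v $ i $ j) \<le> K i j" by metis
  define K' where "K' = max (max (K 1 1) (K 1 2)) (max (K 2 1) (K 2 2))"
  have "norm (P (exp \<zeta>) $ i $ j) \<le> K'" if "Re \<zeta> \<le> 0" for \<zeta> i j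
  proof -
    have "norm (P (exp \<zeta>) $ i $ j) \<le> K i j" by (rule K) (use that in simp)
    also have "\<dots> \<le> K'" using exhaust_2[of i] exhaust_2[of j] by (auto simp: K'_def)
    finally show ?thesis .
  qed
  then show ?thesis by (intro moderate_solution[OF H, of "ln 2" K']) auto
qed

text \<open>Here \<open>N = \<epsilon> exp (2 \<pi> i L)\<close> with \<open>\<epsilon> = (- 1)\<^sup>n\<close>, and the factor \<open>1 - \<zeta> L = exp (- \<zeta> L)\<close> removes the logarithms from \<open>H\<close>.\<close>
lemma resonant_form:
  fixes n :: nat and N :: cmat
  assumes H: "\<And>\<zeta>. Re \<zeta> < ln 2 \<Longrightarrow> has_mderiv H (P (exp \<zeta>) ** H \<zeta>) \<zeta>" and P: "mholo P (ball 0 2)"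
    and mon: "\<And>\<zeta>. Re \<zeta> < ln 2 \<Longrightarrow> H (\<zeta> + 2 * of_real pi * \<i>) = H \<zeta> ** N"
    and n: "n > 0" and P0: "trace (P 0) = 0" "det (P 0) = - ((of_nat n)\<^sup>2 / 4)"
    and N: "trace N = 2 * (-1) ^ n" "det N = 1"
  defines "L \<equiv> scale_mat ((-1) ^ n / (2 * of_real pi * \<i>)) (N - scale_mat ((-1) ^ n) (mat 1))"
  shows "L ** L = 0"
    and "\<exists>g. mholo g (ball 0 2) \<and> g 0 ** L = 0 \<and>
      (\<forall>\<zeta>. Re \<zeta> < ln 2 \<longrightarrow> scale_mat (exp (of_nat n / 2 * \<zeta>)) (H \<zeta> ** (mat 1 - scale_mat \<zeta> L)) = g (exp \<zeta>))"
proof -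
  define \<epsilon> :: complex where "\<epsilon> = (-1) ^ n"
  have \<epsilon>2: "\<epsilon> * \<epsilon> = 1" by (simp add: \<epsilon>_def power_mult_distrib[symmetric])
  have N22: "N$2$2 = 2 * \<epsilon> - N$1$1" using N(1) by (simp add: trace_2 \<epsilon>_def algebra_simps)
  have dN: "N$1$1 * (2 * \<epsilon> - N$1$1) - N$1$2 * N$2$1 = 1" using N(2) by (simp add: det_2 N22)
  \<comment> \<open>Trace and determinant say that \<open>N\<close> has the double eigenvalue
    \<epsilon>, so K^2 = 0 by the Cayley-Hamilton theorem.\<close>
  define K where "K = N - scale_mat \<epsilon> (mat 1)"
  have KK: "K ** K = 0" unfolding cmat_eq_iff mmult_nth K_def vector_minus_component scale_mat_nth mat_one_nth N22 zero_index
    by (intro conjI; (algebra | use dN \<epsilon>2 in algebra))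
  have L: "L = scale_mat (\<epsilon> / (2 * of_real pi * \<i>)) K" by (simp add: L_def K_def \<epsilon>_def)
  show LL: "L ** L = 0" by (simp add: L scale_mat_mult KK cmat_eq_iff)
  have NK: "N = K + scale_mat \<epsilon> (mat 1)" by (simp add: K_def)
  \<comment> \<open>Since N = \<epsilon> (1 + 2 pi i L) and L^2 = 0, a turn changes the factor 1 -
    \<zeta> L by the inverse of N, up to \<epsilon>.\<close>
  have NU: "N ** (mat 1 - scale_mat (\<zeta> + 2 * of_real pi * \<i>) L) = scale_mat \<epsilon> (mat 1 - scale_mat \<zeta> L)" for \<zeta>
  proof -
    have c: "(2 * of_real pi * \<i>) * (\<epsilon> / (2 * of_real pi * \<i>)) = \<epsilon>" by simp
    have KL: "K ** L = 0" by (simp add: L scale_mat_mult KK cmat_eq_iff)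
    have sL: "scale_mat (2 * of_real pi * \<i>) L = scale_mat \<epsilon> K" unfolding L using c by (simp add: cmat_eq_iff mult.assoc[symmetric])
    have "mat 1 - scale_mat (\<zeta> + 2 * of_real pi * \<i>) L = mat 1 - scale_mat \<zeta> L - scale_mat (2 * of_real pi * \<i>) L"
      by (simp add: cmat_eq_iff algebra_simps)
    also have "\<dots> = mat 1 - scale_mat \<zeta> L - scale_mat \<epsilon> K" by (simp add: sL)
    finally have e: "mat 1 - scale_mat (\<zeta> + 2 * of_real pi * \<i>) L = mat 1 - scale_mat \<zeta> L - scale_mat \<epsilon> K" .
    have kl: "K$1$1 * L$1$1 + K$1$2 * L$2$1 = 0" "K$1$1 * L$1$2 + K$1$2 * L$2$2 = 0" "K$2$1 * L$1$1 + K$2$2 * L$2$1 = 0" "K$2$1 * L$1$2 + K$2$2 * L$2$2 = 0"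
      using KL by (simp_all add: cmat_eq_iff mmult_nth)
    have kk: "K$1$1 * K$1$1 + K$1$2 * K$2$1 = 0" "K$1$1 * K$1$2 + K$1$2 * K$2$2 = 0" "K$2$1 * K$1$1 + K$2$2 * K$2$1 = 0" "K$2$1 * K$1$2 + K$2$2 * K$2$2 = 0"
      using KK by (simp_all add: cmat_eq_iff mmult_nth)
    show ?thesis unfolding e NK cmat_eq_iff mmult_nth vector_minus_component vector_add_component scale_mat_nth mat_one_nth
      by (intro conjI; (algebra | use kl kk \<epsilon>2 in algebra))
  qed
  \<comment> \<open>The factor exp (n \<zeta> / 2) shifts the exponents n/2 and -n/2 to n and 0,
    which excludes poles, and its sign (-1)^n under a turn cancels the remaining \<epsilon>.\<close>
  define c :: complex where "c = of_nat n / 2"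
  define U where "U \<zeta> = mat 1 - scale_mat \<zeta> L" for \<zeta>
  define G where "G \<zeta> = scale_mat (exp (c * \<zeta>)) (H \<zeta> ** U \<zeta>)" for \<zeta>
  have UL: "U \<zeta> ** L = L" for \<zeta>
  proof -
    have ll: "L$1$1 * L$1$1 + L$1$2 * L$2$1 = 0" "L$1$1 * L$1$2 + L$1$2 * L$2$2 = 0" "L$2$1 * L$1$1 + L$2$2 * L$2$1 = 0" "L$2$1 * L$1$2 + L$2$2 * L$2$2 = 0"
      using LL by (simp_all add: cmat_eq_iff mmult_nth)
    show ?thesis unfolding U_def cmat_eq_iff mmult_nth vector_minus_component scale_mat_nth mat_one_nth
      by (intro conjI; (algebra | use ll in algebra))
  qed
  define P' where "P' v = P v + mat c" for v
  have dG: "has_mderiv G (P' (exp \<zeta>) ** G \<zeta> - G \<zeta> ** L) \<zeta>" if z: "Re \<zeta> < ln 2" for \<zeta>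
  proof -
    have "has_mderiv G (scale_mat (c * exp (c * \<zeta>)) (H \<zeta> ** U \<zeta>) + scale_mat (exp (c * \<zeta>)) ((P (exp \<zeta>) ** H \<zeta>) ** U \<zeta> + H \<zeta> ** (- L))) \<zeta>"
      unfolding G_def[abs_def]
      by (rule has_mderiv_scale)
         (auto intro!: derivative_eq_intros has_mderiv_mult H[OF z] has_mderiv_linear simp: U_def[abs_def])
    moreover have "scale_mat (c * exp (c * \<zeta>)) (H \<zeta> ** U \<zeta>) + scale_mat (exp (c * \<zeta>)) ((P (exp \<zeta>) ** H \<zeta>) ** U \<zeta> + H \<zeta> ** (- L))
       = P' (exp \<zeta>) ** G \<zeta> - G \<zeta> ** L"
    proof -
      have "G \<zeta> ** L = scale_mat (exp (c * \<zeta>)) (H \<zeta> ** L)"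
        unfolding G_def scale_mat_mult by (simp add: matrix_mul_assoc[symmetric] UL)
      moreover have "P' (exp \<zeta>) ** G \<zeta> = scale_mat (exp (c * \<zeta>)) ((P (exp \<zeta>) ** H \<zeta>) ** U \<zeta>) + scale_mat c (G \<zeta>)"
        unfolding P'_def matrix_add_rdistrib2 G_def scale_mat_mult mat_mult_left(1) by (simp add: matrix_mul_assoc cmat_eq_iff algebra_simps)
      moreover have "scale_mat (exp (c * \<zeta>)) (H \<zeta> ** (- L)) = - scale_mat (exp (c * \<zeta>)) (H \<zeta> ** L)"
        by (simp add: cmat_eq_iff mmult_nth algebra_simps)
      ultimately show ?thesis by (simp add: G_def cmat_eq_iff algebra_simps)
    qed
    ultimately show ?thesis by simp
  qed
  have hG: "mholo G {\<zeta>. Re \<zeta> < ln 2}" by (rule mholo_mderiv[OF open_halfspace_Re_lt]) (use dG in auto)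
  have per: "G (\<zeta> + 2 * of_real pi * \<i>) = G \<zeta>" if z: "Re \<zeta> < ln 2" for \<zeta>
  proof -
    have e: "exp (c * (\<zeta> + 2 * of_real pi * \<i>)) = \<epsilon> * exp (c * \<zeta>)"
    proof -
      have "exp (c * (\<zeta> + 2 * of_real pi * \<i>)) = exp (c * \<zeta>) * exp (of_nat n * (of_real pi * \<i>))"
        unfolding exp_add[symmetric] by (simp add: c_def algebra_simps)
      also have "exp (of_nat n * (of_real pi * \<i>)) = \<epsilon>" unfolding exp_of_nat_mult \<epsilon>_def by simp
      finally show ?thesis by simp
    qed
    have "H (\<zeta> + 2 * of_real pi * \<i>) ** U (\<zeta> + 2 * of_real pi * \<i>) = H \<zeta> ** (N ** U (\<zeta> + 2 * of_real pi * \<i>))"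
      unfolding mon[OF z] by (simp add: matrix_mul_assoc)
    also have "\<dots> = scale_mat \<epsilon> (H \<zeta> ** U \<zeta>)" unfolding U_def NU by (simp add: scale_mat_mult)
    finally have "G (\<zeta> + 2 * of_real pi * \<i>) = scale_mat (\<epsilon> * exp (c * \<zeta>)) (scale_mat \<epsilon> (H \<zeta> ** U \<zeta>))" by (simp add: G_def e)
    also have "\<dots> = scale_mat ((\<epsilon> * \<epsilon>) * exp (c * \<zeta>)) (H \<zeta> ** U \<zeta>)" by (simp add: cmat_eq_iff)
    finally show ?thesis by (simp add: \<epsilon>2 G_def)
  qed
  have mod: "moderate G"
  proof -
    have "moderate (\<lambda>\<zeta>. H \<zeta> ** scale_mat (exp (of_real (real n / 2) * \<zeta>)) (mat 1 - scale_mat \<zeta> L))"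
      by (intro moderate_mult moderate_linear moderate_local_solution[OF H P]) auto
    then show ?thesis by (simp add: G_def[abs_def] U_def c_def scale_mat_mult)
  qed
  obtain k :: nat and g0 where g0: "mholo g0 (ball 0 2)"
    "\<And>\<zeta>. Re \<zeta> < ln 2 \<Longrightarrow> G \<zeta> = scale_mat (exp (- (of_nat k * \<zeta>))) (g0 (exp \<zeta>))" using periodic_pole[OF hG per mod] by metis
  have hP': "mholo P' (ball 0 2)" "mholo (\<lambda>v. L) (ball 0 2)" unfolding P'_def[abs_def] by (intro mholo_add mholo_const P)+
  have P'a: "P' 0 ** a + scale_mat (of_nat k) a = P 0 ** a + scale_mat (of_nat n / 2 + of_nat k) a" for k :: nat and a
    unfolding P'_def matrix_add_rdistrib2 mat_mult_left(1) by (simp add: cmat_eq_iff c_def algebra_simps)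
  have "\<exists>g. mholo g (ball 0 2) \<and> (\<forall>\<zeta>. Re \<zeta> < ln 2 \<longrightarrow> G \<zeta> = g (exp \<zeta>))"
  proof (rule pole_removal[OF dG hP' g0])
    fix k :: nat and a assume k: "0 < k" and a: "P' 0 ** a + scale_mat (of_nat k) a = a ** L"
    have "of_nat k * (of_nat k + of_nat n) \<noteq> (0 :: complex)" using k by (simp add: of_nat_add[symmetric] del: of_nat_add)
    then show "a = 0" by (rule nilpotent_sylvester(1)[OF P0 LL a[unfolded P'a]])
  qed auto
  then obtain g where g: "mholo g (ball 0 2)" "\<And>\<zeta>. Re \<zeta> < ln 2 \<Longrightarrow> G \<zeta> = g (exp \<zeta>)" by blast
  have "P' 0 ** g 0 + scale_mat (of_nat 0) (g 0) = g 0 ** L"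
    by (rule leading_coefficient[OF dG hP' g(1)]) (use g(2) in \<open>auto simp: cmat_eq_iff\<close>)
  from nilpotent_sylvester(2)[OF P0 LL this[unfolded P'a]] n have "g 0 ** L = 0" by simp
  then show "\<exists>g. mholo g (ball 0 2) \<and> g 0 ** L = 0 \<and>
      (\<forall>\<zeta>. Re \<zeta> < ln 2 \<longrightarrow> scale_mat (exp (of_nat n / 2 * \<zeta>)) (H \<zeta> ** (mat 1 - scale_mat \<zeta> L)) = g (exp \<zeta>))"
    using g by (intro exI[of _ g]) (simp add: G_def U_def c_def)
qed

text \<open>All rows of \<open>a\<close> and \<open>b\<close> annihilate one nonzero column of
  \<open>L\<close>, so any two of them are proportional. Up to sign the entries of
  \<open>a ** adj2 b\<close> are the 2 x 2 determinants formed from a row of \<open>a\<close> and a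
  row of \<open>b\<close>.\<close>

lemma annihilators_adj2:
  assumes "a ** L = 0" "b ** L = 0" "L \<noteq> 0"
  shows "a ** adj2 b = (0 :: cmat)"
proof -
  have e: "a$1$1 * L$1$j + a$1$2 * L$2$j = 0" "a$2$1 * L$1$j + a$2$2 * L$2$j = 0"
    "b$1$1 * L$1$j + b$1$2 * L$2$j = 0" "b$2$1 * L$1$j + b$2$2 * L$2$j = 0" for j
    using arg_cong[OF assms(1), of "\<lambda>M. M $ 1 $ j"] arg_cong[OF assms(1), of "\<lambda>M. M $ 2 $ j"]
      arg_cong[OF assms(2), of "\<lambda>M. M $ 1 $ j"] arg_cong[OF assms(2), of "\<lambda>M. M $ 2 $ j"] by (simp_all add: mmult_nth)
  obtain i j where ij: "L $ i $ j \<noteq> 0" using assms(3) by (auto simp: vec_eq_iff)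
  have "L $ i $ j * (a ** adj2 b) $ p $ q = 0" for p q
  proof -
    have "L $ 1 $ j * (a ** adj2 b) $ p $ q = 0 \<and> L $ 2 $ j * (a ** adj2 b) $ p $ q = 0"
    proof -
      have "\<forall>p q. L $ 1 $ j * (a ** adj2 b) $ p $ q = 0 \<and> L $ 2 $ j * (a ** adj2 b) $ p $ q = 0"
        unfolding all_2_iff mmult_nth adj2_nth by (intro conjI; (algebra | use e[of j] in algebra))
      then show ?thesis by blast
    qed
    then show ?thesis using exhaust_2[of i] by metis
  qed
  then show ?thesis using ij by (simp add: vec_eq_iff)
qed

lemma cos_pi_integer:
  fixes \<theta> :: complex
  assumes "(of_nat k)\<^sup>2 = \<theta>\<^sup>2"
  shows "cos (of_real pi * \<theta>) = (-1) ^ k"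
proof -
  have "cos (of_real pi * of_nat k :: complex) = of_real (cos (pi * real k))" by (metis cos_of_real of_real_mult of_real_of_nat_eq)
  then have c: "cos (of_real pi * of_nat k :: complex) = (-1) ^ k" unfolding cos_npi2 by simp
  have "\<theta> = of_nat k \<or> \<theta> = - of_nat k" using assms by (metis power2_eq_iff)
  then show ?thesis using c by auto
qed

text \<open>The common monodromy \<open>N\<close> cancels in H K^-1, so the quotient has at worst a
  pole. Without resonance every order is excluded directly; with \<theta>^2 = n^2 only the order n
  needs the special form of the two solutions.\<close>

lemma local_quotient:
  fixes N :: cmat and \<theta> :: complex
  assumes H: "\<And>\<zeta>. Re \<zeta> < ln 2 \<Longrightarrow> has_mderiv H (P (exp \<zeta>) ** H \<zeta>) \<zeta>" and P: "mholo P (ball 0 2)"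
    and K: "\<And>\<zeta>. Re \<zeta> < ln 2 \<Longrightarrow> has_mderiv K (Q (exp \<zeta>) ** K \<zeta>) \<zeta>" and Q: "mholo Q (ball 0 2)"
    and tr: "trace (P 0) = 0" "\<And>v. trace (Q v) = 0" and dets: "det (P 0) = - (\<theta>\<^sup>2 / 4)" "det (Q 0) = - (\<theta>\<^sup>2 / 4)"
    and monH: "\<And>\<zeta>. Re \<zeta> < ln 2 \<Longrightarrow> H (\<zeta> + 2 * of_real pi * \<i>) = H \<zeta> ** N"
    and monK: "\<And>\<zeta>. Re \<zeta> < ln 2 \<Longrightarrow> K (\<zeta> + 2 * of_real pi * \<i>) = K \<zeta> ** N"
    and N: "det N = 1" "trace N = 2 * cos (of_real pi * \<theta>)" "N \<notin> {mat 1, - mat 1}"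
  shows "\<exists>r. mholo r (ball 0 2) \<and> (\<forall>\<zeta>. Re \<zeta> < ln 2 \<longrightarrow> H \<zeta> ** adj2 (K \<zeta>) = r (exp \<zeta>))"
proof -
  define R where "R \<zeta> = H \<zeta> ** adj2 (K \<zeta>)" for \<zeta>
  have dR: "has_mderiv R (P (exp \<zeta>) ** R \<zeta> - R \<zeta> ** Q (exp \<zeta>)) \<zeta>" if z: "Re \<zeta> < ln 2" for \<zeta>
  proof -
    have "has_mderiv R (P (exp \<zeta>) ** H \<zeta> ** adj2 (K \<zeta>) + H \<zeta> ** adj2 (Q (exp \<zeta>) ** K \<zeta>)) \<zeta>"
      unfolding R_def[abs_def] by (intro has_mderiv_mult has_mderiv_adj2 H[OF z] K[OF z])
    moreover have "P (exp \<zeta>) ** H \<zeta> ** adj2 (K \<zeta>) + H \<zeta> ** adj2 (Q (exp \<zeta>) ** K \<zeta>) = P (exp \<zeta>) ** R \<zeta> - R \<zeta> ** Q (exp \<zeta>)"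
      unfolding R_def adj2_traceless[OF tr(2)] by (simp add: matrix_mul_assoc[symmetric]) (simp add: cmat_eq_iff mmult_nth algebra_simps)
    ultimately show ?thesis by simp
  qed
  have hR: "mholo R {\<zeta>. Re \<zeta> < ln 2}" by (rule mholo_mderiv[OF open_halfspace_Re_lt]) (use dR in auto)
  have per: "R (\<zeta> + 2 * of_real pi * \<i>) = R \<zeta>" if z: "Re \<zeta> < ln 2" for \<zeta>
  proof -
    have "R (\<zeta> + 2 * of_real pi * \<i>) = H \<zeta> ** ((N ** adj2 N) ** adj2 (K \<zeta>))"
      unfolding R_def monH[OF z] monK[OF z] adj2_mult by (simp add: matrix_mul_assoc)
    then show ?thesis by (simp add: R_def adj2_right N(1))
  qed
  have mod: "moderate R" unfolding R_def[abs_def]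
    by (intro moderate_mult moderate_adj2 moderate_local_solution[OF H P] moderate_local_solution[OF K Q])
  have syl: "a = 0" if "0 < k" "(of_nat k)\<^sup>2 \<noteq> \<theta>\<^sup>2" "P 0 ** a + scale_mat (of_nat k) a = a ** Q 0" for k :: nat and a
    by (rule sylvester_traceless[OF tr(1) tr(2) dets _ that(2,3)]) (use that(1) in simp)
  have "\<exists>r. mholo r (ball 0 2) \<and> (\<forall>\<zeta>. Re \<zeta> < ln 2 \<longrightarrow> R \<zeta> = r (exp \<zeta>))"
  proof (cases "\<exists>k::nat. 0 < k \<and> (of_nat k)\<^sup>2 = \<theta>\<^sup>2")
    case False
    obtain k g where g: "mholo g (ball 0 2)" "\<And>\<zeta>. Re \<zeta> < ln 2 \<Longrightarrow> R \<zeta> = scale_mat (exp (- (of_nat k * \<zeta>))) (g (exp \<zeta>))"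
      using periodic_pole[OF hR per mod] by metis
    show ?thesis by (rule pole_removal[OF dR P Q g]) (use False syl in blast)+
  next
    case True
    then obtain n :: nat where n: "0 < n" "(of_nat n)\<^sup>2 = \<theta>\<^sup>2" by blast
    define L where "L = scale_mat ((-1) ^ n / (2 * of_real pi * \<i>)) (N - scale_mat ((-1) ^ n) (mat 1))"
    have trN: "trace N = 2 * (-1) ^ n" using N(2) cos_pi_integer[OF n(2)] by simp
    have L0: "L \<noteq> 0"
    proof
      assume "L = 0"
      then have "N = scale_mat ((-1) ^ n) (mat 1)" by (simp add: L_def cmat_eq_iff)
      then have "N = mat 1 \<or> N = - mat 1" by (cases "even n") (auto simp: cmat_eq_iff)
      then show False using N(3) by simp
    qed
    obtain g h where g: "mholo g (ball 0 2)" "g 0 ** L = 0"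
        "\<And>\<zeta>. Re \<zeta> < ln 2 \<Longrightarrow> scale_mat (exp (of_nat n / 2 * \<zeta>)) (H \<zeta> ** (mat 1 - scale_mat \<zeta> L)) = g (exp \<zeta>)"
      and h: "mholo h (ball 0 2)" "h 0 ** L = 0"
        "\<And>\<zeta>. Re \<zeta> < ln 2 \<Longrightarrow> scale_mat (exp (of_nat n / 2 * \<zeta>)) (K \<zeta> ** (mat 1 - scale_mat \<zeta> L)) = h (exp \<zeta>)"
      using resonant_form(2)[OF H P monH n(1) tr(1) _ trN N(1)] resonant_form(2)[OF K Q monK n(1) tr(2) _ trN N(1)] dets n(2)
      unfolding L_def by metis
    have LL: "L ** L = 0" unfolding L_def by (rule resonant_form(1)[OF H P monH n(1) tr(1) _ trN N(1)]) (use dets n(2) in auto)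
    have "N$2$2 = 2 * (-1) ^ n - N$1$1" using trN by (simp add: trace_2 eq_diff_eq add.commute)
    then have "(N - scale_mat ((-1) ^ n) (mat 1)) $ 2 $ 2 = - (N - scale_mat ((-1) ^ n) (mat 1)) $ 1 $ 1" by simp
    moreover have "scale_mat c K $ 2 $ 2 = - scale_mat c K $ 1 $ 1" if "K $ 2 $ 2 = - K $ 1 $ 1" for c K using that by simp
    ultimately have trL: "L$2$2 = - L$1$1" unfolding L_def by blast
    \<comment> \<open>The quotient is v^-n \<open>w\<close>, and w(0) = 0 because both leading
      coefficients annihilate the same nonzero \<open>L\<close>. The pole order is then at most n -
      1, below the only resonant order.\<close>
    define w where "w v = g v ** adj2 (h v)" for v
    have hw: "mholo w (ball 0 2)" unfolding w_def[abs_def] by (intro mholo_mult mholo_adj2 g h)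
    have w0: "w 0 = 0" unfolding w_def by (rule annihilators_adj2[OF g(2) h(2) L0])
    have Rw: "R \<zeta> = scale_mat (exp (- (of_nat n * \<zeta>))) (w (exp \<zeta>))" if z: "Re \<zeta> < ln 2" for \<zeta>
    proof -
      let ?U = "mat 1 - scale_mat \<zeta> L" and ?e = "exp (of_nat n / 2 * \<zeta>)"
      have dU: "det ?U = 1"
      proof -
        have "L$1$1 * L$1$1 + L$1$2 * L$2$1 = 0" using LL by (simp add: cmat_eq_iff mmult_nth)
        then show ?thesis unfolding det_2 vector_minus_component scale_mat_nth mat_one_nth trL by algebra
      qed
      have "w (exp \<zeta>) = scale_mat (?e * ?e) (H \<zeta> ** ((?U ** adj2 ?U) ** adj2 (K \<zeta>)))"
      proof -
        have a: "adj2 (scale_mat ?e (K \<zeta> ** ?U)) = scale_mat ?e (adj2 ?U ** adj2 (K \<zeta>))"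
          by (simp add: adj2_mult[symmetric] cmat_eq_iff)
        have ss: "scale_mat c (scale_mat d M) = scale_mat (c * d) M" for c d M by (simp add: cmat_eq_iff)
        show ?thesis unfolding w_def g(3)[OF z, symmetric] h(3)[OF z, symmetric] a scale_mat_mult ss
          by (simp add: matrix_mul_assoc)
      qed
      also have "\<dots> = scale_mat (?e * ?e) (R \<zeta>)" by (simp add: adj2_right dU R_def)
      also have "?e * ?e = exp (of_nat n * \<zeta>)" by (simp add: exp_add[symmetric] mult.commute)
      finally show ?thesis by (simp add: cmat_eq_iff exp_minus)
    qed
    obtain w' where w': "mholo w' (ball 0 2)" "\<And>v. w v = scale_mat v (w' v)" using mholo_divide_zero[OF hw w0] by metis
    obtain m where m: "n = Suc m" using n(1) by (cases n) auto
    show ?thesis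
    proof (rule pole_removal[OF dR P Q w'(1)])
      fix \<zeta> :: complex assume z: "Re \<zeta> < ln 2"
      have "exp (- (of_nat n * \<zeta>)) * exp \<zeta> = exp (- (of_nat m * \<zeta>))" by (simp add: m exp_add[symmetric] algebra_simps)
      then show "R \<zeta> = scale_mat (exp (- (of_nat m * \<zeta>))) (w' (exp \<zeta>))"
        unfolding Rw[OF z] w'(2)[of "exp \<zeta>"] by (simp add: cmat_eq_iff mult.assoc[symmetric])
    next
      fix k :: nat and a assume k: "0 < k" "k \<le> m" "P 0 ** a + scale_mat (of_nat k) a = a ** Q 0"
      have "k\<^sup>2 \<noteq> n\<^sup>2" using k(2) m by (simp add: power2_eq_iff_nonneg)
      then have "(of_nat (k\<^sup>2) :: complex) \<noteq> of_nat (n\<^sup>2)" unfolding of_nat_eq_iff .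
      then have "(of_nat k :: complex)\<^sup>2 \<noteq> (of_nat n)\<^sup>2" by simp
      then show "a = 0" using syl[OF k(1) _ k(3)] n(2) by simp
    qed auto
  qed
  then show ?thesis by (simp add: R_def)
qed

text \<open>The system in the local coordinate \<open>v = \<eta> - a\<close>, multiplied by \<open>v\<close>.\<close>
definition local_coeff :: "cmat \<Rightarrow> cmat \<Rightarrow> complex \<Rightarrow> complex \<Rightarrow> complex \<Rightarrow> cmat" where
  "local_coeff A B x a v = scale_mat (v * x / 4) sigma3 + A + scale_mat (v / (v + 2 * a)) B"

lemma local_coeff_eta:
  "v \<noteq> 0 \<Longrightarrow> scale_mat v (eta_coeff A0 A1 x (- 1 + v)) = local_coeff A0 A1 x (- 1) v"
  "v \<noteq> 0 \<Longrightarrow> scale_mat v (eta_coeff A0 A1 x (1 + v)) = local_coeff A1 A0 x 1 v"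
  by (simp_all add: eta_coeff_def local_coeff_def cmat_eq_iff algebra_simps)

lemma local_coeff_holo: "a = 1 \<or> a = -1 \<Longrightarrow> mholo (local_coeff A B x a) (ball 0 2)"
  unfolding mholo_def local_coeff_def[abs_def] vector_add_component scale_mat_nth
  by (intro allI holomorphic_intros) (auto simp: add_eq_0_iff2)

lemma local_coeff_0 [simp]: "local_coeff A B x a 0 = A"
  by (simp add: local_coeff_def cmat_eq_iff)

lemma local_coeff_trace: "trace A = 0 \<Longrightarrow> trace B = 0 \<Longrightarrow> trace (local_coeff A B x a v) = 0"
  by (simp add: local_coeff_def trace_2 add_eq_0_iff)

text \<open>If the residue at \<open>a\<close> vanishes, the system is regular there and its
  solutions are functions of exp \<zeta>. Read backwards: monodromy different from 1 forces a
  nonzero residue, from which \<open>u\<close> and \<open>y\<close> can be recovered.\<close>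

lemma trivial_monodromy:
  assumes H: "\<And>\<zeta>. Re \<zeta> < ln 2 \<Longrightarrow> has_mderiv H (local_coeff 0 B x a (exp \<zeta>) ** H \<zeta>) \<zeta> \<and> det (H \<zeta>) = 1"
    and a: "a = 1 \<or> a = -1" and B: "trace B = 0"
    and mon: "\<And>\<zeta>. Re \<zeta> < ln 2 \<Longrightarrow> H (\<zeta> + 2 * of_real pi * \<i>) = H \<zeta> ** N"
  shows "N = mat 1"
proof -
  define C where "C v = scale_mat (x / 4) sigma3 + scale_mat (1 / (v + 2 * a)) B" for v
  have hC: "mholo C (ball 0 2)"
    unfolding mholo_def C_def[abs_def] vector_add_component scale_mat_nth
    by (intro allI holomorphic_intros) (use a in \<open>auto simp: add_eq_0_iff2\<close>)
  have vC: "scale_mat v (C v) = local_coeff 0 B x a v" for v by (simp add: C_def local_coeff_def cmat_eq_iff algebra_simps)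
  obtain \<Phi> where \<Phi>: "\<Phi> 0 = mat 1" "\<And>v. v \<in> ball 0 2 \<Longrightarrow> has_mderiv \<Phi> (C v ** \<Phi> v) v"
  proof (rule lode_starlike[of "ball 0 2" 0 C])
    fix z :: complex assume "z \<in> ball 0 2"
    then show "closed_segment 0 z \<subseteq> ball 0 2" by (intro closed_segment_subset) auto
  qed (use hC that in auto)
  have trC: "trace (C v) = 0" for v using B by (simp add: C_def trace_2 add_eq_0_iff)
  have b: "exp \<zeta> \<in> ball 0 2" if "Re \<zeta> < ln 2" for \<zeta>
    using that by (simp, metis exp_less_cancel_iff exp_ln zero_less_numeral)
  have d\<Phi>: "det (\<Phi> v) = 1" if "v \<in> ball 0 2" for v
    using lode_det_const[OF open_ball connected_ball \<Phi>(2) trC that centre_in_ball[THEN iffD2]] by (simp add: \<Phi>(1))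
  have d: "has_mderiv (\<lambda>\<zeta>. \<Phi> (exp \<zeta>)) (local_coeff 0 B x a (exp \<zeta>) ** \<Phi> (exp \<zeta>)) \<zeta>" if "Re \<zeta> < ln 2" for \<zeta>
    using has_mderiv_chain[where g = exp, OF \<Phi>(2)[OF b[OF that]] DERIV_exp] by (simp add: vC[symmetric] scale_mat_mult)
  define c0 where "c0 = adj2 (\<Phi> (exp 0)) ** H 0"
  have "adj2 (\<Phi> (exp \<zeta>)) ** H \<zeta> = c0" if "Re \<zeta> < ln 2" for \<zeta>
    unfolding c0_def
    by (rule lode_quotient_const[of "{\<zeta>. Re \<zeta> < ln 2}" _ "\<lambda>\<zeta>. local_coeff 0 B x a (exp \<zeta>)"])
       (use convex_halfplane_lt[of "ln 2"] d H that local_coeff_trace[OF _ B, of 0] in \<open>auto simp: convex_connected trace_2\<close>)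
  then have e: "H \<zeta> = \<Phi> (exp \<zeta>) ** c0" if "Re \<zeta> < ln 2" for \<zeta>
    using adj2_cancel(4)[OF d\<Phi>[OF b[OF that]]] that by metis
  have "H 0 ** N = H 0" using mon[of 0] e[of "2 * of_real pi * \<i>"] e[of 0] by simp
  then have "adj2 (H 0) ** (H 0 ** N) = adj2 (H 0) ** H 0" by simp
  then show ?thesis using H[of 0] by (simp add: adj2_cancel)
qed

section \<open>Rigidity and uniqueness\<close>

text \<open>Each point has a neighbourhood with a holomorphic extension of \<open>f\<close> from its
  nonreal part. Taking the limit from above as the value selects all these extensions at once, and
  so the local pieces agree without an argument on overlaps.\<close>

lemma glue_off_reals:
  fixes f :: "complex \<Rightarrow> complex"
  assumes "\<And>z. \<exists>U h. open U \<and> z \<in> U \<and> h holomorphic_on U \<and> (\<forall>v\<in>U. Im v \<noteq> 0 \<longrightarrow> h v = f v)"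
  obtains g where "g holomorphic_on UNIV" "\<And>v. Im v \<noteq> 0 \<Longrightarrow> g v = f v"
proof -
  define g where "g v = Lim (at_right 0) (\<lambda>t::real. f (v + \<i> * of_real t))" for v
  have gh: "g v = h v" if U: "open U" "h holomorphic_on U" "\<forall>v\<in>U. Im v \<noteq> 0 \<longrightarrow> h v = f v" and v: "v \<in> U" for U h v
  proof -
    have lim: "((\<lambda>t::real. v + \<i> * of_real t) \<longlongrightarrow> v) (at_right 0)" by (rule tendsto_eq_intros refl | simp)+
    have "continuous_on U h" using U(2) by (rule holomorphic_on_imp_continuous_on)
    then have "isCont h v" using U(1) v by (simp add: continuous_on_eq_continuous_at)
    from isCont_tendsto_compose[OF this lim] have l: "((\<lambda>t::real. h (v + \<i> * of_real t)) \<longlongrightarrow> h v) (at_right 0)" .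
    have e1: "\<forall>\<^sub>F t in at_right 0. v + \<i> * of_real t \<in> U" using topological_tendstoD[OF lim U(1) v] .
    have e2: "\<forall>\<^sub>F t::real in at_right 0. Im v + t \<noteq> 0"
    proof (cases "Im v < 0")
      case True
      then show ?thesis by (auto simp: eventually_at_right[OF zero_less_one] intro: exI[of _ "- Im v"])
    next
      case False
      then show ?thesis by (auto simp: eventually_at_right[OF zero_less_one] intro: exI[of _ 1])
    qed
    have "((\<lambda>t::real. f (v + \<i> * of_real t)) \<longlongrightarrow> h v) (at_right 0)"
      by (rule Lim_transform_eventually[OF l]) (use eventually_conj[OF e1 e2] U(3) in \<open>auto elim!: eventually_mono\<close>)
    then show ?thesis unfolding g_def by (intro tendsto_Lim) auto
  qed
  show thesis
  proof (rule that[of g])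
    have "g field_differentiable at z" for z
    proof -
      obtain U h where U: "open U" "z \<in> U" "h holomorphic_on U" "\<forall>v\<in>U. Im v \<noteq> 0 \<longrightarrow> h v = f v" using assms by blast
      have "g holomorphic_on U" by (rule holomorphic_transform[OF U(3)]) (use gh[OF U(1,3,4)] in auto)
      then show ?thesis using U(1,2) holomorphic_on_imp_differentiable_at by blast
    qed
    then show "g holomorphic_on UNIV" by (simp add: holomorphic_on_def field_differentiable_at_within)
    show "g v = f v" if v: "Im v \<noteq> 0" for v
    proof -
      obtain U h where U: "open U" "v \<in> U" "h holomorphic_on U" "\<forall>v\<in>U. Im v \<noteq> 0 \<longrightarrow> h v = f v" using assms by blast
      show ?thesis using gh[OF U(1,3,4,2)] U(2,4) v by simp
    qed
  qed
qed

lemma strip_logarithm: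
  assumes "Im v \<noteq> 0" "norm v < 2" "o' = - pi \<or> o' = 0"
  obtains \<zeta> where "exp \<zeta> = v" "Re \<zeta> < ln 2" "o' < Im \<zeta>" "Im \<zeta> < o' + 2 * pi"
proof -
  have v0: "v \<noteq> 0" using assms(1) by auto
  then have r: "Re (Ln v) < ln 2" using assms(2) by simp
  show thesis
  proof (cases "o' = 0 \<and> Im v < 0")
    case True
    have "Im (Ln v) < 0" using True Im_Ln_pos_le[OF v0] Im_Ln_le_pi[OF v0] by auto
    then show thesis using mpi_less_Im_Ln[OF v0] True r v0
      by (intro that[of "Ln v + 2 * of_real pi * \<i>"]) (auto simp: exp_add)
  next
    case False
    have "v \<notin> \<real>\<^sub>\<le>\<^sub>0" using assms(1) by (auto simp: complex_nonpos_Reals_iff)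
    then have "Im (Ln v) < pi" by (meson Im_Ln_less_pi complex_nonpos_Reals_iff not_le v0)
    moreover have "Im (Ln v) > 0" if "Im v > 0" using Im_Ln_pos_lt_imp[OF that] by simp
    ultimately show thesis using mpi_less_Im_Ln[OF v0] False r v0 assms(1,3)
      by (intro that[of "Ln v"]) auto
  qed
qed

text \<open>For Im s = 0 the variables \<lambda> and \<eta> coincide and the loops surround -1 and
  1. The last equation compares two computations of the circuit around infinity: by the two loops,
  and by Stokes matrices with formal monodromy.\<close>

lemma continuation_data:
  assumes X: "canon_family \<theta> A0 A1 s X S1 S2" and L: "loop_data 0 (X 0) M0 M1" and s: "Im s = 0"
    and tr: "trace A0 = 0" "trace A1 = 0"
  obtains F H0 H1 where "plane_solution A0 A1 (exp s) F" "\<And>m. Re m > 0 \<Longrightarrow> 0 < Im m \<Longrightarrow> Im m < pi \<Longrightarrow> F (exp m) = X 0 m"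
    "local_lift A0 A1 (exp s) (-1) (- pi) F H0" "\<And>\<zeta>. Re \<zeta> < ln 2 \<Longrightarrow> H0 (\<zeta> + 2 * of_real pi * \<i>) = H0 \<zeta> ** M0"
    "local_lift A0 A1 (exp s) 1 0 F H1" "\<And>\<zeta>. Re \<zeta> < ln 2 \<Longrightarrow> H1 (\<zeta> + 2 * of_real pi * \<i>) = H1 \<zeta> ** M1"
    "\<And>m. Re m > 0 \<Longrightarrow> X 0 (m + 2 * of_real pi * \<i>) = X 0 m ** (M1 ** M0)"
    "\<And>m. Re m > 0 \<Longrightarrow> pi < Im m \<Longrightarrow> Im m < 2 * pi \<Longrightarrow> X 0 m = F (exp m) ** M0"
    "M1 ** M0 = adj2 S1 ** exp_sigma3 (- (of_real pi * \<i> * \<theta>)) ** adj2 S2"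
proof -
  have sol: "system_solution A0 A1 (exp s) (X 0)" using X by (simp add: canon_family_def canonX_def)
  have det: "det (X 0 m) = 1" if "Re m > 0" for m by (rule canon_family_det[OF X tr that])
  obtain F where F: "plane_solution A0 A1 (exp s) F" "\<And>m. Re m > 0 \<Longrightarrow> 0 < Im m \<Longrightarrow> Im m < pi \<Longrightarrow> F (exp m) = X 0 m"
    by (rule plane_solution_exists[OF sol _ tr], rule det, assumption, rule that, assumption+)
  obtain H0 where H0: "local_lift A0 A1 (exp s) (-1) (- pi) F H0" using local_lift_exists[where a = "-1" and o' = "- pi", OF F(1) tr] by blast
  obtain H1 where H1: "local_lift A0 A1 (exp s) 1 0 F H1" using local_lift_exists[where a = 1 and o' = 0, OF F(1) tr] by blast
  have con: "continues_along (lasso (\<i> * 101) (-1) (1/2)) (\<lambda>v. X 0 (Ln v)) (\<lambda>v. X 0 (Ln v) ** M0)"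
     "continues_along (lasso (\<i> * 101) 1 (1/2)) (\<lambda>v. X 0 (Ln v)) (\<lambda>v. X 0 (Ln v) ** M1)"
    using L[unfolded loop_data_def, rule_format, of 101 "1/2"] by simp_all
  have m0: "H0 (\<zeta> + 2 * of_real pi * \<i>) = H0 \<zeta> ** M0" if "Re \<zeta> < ln 2" for \<zeta>
    by (rule local_lift_monodromy[where X = "X 0", OF F(1) F(2) _ H0 con(1) that]) auto
  have m1: "H1 (\<zeta> + 2 * of_real pi * \<i>) = H1 \<zeta> ** M1" if "Re \<zeta> < ln 2" for \<zeta>
    by (rule local_lift_monodromy[where X = "X 0", OF F(1) F(2) _ H1 con(2) that]) auto
  have hX: "mholo (X 0) {m. Re m > 0}"
    using half_plane(1)[of 0] sol by (intro mholo_mderiv) (auto simp: system_solution_def)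
  have circ: "X 0 (m + 2 * of_real pi * \<i>) = X 0 m ** (M1 ** M0)" if "Re m > 0" for m
    by (rule circle_monodromy[OF F(1) F(2) H0 m0 H1 m1 hX that])
  have c1: "X 0 m = F (exp m) ** M0" if "Re m > 0" "pi < Im m" "Im m < 2 * pi" for m
    using crossing[OF _ _ F(1) H0 m0 hX, of pi "mat 1" m] F(2) that by simp
  have "X 0 1 ** (M1 ** M0) = X 0 1 ** (adj2 S1 ** exp_sigma3 (- (of_real pi * \<i> * \<theta>)) ** adj2 S2)"
    using circ[of 1] canon_family_extra_stokes(3)[OF X tr, of 1] by simp
  then have "adj2 (X 0 1) ** (X 0 1 ** (M1 ** M0)) = adj2 (X 0 1) ** (X 0 1 ** (adj2 S1 ** exp_sigma3 (- (of_real pi * \<i> * \<theta>)) ** adj2 S2))" by simp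
  then have "M1 ** M0 = adj2 S1 ** exp_sigma3 (- (of_real pi * \<i> * \<theta>)) ** adj2 S2"
    unfolding adj2_cancel(3)[OF det[of 1, simplified]] by simp
  with F H0 m0 H1 m1 circ c1 show thesis by (rule that)
qed

text \<open>Re m tends to infinity uniformly for Im m in \<open>S\<close>. Ray-wise limits would not
  do for a limit at infinity in \<eta>.\<close>

definition sector_filter :: "real set \<Rightarrow> complex filter" where
  "sector_filter S = inf (filtercomap Re at_top) (principal {m. Im m \<in> S})"

lemma eventually_sector_filter:
  "eventually P (sector_filter S) \<longleftrightarrow> (\<exists>R. \<forall>m. Re m > R \<longrightarrow> Im m \<in> S \<longrightarrow> P m)"
  unfolding sector_filter_def eventually_inf_principal eventually_filtercomap_at_top_dense by auto

lemma col_asym_sector: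
  assumes "col_asym \<theta> x X S"
  shows "((\<lambda>m. X m $ 1 $ 1 * exp (- qexp \<theta> x m)) \<longlongrightarrow> 1) (sector_filter S)"
    and "((\<lambda>m. X m $ 2 $ 1 * exp (- qexp \<theta> x m)) \<longlongrightarrow> 0) (sector_filter S)"
proof -
  obtain C R where CR: "\<And>m. Re m > R \<Longrightarrow> Re m > 0 \<Longrightarrow> Im m \<in> S \<Longrightarrow>
      norm (X m $ 1 $ 1 * exp (- qexp \<theta> x m) - 1) \<le> C * exp (- Re m) \<and>
      norm (X m $ 2 $ 1 * exp (- qexp \<theta> x m)) \<le> C * exp (- Re m)"
    using assms unfolding col_asym_def by blast
  have Re: "filterlim Re at_top (sector_filter S)" unfolding sector_filter_def
    by (rule filterlim_mono[OF filterlim_filtercomap order_refl]) simp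
  have "((\<lambda>r::real. C * exp (- r)) \<longlongrightarrow> C * 0) at_top"
    by (intro tendsto_intros filterlim_compose[OF exp_at_bot] filterlim_uminus_at_bot_at_top)
  then have b: "((\<lambda>m. C * exp (- Re m)) \<longlongrightarrow> 0) (sector_filter S)" using filterlim_compose[OF _ Re] by fastforce
  have ev: "eventually (\<lambda>m. norm (X m $ 1 $ 1 * exp (- qexp \<theta> x m) - 1) \<le> C * exp (- Re m) \<and>
      norm (X m $ 2 $ 1 * exp (- qexp \<theta> x m)) \<le> C * exp (- Re m)) (sector_filter S)"
    unfolding eventually_sector_filter by (rule exI[of _ "max R 0"]) (use CR in auto)
  have "((\<lambda>m. X m $ 1 $ 1 * exp (- qexp \<theta> x m) - 1) \<longlongrightarrow> 0) (sector_filter S)"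
    by (rule Lim_null_comparison[OF _ b]) (use ev in \<open>auto elim: eventually_mono\<close>)
  then show "((\<lambda>m. X m $ 1 $ 1 * exp (- qexp \<theta> x m)) \<longlongrightarrow> 1) (sector_filter S)" by (simp add: LIM_zero_iff)
  show "((\<lambda>m. X m $ 2 $ 1 * exp (- qexp \<theta> x m)) \<longlongrightarrow> 0) (sector_filter S)"
    by (rule Lim_null_comparison[OF _ b]) (use ev in \<open>auto elim: eventually_mono\<close>)
qed

text \<open>A diagonal \<open>D\<close> commutes with exp (q \<sigma>_3), so the exponentials of
  \<open>X\<close> and of Y^-1 cancel, and every entry is a sum of products of normalised
  quantities.\<close>

lemma canonX_quotient_limit:
  assumes X: "canonX \<theta> A0 A1 x c X" and Y: "canonX \<theta> B0 B1 x c Y" and \<delta>: "\<delta> > 0"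
    and D: "D $ 1 $ 2 = 0" "D $ 2 $ 1 = 0"
  shows "((\<lambda>m. (X m ** (D ** adj2 (Y m))) $ i $ j) \<longlongrightarrow> D $ i $ j) (sector_filter {c - (pi - \<delta>)..c + (pi - \<delta>)})"
proof -
  let ?F = "sector_filter {c - (pi - \<delta>)..c + (pi - \<delta>)}" and ?q = "qexp \<theta> x"
  have lim: "((\<lambda>m. Z m $ 1 $ 1 * exp (- ?q m)) \<longlongrightarrow> 1) ?F" "((\<lambda>m. Z m $ 2 $ 1 * exp (- ?q m)) \<longlongrightarrow> 0) ?F"
    "((\<lambda>m. Z m $ 2 $ 2 * exp (?q m)) \<longlongrightarrow> 1) ?F" "((\<lambda>m. Z m $ 1 $ 2 * exp (?q m)) \<longlongrightarrow> 0) ?F"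
    if "canonX \<theta> C0 C1 x c Z" for C0 C1 Z
  proof -
    have "col_asym \<theta> x Z {c - (pi - \<delta>)..c + (pi - \<delta>)}" "col_asym (- \<theta>) (- x) (\<lambda>m. conj_sigma1 (Z m)) {c - (pi - \<delta>)..c + (pi - \<delta>)}"
      using that \<delta> by (auto simp: canonX_def)
    from col_asym_sector[OF this(1)] col_asym_sector[OF this(2)]
    show "((\<lambda>m. Z m $ 1 $ 1 * exp (- ?q m)) \<longlongrightarrow> 1) ?F" "((\<lambda>m. Z m $ 2 $ 1 * exp (- ?q m)) \<longlongrightarrow> 0) ?F"
    "((\<lambda>m. Z m $ 2 $ 2 * exp (?q m)) \<longlongrightarrow> 1) ?F" "((\<lambda>m. Z m $ 1 $ 2 * exp (?q m)) \<longlongrightarrow> 0) ?F"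
      by (simp_all add: qexp_minus conj_sigma1_nth)
  qed
  note lX = lim[OF X] and lY = lim[OF Y]
  have e: "exp (- ?q m) * exp (?q m) = 1" for m by (simp add: exp_add[symmetric])
  have r: "(X m ** (D ** adj2 (Y m))) $ 1 $ 1 = (X m $ 1 $ 1 * exp (- ?q m)) * (D$1$1 * (Y m $ 2 $ 2 * exp (?q m))) - (X m $ 1 $ 2 * exp (?q m)) * (D$2$2 * (Y m $ 2 $ 1 * exp (- ?q m)))"
    "(X m ** (D ** adj2 (Y m))) $ 1 $ 2 = - (X m $ 1 $ 1 * exp (- ?q m)) * (D$1$1 * (Y m $ 1 $ 2 * exp (?q m))) + (X m $ 1 $ 2 * exp (?q m)) * (D$2$2 * (Y m $ 1 $ 1 * exp (- ?q m)))"
    "(X m ** (D ** adj2 (Y m))) $ 2 $ 1 = (X m $ 2 $ 1 * exp (- ?q m)) * (D$1$1 * (Y m $ 2 $ 2 * exp (?q m))) - (X m $ 2 $ 2 * exp (?q m)) * (D$2$2 * (Y m $ 2 $ 1 * exp (- ?q m)))"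
    "(X m ** (D ** adj2 (Y m))) $ 2 $ 2 = - (X m $ 2 $ 1 * exp (- ?q m)) * (D$1$1 * (Y m $ 1 $ 2 * exp (?q m))) + (X m $ 2 $ 2 * exp (?q m)) * (D$2$2 * (Y m $ 1 $ 1 * exp (- ?q m)))" for m
    unfolding mmult_nth adj2_nth D using e[of m] by algebra+
  have "\<forall>i j. ((\<lambda>m. (X m ** (D ** adj2 (Y m))) $ i $ j) \<longlongrightarrow> D $ i $ j) ?F"
    unfolding all_2_iff r
    by (intro conjI) (rule tendsto_eq_intros lX lY refl | simp add: D)+
  then show ?thesis by blast
qed

definition diag2 :: "complex \<Rightarrow> cmat" where "diag2 d = mat2 d 0 0 (1 / d)"

lemma diag2_nth [simp]: "diag2 d $ 1 $ 1 = d" "diag2 d $ 1 $ 2 = 0" "diag2 d $ 2 $ 1 = 0" "diag2 d $ 2 $ 2 = 1 / d"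
  by (simp_all add: diag2_def)

lemma det_diag2 [simp]: "d \<noteq> 0 \<Longrightarrow> det (diag2 d) = 1"
  by (simp add: det_2)

lemma gauge_diag2: "gauge d M = diag2 d ** M ** adj2 (diag2 d)"
  by (simp add: gauge_def diag2_def adj2_def)

lemma gauge_nth [simp]:
  assumes "d \<noteq> 0"
  shows "gauge d M $ 1 $ 1 = M $ 1 $ 1" "gauge d M $ 1 $ 2 = d\<^sup>2 * M $ 1 $ 2"
    "gauge d M $ 2 $ 1 = M $ 2 $ 1 / d\<^sup>2" "gauge d M $ 2 $ 2 = M $ 2 $ 2"
  using assms by (simp_all add: gauge_diag2 mmult_nth power2_eq_square field_simps)

lemma patch_at_singularity:
  assumes a: "a = -1 \<and> o' = - pi \<or> a = 1 \<and> o' = 0" and d: "d \<noteq> 0"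
    and H: "local_lift A0 A1 x a o' F H" "\<And>\<zeta>. Re \<zeta> < ln 2 \<Longrightarrow> H (\<zeta> + 2 * of_real pi * \<i>) = H \<zeta> ** N"
    and K: "local_lift B0 B1 x a o' G K" "\<And>\<zeta>. Re \<zeta> < ln 2 \<Longrightarrow> K (\<zeta> + 2 * of_real pi * \<i>) = K \<zeta> ** gauge d N"
    and tr: "trace A0 = 0" "trace A1 = 0" "trace B0 = 0" "trace B1 = 0"
    and det: "det (if a = 1 then A1 else A0) = - (\<theta>\<^sup>2 / 4)" "det (if a = 1 then B1 else B0) = - (\<theta>\<^sup>2 / 4)"
    and N: "det N = 1" "trace N = 2 * cos (of_real pi * \<theta>)" "N \<notin> {mat 1, - mat 1}"
  shows "\<exists>r. mholo r (ball a 2) \<and> (\<forall>\<eta>\<in>ball a 2. Im \<eta> \<noteq> 0 \<longrightarrow> r \<eta> = F \<eta> ** (adj2 (diag2 d) ** adj2 (G \<eta>)))"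
proof -
  have a1: "a = 1 \<or> a = -1" using a by auto
  let ?P = "local_coeff (if a = 1 then A1 else A0) (if a = 1 then A0 else A1) x a"
  let ?Q = "local_coeff (if a = 1 then B1 else B0) (if a = 1 then B0 else B1) x a"
  have le: "scale_mat v (eta_coeff C0 C1 x (a + v)) = local_coeff (if a = 1 then C1 else C0) (if a = 1 then C0 else C1) x a v"
    if "v \<noteq> 0" for v C0 C1 using a1 local_coeff_eta[OF that, of C0 C1 x] by auto
  \<comment> \<open>Multiplication by the diagonal matrix turns the monodromy
    \<open>gauge d N\<close> back into \<open>N\<close>, so that the two solutions to be compared
    have the same local monodromy.\<close>
  define K' where "K' \<zeta> = K \<zeta> ** diag2 d" for \<zeta>
  have "\<exists>r. mholo r (ball 0 2) \<and> (\<forall>\<zeta>. Re \<zeta> < ln 2 \<longrightarrow> H \<zeta> ** adj2 (K' \<zeta>) = r (exp \<zeta>))"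
  proof (rule local_quotient[where P = ?P and Q = ?Q])
    fix \<zeta> :: complex assume z: "Re \<zeta> < ln 2"
    have "has_mderiv H (scale_mat (exp \<zeta>) (eta_coeff A0 A1 x (a + exp \<zeta>)) ** H \<zeta>) \<zeta>"
      "has_mderiv K (scale_mat (exp \<zeta>) (eta_coeff B0 B1 x (a + exp \<zeta>)) ** K \<zeta>) \<zeta>"
      using H(1) K(1) z unfolding local_lift_def by blast+
    then have P: "has_mderiv H (?P (exp \<zeta>) ** H \<zeta>) \<zeta>" "has_mderiv K (?Q (exp \<zeta>) ** K \<zeta>) \<zeta>"
      unfolding le[OF exp_not_eq_zero] .
    show "has_mderiv H (?P (exp \<zeta>) ** H \<zeta>) \<zeta>" by (rule P)
    from has_mderiv_rmult[OF P(2), of "diag2 d"]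
    show "has_mderiv K' (?Q (exp \<zeta>) ** K' \<zeta>) \<zeta>" by (simp add: K'_def[abs_def] matrix_mul_assoc)
    show "H (\<zeta> + 2 * of_real pi * \<i>) = H \<zeta> ** N" by (rule H(2)[OF z])
    show "K' (\<zeta> + 2 * of_real pi * \<i>) = K' \<zeta> ** N"
      unfolding K'_def K(2)[OF z] gauge_diag2 using d by (simp add: matrix_mul_assoc[symmetric] adj2_left)
  qed (use a1 tr det N in \<open>auto intro!: local_coeff_holo local_coeff_trace\<close>)
  then obtain r where r: "mholo r (ball 0 2)" "\<And>\<zeta>. Re \<zeta> < ln 2 \<Longrightarrow> H \<zeta> ** adj2 (K' \<zeta>) = r (exp \<zeta>)" by blast
  show ?thesis
  proof (intro exI[of _ "\<lambda>\<eta>. r (\<eta> - a)"] conjI ballI impI)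
    show "mholo (\<lambda>\<eta>. r (\<eta> - a)) (ball a 2)"
      by (rule mholo_compose[OF r(1)]) (auto intro!: holomorphic_intros simp: dist_norm norm_minus_commute)
    fix \<eta> assume e: "\<eta> \<in> ball a 2" "Im \<eta> \<noteq> 0"
    have "Im (\<eta> - a) \<noteq> 0" using e(2) a1 by auto
    moreover have "norm (\<eta> - a) < 2" using e(1) by (simp add: dist_norm norm_minus_commute)
    ultimately obtain \<zeta> where z: "exp \<zeta> = \<eta> - a" "Re \<zeta> < ln 2" "o' < Im \<zeta>" "Im \<zeta> < o' + 2 * pi"
      using strip_logarithm[of "\<eta> - a" o'] a by blast
    have "H \<zeta> = F \<eta>" "K \<zeta> = G \<eta>" using H(1) K(1) z by (simp_all add: local_lift_def)
    then show "r (\<eta> - a) = F \<eta> ** (adj2 (diag2 d) ** adj2 (G \<eta>))"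
      using r(2)[OF z(2)] by (simp add: K'_def adj2_mult z(1))
  qed
qed

text \<open>The quotient of the two fundamental solutions, corrected by the diagonal matrix of the
  gauge, extends to an entire function with a limit at infinity. By Liouville it is constant, the
  systems differ by this gauge, and the residues can be compared.\<close>

lemma coefficient_rigidity:
  assumes X: "canon_family \<theta> A0 A1 s X S1 S2" "loop_data 0 (X 0) M0 M1"
    and Y: "canon_family \<theta> B0 B1 s Y T1 T2" "loop_data 0 (Y 0) (gauge d M0) (gauge d M1)"
    and s: "Im s = 0" and d: "d \<noteq> 0"
    and tr: "trace A0 = 0" "trace A1 = 0" "trace B0 = 0" "trace B1 = 0"
    and det: "det A0 = - (\<theta>0\<^sup>2 / 4)" "det B0 = - (\<theta>0\<^sup>2 / 4)" "det A1 = - (\<theta>1\<^sup>2 / 4)" "det B1 = - (\<theta>1\<^sup>2 / 4)"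
    and M0: "det M0 = 1" "trace M0 = 2 * cos (of_real pi * \<theta>0)" "M0 \<notin> {mat 1, - mat 1}"
    and M1: "det M1 = 1" "trace M1 = 2 * cos (of_real pi * \<theta>1)" "M1 \<notin> {mat 1, - mat 1}"
  shows "A0 = gauge (1 / d) B0" "A1 = gauge (1 / d) B1" "A0 \<noteq> 0" "A1 \<noteq> 0"
proof -
  define D where "D = diag2 d"
  define D' where "D' = adj2 D"
  have DD: "det D = 1" "det D' = 1" using d by (simp_all add: D_def D'_def det_adj2)
  have D'nth: "D' $ 1 $ 2 = 0" "D' $ 2 $ 1 = 0" by (simp_all add: D'_def D_def)
  have DC: "D ** D' = mat 1" "D' ** D = mat 1" "D ** (D' ** M) = M" "D' ** (D ** M) = M" for M
    using adj2_cancel[OF DD(1)] by (simp_all add: D'_def)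
  have gD: "gauge d M = D ** M ** D'" for M by (simp add: gauge_diag2 D_def D'_def)
  obtain F H0 H1 where F: "plane_solution A0 A1 (exp s) F" "\<And>m. Re m > 0 \<Longrightarrow> 0 < Im m \<Longrightarrow> Im m < pi \<Longrightarrow> F (exp m) = X 0 m"
    and H0: "local_lift A0 A1 (exp s) (-1) (- pi) F H0" "\<And>\<zeta>. Re \<zeta> < ln 2 \<Longrightarrow> H0 (\<zeta> + 2 * of_real pi * \<i>) = H0 \<zeta> ** M0"
    and H1: "local_lift A0 A1 (exp s) 1 0 F H1" "\<And>\<zeta>. Re \<zeta> < ln 2 \<Longrightarrow> H1 (\<zeta> + 2 * of_real pi * \<i>) = H1 \<zeta> ** M1"
    and Xc: "\<And>m. Re m > 0 \<Longrightarrow> X 0 (m + 2 * of_real pi * \<i>) = X 0 m ** (M1 ** M0)"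
    "\<And>m. Re m > 0 \<Longrightarrow> pi < Im m \<Longrightarrow> Im m < 2 * pi \<Longrightarrow> X 0 m = F (exp m) ** M0"
    and XS: "M1 ** M0 = adj2 S1 ** exp_sigma3 (- (of_real pi * \<i> * \<theta>)) ** adj2 S2"
    using continuation_data[OF X s tr(1,2)] by blast
  obtain G K0 K1 where G: "plane_solution B0 B1 (exp s) G" "\<And>m. Re m > 0 \<Longrightarrow> 0 < Im m \<Longrightarrow> Im m < pi \<Longrightarrow> G (exp m) = Y 0 m"
    and K0: "local_lift B0 B1 (exp s) (-1) (- pi) G K0" "\<And>\<zeta>. Re \<zeta> < ln 2 \<Longrightarrow> K0 (\<zeta> + 2 * of_real pi * \<i>) = K0 \<zeta> ** gauge d M0"
    and K1: "local_lift B0 B1 (exp s) 1 0 G K1" "\<And>\<zeta>. Re \<zeta> < ln 2 \<Longrightarrow> K1 (\<zeta> + 2 * of_real pi * \<i>) = K1 \<zeta> ** gauge d M1"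
    and Yc: "\<And>m. Re m > 0 \<Longrightarrow> Y 0 (m + 2 * of_real pi * \<i>) = Y 0 m ** (gauge d M1 ** gauge d M0)"
    "\<And>m. Re m > 0 \<Longrightarrow> pi < Im m \<Longrightarrow> Im m < 2 * pi \<Longrightarrow> Y 0 m = G (exp m) ** gauge d M0"
    and YS: "gauge d M1 ** gauge d M0 = adj2 T1 ** exp_sigma3 (- (of_real pi * \<i> * \<theta>)) ** adj2 T2"
    using continuation_data[OF Y s tr(3,4)] by blast
  have solX: "system_solution A0 A1 (exp s) (X k)" and cX: "canonX \<theta> A0 A1 (exp s) (pi / 2 + of_int k * pi) (X k)"
    and solY: "system_solution B0 B1 (exp s) (Y k)" and cY: "canonX \<theta> B0 B1 (exp s) (pi / 2 + of_int k * pi) (Y k)" for k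
    using X(1) Y(1) s by (auto simp: canon_family_def canonX_def)
  have hX: "mholo (X 0) {m. Re m > 0}" "mholo (Y 0) {m. Re m > 0}"
    using half_plane(1)[of 0] solX[of 0] solY[of 0] by (auto intro!: mholo_mderiv simp: system_solution_def)
  define Q where "Q m = X 0 m ** (D' ** adj2 (Y 0 m))" for m
  define R where "R \<eta> = F \<eta> ** (D' ** adj2 (G \<eta>))" for \<eta>
  have hQ: "mholo Q {m. Re m > 0}" unfolding Q_def[abs_def] by (intro mholo_mult mholo_const mholo_adj2 hX)
  have hF: "mholo F slit_plane" "mholo G slit_plane" using F(1) G(1) by (auto intro!: mholo_mderiv slit_plane_open simp: plane_solution_def)
  have hR: "mholo R slit_plane" unfolding R_def[abs_def] by (intro mholo_mult mholo_const mholo_adj2 hF)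
  have conj_cancel: "Z ** C ** (D' ** adj2 (Z' ** (D ** C ** D'))) = Z ** (D' ** adj2 Z')" if "det C = 1" for Z Z' C
  proof -
    have "adj2 (D ** C ** D') = D ** adj2 C ** D'"
      unfolding adj2_mult using DC by (simp add: D'_def matrix_mul_assoc cmat_eq_iff mmult_nth D_def)
    then have "Z ** C ** (D' ** adj2 (Z' ** (D ** C ** D'))) = Z ** (C ** (D' ** (D ** (adj2 C ** (D' ** adj2 Z')))))"
      by (simp add: adj2_mult matrix_mul_assoc)
    then show ?thesis using that by (simp add: DC adj2_cancel)
  qed
  have perQ: "Q (m + 2 * of_real pi * \<i>) = Q m" if "Re m > 0" for m
  proof -
    have "gauge d M1 ** gauge d M0 = D ** (M1 ** M0) ** D'" by (simp add: gD matrix_mul_assoc[symmetric] DC)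
    then show ?thesis unfolding Q_def Xc(1)[OF that] Yc(1)[OF that] using conj_cancel[of "M1 ** M0"] M0(1) M1(1) by (simp add: det_mul)
  qed
  have QR: "Q m = R (exp m)" if m: "Re m > 0" "Im (exp m) \<noteq> 0" for m
  proof -
    let ?l = "Ln (exp m)"
    have r: "Re ?l > 0" using m by simp
    have li: "- pi < Im ?l" "Im ?l < pi" "Im ?l \<noteq> 0"
    proof -
      show "- pi < Im ?l" by (simp add: mpi_less_Im_Ln)
      have "exp m \<notin> \<real>\<^sub>\<le>\<^sub>0" using m(2) by (auto simp: complex_nonpos_Reals_iff)
      then show "Im ?l < pi" by (meson Im_Ln_less_pi complex_nonpos_Reals_iff not_le exp_not_eq_zero)
      show "Im ?l \<noteq> 0" using m(2) Im_exp[of ?l] by auto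
    qed
    have "\<exists>m'. exp m' = exp m \<and> Re m' > 0 \<and> Q m' = R (exp m')"
    proof (cases "Im ?l > 0")
      case True
      then have "Q ?l = R (exp ?l)" unfolding Q_def R_def using F(2)[of ?l] G(2)[of ?l] r li by simp
      then show ?thesis using r by (intro exI[of _ ?l]) simp
    next
      case False
      let ?m = "?l + 2 * of_real pi * \<i>"
      have b: "Re ?m > 0" "pi < Im ?m" "Im ?m < 2 * pi" using False li r by auto
      have "Q ?m = R (exp ?m)" unfolding Q_def R_def Xc(2)[OF b] Yc(2)[OF b] gD by (rule conj_cancel[OF M0(1)])
      then show ?thesis using b by (intro exI[of _ ?m]) (simp add: exp_add)
    qed
    then obtain m' where m': "exp m' = exp m" "Re m' > 0" "Q m' = R (exp m')" by blast
    have "Q m = Q m'" by (rule periodic_exp[where P = "\<lambda>r. r > 0" and G = Q, OF perQ]) (use m' in simp_all)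
    then show ?thesis using m' by simp
  qed
  have pm: "\<exists>r. mholo r (ball (-1) 2) \<and> (\<forall>\<eta>\<in>ball (-1) 2. Im \<eta> \<noteq> 0 \<longrightarrow> r \<eta> = R \<eta>)"
    unfolding R_def D'_def D_def
    by (rule patch_at_singularity[where o' = "- pi", OF _ d H0 K0 tr _ _ M0]) (use det in simp_all)
  have pp: "\<exists>r. mholo r (ball 1 2) \<and> (\<forall>\<eta>\<in>ball 1 2. Im \<eta> \<noteq> 0 \<longrightarrow> r \<eta> = R \<eta>)"
    unfolding R_def D'_def D_def
    by (rule patch_at_singularity[where o' = 0, OF _ d H1 K1 tr _ _ M1]) (use det in simp_all)
  have cover: "\<exists>U h. open U \<and> z \<in> U \<and> h holomorphic_on U \<and> (\<forall>v\<in>U. Im v \<noteq> 0 \<longrightarrow> h v = R v $ i $ j)" for z i j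
  proof -
    let ?g = "\<lambda>U h. open U \<and> z \<in> U \<and> mholo h U \<and> (\<forall>v\<in>U. Im v \<noteq> 0 \<longrightarrow> h v = R v)"
    have "\<exists>U h. ?g U h"
    proof -
      \<comment> \<open>The discs of radius 2 about -1 and 1 cover the real points with |Re z| < 3;
        beyond them the circuit around infinity shows that the quotient, as a function of ln \<eta>,
        is single valued.\<close>
      consider "z \<in> slit_plane" | "z \<in> ball (-1) 2" | "z \<in> ball 1 2" | "Re z \<ge> 3" | "Re z \<le> -3"
      proof -
        have "z \<in> slit_plane \<or> (Im z = 0 \<and> \<bar>Re z\<bar> \<ge> 1)" by (auto simp: slit_plane_def)
        moreover have "norm (z - c) = \<bar>Re z - Re c\<bar>" if "Im z = 0" "Im c = 0" for c
          using that cmod_eq_Re[of "z - c"] by simp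
        from this[of 1] this[of "-1"] have "dist 1 z = \<bar>Re z - 1\<bar> \<and> dist (-1) z = \<bar>Re z + 1\<bar>" if "Im z = 0"
          using that by (simp add: dist_norm norm_minus_commute)
        ultimately show thesis using that by fastforce
      qed
      then show ?thesis
      proof cases
        case 1
        then show ?thesis using slit_plane_open hR by (intro exI[of _ slit_plane] exI[of _ R]) auto
      next
        case 2
        then show ?thesis using pm open_ball by blast
      next
        case 3
        then show ?thesis using pp open_ball by blast
      next
        case 4
        let ?U = "{v. Re v > 0} \<inter> {v. norm v > 1}" and ?h = "\<lambda>v. Q (Ln v)"
        have "open ?U" by (intro open_Int open_halfspace_Re_gt open_Collect_less continuous_intros)
        moreover have "z \<in> ?U" using 4 complex_Re_le_cmod[of z] by simp
        moreover have "mholo ?h ?U"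
        proof (rule mholo_compose[OF hQ])
          show "Ln holomorphic_on ?U" by (intro holomorphic_intros) (auto simp: complex_nonpos_Reals_iff)
          show "Ln ` ?U \<subseteq> {m. Re m > 0}"
          proof (rule image_subsetI)
            fix v assume "v \<in> ?U"
            then show "Ln v \<in> {m. Re m > 0}" by (cases "v = 0") auto
          qed
        qed
        moreover have "?h v = R v" if "v \<in> ?U" "Im v \<noteq> 0" for v
          using QR[of "Ln v"] that by (cases "v = 0") auto
        ultimately show ?thesis by blast
      next
        case 5
        let ?U = "{v. Re v < 0} \<inter> {v. norm v > 1}" and ?h = "\<lambda>v. Q (Ln (- v) + of_real pi * \<i>)"
        have "open ?U" by (intro open_Int open_halfspace_Re_lt open_Collect_less continuous_intros)
        moreover have "z \<in> ?U" using 5 abs_Re_le_cmod[of z] by simp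
        moreover have "mholo ?h ?U"
        proof (rule mholo_compose[OF hQ])
          show "(\<lambda>v. Ln (- v) + of_real pi * \<i>) holomorphic_on ?U"
            by (intro holomorphic_intros) (auto simp: complex_nonpos_Reals_iff)
          show "(\<lambda>v. Ln (- v) + of_real pi * \<i>) ` ?U \<subseteq> {m. Re m > 0}"
          proof (rule image_subsetI)
            fix v assume "v \<in> ?U"
            then show "Ln (- v) + of_real pi * \<i> \<in> {m. Re m > 0}" by (cases "v = 0") auto
          qed
        qed
        moreover have "?h v = R v" if "v \<in> ?U" "Im v \<noteq> 0" for v
          using QR[of "Ln (- v) + of_real pi * \<i>"] that by (cases "v = 0") (auto simp: exp_add)
        ultimately show ?thesis by blast
      qed
    qed
    then obtain U h where "?g U h" by blast
    then show ?thesis by (intro exI[of _ U] exI[of _ "\<lambda>v. h v $ i $ j"]) (auto dest: mholoD)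
  qed
  \<comment> \<open>The (1,2) entry of M^1 M^0 equals - exp (-pi i \<theta>) s_2. Hence the second
    Stokes matrices correspond under the gauge as well, and the quotient can also be formed in the
    next sector.\<close>
  have T2: "T2 = gauge d S2"
  proof -
    note sX = canon_family_stokes[OF X(1) tr(1,2)] and sY = canon_family_stokes[OF Y(1) tr(3,4)]
    have "gauge d M1 ** gauge d M0 = gauge d (M1 ** M0)" by (simp add: gD matrix_mul_assoc[symmetric] DC)
    then have "(adj2 T1 ** exp_sigma3 (- (of_real pi * \<i> * \<theta>)) ** adj2 T2) $ 1 $ 2 =
        gauge d (adj2 S1 ** exp_sigma3 (- (of_real pi * \<i> * \<theta>)) ** adj2 S2) $ 1 $ 2" using XS YS by simp
    then have "T2 $ 1 $ 2 = d\<^sup>2 * S2 $ 1 $ 2" using d by (simp add: mmult_nth sX sY)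
    then show ?thesis using d by (simp add: cmat_eq_iff sX sY)
  qed
  have Q1: "Q m = X 1 m ** (D' ** adj2 (Y 1 m))" if "Re m > 0" for m
  proof -
    have e: "X 1 m = X 0 m ** S2" "Y 1 m = Y 0 m ** (D ** S2 ** D')"
      using X(1) Y(1) that T2 gD by (auto simp: canon_family_def)
    show ?thesis unfolding Q_def e by (rule conj_cancel[OF canon_family_stokes(8)[OF X(1) tr(1,2)], symmetric])
  qed
  have R_const: "R v $ i $ j = D' $ i $ j" if v: "Im v \<noteq> 0" for v i j
  proof -
    obtain g where g: "g holomorphic_on UNIV" "\<And>v. Im v \<noteq> 0 \<Longrightarrow> g v = R v $ i $ j"
      using glue_off_reals[of "\<lambda>v. R v $ i $ j", OF cover] by blast
    have gQ: "g (exp m) = Q m $ i $ j" if "Re m > 0" for m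
    proof (rule analytic_continuation_open[where s = "{m. Re m > 0 \<and> 0 < Im m \<and> Im m < pi}" and s' = "{m. Re m > 0}"
          and f = "\<lambda>m. g (exp m)" and g = "\<lambda>m. Q m $ i $ j" and z = m])
      show "(\<lambda>m. g (exp m)) holomorphic_on {m. Re m > 0}"
        by (rule holomorphic_on_compose_gen[of exp _ g UNIV, unfolded o_def]) (use g(1) in \<open>auto intro!: holomorphic_intros\<close>)
      show "(\<lambda>m. Q m $ i $ j) holomorphic_on {m. Re m > 0}" by (rule mholoD[OF hQ])
      have "Complex 1 (pi / 2) \<in> {m. Re m > 0 \<and> 0 < Im m \<and> Im m < pi}" by simp
      then show "{m. Re m > 0 \<and> 0 < Im m \<and> Im m < pi} \<noteq> {}" by blast
      show "g (exp z) = Q z $ i $ j" if "z \<in> {m. Re m > 0 \<and> 0 < Im m \<and> Im m < pi}" for z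
      proof -
        have "Im (exp z) \<noteq> 0" using that sin_gt_zero[of "Im z"] by (simp add: Im_exp)
        then show ?thesis using g(2) QR[of z] that by simp
      qed
    qed (use half_plane[of 0] strip_convex_open(2)[of 0 0 pi] that in auto)
    \<comment> \<open>The sector of X_0 leaves out the direction -pi/2, to which its estimate is not
      uniform; the sector of X_1 contains 3 pi/2. Together they give a limit in all
      directions.\<close>
    have "(g \<longlongrightarrow> D' $ i $ j) at_infinity"
    proof (rule tendstoI)
      fix e :: real assume e: "e > 0"
      have "((\<lambda>m. (X 0 m ** (D' ** adj2 (Y 0 m))) $ i $ j) \<longlongrightarrow> D' $ i $ j) (sector_filter {pi / 2 + of_int 0 * pi - (pi - pi / 4)..pi / 2 + of_int 0 * pi + (pi - pi / 4)})"
        by (rule canonX_quotient_limit[OF cX cY _ D'nth]) simp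
      from tendstoD[OF this e] obtain R1 where R1: "\<And>m. Re m > R1 \<Longrightarrow> - pi / 4 \<le> Im m \<Longrightarrow> Im m \<le> 5 * pi / 4 \<Longrightarrow> dist (Q m $ i $ j) (D' $ i $ j) < e"
        unfolding eventually_sector_filter Q_def[symmetric] by (auto simp: field_simps)
      have "((\<lambda>m. (X 1 m ** (D' ** adj2 (Y 1 m))) $ i $ j) \<longlongrightarrow> D' $ i $ j) (sector_filter {pi / 2 + of_int 1 * pi - (pi - pi / 4)..pi / 2 + of_int 1 * pi + (pi - pi / 4)})"
        by (rule canonX_quotient_limit[OF cX cY _ D'nth]) simp
      from tendstoD[OF this e] obtain R2 where R2: "\<And>m. Re m > R2 \<Longrightarrow> 3 * pi / 4 \<le> Im m \<Longrightarrow> Im m \<le> 9 * pi / 4 \<Longrightarrow> dist ((X 1 m ** (D' ** adj2 (Y 1 m))) $ i $ j) (D' $ i $ j) < e"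
        unfolding eventually_sector_filter by (auto simp: field_simps)
      show "\<forall>\<^sub>F v in at_infinity. dist (g v) (D' $ i $ j) < e"
        unfolding eventually_at_infinity
      proof (intro exI[of _ "exp (max (max R1 R2) 0 + 1)"] allI impI)
        fix v :: complex assume v: "exp (max (max R1 R2) 0 + 1) \<le> norm v"
        have "0 < exp (max (max R1 R2) 0 + 1)" by simp
        then have v0: "v \<noteq> 0" using v by auto
        have "ln (exp (max (max R1 R2) 0 + 1)) \<le> ln (norm v)" using v v0 by (subst ln_le_cancel_iff) auto
        moreover have "Re (Ln v) = ln (norm v)" using v0 by simp
        ultimately have "max (max R1 R2) 0 < Re (Ln v)" unfolding ln_exp by linarith
        then have r: "Re (Ln v) > R1" "Re (Ln v) > R2" "Re (Ln v) > 0" by (simp_all only: max_less_iff_conj)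
        show "dist (g v) (D' $ i $ j) < e"
        proof (cases "- pi / 4 \<le> Im (Ln v)")
          case True
          then have "dist (Q (Ln v) $ i $ j) (D' $ i $ j) < e" using R1[of "Ln v"] r Im_Ln_le_pi[OF v0] pi_gt_zero by linarith
          then show ?thesis using gQ[of "Ln v"] r v0 by simp
        next
          case False
          let ?m = "Ln v + 2 * of_real pi * \<i>"
          have m: "Re ?m > R2" "Re ?m > 0" "exp ?m = v" using r v0 by (simp_all add: exp_add)
          have "dist ((X 1 ?m ** (D' ** adj2 (Y 1 ?m))) $ i $ j) (D' $ i $ j) < e"
            by (rule R2[OF m(1)]) (use False mpi_less_Im_Ln[OF v0] pi_gt_zero in \<open>simp; linarith\<close>)+
          then show ?thesis using gQ[OF m(2)] Q1[OF m(2)] m(3) by simp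
        qed
      qed
    qed
    then have "g v = D' $ i $ j" by (rule Liouville_weak[OF g(1)])
    then show ?thesis using g(2)[OF v] by simp
  qed
  have FG: "F v = D' ** G v ** D" if v: "Im v > 0" for v
  proof -
    have vs: "v \<in> slit_plane" using v by (auto simp: slit_plane_def)
    have "R v = D'" using R_const v by (simp add: vec_eq_iff)
    then have "F v ** (D' ** (adj2 (G v) ** (G v ** D))) = D' ** G v ** D" unfolding R_def by (simp add: matrix_mul_assoc)
    moreover have "adj2 (G v) ** (G v ** D) = D" using G(1) vs by (intro adj2_cancel(3)) (simp add: plane_solution_def)
    ultimately show ?thesis by (simp add: DC)
  qed
  have eta: "eta_coeff A0 A1 (exp s) v = D' ** eta_coeff B0 B1 (exp s) v ** D" if v: "Im v > 0" for v
  proof -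
    let ?a = "eta_coeff A0 A1 (exp s) v" and ?b = "eta_coeff B0 B1 (exp s) v"
    have vs: "v \<in> slit_plane" using v by (auto simp: slit_plane_def)
    have dF: "has_mderiv F (?a ** F v) v" "det (F v) = 1" and dG: "has_mderiv G (?b ** G v) v"
      using F(1) G(1) vs by (auto simp: plane_solution_def)
    have "has_mderiv (\<lambda>v. D' ** G v ** D) (D' ** (?b ** G v) ** D) v" by (intro has_mderiv_rmult has_mderiv_lmult dG)
    then have "has_mderiv F (D' ** (?b ** G v) ** D) v"
    proof (rule has_mderiv_cong_ev)
      have "\<forall>\<^sub>F v in nhds v. v \<in> {v. Im v > 0}" by (rule eventually_nhds_in_open) (use v open_halfspace_Im_gt in auto)
      then show "\<forall>\<^sub>F v in nhds v. D' ** G v ** D = F v" by eventually_elim (simp add: FG)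
    qed
    then have "(?a ** F v) $ i $ j = (D' ** (?b ** G v) ** D) $ i $ j" for i j
      using dF(1) unfolding has_mderiv_def by (meson DERIV_unique)
    then have "?a ** F v = D' ** (?b ** G v) ** D" by (simp add: vec_eq_iff)
    also have "\<dots> = (D' ** ?b ** D) ** F v" unfolding FG[OF v] by (simp add: matrix_mul_assoc[symmetric] DC)
    finally have "?a ** F v ** adj2 (F v) = (D' ** ?b ** D) ** F v ** adj2 (F v)" by simp
    then show ?thesis using dF(2) by (simp add: matrix_mul_assoc[symmetric] adj2_right)
  qed
  have eD: "D' ** M ** D = gauge (1 / d) M" for M
    using d by (simp add: cmat_eq_iff D'_def D_def mmult_nth power2_eq_square field_simps)
  have AB: "A0 $ i $ j = gauge (1 / d) B0 $ i $ j \<and> A1 $ i $ j = gauge (1 / d) B1 $ i $ j" for i j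
  proof -
    define p where "p = A0 $ i $ j - gauge (1 / d) B0 $ i $ j"
    define q where "q = A1 $ i $ j - gauge (1 / d) B1 $ i $ j"
    have e: "p / (v + 1) + q / (v - 1) = 0" if v: "Im v > 0" for v
    proof -
      have g: "gauge (1 / d) (eta_coeff B0 B1 (exp s) v) = eta_coeff (gauge (1 / d) B0) (gauge (1 / d) B1) (exp s) v"
        using d by (simp add: cmat_eq_iff eta_coeff_def algebra_simps add_divide_distrib)
      have "eta_coeff A0 A1 (exp s) v $ i $ j = eta_coeff (gauge (1 / d) B0) (gauge (1 / d) B1) (exp s) v $ i $ j"
        using eta[OF v] unfolding eD g by simp
      then show ?thesis by (simp add: eta_coeff_def p_def q_def diff_divide_distrib) algebra
    qed
    \<comment> \<open>Two sample points in the upper half-plane give two independent linear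
      equations for the differences of the residues.\<close>
    have "p * (\<i> - 1) + q * (\<i> + 1) = 0" "p * (2 * \<i> - 1) + q * (2 * \<i> + 1) = 0"
    proof -
      have n: "\<i> + 1 \<noteq> 0" "\<i> - 1 \<noteq> 0" "2 * \<i> + 1 \<noteq> 0" "2 * \<i> - 1 \<noteq> 0" by (auto simp: complex_eq_iff)
      show "p * (\<i> - 1) + q * (\<i> + 1) = 0" using e[of \<i>] n(1,2) by (simp add: add_frac_eq)
      show "p * (2 * \<i> - 1) + q * (2 * \<i> + 1) = 0" using e[of "2 * \<i>"] n(3,4) by (simp add: add_frac_eq)
    qed
    moreover have "\<i> * \<i> = (-1 :: complex)" by simp
    ultimately have "2 * p = 0" "2 * q = 0" by algebra+
    then show ?thesis by (simp add: p_def q_def)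
  qed
  show "A0 = gauge (1 / d) B0" "A1 = gauge (1 / d) B1" using AB by (simp_all add: vec_eq_iff)
  show "A0 \<noteq> 0"
  proof
    assume "A0 = 0"
    then have "M0 = mat 1"
      using H0 local_coeff_eta(1)[of "exp _" A0 A1 "exp s"]
      by (intro trivial_monodromy[where a = "-1" and B = A1 and x = "exp s" and H = H0]) (auto simp: local_lift_def tr)
    then show False using M0(3) by simp
  qed
  show "A1 \<noteq> 0"
  proof
    assume "A1 = 0"
    then have "M1 = mat 1"
      using H1 local_coeff_eta(2)[of "exp _" A0 A1 "exp s"]
      by (intro trivial_monodromy[where a = 1 and B = A0 and x = "exp s" and H = H1]) (auto simp: local_lift_def tr)
    then show False using M1(3) by simp
  qed
qed

section \<open>The gauge action and recovery of the solution from its residues\<close>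

lemma gauge_mult: "c \<noteq> 0 \<Longrightarrow> gauge c (A ** B) = gauge c A ** gauge c B"
  by (simp add: cmat_eq_iff mmult_nth field_simps)

lemma gauge_adj2: "c \<noteq> 0 \<Longrightarrow> gauge c (adj2 A) = adj2 (gauge c A)"
  by (simp add: cmat_eq_iff)

lemma gauge_gauge: "b \<noteq> 0 \<Longrightarrow> c \<noteq> 0 \<Longrightarrow> gauge b (gauge c A) = gauge (b * c) A"
  by (simp add: cmat_eq_iff power_mult_distrib)

lemma gauge_1 [simp]: "gauge 1 A = A"
  by (simp add: cmat_eq_iff)

lemma gauge_exp_sigma3: "c \<noteq> 0 \<Longrightarrow> gauge c (exp_sigma3 a) = exp_sigma3 a"
  by (simp add: cmat_eq_iff)

lemma gauge_conj_sigma1: "c \<noteq> 0 \<Longrightarrow> conj_sigma1 (gauge c A) = gauge (1 / c) (conj_sigma1 A)"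
  by (simp add: cmat_eq_iff conj_sigma1_nth power_divide)

lemma gauge_one: "c \<noteq> 0 \<Longrightarrow> gauge c (mat 1) = mat 1" "c \<noteq> 0 \<Longrightarrow> gauge c (- mat 1) = - mat 1"
  by (simp_all add: cmat_eq_iff)

lemma det_gauge: "c \<noteq> 0 \<Longrightarrow> det (gauge c A) = det A"
  by (simp add: det_2)

lemma trace_gauge: "c \<noteq> 0 \<Longrightarrow> trace (gauge c A) = trace A"
  by (simp add: trace_2)

lemma gauge_eq_one: "c \<noteq> 0 \<Longrightarrow> gauge c A \<in> {mat 1, - mat 1} \<longleftrightarrow> A \<in> {mat 1, - mat 1}"
  using gauge_gauge[of "1 / c" c A] gauge_one[of c] gauge_one[of "1 / c"] by auto

lemma matrix_inv_adj2:
  assumes "det S = 1"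
  shows "matrix_inv S = adj2 S"
proof -
  have "S ** adj2 S = mat 1 \<and> adj2 S ** S = mat 1" using assms by (simp add: adj2_left adj2_right)
  then have "S ** matrix_inv S = mat 1 \<and> matrix_inv S ** S = mat 1" unfolding matrix_inv_def by (rule someI)
  then have "adj2 S ** (S ** matrix_inv S) = adj2 S" by simp
  then show ?thesis using assms by (simp add: adj2_cancel(3))
qed

lemma det_residues:
  "u \<noteq> 0 \<Longrightarrow> det (residue0 \<theta>0 z u) = - (\<theta>0\<^sup>2 / 4)"
  "u \<noteq> 0 \<Longrightarrow> y \<noteq> 0 \<Longrightarrow> det (residue1 \<theta>0 \<theta>1 \<theta> y z u) = - (\<theta>1\<^sup>2 / 4)"
  by (simp_all add: det_2 residue0_def residue1_def power2_eq_square field_simps)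

text \<open>The diagonal yields \<open>z\<close>. The off-diagonal entries of a residue vanish
  together only if the whole residue does, so one entry of the first residue determines
  \<open>u\<close>, one of the second determines u y, both up to the same factor e^2, which cancels
  in \<open>y\<close>.\<close>

lemma residues_determine:
  assumes nz: "u \<noteq> 0" "y \<noteq> 0" "u' \<noteq> 0" "y' \<noteq> 0" "e \<noteq> 0"
    and r0: "residue0 \<theta>0 z u = gauge e (residue0 \<theta>0 z' u')" "residue0 \<theta>0 z u \<noteq> 0"
    and r1: "residue1 \<theta>0 \<theta>1 \<theta> y z u = gauge e (residue1 \<theta>0 \<theta>1 \<theta> y' z' u')" "residue1 \<theta>0 \<theta>1 \<theta> y z u \<noteq> 0"
  shows "y = y'"
proof -
  define \<alpha> where "\<alpha> = (\<theta>0 - \<theta>1 + \<theta>) / 2"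
  define \<beta> where "\<beta> = (\<theta>0 + \<theta>1 + \<theta>) / 2"
  have z: "z' = z" using arg_cong[OF r0(1), of "\<lambda>M. M $ 1 $ 1"] nz by (simp add: residue0_def)
  have a: "u * (z + \<theta>0) = e\<^sup>2 * (u' * (z + \<theta>0))" "z / u = z / u' / e\<^sup>2"
    using arg_cong[OF r0(1), of "\<lambda>M. M $ 1 $ 2"] arg_cong[OF r0(1), of "\<lambda>M. M $ 2 $ 1"] nz by (simp_all add: residue0_def z algebra_simps)
  have "u = e\<^sup>2 * u'"
  proof (cases "z = 0")
    case False
    then show ?thesis using a(2) nz by (simp add: field_simps)
  next
    case True
    then have "\<theta>0 \<noteq> 0" using r0(2) by (auto simp: residue0_def cmat_eq_iff)
    then show ?thesis using a(1) True by simp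
  qed
  have b: "u * y * (z + \<alpha>) = e\<^sup>2 * (u' * y' * (z + \<alpha>))" "(z + \<beta>) / (u * y) = (z + \<beta>) / (u' * y') / e\<^sup>2"
    using arg_cong[OF r1(1), of "\<lambda>M. M $ 1 $ 2"] arg_cong[OF r1(1), of "\<lambda>M. M $ 2 $ 1"] nz
    by (simp_all add: residue1_def z \<alpha>_def \<beta>_def)
  have "u * y = e\<^sup>2 * (u' * y')"
  proof (cases "z + \<beta> = 0")
    case False
    then show ?thesis using b(2) nz by (simp add: field_simps)
  next
    case True
    have "z + \<alpha> \<noteq> 0"
    proof
      assume "z + \<alpha> = 0"
      moreover have "\<theta>1 = (z + \<beta>) - (z + \<alpha>)" by (simp add: \<alpha>_def \<beta>_def field_simps)
      ultimately have "\<theta>1 = 0" "z = - \<alpha>" using True by (simp_all add: eq_neg_iff_add_eq_0)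
      then have "residue1 \<theta>0 \<theta>1 \<theta> y z u = 0" by (simp add: residue1_def cmat_eq_iff \<alpha>_def)
      then show False using r1(2) by simp
    qed
    then show ?thesis using b(1) by simp
  qed
  then show ?thesis using \<open>u = e\<^sup>2 * u'\<close> nz by simp
qed

text \<open>Two different meromorphic functions agree on a sparse, hence countable set, whereas the
  real line is uncountable. Values at poles agree because the normalisation sets them to 0.\<close>

lemma nicely_meromorphic_eqI:
  fixes f g :: "complex \<Rightarrow> complex"
  assumes f: "f nicely_meromorphic_on UNIV" and g: "g nicely_meromorphic_on UNIV"
    and B: "countable B" and eq: "\<And>s. Im s = 0 \<Longrightarrow> s \<notin> B \<Longrightarrow> f s = g s"
  shows "f s = g s"
proof -
  have m: "f meromorphic_on UNIV" "g meromorphic_on UNIV" using f g by (simp_all add: nicely_meromorphic_on_def)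
  have "\<not> eventually (\<lambda>s. f s - g s \<noteq> 0) (cosparse UNIV)"
  proof
    assume "eventually (\<lambda>s. f s - g s \<noteq> 0) (cosparse UNIV)"
    then have sp: "{s. f s = g s} sparse_in UNIV" by (simp add: eventually_cosparse)
    have "countable {s. f s = g s}" using sparse_imp_countable[OF open_UNIV sp] by simp
    moreover have "complex_of_real ` UNIV \<subseteq> {s. f s = g s} \<union> B" using eq by auto
    ultimately have "countable (complex_of_real ` UNIV)" using B countable_subset countable_Un by metis
    then have "countable (UNIV :: real set)" by (rule countable_image_inj_on) (simp add: inj_on_def)
    then show False using uncountable_UNIV_real by simp
  qed
  moreover have "eventually (\<lambda>s. f s - g s = 0) (cosparse UNIV) \<or> eventually (\<lambda>s. f s - g s \<noteq> 0) (cosparse UNIV)"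
    by (rule meromorphic_imp_constant_or_avoid) (auto intro!: meromorphic_intros m)
  ultimately have "eventually (\<lambda>s. f s = g s) (cosparse UNIV)" by simp
  then have ev: "eventually (\<lambda>v. f v = g v) (at s)" by (simp add: eventually_cosparse_open_eq)
  have P: "is_pole f s \<longleftrightarrow> is_pole g s" by (rule is_pole_cong[OF ev refl])
  have nf: "is_pole f s \<and> f s = 0 \<or> f \<midarrow>s\<rightarrow> f s" and ng: "is_pole g s \<and> g s = 0 \<or> g \<midarrow>s\<rightarrow> g s"
    using f g unfolding nicely_meromorphic_on_def by blast+
  show ?thesis
  proof (cases "is_pole f s")
    case True
    have "\<not> h \<midarrow>s\<rightarrow> h s" if "is_pole h s" for h :: "complex \<Rightarrow> complex"
      using that not_tendsto_and_filterlim_at_infinity[of "at s" h "h s"] unfolding is_pole_def by auto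
    then show ?thesis using True P nf ng by metis
  next
    case False
    then have l: "f \<midarrow>s\<rightarrow> f s" "g \<midarrow>s\<rightarrow> g s" using P nf ng by auto
    have "f \<midarrow>s\<rightarrow> g s" using l(2) tendsto_cong[OF ev] by blast
    then show ?thesis using l(1) tendsto_unique[of "at s"] by auto
  qed
qed

text \<open>Each solution brings its own auxiliary functions and its own gauge at every point.
  Rigidity is applied at real s that are regular for both, with the relative gauge c' / c.\<close>

lemma labelled_solution_unique:
  assumes v: "labelled_solution \<theta>0 \<theta>1 \<theta> N0 N1 v" and v': "labelled_solution \<theta>0 \<theta>1 \<theta> N0 N1 v'"
    and N: "N0 \<notin> {mat 1, - mat 1}" "N1 \<notin> {mat 1, - mat 1}"
  shows "v s = v' s"
proof -
  obtain zf uf S1 S2 where sys: "PV_system \<theta>0 \<theta>1 \<theta> v zf uf" and dat: "\<And>s. \<bar>Im s\<bar> < pi / 2 \<Longrightarrow> regular_point v zf uf s \<Longrightarrow>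
      \<exists>c. c \<noteq> 0 \<and> has_monodromy_data \<theta>0 \<theta>1 \<theta> s (v s) (zf s) (uf s) (gauge c S1) (gauge c S2) (gauge c N0) (gauge c N1)"
    and pair: "(N0, N1) \<in> monodromy_pairs \<theta>0 \<theta>1 \<theta>"
    using v unfolding labelled_solution_def solution_with_data_def by blast
  obtain zf' uf' S1' S2' where sys': "PV_system \<theta>0 \<theta>1 \<theta> v' zf' uf'" and dat': "\<And>s. \<bar>Im s\<bar> < pi / 2 \<Longrightarrow> regular_point v' zf' uf' s \<Longrightarrow>
      \<exists>c. c \<noteq> 0 \<and> has_monodromy_data \<theta>0 \<theta>1 \<theta> s (v' s) (zf' s) (uf' s) (gauge c S1') (gauge c S2') (gauge c N0) (gauge c N1)"
    using v' unfolding labelled_solution_def solution_with_data_def by blast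
  have dN: "det N0 = 1" "det N1 = 1" "trace N0 = 2 * cos (of_real pi * \<theta>0)" "trace N1 = 2 * cos (of_real pi * \<theta>1)"
    using pair by (auto simp: monodromy_pairs_def)
  let ?B = "{s. \<not> regular_point v zf uf s} \<union> {s. \<not> regular_point v' zf' uf' s}"
  show ?thesis
  proof (rule nicely_meromorphic_eqI[where B = ?B and f = v and g = v' and s = s])
    show "v nicely_meromorphic_on UNIV" "v' nicely_meromorphic_on UNIV" using sys sys' by (simp_all add: PV_system_def)
    show "countable ?B" using regular_open(2)[OF sys] regular_open(2)[OF sys'] by simp
    fix s assume s: "Im s = 0" "s \<notin> ?B"
    then have reg: "regular_point v zf uf s" "regular_point v' zf' uf' s" by auto
    have Im: "\<bar>Im s\<bar> < pi / 2" using s by simp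
    obtain c where c: "c \<noteq> 0" "has_monodromy_data \<theta>0 \<theta>1 \<theta> s (v s) (zf s) (uf s) (gauge c S1) (gauge c S2) (gauge c N0) (gauge c N1)"
      using dat[OF Im reg(1)] by blast
    obtain c' where c': "c' \<noteq> 0" "has_monodromy_data \<theta>0 \<theta>1 \<theta> s (v' s) (zf' s) (uf' s) (gauge c' S1') (gauge c' S2') (gauge c' N0) (gauge c' N1)"
      using dat'[OF Im reg(2)] by blast
    obtain X where X: "canon_family \<theta> (residue0 \<theta>0 (zf s) (uf s)) (residue1 \<theta>0 \<theta>1 \<theta> (v s) (zf s) (uf s)) s X (gauge c S1) (gauge c S2)"
      "loop_data 0 (X 0) (gauge c N0) (gauge c N1)" using c(2) s(1) unfolding has_monodromy_data_iff by auto
    obtain Y where Y: "canon_family \<theta> (residue0 \<theta>0 (zf' s) (uf' s)) (residue1 \<theta>0 \<theta>1 \<theta> (v' s) (zf' s) (uf' s)) s Y (gauge c' S1') (gauge c' S2')"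
      "loop_data 0 (Y 0) (gauge c' N0) (gauge c' N1)" using c'(2) s(1) unfolding has_monodromy_data_iff by auto
    define d where "d = c' / c"
    have d: "d \<noteq> 0" "gauge c' M = gauge d (gauge c M)" for M using c c' by (simp_all add: d_def gauge_gauge)
    have nz: "uf s \<noteq> 0" "v s \<noteq> 0" "uf' s \<noteq> 0" "v' s \<noteq> 0" using reg by (simp_all add: regular_point_def)
    note rig = coefficient_rigidity[OF X Y(1) Y(2)[unfolded d(2)] s(1) d(1) trace_residues trace_residues
      det_residues(1)[OF nz(1)] det_residues(1)[OF nz(3)] det_residues(2)[OF nz(1,2)] det_residues(2)[OF nz(3,4)]]
    show "v s = v' s"
      by (rule residues_determine[OF nz _ rig(1) rig(3) rig(2) rig(4)])
         (use dN N c(1) d(1) in \<open>simp_all add: det_gauge trace_gauge gauge_eq_one del: insert_iff\<close>)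
  qed
qed

section \<open>The reflected solution\<close>

text \<open>The common form of both transformations: S = S_2 for the turn by pi and S = S_1^-1 for
  the turn by -pi, with \<open>g\<close> the power of e^(pi i \<theta>) that survives as a
  gauge.\<close>

definition reflect_mat :: "complex \<Rightarrow> cmat \<Rightarrow> cmat \<Rightarrow> cmat" where
  "reflect_mat g S M = gauge g (conj_sigma1 (adj2 S ** M ** S))"

lemma det_conj_sigma1: "det (conj_sigma1 A) = det A"
  by (simp add: det_2)

lemma trace_conj_sigma1: "trace (conj_sigma1 A) = trace A"
  by (simp add: trace_2)

lemma reflect_mat_mult:
  assumes "det S = 1" "g \<noteq> 0"
  shows "reflect_mat g S A ** reflect_mat g S B = reflect_mat g S (A ** B)"
proof -
  have "adj2 S ** A ** S ** (adj2 S ** B ** S) = adj2 S ** (A ** (S ** (adj2 S ** (B ** S))))" by (simp add: matrix_mul_assoc)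
  also have "\<dots> = adj2 S ** (A ** B) ** S" unfolding adj2_cancel(4)[OF assms(1)] by (simp add: matrix_mul_assoc)
  finally show ?thesis
    unfolding reflect_mat_def gauge_mult[OF assms(2), symmetric] conj_sigma1_mult[symmetric] by simp
qed

lemma reflect_mat_eq_one:
  assumes S: "det S = 1" and g: "g \<noteq> 0"
  shows "reflect_mat g S M \<in> {mat 1, - mat 1} \<longleftrightarrow> M \<in> {mat 1, - mat 1}"
proof -
  have c: "conj_sigma1 A \<in> {mat 1, - mat 1} \<longleftrightarrow> A \<in> {mat 1, - mat 1}" for A by (auto simp: cmat_eq_iff)
  have s: "adj2 S ** M ** S = A \<longleftrightarrow> M = S ** A ** adj2 S" for A
    using adj2_cancel[OF S] by (metis matrix_mul_assoc matrix_mul_rid)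
  have "S ** (- mat 1) = - S" by (simp add: cmat_eq_iff mmult_nth)
  then have "S ** mat 1 ** adj2 S = mat 1" "S ** (- mat 1) ** adj2 S = - mat 1"
    using adj2_cancel(2)[OF S] by simp_all
  then show ?thesis unfolding reflect_mat_def gauge_eq_one[OF g] c using s[of "mat 1"] s[of "- mat 1"] by auto
qed

text \<open>The defining condition of the manifold concerns the (1,1) entry of M^1 M^0. After
  conjugation by \<sigma>_1 it concerns the (2,2) entry, which the gauge leaves alone.\<close>

lemma reflect_monodromy_pair:
  assumes M: "(M0, M1) \<in> monodromy_pairs \<theta>0 \<theta>1 \<theta>" and S: "det S = 1" and g: "g \<noteq> 0"
    and e: "(adj2 S ** (M1 ** M0) ** S) $ 2 $ 2 = exp (of_real pi * \<i> * \<theta>)"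
  shows "(reflect_mat g S M0, reflect_mat g S M1) \<in> monodromy_pairs \<theta>0 \<theta>1 (- \<theta>)"
proof -
  have dS: "det (adj2 S) = 1" using S by (simp add: det_adj2)
  have d: "det (reflect_mat g S A) = det A" for A
    by (simp add: reflect_mat_def det_gauge[OF g] det_conj_sigma1 det_mul S dS)
  have "trace (adj2 S ** A ** S) = trace A" for A
  proof -
    have "trace (adj2 S ** A ** S) = trace (S ** (adj2 S ** A))" by (rule trace_mul_sym)
    then show ?thesis by (simp add: adj2_cancel(4)[OF S])
  qed
  then have t: "trace (reflect_mat g S A) = trace A" for A
    by (simp add: reflect_mat_def trace_gauge[OF g] trace_conj_sigma1)
  have "(reflect_mat g S M1 ** reflect_mat g S M0) $ 1 $ 1 = exp (of_real pi * \<i> * \<theta>)"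
    unfolding reflect_mat_mult[OF S g] using e by (simp add: reflect_mat_def g)
  then show ?thesis using M by (simp add: monodromy_pairs_def d t mmult_nth mult.commute)
qed

text \<open>\<open>S1\<close> and \<open>S2\<close> are constrained only through the linear system
  at regular points. One real regular point exists, since the other points are countable, and there
  the properties can be read off up to gauge.\<close>

lemma solution_with_data_relation:
  assumes "solution_with_data \<theta>0 \<theta>1 \<theta> S1 S2 M0 M1 w"
  shows "det S1 = 1" "det S2 = 1" "S1 $ 2 $ 2 = 1" "S1 $ 1 $ 2 = 0" "S2 $ 2 $ 2 = 1" "S2 $ 2 $ 1 = 0"
    "M1 ** M0 = adj2 S1 ** exp_sigma3 (- (of_real pi * \<i> * \<theta>)) ** adj2 S2"
proof -
  obtain zf uf where sys: "PV_system \<theta>0 \<theta>1 \<theta> w zf uf" and dat: "\<And>s. \<bar>Im s\<bar> < pi / 2 \<Longrightarrow> regular_point w zf uf s \<Longrightarrow>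
      \<exists>c. c \<noteq> 0 \<and> has_monodromy_data \<theta>0 \<theta>1 \<theta> s (w s) (zf s) (uf s) (gauge c S1) (gauge c S2) (gauge c M0) (gauge c M1)"
    using assms unfolding solution_with_data_def by blast
  have "\<exists>s. Im s = 0 \<and> regular_point w zf uf s"
  proof (rule ccontr)
    assume "\<not> ?thesis"
    then have "complex_of_real ` UNIV \<subseteq> {s. \<not> regular_point w zf uf s}" by auto
    then have "countable (complex_of_real ` UNIV)" by (rule countable_subset[OF _ regular_open(2)[OF sys]])
    then have "countable (UNIV :: real set)" by (rule countable_image_inj_on) (simp add: inj_on_def)
    then show False using uncountable_UNIV_real by simp
  qed
  then obtain s where s: "Im s = 0" "regular_point w zf uf s" by blast
  then obtain c where c: "c \<noteq> 0" "has_monodromy_data \<theta>0 \<theta>1 \<theta> s (w s) (zf s) (uf s) (gauge c S1) (gauge c S2) (gauge c M0) (gauge c M1)"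
    using dat[of s] by auto
  obtain X where X: "canon_family \<theta> (residue0 \<theta>0 (zf s) (uf s)) (residue1 \<theta>0 \<theta>1 \<theta> (w s) (zf s) (uf s)) s X (gauge c S1) (gauge c S2)"
      "loop_data 0 (X 0) (gauge c M0) (gauge c M1)" using c(2) s(1) unfolding has_monodromy_data_iff by auto
  note st = canon_family_stokes[OF X(1) trace_residues]
  show "det S1 = 1" "det S2 = 1" "S1 $ 2 $ 2 = 1" "S1 $ 1 $ 2 = 0" "S2 $ 2 $ 2 = 1" "S2 $ 2 $ 1 = 0"
    using st c(1) by (simp_all add: det_gauge)
  have "gauge c M1 ** gauge c M0 = adj2 (gauge c S1) ** exp_sigma3 (- (of_real pi * \<i> * \<theta>)) ** adj2 (gauge c S2)"
    using continuation_data[OF X s(1) trace_residues] by blast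
  then have e: "gauge c (M1 ** M0) = gauge c (adj2 S1 ** exp_sigma3 (- (of_real pi * \<i> * \<theta>)) ** adj2 S2)"
    using c(1) by (simp add: gauge_mult gauge_adj2 gauge_exp_sigma3)
  show "M1 ** M0 = adj2 S1 ** exp_sigma3 (- (of_real pi * \<i> * \<theta>)) ** adj2 S2"
    using arg_cong[OF e, of "gauge (1 / c)"] c(1) by (simp add: gauge_gauge)
qed

text \<open>For each admissible s the data at s follow from those of the given solution at a nearby
  s + t, transported to s + i pi or s - i pi. Solutions are labelled by classes only, so the
  constant gauge \<open>g\<close> may be inserted and is compensated in the choice of
  \<open>c\<close>.\<close>

lemma reflected_solution:
  fixes \<kappa> :: real
  assumes sol: "solution_with_data \<theta>0 \<theta>1 \<theta> S1 S2 M0 M1 w" and \<kappa>: "\<kappa> = 1 \<or> \<kappa> = -1" and g: "g \<noteq> 0"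
  defines "S \<equiv> if \<kappa> = 1 then S2 else adj2 S1"
  shows "labelled_solution \<theta>0 \<theta>1 (- \<theta>) (reflect_mat g S M0) (reflect_mat g S M1) (\<lambda>s. 1 / w (s + \<i> * of_real (\<kappa> * pi)))"
    and "det S = 1"
proof -
  define E where "E = exp_sigma3 (of_real pi * \<i> * \<theta>)"
  define E' where "E' = exp_sigma3 (- (of_real pi * \<i> * \<theta>))"
  define c0 where "c0 = \<i> * of_real (\<kappa> * pi)"
  note rel = solution_with_data_relation[OF sol]
  show S: "det S = 1" using rel by (simp add: S_def det_adj2)
  have ec: "exp c0 = -1" using \<kappa> by (auto simp: c0_def exp_Euler exp_minus complex_eq_iff Re_exp Im_exp)
  obtain zf uf where sys: "PV_system \<theta>0 \<theta>1 \<theta> w zf uf" and dat: "\<And>s. \<bar>Im s\<bar> < pi / 2 \<Longrightarrow> regular_point w zf uf s \<Longrightarrow>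
      \<exists>c. c \<noteq> 0 \<and> has_monodromy_data \<theta>0 \<theta>1 \<theta> s (w s) (zf s) (uf s) (gauge c S1) (gauge c S2) (gauge c M0) (gauge c M1)"
    and pv: "PV_solution \<theta>0 \<theta>1 \<theta> w" and M: "(M0, M1) \<in> monodromy_pairs \<theta>0 \<theta>1 \<theta>"
    using sol unfolding solution_with_data_def by blast
  define zf' where "zf' = remove_sings (\<lambda>s. - zf (s + c0) - \<theta>0)"
  define w' where "w' s = 1 / w (s + c0)" for s
  define uf' where "uf' s = 1 / uf (s + c0)" for s
  have pv': "PV_solution \<theta>0 \<theta>1 (- \<theta>) w'" unfolding w'_def[abs_def] by (rule PV_solution_reflect[OF pv ec])
  have sys': "PV_system \<theta>0 \<theta>1 (- \<theta>) w' zf' uf'"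
    unfolding w'_def[abs_def] uf'_def[abs_def] zf'_def by (rule PV_system_reflect(1)[OF sys ec])
  have reg': "regular_point w zf uf (s + c0) \<and> zf' s = - zf (s + c0) - \<theta>0" if "regular_point w' zf' uf' s" for s
    using PV_system_reflect(2)[OF sys ec, of s] that unfolding w'_def[abs_def] uf'_def[abs_def] zf'_def by blast
  \<comment> \<open>Conjugation by \<sigma>_1 exchanges upper and lower triangular matrices, and the
    shift of the sectors by one makes a Stokes matrix outside the pair (S_1, S_2) enter; formal
    monodromy expresses it by \<open>E\<close>.\<close>
  define Ta where "Ta = (if \<kappa> = 1 then conj_sigma1 S2 else conj_sigma1 (E' ** S2 ** E))"
  define Tb where "Tb = (if \<kappa> = 1 then conj_sigma1 (E ** S1 ** E') else conj_sigma1 S1)"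
  have "solution_with_data \<theta>0 \<theta>1 (- \<theta>) (gauge g Ta) (gauge g Tb) (reflect_mat g S M0) (reflect_mat g S M1) w'"
    unfolding solution_with_data_def
  proof (intro conjI pv')
    \<comment> \<open>In M^1 M^0 = S_1^-1 e^(-pi i \<theta> \<sigma>_3) S_2^-1 the conjugation
      cancels one outer factor and moves it to the other side. The remaining triangular product has
      the (2,2) entry e^(pi i \<theta>).\<close>
    have a: "adj2 S ** (M1 ** M0) ** S = (if \<kappa> = 1 then adj2 S2 ** adj2 S1 ** E' else E' ** adj2 S2 ** adj2 S1)"
    proof (cases "\<kappa> = 1")
      case True
      have "adj2 S2 ** (adj2 S1 ** E' ** adj2 S2) ** S2 = adj2 S2 ** adj2 S1 ** E' ** (adj2 S2 ** S2)" by (simp add: matrix_mul_assoc)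
      then show ?thesis using True rel by (simp add: S_def E'_def adj2_cancel)
    next
      case False
      have "adj2 (adj2 S1) = S1" by (simp add: cmat_eq_iff)
      moreover have "S1 ** (adj2 S1 ** E' ** adj2 S2) ** adj2 S1 = S1 ** (adj2 S1 ** (E' ** adj2 S2 ** adj2 S1))" by (simp add: matrix_mul_assoc)
      ultimately show ?thesis using False rel by (simp add: S_def E'_def adj2_cancel)
    qed
    have "(adj2 S ** (M1 ** M0) ** S) $ 2 $ 2 = exp (of_real pi * \<i> * \<theta>)"
      unfolding a E'_def using rel det_2[of S1] det_2[of S2] by (simp add: mmult_nth)
    then show "(reflect_mat g S M0, reflect_mat g S M1) \<in> monodromy_pairs \<theta>0 \<theta>1 (- \<theta>)"
      by (rule reflect_monodromy_pair[OF M S g])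
    show "\<exists>zf uf. PV_system \<theta>0 \<theta>1 (- \<theta>) w' zf uf \<and>
        (\<forall>s. \<bar>Im s\<bar> < pi / 2 \<and> regular_point w' zf uf s \<longrightarrow>
           (\<exists>c. c \<noteq> 0 \<and> has_monodromy_data \<theta>0 \<theta>1 (- \<theta>) s (w' s) (zf s) (uf s)
              (gauge c (gauge g Ta)) (gauge c (gauge g Tb)) (gauge c (reflect_mat g S M0)) (gauge c (reflect_mat g S M1))))"
    proof (rule exI[of _ zf'], rule exI[of _ uf'], intro conjI sys' allI impI)
    fix s assume s: "\<bar>Im s\<bar> < pi / 2 \<and> regular_point w' zf' uf' s"
    define p where "p = s + \<i> * of_real (\<kappa> * pi)"
    have p: "regular_point w zf uf p" "zf' s = - zf p - \<theta>0" "w' s = 1 / w p" "uf' s = 1 / uf p"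
      using reg'[of s] s by (simp_all add: p_def c0_def w'_def uf'_def)
    have pB: "p \<notin> {s. \<not> regular_point w zf uf s}" using p(1) by simp
    obtain t where t: "0 < t" "t < pi / 10" "closed_segment (p - \<i> * of_real (\<kappa> * pi) + of_real t) p \<inter> {s. \<not> regular_point w zf uf s} = {}"
      by (rule segment_avoiding_countable[OF regular_open(2)[OF sys] pB \<kappa>])
    have seg: "closed_segment (s + of_real t) p \<subseteq> {s. regular_point w zf uf s}" using t(3) by (auto simp: p_def)
    then have "regular_point w zf uf (s + of_real t)" by auto
    then obtain c where c: "c \<noteq> 0" "has_monodromy_data \<theta>0 \<theta>1 \<theta> (s + of_real t) (w (s + of_real t)) (zf (s + of_real t)) (uf (s + of_real t))
        (gauge c S1) (gauge c S2) (gauge c M0) (gauge c M1)"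
      using dat[of "s + of_real t"] s by auto
    have gc: "conj_sigma1 (gauge c A) = gauge (1 / (c * g)) (gauge g (conj_sigma1 A))" for A
      using c(1) g by (simp add: gauge_conj_sigma1 gauge_gauge)
    have gm: "adj2 (gauge c A) ** gauge c B ** gauge c A = gauge c (adj2 A ** B ** A)"
      "gauge c A ** gauge c B ** adj2 (gauge c A) = gauge c (A ** B ** adj2 A)" for A B
      using c(1) by (simp_all add: gauge_mult gauge_adj2)
    have ge: "E ** gauge c A ** E' = gauge c (E ** A ** E')" "E' ** gauge c A ** E = gauge c (E' ** A ** E)" for A
      using c(1) by (simp_all add: gauge_mult gauge_exp_sigma3 E_def E'_def)
    have ss: "adj2 (adj2 S1) = S1" by (simp add: cmat_eq_iff)
    have "has_monodromy_data \<theta>0 \<theta>1 (- \<theta>) s (1 / w p) (- zf p - \<theta>0) (1 / uf p)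
        (gauge (1 / (c * g)) (gauge g Ta)) (gauge (1 / (c * g)) (gauge g Tb))
        (gauge (1 / (c * g)) (reflect_mat g S M0)) (gauge (1 / (c * g)) (reflect_mat g S M1))"
    proof (cases "\<kappa> = 1")
      case True
      from transported_monodromy_data(1)[OF sys \<kappa> t(1,2) p_def seg c(2) True, folded E_def E'_def, unfolded ge gm gc]
      show ?thesis using True by (simp add: Ta_def Tb_def reflect_mat_def S_def)
    next
      case False
      then have k: "\<kappa> = -1" using \<kappa> by simp
      from transported_monodromy_data(2)[OF sys \<kappa> t(1,2) p_def seg c(2) k, folded E_def E'_def, unfolded ge gm gc]
      show ?thesis using False by (simp add: Ta_def Tb_def reflect_mat_def S_def ss)
    qed
    then show "\<exists>c. c \<noteq> 0 \<and> has_monodromy_data \<theta>0 \<theta>1 (- \<theta>) s (w' s) (zf' s) (uf' s)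
        (gauge c (gauge g Ta)) (gauge c (gauge g Tb)) (gauge c (reflect_mat g S M0)) (gauge c (reflect_mat g S M1))"
      unfolding p(2-4) using c(1) g by (intro exI[of _ "1 / (c * g)"]) simp_all
    qed
  qed
  then show "labelled_solution \<theta>0 \<theta>1 (- \<theta>) (reflect_mat g S M0) (reflect_mat g S M1) (\<lambda>s. 1 / w (s + \<i> * of_real (\<kappa> * pi)))"
    unfolding labelled_solution_def w'_def[abs_def] c0_def by blast
qed

lemma exp_sigma3_conj_gauge: "exp_sigma3 a ** A ** exp_sigma3 (- a) = gauge (exp a) A"
  by (simp add: cmat_eq_iff mmult_nth power2_eq_square exp_minus field_simps)

text \<open>Diagonal conjugation is a gauge, and \<sigma>_1 inverts its parameter; this is why the
  exponent changes sign between the two sides.\<close>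

lemma hat_mat_reflect:
  "det S2 = 1 \<Longrightarrow> conj_sigma1 (hat_mat \<theta> S2 M) = reflect_mat (exp (of_real pi * \<i> / 2 * \<theta>)) S2 M"
  using exp_sigma3_conj_gauge[of "- (of_real pi * \<i> / 2 * \<theta>)" "adj2 S2 ** M ** S2"]
  by (simp add: hat_mat_def reflect_mat_def matrix_inv_adj2 matrix_mul_assoc gauge_conj_sigma1 exp_minus field_simps)

lemma check_mat_reflect:
  "det S1 = 1 \<Longrightarrow> conj_sigma1 (check_mat \<theta> S1 M) = reflect_mat (exp (- (of_real pi * \<i> / 2 * \<theta>))) (adj2 S1) M"
proof -
  assume S: "det S1 = 1"
  have ss: "adj2 (adj2 S1) = S1" by (simp add: cmat_eq_iff)
  show ?thesis
    using exp_sigma3_conj_gauge[of "of_real pi * \<i> / 2 * \<theta>" "S1 ** M ** adj2 S1"]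
    by (simp add: check_mat_def reflect_mat_def matrix_inv_adj2 S ss matrix_mul_assoc gauge_conj_sigma1 exp_minus field_simps)
qed

theorem theorem2p15:
  fixes \<theta>0 \<theta>1 \<theta>inf :: complex
    and M0 M1 S1 S2 :: cmat
    and w :: "complex \<Rightarrow> complex"
  assumes "(M0, M1) \<in> monodromy_pairs \<theta>0 \<theta>1 \<theta>inf"
    and "solution_with_data \<theta>0 \<theta>1 \<theta>inf S1 S2 M0 M1 w"
  shows
    "(let N0 = conj_sigma1 (hat_mat \<theta>inf S2 M0); N1 = conj_sigma1 (hat_mat \<theta>inf S2 M1)
      in labelled_solution \<theta>0 \<theta>1 (- \<theta>inf) N0 N1 (\<lambda>s. 1 / w (s + \<i> * of_real pi)) \<and>
         (M0 \<notin> {mat 1, - mat 1} \<and> M1 \<notin> {mat 1, - mat 1} \<longrightarrow>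
            (\<forall>v. labelled_solution \<theta>0 \<theta>1 (- \<theta>inf) N0 N1 v \<longrightarrow>
               (\<forall>s. w (s + \<i> * of_real pi) = 1 / v s)))) \<and>
     (let N0 = conj_sigma1 (check_mat \<theta>inf S1 M0); N1 = conj_sigma1 (check_mat \<theta>inf S1 M1)
      in labelled_solution \<theta>0 \<theta>1 (- \<theta>inf) N0 N1 (\<lambda>s. 1 / w (s - \<i> * of_real pi)) \<and>
         (M0 \<notin> {mat 1, - mat 1} \<and> M1 \<notin> {mat 1, - mat 1} \<longrightarrow>
            (\<forall>v. labelled_solution \<theta>0 \<theta>1 (- \<theta>inf) N0 N1 v \<longrightarrow>
               (\<forall>s. w (s - \<i> * of_real pi) = 1 / v s))))"
proof -
  \<comment> \<open>With 1 / 0 = 0 this holds at zeros and poles too, in accordance with the value 0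
    of the functions at poles.\<close>
  have recip: "w s' = 1 / v s" if "v s = 1 / w s'" for v :: "complex \<Rightarrow> complex" and s s' using that by simp
  have main: "labelled_solution \<theta>0 \<theta>1 (- \<theta>inf) (reflect_mat g S M0) (reflect_mat g S M1) (\<lambda>s. 1 / w (s + c)) \<and>
      (M0 \<notin> {mat 1, - mat 1} \<and> M1 \<notin> {mat 1, - mat 1} \<longrightarrow>
        (\<forall>v. labelled_solution \<theta>0 \<theta>1 (- \<theta>inf) (reflect_mat g S M0) (reflect_mat g S M1) v \<longrightarrow>
           (\<forall>s. w (s + c) = 1 / v s)))"
    if L: "labelled_solution \<theta>0 \<theta>1 (- \<theta>inf) (reflect_mat g S M0) (reflect_mat g S M1) (\<lambda>s. 1 / w (s + c))"
      and S: "det S = 1" and g: "g \<noteq> 0" for g S c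
  proof (intro conjI L impI allI)
    fix v s assume M: "M0 \<notin> {mat 1, - mat 1} \<and> M1 \<notin> {mat 1, - mat 1}"
      and v: "labelled_solution \<theta>0 \<theta>1 (- \<theta>inf) (reflect_mat g S M0) (reflect_mat g S M1) v"
    have "v s = 1 / w (s + c)"
      by (rule labelled_solution_unique[OF v L]) (use M reflect_mat_eq_one[OF S g] in blast)+
    then show "w (s + c) = 1 / v s" by (rule recip)
  qed
  note S = solution_with_data_relation(1,2)[OF assms(2)]
  note hat = main[OF reflected_solution[OF assms(2), of 1 "exp (of_real pi * \<i> / 2 * \<theta>inf)"]]
  note check = main[OF reflected_solution[OF assms(2), of "-1" "exp (- (of_real pi * \<i> / 2 * \<theta>inf))"]]
  show ?thesis
    using hat check unfolding Let_def hat_mat_reflect[OF S(2)] check_mat_reflect[OF S(1)] by simp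
qed

end
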